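(* Let $0<\alpha<1$, $m\in L^\infty(\Omega)$, $|\Omega^0\cup\Omega^+|>0$, assume the domain regularity assumptions listed in the context, and suppose $$\int_\Omega m(x)\varphi_{1,\Omega}^{\alpha+1}\,dx<0 .$$ Then: (i) The minimization problem $$\lambda^*=\inf\Big\{\frac{\int_\Omega|\nabla u|^2dx}{\int_\Omega|u|^2dx}:u\in H_0^1(\Omega)\setminus\{0\},\ M(u)\ge0\Big\}$$ has a nonzero non-negative minimizer $\overline u\in H_0^1(\Omega)$. Moreover, $H_{\lambda^*}(\overline u)=0$ and $M(\overline u)=0$. (ii) If $|\Omega^+|=0$, then $\lambda^*=\lambda_{1,\Omega^0}$, and $\overline u$ is a positive multiple of $\varphi_{1,\Omega^0}$, extended by zero outside $\Omega^0$. (iii) If, in addition, either $|\Omega^0|=0$, or $|\Omega^0|>0$, $\Omega^0\cup\Omega^+$ is a domain and $\lambda_{1,\Omega^0\cup\Omega^+}<\lambda_{1,\Omega^0}$, then there exists $\tau>0$ such that $\tau\overline u$ is a weak solution of $$-\Delta u=\lambda^* u+m(x)|u|^{\alpha-1}u\ \text{ in }\Omega,\qquad u=0\ \text{ on }\partial\Omega,$$ and $E_{\lambda^*}''(\tau\overline u)=0$.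
   Context: $\Omega\subset\mathbb R^N$, $N\ge1$, is a bounded connected domain with sufficiently smooth boundary; $|A|$ is the Lebesgue measure of $A$. A representative of $m$ is fixed; $\Omega^+=\{m>0\}$, $Z_m=\{m=0\}$, $\Omega^0=\operatorname{int}Z_m$. For a domain $D$, $\lambda_{1,D}$ and $\varphi_{1,D}>0$ denote the first Dirichlet eigenvalue and a corresponding positive eigenfunction of $-\Delta$ in $D$. Domain regularity assumptions: $\Omega^0\cup\Omega^+$ is a nonempty connected Lipschitz domain; if $|\Omega^0|>0$, then $\Omega^0$ is a connected Lipschitz domain with $\Omega^0\Subset\Omega$; and $Z_m=\overline{\Omega^0}$ up to a set of Lebesgue measure zero. $H_\lambda(u)=\int_\Omega(|\nabla u|^2-\lambda u^2)\,dx$, $M(u)=\int_\Omega m|u|^{\alpha+1}\,dx$, and $E_\lambda''(u):=H_\lambda(u)-\alpha M(u)$ (second fibering derivative of $E_\lambda=\frac12H_\lambda-\frac1{\alpha+1}M$). *)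

theory Defs
  imports "HOL-Analysis.Analysis"
begin

section \<open>Test functions, weak gradients and Sobolev spaces\<close>

definition grad :: "('a::euclidean_space \<Rightarrow> real) \<Rightarrow> 'a \<Rightarrow> 'a" where
  "grad f x = (\<Sum>i\<in>Basis. frechet_derivative f (at x) i *\<^sub>R i)"

primrec Ck :: "nat \<Rightarrow> ('a::euclidean_space \<Rightarrow> real) \<Rightarrow> bool" where
  "Ck 0 f \<longleftrightarrow> continuous_on UNIV f"
| "Ck (Suc k) f \<longleftrightarrow> f differentiable_on UNIV \<and>
     (\<forall>i\<in>Basis. Ck k (\<lambda>x. frechet_derivative f (at x) i))"

definition test_functions :: "'a::euclidean_space set \<Rightarrow> ('a \<Rightarrow> real) set" where
  "test_functions D = {\<phi>. (\<forall>k. Ck k \<phi>) \<and> compact (closure {x. \<phi> x \<noteq> 0}) \<and>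
     closure {x. \<phi> x \<noteq> 0} \<subseteq> D}"

text \<open>Elements of function spaces on \<open>D\<close> are total functions whose values outside \<open>D\<close> are
  irrelevant; they are identified when they agree almost everywhere in \<open>D\<close>.\<close>

definition L2 :: "'a::euclidean_space set \<Rightarrow> ('a \<Rightarrow> 'b::euclidean_space) set" where
  "L2 D = {u \<in> borel_measurable (lebesgue_on D).
     integrable (lebesgue_on D) (\<lambda>x. (norm (u x))\<^sup>2)}"

definition Linfty :: "'a::euclidean_space set \<Rightarrow> ('a \<Rightarrow> real) set" where
  "Linfty D = {u \<in> borel_measurable (lebesgue_on D).
     \<exists>C. AE x in lebesgue_on D. \<bar>u x\<bar> \<le> C}"

definition is_weak_grad ::
    "'a::euclidean_space set \<Rightarrow> ('a \<Rightarrow> real) \<Rightarrow> ('a \<Rightarrow> 'a) \<Rightarrow> bool" where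
  "is_weak_grad D u g \<longleftrightarrow> (\<forall>\<phi>\<in>test_functions D. \<forall>i\<in>Basis.
     (LINT x|lebesgue_on D. u x * (grad \<phi> x \<bullet> i)) =
     - (LINT x|lebesgue_on D. (g x \<bullet> i) * \<phi> x))"

definition H1 :: "'a::euclidean_space set \<Rightarrow> ('a \<Rightarrow> real) set" where
  "H1 D = {u \<in> L2 D. \<exists>g\<in>L2 D. is_weak_grad D u g}"

text \<open>The weak gradient is unique almost everywhere in an open set \<open>D\<close>, so the integrals below
  do not depend on the representative chosen here.\<close>

definition wgrad :: "'a::euclidean_space set \<Rightarrow> ('a \<Rightarrow> real) \<Rightarrow> 'a \<Rightarrow> 'a" where
  "wgrad D u = (SOME g. g \<in> L2 D \<and> is_weak_grad D u g)"

definition H01 :: "'a::euclidean_space set \<Rightarrow> ('a \<Rightarrow> real) set" where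
  "H01 D = {u \<in> H1 D. \<exists>\<phi>. (\<forall>n::nat. \<phi> n \<in> test_functions D) \<and>
     (\<lambda>n. LINT x|lebesgue_on D. (u x - \<phi> n x)\<^sup>2 + (norm (wgrad D u x - grad (\<phi> n) x))\<^sup>2)
       \<longlonglongrightarrow> 0}"

definition nonzero_on :: "'a::euclidean_space set \<Rightarrow> ('a \<Rightarrow> real) \<Rightarrow> bool" where
  "nonzero_on D u \<longleftrightarrow> \<not> (AE x in lebesgue_on D. u x = 0)"


section \<open>Domains\<close>

definition is_domain :: "'a::euclidean_space set \<Rightarrow> bool" where
  "is_domain D \<longleftrightarrow> open D \<and> connected D \<and> D \<noteq> {}"

text \<open>Near each boundary point, \<open>D\<close> is the strict epigraph, in some direction \<open>e\<close>, of a function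
  \<open>\<gamma>\<close> of the regularity \<open>P\<close> on the hyperplane orthogonal to \<open>e\<close>. Only the values of \<open>\<gamma>\<close> on
  that hyperplane enter, so \<open>\<gamma>\<close> may be taken on the whole space, constant along \<open>e\<close>.\<close>

definition graph_boundary ::
    "(('a::euclidean_space \<Rightarrow> real) \<Rightarrow> bool) \<Rightarrow> 'a set \<Rightarrow> bool" where
  "graph_boundary P D \<longleftrightarrow> (\<forall>p\<in>frontier D. \<exists>e \<gamma> r. norm e = 1 \<and> P \<gamma> \<and> 0 < r \<and>
     (\<forall>x\<in>ball p r. x \<in> D \<longleftrightarrow> \<gamma> (x - (x \<bullet> e) *\<^sub>R e) < x \<bullet> e))"

definition C1_boundary :: "'a::euclidean_space set \<Rightarrow> bool" where
  "C1_boundary D \<longleftrightarrow> graph_boundary (Ck 1) D"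

definition lipschitz_domain :: "'a::euclidean_space set \<Rightarrow> bool" where
  "lipschitz_domain D \<longleftrightarrow> is_domain D \<and> graph_boundary (\<lambda>\<gamma>. \<exists>L. L-lipschitz_on UNIV \<gamma>) D"


section \<open>The first Dirichlet eigenvalue\<close>

definition dirichlet_eigenfunction ::
    "'a::euclidean_space set \<Rightarrow> real \<Rightarrow> ('a \<Rightarrow> real) \<Rightarrow> bool" where
  "dirichlet_eigenfunction D \<mu> u \<longleftrightarrow> u \<in> H01 D \<and> nonzero_on D u \<and>
     (\<forall>v\<in>H01 D. (LINT x|lebesgue_on D. wgrad D u x \<bullet> wgrad D v x) =
        \<mu> * (LINT x|lebesgue_on D. u x * v x))"

definition lambda1 :: "'a::euclidean_space set \<Rightarrow> real" where
  "lambda1 D = (LEAST \<mu>. \<exists>u. dirichlet_eigenfunction D \<mu> u)"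

definition pos_first_eigenfunction :: "'a::euclidean_space set \<Rightarrow> ('a \<Rightarrow> real) \<Rightarrow> bool" where
  "pos_first_eigenfunction D \<phi> \<longleftrightarrow> dirichlet_eigenfunction D (lambda1 D) \<phi> \<and>
     (AE x in lebesgue_on D. 0 < \<phi> x)"


section \<open>The weight, the functionals and the minimization problem\<close>

definition Omega_plus :: "'a::euclidean_space set \<Rightarrow> ('a \<Rightarrow> real) \<Rightarrow> 'a set" where
  "Omega_plus \<Omega> m = {x \<in> \<Omega>. 0 < m x}"

definition zero_set :: "'a::euclidean_space set \<Rightarrow> ('a \<Rightarrow> real) \<Rightarrow> 'a set" where
  "zero_set \<Omega> m = {x \<in> \<Omega>. m x = 0}"

definition Omega_zero :: "'a::euclidean_space set \<Rightarrow> ('a \<Rightarrow> real) \<Rightarrow> 'a set" where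
  "Omega_zero \<Omega> m = interior (zero_set \<Omega> m)"

definition domain_regularity :: "'a::euclidean_space set \<Rightarrow> ('a \<Rightarrow> real) \<Rightarrow> bool" where
  "domain_regularity \<Omega> m \<longleftrightarrow>
     lipschitz_domain (Omega_zero \<Omega> m \<union> Omega_plus \<Omega> m) \<and>
     (0 < measure lebesgue (Omega_zero \<Omega> m) \<longrightarrow>
        lipschitz_domain (Omega_zero \<Omega> m) \<and>
        compact (closure (Omega_zero \<Omega> m)) \<and> closure (Omega_zero \<Omega> m) \<subseteq> \<Omega>) \<and>
     negligible (sym_diff (zero_set \<Omega> m) (closure (Omega_zero \<Omega> m)))"

definition H_fun :: "'a::euclidean_space set \<Rightarrow> real \<Rightarrow> ('a \<Rightarrow> real) \<Rightarrow> real" where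
  "H_fun \<Omega> \<mu> u = (LINT x|lebesgue_on \<Omega>. (norm (wgrad \<Omega> u x))\<^sup>2 - \<mu> * (u x)\<^sup>2)"

definition M_fun ::
    "'a::euclidean_space set \<Rightarrow> ('a \<Rightarrow> real) \<Rightarrow> real \<Rightarrow> ('a \<Rightarrow> real) \<Rightarrow> real" where
  "M_fun \<Omega> m \<alpha> u = (LINT x|lebesgue_on \<Omega>. m x * \<bar>u x\<bar> powr (\<alpha> + 1))"

definition E_second ::
    "'a::euclidean_space set \<Rightarrow> ('a \<Rightarrow> real) \<Rightarrow> real \<Rightarrow> real \<Rightarrow> ('a \<Rightarrow> real) \<Rightarrow> real" where
  "E_second \<Omega> m \<alpha> \<mu> u = H_fun \<Omega> \<mu> u - \<alpha> * M_fun \<Omega> m \<alpha> u"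

definition rayleigh :: "'a::euclidean_space set \<Rightarrow> ('a \<Rightarrow> real) \<Rightarrow> real" where
  "rayleigh \<Omega> u = (LINT x|lebesgue_on \<Omega>. (norm (wgrad \<Omega> u x))\<^sup>2) /
                  (LINT x|lebesgue_on \<Omega>. (u x)\<^sup>2)"

definition admissible ::
    "'a::euclidean_space set \<Rightarrow> ('a \<Rightarrow> real) \<Rightarrow> real \<Rightarrow> ('a \<Rightarrow> real) set" where
  "admissible \<Omega> m \<alpha> = {u \<in> H01 \<Omega>. nonzero_on \<Omega> u \<and> 0 \<le> M_fun \<Omega> m \<alpha> u}"

definition lambda_star :: "'a::euclidean_space set \<Rightarrow> ('a \<Rightarrow> real) \<Rightarrow> real \<Rightarrow> real" where
  "lambda_star \<Omega> m \<alpha> = (INF u\<in>admissible \<Omega> m \<alpha>. rayleigh \<Omega> u)"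

definition nonneg_minimizer ::
    "'a::euclidean_space set \<Rightarrow> ('a \<Rightarrow> real) \<Rightarrow> real \<Rightarrow> ('a \<Rightarrow> real) \<Rightarrow> bool" where
  "nonneg_minimizer \<Omega> m \<alpha> u \<longleftrightarrow> u \<in> admissible \<Omega> m \<alpha> \<and>
     rayleigh \<Omega> u = lambda_star \<Omega> m \<alpha> \<and> (AE x in lebesgue_on \<Omega>. 0 \<le> u x)"

text \<open>At \<open>w x = 0\<close> the nonlinearity \<open>\<bar>w x\<bar> powr (\<alpha> - 1) * w x\<close> is zero, as intended.\<close>

definition weak_solution ::
    "'a::euclidean_space set \<Rightarrow> ('a \<Rightarrow> real) \<Rightarrow> real \<Rightarrow> real \<Rightarrow> ('a \<Rightarrow> real) \<Rightarrow> bool" where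
  "weak_solution \<Omega> m \<alpha> \<mu> w \<longleftrightarrow> w \<in> H01 \<Omega> \<and>
     (\<forall>v\<in>H01 \<Omega>. (LINT x|lebesgue_on \<Omega>. wgrad \<Omega> w x \<bullet> wgrad \<Omega> v x) =
        (LINT x|lebesgue_on \<Omega>. (\<mu> * w x + m x * (\<bar>w x\<bar> powr (\<alpha> - 1) * w x)) * v x))"

end

theory Submission
  imports Defs "HOL-Complex_Analysis.Great_Picard"
begin

text \<open>
  Functions on \<open>D\<close> are extended by zero, and \<open>H\<^sub>0\<^sup>1(D)\<close> becomes a closed subspace of
  \<open>L\<^sup>2 \<times> L\<^sup>2\<close>, the closure of the pairs \<open>(\<phi>, \<nabla>\<phi>)\<close> of test functions and their gradients.
  Weak compactness is replaced by two strong arguments: Rellich's theorem, from the Poincare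
  inequality on the cells of a fine division, and a parallelogram argument that turns \<open>L\<^sup>2\<close>
  convergence with bounded gradients into membership of the limit. They give a minimizer, which
  may be replaced by its absolute value.

  If \<open>M(u) > 0\<close>, the constraint is inactive, so \<open>u\<close> is a nonnegative eigenfunction, hence a multiple
  of the first one by the strong maximum principle (the logarithmic test function
  \<open>\<psi>\<^sup>2 / (u + \<epsilon>)\<close>, smoothed), which contradicts \<open>M(\<phi>) < 0\<close>. So \<open>M(u) = 0\<close>.

  If \<open>m u\<^sup>\<alpha>\<close> does not vanish, one-sided variations give a Lagrange multiplier \<open>\<mu> \<ge> 0\<close>; it is positive by the
  same contradiction, and \<open>\<tau>\<close> with \<open>\<tau>\<^sup>\<alpha> = \<tau> \<mu>\<close> absorbs it. If \<open>m u\<^sup>\<alpha>\<close> vanishes, or if \<open>m \<le> 0\<close>, then \<open>u\<close>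
  vanishes outside the closure of \<open>\<Omega>\<^sup>0\<close>; translating \<open>u\<close> into \<open>\<Omega>\<^sup>0\<close> along the graph directions of the boundary
  shows that \<open>u\<close> belongs to \<open>H\<^sub>0\<^sup>1(\<Omega>\<^sup>0)\<close>, so the minimum is compared with the first eigenvalue of \<open>\<Omega>\<^sup>0\<close>.
\<close>

section \<open>Smooth functions and cutoffs\<close>

text \<open>The weak gradient is fixed only by a choice operator, and the gradients of a minimising
  sequence need not converge, so function and gradient are never separated: in the closure of test
  pairs the second component is determined by the first, and every limit is taken among pairs. All
  classes live on the whole space, hence spaces over different domains are compared by inclusion,
  and translation needs no change of space. What compactness must deliver is modest:
  \<open>M\<close> is continuous for strong L2 convergence because \<alpha> + 1 < 2 and \<Omega> is
  bounded, so only the function has to converge strongly, while for the gradient a norm bound in the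
  limit suffices. The nonlinearity is not differentiable at zero, but \<open>M\<close> has exponent
  above 1, and its derivative at a nonnegative function is the weight times the \<alpha>-th power of
  that function. The derivative is used only in directions of increase, since the minimizer lies on
  the boundary of the constraint set; if it vanishes, the minimizer lives where m = 0, and the
  assumptions of (iii) exclude exactly this.\<close>

lemma Ck_Suc_imp: "Ck (Suc k) f \<Longrightarrow> Ck k f"
proof (induction k arbitrary: f)
  case 0
  then show ?case by (simp add: differentiable_imp_continuous_on)
next
  case (Suc k)
  then show ?case by auto
qed

lemma Ck_SucI:
  assumes "\<And>x. (f has_derivative f' x) (at x)" "\<And>i. i \<in> Basis \<Longrightarrow> Ck k (\<lambda>x. f' x i)"
  shows "Ck (Suc k) f"
proof -
  have "frechet_derivative f (at x) = f' x" for x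
    using assms(1)[of x] by (metis frechet_derivative_at)
  moreover have "f differentiable_on UNIV"
    using assms(1) by (meson differentiable_def differentiable_at_imp_differentiable_on)
  ultimately show ?thesis using assms(2) by simp
qed

lemma Ck_has_derivative:
  assumes "Ck (Suc k) f"
  shows "(f has_derivative frechet_derivative f (at x)) (at x)"
  using assms by (simp add: differentiable_on_def flip: frechet_derivative_works)

lemma Ck_const: "Ck k (\<lambda>x. c)"
proof (induction k arbitrary: c)
  case (Suc k)
  show ?case by (rule Ck_SucI[where f' = "\<lambda>x h. 0"]) (auto intro: Suc)
qed simp

lemma Ck_add:
  assumes "Ck k f" "Ck k g" shows "Ck k (\<lambda>x. f x + g x)"
  using assms
proof (induction k arbitrary: f g)
  case 0
  then show ?case by (simp add: continuous_on_add)
next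
  case (Suc k)
  show ?case
    by (rule Ck_SucI[where f' = "\<lambda>x h. frechet_derivative f (at x) h + frechet_derivative g (at x) h"])
      (use Suc in \<open>auto intro!: derivative_intros Ck_has_derivative simp del: Ck.simps(2) intro: Suc.IH\<close>,
       use Suc in auto)
qed

lemma Ck_mult:
  assumes "Ck k f" "Ck k g" shows "Ck k (\<lambda>x. f x * g x)"
  using assms
proof (induction k arbitrary: f g)
  case 0
  then show ?case by (simp add: continuous_on_mult)
next
  case (Suc k)
  have "((\<lambda>x. f x * g x) has_derivative
      (\<lambda>h. f x * frechet_derivative g (at x) h + frechet_derivative f (at x) h * g x)) (at x)" for x
    using Suc.prems by (intro has_derivative_mult Ck_has_derivative)
  moreover have "Ck k f" "Ck k g" using Suc.prems by (blast intro: Ck_Suc_imp)+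
  ultimately show ?case
    using Suc.prems by (elim Ck_SucI) (auto intro!: Ck_add Suc.IH)
qed

text \<open>The outer function is constrained only at the values taken by \<open>f\<close>, so that
  \<open>inverse\<close> and \<open>sqrt\<close> are covered although they are not differentiable
  everywhere. The regularity of \<open>F'\<close> along \<open>f\<close> is left to the induction of
  the caller.\<close>

lemma Ck_compose_real:
  assumes "\<And>x. (F has_real_derivative F' (f x)) (at (f x))" "Ck (Suc k) f" "Ck k (\<lambda>x. F' (f x))"
  shows "Ck (Suc k) (\<lambda>x. F (f x))"
proof (rule Ck_SucI)
  fix x
  show "((\<lambda>x. F (f x)) has_derivative (\<lambda>h. F' (f x) * frechet_derivative f (at x) h)) (at x)"
    using has_derivative_compose[OF Ck_has_derivative[OF assms(2)]
      assms(1)[unfolded has_field_derivative_def]] by simp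
next
  fix i :: 'a assume "i \<in> Basis"
  then show "Ck k (\<lambda>x. F' (f x) * frechet_derivative f (at x) i)"
    using assms(2,3) by (intro Ck_mult) auto
qed

lemma Ck_inverse:
  assumes "Ck k f" "\<And>x. f x \<noteq> 0" shows "Ck k (\<lambda>x. inverse (f x))"
  using assms
proof (induction k arbitrary: f)
  case 0
  then show ?case by (simp add: continuous_on_inverse)
next
  case (Suc k)
  have "Ck k (\<lambda>x. inverse (f x))" using Suc by (blast intro: Ck_Suc_imp)
  then have "Ck k (\<lambda>x. (-1) * (inverse (f x) * inverse (f x)))"
    by (intro Ck_mult Ck_const)
  then show ?case
    using Suc.prems
    by (intro Ck_compose_real[where F' = "\<lambda>y. (-1) * (inverse y * inverse y)" and F = inverse])
      (auto intro!: derivative_eq_intros simp del: Ck.simps(2))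
qed

lemma Ck_sqrt:
  assumes "Ck k f" "\<And>x. 0 < f x" shows "Ck k (\<lambda>x. sqrt (f x))"
  using assms
proof (induction k arbitrary: f)
  case 0
  then show ?case by (simp add: continuous_on_real_sqrt)
next
  case (Suc k)
  have "Ck k (\<lambda>x. sqrt (f x))" using Suc by (blast intro: Ck_Suc_imp)
  then have "Ck k (\<lambda>x. inverse (sqrt (f x)) * (1/2))"
    using Suc.prems(2) by (intro Ck_mult Ck_const Ck_inverse) (auto simp: less_imp_neq[symmetric])
  moreover have "(sqrt has_real_derivative inverse (sqrt (f x)) * (1/2)) (at (f x))" for x
    using DERIV_real_sqrt[OF Suc.prems(2)[of x]] by simp
  ultimately show ?case
    using Suc.prems(1)
    by (intro Ck_compose_real[where F' = "\<lambda>y. inverse (sqrt y) * (1/2)" and F = sqrt])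
qed

lemma Ck_linear:
  assumes "bounded_linear f" shows "Ck k f"
proof (cases k)
  case 0
  then show ?thesis using assms by (simp add: linear_continuous_on)
next
  case (Suc n)
  then show ?thesis
    unfolding Suc by (intro Ck_SucI[where f' = "\<lambda>x. f"] Ck_const bounded_linear_imp_has_derivative assms)
qed

lemma Ck_translate:
  assumes "Ck k f" shows "Ck k (\<lambda>x. f (x + s))"
  using assms
proof (induction k arbitrary: f)
  case 0
  then show ?case by (auto intro!: continuous_intros intro: continuous_on_compose2)
next
  case (Suc k)
  have "((\<lambda>x. f (x + s)) has_derivative frechet_derivative f (at (x + s))) (at x)" for x
    by (rule has_derivative_compose[of "\<lambda>x. x + s" "\<lambda>h. h" x UNIV f, OF _ Ck_has_derivative[OF Suc.prems]])
      (auto intro!: derivative_eq_intros)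
  then show ?case
    using Suc by (intro Ck_SucI) auto
qed

lemma Ck_norm_sq: "Ck k (\<lambda>x::'a::euclidean_space. (norm (x - p))\<^sup>2)"
proof -
  have *: "Ck k (\<lambda>x::'a. (x - p) \<bullet> b)" for b k
    using Ck_add[OF Ck_linear[OF bounded_linear_inner_left[of b]] Ck_const[of _ "- (p \<bullet> b)"]]
    by (simp add: inner_diff_left)
  have "Ck k (\<lambda>x. (norm (x - p))\<^sup>2)" if "k = Suc n" for n
    unfolding that power2_norm_eq_inner
  proof (rule Ck_SucI)
    show "((\<lambda>x. (x - p) \<bullet> (x - p)) has_derivative (\<lambda>h. 2 * ((x - p) \<bullet> h))) (at x)" for x
      by (auto intro!: derivative_eq_intros simp: inner_commute)
  qed (intro Ck_mult Ck_const *)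
  then show ?thesis by (cases k) (auto intro!: continuous_intros simp del: Ck.simps(2))
qed

text \<open>The classical function exp(-1/t), extended by zero, with a polynomial factor in 1/t. The
  factor makes the family closed under differentiation, so that smoothness follows by one induction
  over the order, with the polynomial arbitrary.\<close>

definition flat :: "real poly \<Rightarrow> real \<Rightarrow> real" where
  "flat p t = (if 0 < t then poly p (inverse t) * exp (- inverse t) else 0)"

lemma flat_tendsto_0: "(flat p \<longlongrightarrow> 0) (at 0)"
proof -
  have "((\<lambda>y. poly p y * exp (- y)) \<longlongrightarrow> 0) at_top"
  proof -
    have "((\<lambda>y. \<Sum>i\<le>degree p. coeff p i * (y ^ i / exp y)) \<longlongrightarrow> (\<Sum>i\<le>degree p. coeff p i * 0)) at_top"
      by (intro tendsto_sum tendsto_mult tendsto_const tendsto_power_div_exp_0)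
    then show ?thesis
      by (simp add: poly_altdef sum_distrib_right exp_minus divide_inverse mult.assoc)
  qed
  from filterlim_compose[OF this filterlim_inverse_at_top_right]
  have "((\<lambda>t. poly p (inverse t) * exp (- inverse t)) \<longlongrightarrow> 0) (at_right 0)" .
  then have "(flat p \<longlongrightarrow> 0) (at_right 0)"
    by (rule Lim_transform_eventually) (auto simp: eventually_at_filter flat_def)
  moreover have "(flat p \<longlongrightarrow> 0) (at_left 0)"
    by (rule Lim_transform_eventually[OF tendsto_const]) (auto simp: eventually_at_filter flat_def)
  ultimately show ?thesis by (simp add: filterlim_split_at_real)
qed

text \<open>With y = 1/t one has dy/dt = -y^2, so the derivative of p(y) exp(-y) is y^2 (p(y) -
  p'(y)) exp(-y); this is the polynomial in the statement.\<close>

lemma flat_deriv: "(flat p has_real_derivative flat (monom 1 2 * (p - pderiv p)) t) (at t)"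
proof -
  consider "t < 0" | "t = 0" | "t > 0" by linarith
  then show ?thesis
  proof cases
    case 1
    have "((\<lambda>t. 0) has_real_derivative 0) (at t)" by simp
    then have "(flat p has_real_derivative 0) (at t)"
      by (rule has_field_derivative_transform_within_open[where S = "{..<0}"]) (use 1 in \<open>auto simp: flat_def\<close>)
    then show ?thesis using 1 by (simp add: flat_def)
  next
    case 2
    \<comment> \<open>Dividing by h raises the degree in 1/h by one: the difference quotient at zero
      is again a flat function, with polynomial \<open>pCons 0 p\<close>, and tends to 0.\<close>
    have "((\<lambda>h. (flat p (0 + h) - flat p 0) / h) \<longlongrightarrow> 0) (at 0)"
      by (rule Lim_transform_eventually[OF flat_tendsto_0[of "pCons 0 p"]])
        (auto simp: eventually_at_filter flat_def divide_inverse)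
    then show ?thesis using 2 by (simp add: DERIV_def flat_def)
  next
    case 3
    have "((\<lambda>t. poly p (inverse t) * exp (- inverse t)) has_real_derivative
      poly (monom 1 2 * (p - pderiv p)) (inverse t) * exp (- inverse t)) (at t)"
      using 3 by (auto intro!: derivative_eq_intros DERIV_chain2[OF poly_DERIV]
          simp: poly_monom power2_eq_square algebra_simps)
    then have "(flat p has_real_derivative poly (monom 1 2 * (p - pderiv p)) (inverse t) * exp (- inverse t)) (at t)"
      by (rule has_field_derivative_transform_within_open[where S = "{0<..}"]) (use 3 in \<open>auto simp: flat_def\<close>)
    then show ?thesis using 3 by (simp add: flat_def)
  qed
qed

lemma Ck_flat: "Ck k f \<Longrightarrow> Ck k (\<lambda>x. flat p (f x))"
proof (induction k arbitrary: p)
  case 0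
  have "continuous_on UNIV (flat p)"
    by (meson DERIV_isCont flat_deriv continuous_at_imp_continuous_on)
  then show ?case using 0 by (auto intro: continuous_on_compose2)
next
  case (Suc k)
  show ?case
    by (rule Ck_compose_real[OF flat_deriv Suc.prems]) (rule Suc.IH[OF Ck_Suc_imp[OF Suc.prems]])
qed

lemma flat_1_nonneg: "0 \<le> flat 1 t" and flat_1_pos: "0 < flat 1 t \<longleftrightarrow> 0 < t"
  by (auto simp: flat_def)

definition smooth :: "('a::euclidean_space \<Rightarrow> real) \<Rightarrow> bool" where
  "smooth f \<longleftrightarrow> (\<forall>k. Ck k f)"

lemma smooth_const: "smooth (\<lambda>x. c)"
  and smooth_add: "smooth f \<Longrightarrow> smooth g \<Longrightarrow> smooth (\<lambda>x. f x + g x)"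
  and smooth_mult: "smooth f \<Longrightarrow> smooth g \<Longrightarrow> smooth (\<lambda>x. f x * g x)"
  and smooth_inverse: "smooth f \<Longrightarrow> (\<And>x. f x \<noteq> 0) \<Longrightarrow> smooth (\<lambda>x. inverse (f x))"
  and smooth_sqrt: "smooth f \<Longrightarrow> (\<And>x. 0 < f x) \<Longrightarrow> smooth (\<lambda>x. sqrt (f x))"
  and smooth_translate: "smooth f \<Longrightarrow> smooth (\<lambda>x. f (x + s))"
  by (auto simp: smooth_def Ck_const Ck_add Ck_mult Ck_inverse Ck_sqrt Ck_translate)

lemma smooth_diff: "smooth f \<Longrightarrow> smooth g \<Longrightarrow> smooth (\<lambda>x. f x - g x)"
  using smooth_add[OF _ smooth_mult[OF smooth_const[of "-1"]], of f g] by simp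

lemma smooth_compose_real:
  assumes "\<And>x. (F has_real_derivative F' (f x)) (at (f x))" "smooth f" "smooth (\<lambda>x. F' (f x))"
  shows "smooth (\<lambda>x. F (f x))"
  using assms Ck_compose_real Ck_Suc_imp unfolding smooth_def by metis

text \<open>The quotient b / (b + c) of two flat functions of the squared distance: \<open>b\<close>
  vanishes outside the large ball, \<open>c\<close> inside the small one, and r < s prevents both
  from vanishing at once.\<close>

lemma smooth_bump:
  fixes p :: "'a::euclidean_space"
  assumes "0 < r" "r < s"
  obtains f where "smooth f" "\<And>x. 0 \<le> f x" "\<And>x. f x \<le> 1" "\<And>x. x \<in> cball p r \<Longrightarrow> f x = 1"
    "\<And>x. x \<notin> ball p s \<Longrightarrow> f x = 0"
proof -
  define b c where "b x = flat 1 (s\<^sup>2 - (norm (x - p))\<^sup>2)" and "c x = flat 1 ((norm (x - p))\<^sup>2 - r\<^sup>2)" for x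
  have rs: "r\<^sup>2 < s\<^sup>2" using assms by (simp add: power_strict_mono)
  have nn: "0 \<le> b x" "0 \<le> c x" for x by (simp_all add: b_def c_def flat_1_nonneg)
  have pos: "0 < b x + c x" for x
  proof -
    have "0 < b x \<or> 0 < c x" using rs unfolding b_def c_def flat_1_pos by linarith
    then show ?thesis using nn[of x] by linarith
  qed
  have "smooth b" "smooth c"
    unfolding b_def c_def smooth_def using Ck_norm_sq[of _ p]
    by (auto intro!: Ck_flat simp: smooth_diff[unfolded smooth_def] smooth_const[unfolded smooth_def])
  then have "smooth (\<lambda>x. b x * inverse (b x + c x))"
    using pos by (intro smooth_mult smooth_inverse smooth_add) (auto simp: less_imp_neq[symmetric])
  moreover have "c x = 0" if "x \<in> cball p r" for x
    using that power_mono[of "norm (x - p)" r 2]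
    by (auto simp: c_def flat_def dist_norm norm_minus_commute[of p])
  moreover have "b x = 0" if "x \<notin> ball p s" for x
    using that assms by (auto simp: b_def flat_def dist_norm norm_minus_commute not_less abs_le_square_iff[symmetric])
  ultimately show thesis
    using nn pos by (intro that[of "\<lambda>x. b x * inverse (b x + c x)"])
      (auto simp: divide_simps less_imp_neq[symmetric] simp flip: divide_inverse, 
       metis add.right_neutral less_irrefl)
qed

section \<open>Gradients of smooth functions\<close>

lemma grad_inner_Basis: "i \<in> Basis \<Longrightarrow> grad f x \<bullet> i = frechet_derivative f (at x) i"
  by (simp add: grad_def)

lemma grad_eqI:
  assumes "(f has_derivative (\<lambda>h. g \<bullet> h)) (at x)" shows "grad f x = g"
proof -
  have "frechet_derivative f (at x) = (\<lambda>h. g \<bullet> h)" using frechet_derivative_at[OF assms] by simp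
  then show ?thesis by (simp add: grad_def euclidean_representation)
qed

lemma smooth_has_derivative:
  assumes "smooth f" shows "(f has_derivative (\<lambda>h. grad f x \<bullet> h)) (at x)"
proof -
  have D: "(f has_derivative frechet_derivative f (at x)) (at x)"
    using assms Ck_has_derivative unfolding smooth_def by blast
  interpret bounded_linear "frechet_derivative f (at x)" using D by (rule has_derivative_bounded_linear)
  have "frechet_derivative f (at x) h = grad f x \<bullet> h" for h
  proof -
    have "frechet_derivative f (at x) h = frechet_derivative f (at x) (\<Sum>i\<in>Basis. (h \<bullet> i) *\<^sub>R i)"
      by (simp add: euclidean_representation)
    also have "\<dots> = grad f x \<bullet> h"
      by (simp add: sum scaleR euclidean_inner[of "grad f x" h] grad_inner_Basis mult.commute)
    finally show ?thesis .
  qed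
  then have "frechet_derivative f (at x) = (\<lambda>h. grad f x \<bullet> h)" by blast
  with D show ?thesis by simp
qed

lemma smooth_continuous: "smooth f \<Longrightarrow> continuous_on S f"
  unfolding smooth_def using Ck.simps(1) continuous_on_subset by blast

lemma smooth_grad_inner: assumes "smooth f" shows "smooth (\<lambda>x. grad f x \<bullet> h)"
proof -
  have "smooth (\<lambda>x. frechet_derivative f (at x) i)" if "i \<in> Basis" for i
    unfolding smooth_def
  proof
    fix k
    have "Ck (Suc k) f" using assms unfolding smooth_def by blast
    then show "Ck k (\<lambda>x. frechet_derivative f (at x) i)" using that by simp
  qed
  then have *: "smooth (\<lambda>x. frechet_derivative f (at x) i * (i \<bullet> h))" if "i \<in> Basis" for i
    using that by (intro smooth_mult smooth_const)
  have H: "finite B \<Longrightarrow> B \<subseteq> Basis \<Longrightarrow> smooth (\<lambda>x. \<Sum>i\<in>B. frechet_derivative f (at x) i * (i \<bullet> h))" for B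
    by (induction B rule: finite_induct) (auto intro!: smooth_const smooth_add *)
  show ?thesis
    unfolding grad_def inner_sum_left inner_scaleR_left by (rule H[OF finite_Basis subset_refl])
qed

lemma continuous_grad: assumes "smooth f" shows "continuous_on S (grad f)"
proof -
  have "continuous_on S (\<lambda>x. frechet_derivative f (at x) i)" if "i \<in> Basis" for i
    using smooth_continuous[OF smooth_grad_inner[OF assms, of i]] that by (simp only: grad_inner_Basis)
  then show ?thesis unfolding grad_def by (intro continuous_intros)
qed

lemma grad_add: "smooth f \<Longrightarrow> smooth g \<Longrightarrow> grad (\<lambda>x. f x + g x) x = grad f x + grad g x"
  by (rule grad_eqI)
    (auto intro!: derivative_eq_intros smooth_has_derivative simp: inner_add_left)

lemma grad_mult: "smooth f \<Longrightarrow> smooth g \<Longrightarrow> grad (\<lambda>x. f x * g x) x = f x *\<^sub>R grad g x + g x *\<^sub>R grad f x"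
  by (rule grad_eqI)
    (auto intro!: derivative_eq_intros smooth_has_derivative simp: inner_add_left mult.commute)

lemma grad_const: "grad (\<lambda>x. c) x = 0"
  by (rule grad_eqI) simp

lemma grad_cmult: "smooth f \<Longrightarrow> grad (\<lambda>x. c * f x) x = c *\<^sub>R grad f x"
  by (simp add: grad_mult smooth_const grad_const)

lemma grad_compose_real:
  assumes "(F has_real_derivative d) (at (f x))" "smooth f"
  shows "grad (\<lambda>x. F (f x)) x = d *\<^sub>R grad f x"
proof (rule grad_eqI)
  show "((\<lambda>x. F (f x)) has_derivative (\<lambda>h. d *\<^sub>R grad f x \<bullet> h)) (at x)"
    using has_derivative_compose[OF smooth_has_derivative[OF assms(2)]
      assms(1)[unfolded has_field_derivative_def]] by simp
qed

lemma grad_translate: "smooth f \<Longrightarrow> grad (\<lambda>x. f (x + s)) x = grad f (x + s)"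
proof (rule grad_eqI)
  assume "smooth f"
  then show "((\<lambda>x. f (x + s)) has_derivative (\<lambda>h. grad f (x + s) \<bullet> h)) (at x)"
    by (intro has_derivative_compose[of "\<lambda>x. x + s" "\<lambda>h. h" x UNIV f, OF _ smooth_has_derivative])
      (auto intro!: derivative_eq_intros)
qed

section \<open>Test functions and cutoffs\<close>

lemma test_functionsI:
  assumes "smooth f" "compact K" "K \<subseteq> D" "\<And>x. x \<notin> K \<Longrightarrow> f x = 0"
  shows "f \<in> test_functions D"
proof -
  have "closure {x. f x \<noteq> 0} \<subseteq> K"
    using assms by (intro closure_minimal compact_imp_closed) auto
  then show ?thesis
    using assms unfolding test_functions_def smooth_def
    by (auto simp: compact_eq_bounded_closed intro: bounded_subset)
qed

lemma test_functionsE: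
  assumes "f \<in> test_functions D"
  obtains K where "smooth f" "compact K" "K \<subseteq> D" "\<And>x. x \<notin> K \<Longrightarrow> f x = 0" "\<And>x. x \<notin> K \<Longrightarrow> grad f x = 0"
proof
  let ?K = "closure {x. f x \<noteq> 0}"
  show "smooth f" "compact ?K" "?K \<subseteq> D" using assms by (auto simp: test_functions_def smooth_def)
  show 0: "f x = 0" if "x \<notin> ?K" for x using that closure_subset[of "{x. f x \<noteq> 0}"] by auto
  show "grad f x = 0" if "x \<notin> ?K" for x
  proof (rule grad_eqI)
    have "((\<lambda>x. 0) has_derivative (\<lambda>h. 0 \<bullet> h)) (at x)" by simp
    then show "(f has_derivative (\<lambda>h. 0 \<bullet> h)) (at x)"
    proof (rule has_derivative_transform_within_open)
      show "open (- ?K)" by (rule open_Compl[OF closed_closure])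
      show "x \<in> - ?K" using that by (simp only: Compl_iff not_False_eq_True)
      show "0 = f y" if "y \<in> - ?K" for y using that by (intro 0[symmetric]) (simp only: Compl_iff not_False_eq_True)
    qed
  qed
qed

lemma test_smooth: "f \<in> test_functions D \<Longrightarrow> smooth f"
  by (auto simp: test_functions_def smooth_def)

lemma test_mono: "f \<in> test_functions D \<Longrightarrow> D \<subseteq> E \<Longrightarrow> f \<in> test_functions E"
  by (auto simp: test_functions_def)

lemma test_0: "(\<lambda>x. 0) \<in> test_functions D"
  by (rule test_functionsI[of _ "{}"]) (auto simp: smooth_const)

lemma test_add:
  assumes "f \<in> test_functions D" "g \<in> test_functions D"
  shows "(\<lambda>x. f x + g x) \<in> test_functions D"
proof -
  from assms(1) obtain K where K: "smooth f" "compact K" "K \<subseteq> D" "\<And>x. x \<notin> K \<Longrightarrow> f x = 0"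
    by (rule test_functionsE) auto
  from assms(2) obtain L where L: "smooth g" "compact L" "L \<subseteq> D" "\<And>x. x \<notin> L \<Longrightarrow> g x = 0"
    by (rule test_functionsE) auto
  show ?thesis by (rule test_functionsI[of _ "K \<union> L"]) (use K L in \<open>auto simp: smooth_add\<close>)
qed

lemma test_mult:
  assumes "f \<in> test_functions D" "smooth g"
  shows "(\<lambda>x. g x * f x) \<in> test_functions D"
proof -
  from assms(1) obtain K where K: "smooth f" "compact K" "K \<subseteq> D" "\<And>x. x \<notin> K \<Longrightarrow> f x = 0"
    by (rule test_functionsE) auto
  show ?thesis by (rule test_functionsI[of _ K]) (use K assms(2) in \<open>auto simp: smooth_mult\<close>)
qed

lemma test_cmult: "f \<in> test_functions D \<Longrightarrow> (\<lambda>x. c * f x) \<in> test_functions D"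
  by (rule test_mult[OF _ smooth_const])

lemma test_translate:
  assumes "f \<in> test_functions UNIV" shows "(\<lambda>x. f (x + s)) \<in> test_functions UNIV"
proof -
  from assms obtain K where K: "smooth f" "compact K" "\<And>x. x \<notin> K \<Longrightarrow> f x = 0"
    by (rule test_functionsE) auto
  have *: "f (x + s) = 0" if "x \<notin> (\<lambda>y. y - s) ` K" for x
    using that K(3)[of "x + s"] by (force simp: image_iff)
  show ?thesis
    by (rule test_functionsI[OF smooth_translate[OF K(1)] compact_translation_subtract[OF K(2), of s]]) (use * in auto)
qed

lemma test_grad_inner:
  assumes "f \<in> test_functions D" shows "(\<lambda>x. grad f x \<bullet> h) \<in> test_functions D"
  using assms
proof (rule test_functionsE)
  fix K assume "smooth f" "compact K" "K \<subseteq> D" "\<And>x. x \<notin> K \<Longrightarrow> grad f x = 0"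
  then show ?thesis by (intro test_functionsI[of _ K] smooth_grad_inner) auto
qed

lemma test_compose:
  assumes "f \<in> test_functions D" "smooth (\<lambda>x. F (f x))" "F 0 = 0"
  shows "(\<lambda>x. F (f x)) \<in> test_functions D"
  using assms(1)
proof (rule test_functionsE)
  fix K assume "smooth f" "compact K" "K \<subseteq> D" "\<And>x. x \<notin> K \<Longrightarrow> f x = 0"
  then show ?thesis using assms by (intro test_functionsI[of _ K]) auto
qed

text \<open>Bumps on finitely many balls covering \<open>K\<close> are glued by f + (1 - f) \<eta>,
  which is 1 - (1 - f)(1 - \<eta>): it stays in the unit interval and equals 1 wherever one of the
  two does.\<close>

lemma cutoff_exists:
  fixes K :: "'a::euclidean_space set"
  assumes "compact K" "open D" "K \<subseteq> D"
  obtains \<eta> where "\<eta> \<in> test_functions D" "\<And>x. 0 \<le> \<eta> x" "\<And>x. \<eta> x \<le> 1" "\<And>x. x \<in> K \<Longrightarrow> \<eta> x = 1"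
proof -
  \<comment> \<open>The bump is 1 on radius r and supported in radius 2 r, so the doubled ball has
    to fit into \<open>D\<close>.\<close>
  have "\<exists>r>0. cball p (2 * r) \<subseteq> D" if "p \<in> K" for p
  proof -
    from that assms obtain e where e: "e > 0" "cball p e \<subseteq> D" by (meson open_contains_cball subsetD)
    then show ?thesis by (intro exI[of _ "e/2"]) auto
  qed
  then have "\<forall>p. \<exists>r. p \<in> K \<longrightarrow> r > 0 \<and> cball p (2 * r) \<subseteq> D" by blast
  from choice[OF this] obtain r where r: "\<And>p. p \<in> K \<Longrightarrow> r p > 0" "\<And>p. p \<in> K \<Longrightarrow> cball p (2 * r p) \<subseteq> D"
    by blast
  obtain F where F: "finite F" "F \<subseteq> K" "K \<subseteq> (\<Union>p\<in>F. ball p (r p))"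
  proof -
    have "K \<subseteq> (\<Union>p\<in>K. ball p (r p))" using r(1) by force
    then show thesis by (rule compactE_image[OF assms(1), rotated]) (use that in auto)
  qed
  define E where "E \<eta> A \<longleftrightarrow> \<eta> \<in> test_functions D \<and> (\<forall>x. 0 \<le> \<eta> x \<and> \<eta> x \<le> 1) \<and>
    (\<forall>x\<in>(\<Union>p\<in>A. ball p (r p)). \<eta> x = 1)" for \<eta> A
  have "\<exists>\<eta>. E \<eta> F"
    using F(1,2)
  proof (induction F rule: finite_induct)
    case empty
    show ?case by (rule exI[of _ "\<lambda>x. 0"]) (simp add: E_def test_0)
  next
    case (insert p F)
    then obtain \<eta> where \<eta>: "E \<eta> F" by auto
    from insert have p: "p \<in> K" by simp
    obtain f where f: "smooth f" "\<And>x. 0 \<le> f x" "\<And>x. f x \<le> 1" "\<And>x. x \<in> cball p (r p) \<Longrightarrow> f x = 1"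
      "\<And>x. x \<notin> ball p (2 * r p) \<Longrightarrow> f x = 0"
      using smooth_bump[of "r p" "2 * r p" p] r(1)[OF p] by auto
    have ft: "f \<in> test_functions D"
      by (rule test_functionsI[OF f(1) compact_cball r(2)[OF p]]) (use f(5) in auto)
    have "smooth (\<lambda>x. 1 - f x)" using f(1) by (intro smooth_diff smooth_const)
    then have "(\<lambda>x. f x + (1 - f x) * \<eta> x) \<in> test_functions D"
      using ft \<eta> by (intro test_add test_mult) (auto simp: E_def)
    moreover have "0 \<le> f x + (1 - f x) * \<eta> x" "f x + (1 - f x) * \<eta> x \<le> 1" for x
    proof -
      have "0 \<le> (1 - f x) * \<eta> x" "(1 - f x) * \<eta> x \<le> (1 - f x) * 1"
        using f(2,3)[of x] \<eta> mult_left_le[of "\<eta> x" "1 - f x"] by (auto simp: E_def)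
      then show "0 \<le> f x + (1 - f x) * \<eta> x" "f x + (1 - f x) * \<eta> x \<le> 1" using f(2)[of x] by auto
    qed
    moreover have "f x + (1 - f x) * \<eta> x = 1" if "x \<in> (\<Union>p\<in>insert p F. ball p (r p))" for x
      using that f(4)[of x] \<eta> by (auto simp: E_def)
    ultimately have "E (\<lambda>x. f x + (1 - f x) * \<eta> x) (insert p F)" by (simp add: E_def)
    then show ?case by blast
  qed
  then obtain \<eta> where \<eta>: "E \<eta> F" by blast
  show thesis
  proof (rule that[of \<eta>])
    show "\<eta> x = 1" if "x \<in> K" for x
      using \<eta> F(3) that unfolding E_def by blast
  qed (use \<eta> in \<open>auto simp: E_def\<close>)
qed

section \<open>The Hilbert space of square integrable functions\<close>

definition square_integrable :: "('a::euclidean_space \<Rightarrow> 'b::euclidean_space) \<Rightarrow> bool" where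
  "square_integrable f \<longleftrightarrow>
     f \<in> borel_measurable lebesgue \<and> integrable lebesgue (\<lambda>x. (norm (f x))\<^sup>2)"

lemma square_integrable_measurable: "square_integrable f \<Longrightarrow> f \<in> borel_measurable lebesgue"
  by (simp add: square_integrable_def)

lemma square_integrable_bound:
  assumes "square_integrable f" "g \<in> borel_measurable lebesgue"
    "AE x in lebesgue. norm (g x) \<le> C * norm (f x)"
  shows "square_integrable g"
proof -
  have "integrable lebesgue (\<lambda>x. (norm (g x))\<^sup>2)"
  proof (rule Bochner_Integration.integrable_bound)
    show "integrable lebesgue (\<lambda>x. C\<^sup>2 * (norm (f x))\<^sup>2)"
      using assms(1) by (simp add: square_integrable_def)
    show "AE x in lebesgue. norm ((norm (g x))\<^sup>2) \<le> norm (C\<^sup>2 * (norm (f x))\<^sup>2)"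
      using assms(3)
    proof eventually_elim
      case (elim x)
      then have "(norm (g x))\<^sup>2 \<le> (C * norm (f x))\<^sup>2" by (simp add: power_mono)
      then show ?case by (simp add: power_mult_distrib)
    qed
  qed (use assms(2) in measurable)
  then show ?thesis using assms(2) by (simp add: square_integrable_def)
qed

lemma square_integrable_0: "square_integrable (\<lambda>x. 0)"
  by (simp add: square_integrable_def)

lemma square_integrable_add:
  assumes "square_integrable f" "square_integrable g"
  shows "square_integrable (\<lambda>x. f x + g x)"
proof -
  have [measurable]: "f \<in> borel_measurable lebesgue" "g \<in> borel_measurable lebesgue"
    using assms by (auto simp: square_integrable_def)
  have "integrable lebesgue (\<lambda>x. (norm (f x + g x))\<^sup>2)"
  proof (rule Bochner_Integration.integrable_bound)
    show "integrable lebesgue (\<lambda>x. 2 * (norm (f x))\<^sup>2 + 2 * (norm (g x))\<^sup>2)"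
      using assms by (simp add: square_integrable_def)
    have "(norm (f x + g x))\<^sup>2 \<le> 2 * (norm (f x))\<^sup>2 + 2 * (norm (g x))\<^sup>2" for x
    proof -
      have "(norm (f x + g x))\<^sup>2 \<le> (norm (f x) + norm (g x))\<^sup>2"
        by (simp add: norm_triangle_ineq power_mono)
      also have "\<dots> \<le> 2 * (norm (f x))\<^sup>2 + 2 * (norm (g x))\<^sup>2"
        using sum_squares_bound[of "norm (f x)" "norm (g x)"] by (simp add: power2_sum)
      finally show ?thesis .
    qed
    then show "AE x in lebesgue. norm ((norm (f x + g x))\<^sup>2) \<le> norm (2 * (norm (f x))\<^sup>2 + 2 * (norm (g x))\<^sup>2)"
      by simp
  qed measurable
  then show ?thesis by (simp add: square_integrable_def)
qed

lemma square_integrable_scaleR: "square_integrable f \<Longrightarrow> square_integrable (\<lambda>x. c *\<^sub>R f x)"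
  by (auto simp: square_integrable_def power_mult_distrib)

lemma square_integrable_uminus: "square_integrable f \<Longrightarrow> square_integrable (\<lambda>x. - f x)"
  by (auto simp: square_integrable_def)

lemma square_integrable_diff:
  "square_integrable f \<Longrightarrow> square_integrable g \<Longrightarrow> square_integrable (\<lambda>x. f x - g x)"
  using square_integrable_add[of f "\<lambda>x. - g x"] by (simp add: square_integrable_uminus)

lemma square_integrable_inner:
  assumes "square_integrable f" "square_integrable g"
  shows "integrable lebesgue (\<lambda>x. f x \<bullet> g x)"
proof (rule Bochner_Integration.integrable_bound)
  show "integrable lebesgue (\<lambda>x. (norm (f x))\<^sup>2 + (norm (g x))\<^sup>2)"
    using assms by (simp add: square_integrable_def)
  have "\<bar>f x \<bullet> g x\<bar> \<le> (norm (f x))\<^sup>2 + (norm (g x))\<^sup>2" for x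
    using Cauchy_Schwarz_ineq2[of "f x" "g x"] sum_squares_bound[of "norm (f x)" "norm (g x)"]
      mult_nonneg_nonneg[OF norm_ge_zero[of "f x"] norm_ge_zero[of "g x"]] by linarith
  then show "AE x in lebesgue. norm (f x \<bullet> g x) \<le> norm ((norm (f x))\<^sup>2 + (norm (g x))\<^sup>2)"
    by simp
qed (use assms in \<open>auto simp: square_integrable_def\<close>)

lemma square_integrable_cong:
  assumes "square_integrable f" "AE x in lebesgue. f x = g x"
  shows "square_integrable g"
proof (rule square_integrable_bound[OF assms(1), where C = 1])
  show "g \<in> borel_measurable lebesgue"
    using assms by (auto simp: square_integrable_def intro: borel_measurable_AE)
qed (use assms(2) in auto)

\<comment> \<open>A partial quotient: only square integrable functions are related to themselves.
  Having the classes as a type makes limits, convexity and completeness available through type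
  classes. The underlying measure space is always the whole space; a domain enters only through
  where a function vanishes.\<close>
quotient_type (overloaded) ('a, 'b) l2 = "'a::euclidean_space \<Rightarrow> 'b::euclidean_space" / partial:
    "\<lambda>f g. square_integrable f \<and> square_integrable g \<and> (AE x in lebesgue. f x = g x)"
proof (rule part_equivpI)
  show "\<exists>f::'a \<Rightarrow> 'b. square_integrable f \<and> square_integrable f \<and> (AE x in lebesgue. f x = f x)"
    using square_integrable_0 by auto
  show "symp (\<lambda>f g::'a \<Rightarrow> 'b. square_integrable f \<and> square_integrable g \<and> (AE x in lebesgue. f x = g x))"
    by (auto simp: symp_def eq_commute)
  show "transp (\<lambda>f g::'a \<Rightarrow> 'b. square_integrable f \<and> square_integrable g \<and> (AE x in lebesgue. f x = g x))"
    by (auto simp: transp_def elim: AE_mp)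
qed


instantiation l2 :: (euclidean_space, euclidean_space) real_inner
begin

lift_definition zero_l2 :: "('a, 'b) l2" is "\<lambda>x. 0"
  by (simp add: square_integrable_0)

lift_definition plus_l2 :: "('a, 'b) l2 \<Rightarrow> ('a, 'b) l2 \<Rightarrow> ('a, 'b) l2" is "\<lambda>f g x. f x + g x"
  by (auto simp: square_integrable_add elim!: AE_mp)

lift_definition minus_l2 :: "('a, 'b) l2 \<Rightarrow> ('a, 'b) l2 \<Rightarrow> ('a, 'b) l2" is "\<lambda>f g x. f x - g x"
  by (auto simp: square_integrable_diff elim!: AE_mp)

lift_definition uminus_l2 :: "('a, 'b) l2 \<Rightarrow> ('a, 'b) l2" is "\<lambda>f x. - f x"
  by (auto simp: square_integrable_uminus)

lift_definition scaleR_l2 :: "real \<Rightarrow> ('a, 'b) l2 \<Rightarrow> ('a, 'b) l2" is "\<lambda>c f x. c *\<^sub>R f x"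
  by (auto simp: square_integrable_scaleR)

lift_definition inner_l2 :: "('a, 'b) l2 \<Rightarrow> ('a, 'b) l2 \<Rightarrow> real" is
  "\<lambda>f g. LINT x|lebesgue. f x \<bullet> g x"
proof -
  fix f g f' g' :: "'a \<Rightarrow> 'b"
  assume *: "square_integrable f \<and> square_integrable g \<and> (AE x in lebesgue. f x = g x)"
    "square_integrable f' \<and> square_integrable g' \<and> (AE x in lebesgue. f' x = g' x)"
  then have "AE x in lebesgue. f x \<bullet> f' x = g x \<bullet> g' x" by (auto elim!: AE_mp)
  then show "(LINT x|lebesgue. f x \<bullet> f' x) = (LINT x|lebesgue. g x \<bullet> g' x)"
    using * by (intro integral_cong_AE borel_measurable_inner square_integrable_measurable) auto
qed

definition norm_l2 :: "('a, 'b) l2 \<Rightarrow> real" where "norm_l2 U = sqrt (inner U U)"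

definition dist_l2 :: "('a, 'b) l2 \<Rightarrow> ('a, 'b) l2 \<Rightarrow> real" where "dist_l2 U V = norm (U - V)"

definition sgn_l2 :: "('a, 'b) l2 \<Rightarrow> ('a, 'b) l2" where "sgn_l2 U = scaleR (inverse (norm U)) U"

definition uniformity_l2 :: "(('a, 'b) l2 \<times> ('a, 'b) l2) filter" where
  "uniformity_l2 = (INF e\<in>{0<..}. principal {(x, y). dist x y < e})"

definition open_l2 :: "('a, 'b) l2 set \<Rightarrow> bool" where
  "open_l2 S = (\<forall>x\<in>S. \<forall>\<^sub>F (x', y) in uniformity. x' = x \<longrightarrow> y \<in> S)"

instance
proof
  fix x y z :: "('a, 'b) l2" and r s :: real
  show "dist x y = norm (x - y)" by (rule dist_l2_def)
  show "sgn x = scaleR (inverse (norm x)) x" by (rule sgn_l2_def)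
  show "(uniformity :: (('a, 'b) l2 \<times> ('a, 'b) l2) filter) = (INF e\<in>{0<..}. principal {(x, y). dist x y < e})"
    by (rule uniformity_l2_def)
  show "open S = (\<forall>x\<in>S. \<forall>\<^sub>F (x', y) in uniformity. x' = x \<longrightarrow> y \<in> S)" for S :: "('a, 'b) l2 set"
    by (rule open_l2_def)
  show "norm x = sqrt (inner x x)" by (rule norm_l2_def)
  show "x + y + z = x + (y + z)" "x + y = y + x" "0 + x = x" "- x + x = 0" "x - y = x + - y"
    by (transfer; simp add: square_integrable_add square_integrable_diff square_integrable_0
        square_integrable_uminus algebra_simps)+
  show "r *\<^sub>R (x + y) = r *\<^sub>R x + r *\<^sub>R y" "(r + s) *\<^sub>R x = r *\<^sub>R x + s *\<^sub>R x"
     "r *\<^sub>R s *\<^sub>R x = (r * s) *\<^sub>R x" "1 *\<^sub>R x = x"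
    by (transfer; simp add: square_integrable_add square_integrable_scaleR algebra_simps)+
  show "inner x y = inner y x" by transfer (simp add: inner_commute)
  show "inner (x + y) z = inner x z + inner y z"
    by transfer (simp add: inner_add_left square_integrable_inner)
  show "inner (r *\<^sub>R x) y = r * inner x y" by transfer simp
  show "0 \<le> inner x x" by transfer simp
  show "(inner x x = 0) = (x = 0)"
  proof transfer
    fix f :: "'a \<Rightarrow> 'b"
    assume *: "square_integrable f \<and> square_integrable f \<and> (AE x in lebesgue. f x = f x)"
    then have "integrable lebesgue (\<lambda>x. f x \<bullet> f x)" by (simp add: square_integrable_inner)
    then have "(LINT x|lebesgue. f x \<bullet> f x) = 0 \<longleftrightarrow> (AE x in lebesgue. f x \<bullet> f x = 0)"
      by (intro integral_nonneg_eq_0_iff_AE) auto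
    then show "((LINT x|lebesgue. f x \<bullet> f x) = 0) =
         (square_integrable f \<and> square_integrable (\<lambda>x. 0::'b) \<and> (AE x in lebesgue. f x = 0))"
      using * by (simp add: square_integrable_0)
  qed
qed

end

section \<open>Functions and their classes\<close>

definition l2_of :: "('a::euclidean_space \<Rightarrow> 'b::euclidean_space) \<Rightarrow> ('a, 'b) l2" where
  "l2_of = abs_l2"

lemma l2_of_eq_iff:
  assumes "square_integrable f" "square_integrable g"
  shows "l2_of f = l2_of g \<longleftrightarrow> (AE x in lebesgue. f x = g x)"
  using assms Quotient3_rel[OF Quotient3_l2, of f g] by (auto simp: l2_of_def)

lemma l2_of_eqI:
  "square_integrable f \<Longrightarrow> AE x in lebesgue. f x = g x \<Longrightarrow> l2_of f = l2_of g"
  using l2_of_eq_iff[of f g] square_integrable_cong[of f g] by simp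

lemma square_integrable_rep: "square_integrable (rep_l2 U)"
  using Quotient3_rep_reflp[OF Quotient3_l2] by blast

lemma rep_measurable [measurable]: "rep_l2 U \<in> borel_measurable lebesgue"
  by (rule square_integrable_measurable[OF square_integrable_rep])

lemma l2_of_rep [simp]: "l2_of (rep_l2 U) = U"
  using Quotient3_abs_rep[OF Quotient3_l2] by (simp add: l2_of_def)

lemma rep_l2_of: "square_integrable f \<Longrightarrow> AE x in lebesgue. rep_l2 (l2_of f) x = f x"
  using l2_of_eq_iff[OF square_integrable_rep, of f "l2_of f"] by simp

lemma l2_of_0: "l2_of (\<lambda>x. 0) = 0"
  by (simp add: l2_of_def zero_l2.abs_eq)

lemma l2_of_add:
  "square_integrable f \<Longrightarrow> square_integrable g \<Longrightarrow> l2_of (\<lambda>x. f x + g x) = l2_of f + l2_of g"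
  by (simp add: l2_of_def plus_l2.abs_eq)

lemma l2_of_diff:
  "square_integrable f \<Longrightarrow> square_integrable g \<Longrightarrow> l2_of (\<lambda>x. f x - g x) = l2_of f - l2_of g"
  by (simp add: l2_of_def minus_l2.abs_eq)

lemma l2_of_scaleR:
  "square_integrable f \<Longrightarrow> l2_of (\<lambda>x. c *\<^sub>R f x) = c *\<^sub>R l2_of f"
  by (simp add: l2_of_def scaleR_l2.abs_eq)

lemma inner_l2_of:
  "square_integrable f \<Longrightarrow> square_integrable g \<Longrightarrow> l2_of f \<bullet> l2_of g = (LINT x|lebesgue. f x \<bullet> g x)"
  by (simp add: l2_of_def inner_l2.abs_eq)

lemma norm_l2_of_sq:
  "square_integrable f \<Longrightarrow> (norm (l2_of f))\<^sup>2 = (LINT x|lebesgue. (norm (f x))\<^sup>2)"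
  by (simp add: power2_norm_eq_inner inner_l2_of)

lemma nn_integral_norm_sq:
  "square_integrable f \<Longrightarrow> (\<integral>\<^sup>+x. ennreal ((norm (f x))\<^sup>2) \<partial>lebesgue) = ennreal ((norm (l2_of f))\<^sup>2)"
  by (simp add: norm_l2_of_sq square_integrable_def nn_integral_eq_integral)

lemma norm_l2_of_le:
  assumes "square_integrable f" "square_integrable g" "0 \<le> C"
    "AE x in lebesgue. norm (g x) \<le> C * norm (f x)"
  shows "norm (l2_of g) \<le> C * norm (l2_of f)"
proof (rule power2_le_imp_le)
  have "(norm (l2_of g))\<^sup>2 \<le> (LINT x|lebesgue. C\<^sup>2 * (norm (f x))\<^sup>2)"
    unfolding norm_l2_of_sq[OF assms(2)]
  proof (rule integral_mono_AE)
    show "AE x in lebesgue. (norm (g x))\<^sup>2 \<le> C\<^sup>2 * (norm (f x))\<^sup>2"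
      using assms(4) by (rule AE_mp) (auto intro!: AE_I2 simp: power_mono simp flip: power_mult_distrib)
  qed (use assms in \<open>auto simp: square_integrable_def\<close>)
  then show "(norm (l2_of g))\<^sup>2 \<le> (C * norm (l2_of f))\<^sup>2"
    using assms by (simp add: norm_l2_of_sq power_mult_distrib)
qed (use assms in simp)

lemma norm_l2_of_diff_le:
  assumes "square_integrable f" "square_integrable g" "square_integrable f'" "square_integrable g'" "0 \<le> C"
    "AE x in lebesgue. norm (f' x - g' x) \<le> C * norm (f x - g x)"
  shows "norm (l2_of f' - l2_of g') \<le> C * norm (l2_of f - l2_of g)"
  using norm_l2_of_le[of "\<lambda>x. f x - g x" "\<lambda>x. f' x - g' x" C] assms
  by (simp add: l2_of_diff square_integrable_diff)

text \<open>Fatou's lemma for the squared distances to the fixed member \<open>f k\<close>. It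
  yields both square integrability of the pointwise limit and the rate of convergence.\<close>

lemma l2_dist_bound_limit:
  fixes f :: "nat \<Rightarrow> 'a::euclidean_space \<Rightarrow> 'b::euclidean_space"
  assumes f: "\<And>k. square_integrable (f k)" and g: "g \<in> borel_measurable lebesgue"
    and lim: "AE x in lebesgue. (\<lambda>k. f k x) \<longlonglongrightarrow> g x"
    and bd: "\<And>j. j \<ge> k \<Longrightarrow> norm (l2_of (f j) - l2_of (f k)) \<le> e" and "0 \<le> e"
  shows "square_integrable g" "norm (l2_of g - l2_of (f k)) \<le> e"
proof -
  note [measurable] = square_integrable_measurable[OF f] g
  have "(\<integral>\<^sup>+x. ennreal ((norm (g x - f k x))\<^sup>2) \<partial>lebesgue)
      = (\<integral>\<^sup>+x. liminf (\<lambda>j. ennreal ((norm (f j x - f k x))\<^sup>2)) \<partial>lebesgue)"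
  proof (rule nn_integral_cong_AE)
    show "AE x in lebesgue. ennreal ((norm (g x - f k x))\<^sup>2) = liminf (\<lambda>j. ennreal ((norm (f j x - f k x))\<^sup>2))"
      using lim
    proof eventually_elim
      case (elim x)
      then have "(\<lambda>j. ennreal ((norm (f j x - f k x))\<^sup>2)) \<longlonglongrightarrow> ennreal ((norm (g x - f k x))\<^sup>2)"
        by (intro tendsto_intros)
      then show ?case by (metis lim_imp_Liminf trivial_limit_sequentially)
    qed
  qed
  also have "\<dots> \<le> liminf (\<lambda>j. \<integral>\<^sup>+x. ennreal ((norm (f j x - f k x))\<^sup>2) \<partial>lebesgue)"
    by (rule nn_integral_liminf) simp
  also have "\<dots> = liminf (\<lambda>j. ennreal ((norm (l2_of (f j) - l2_of (f k)))\<^sup>2))"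
    using f by (simp add: nn_integral_norm_sq square_integrable_diff l2_of_diff)
  also have "\<dots> \<le> limsup (\<lambda>j. ennreal ((norm (l2_of (f j) - l2_of (f k)))\<^sup>2))"
    by (rule Liminf_le_Limsup) simp
  also have "\<dots> \<le> ennreal (e\<^sup>2)"
    using bd by (intro Limsup_bounded eventually_sequentiallyI[of k]) (auto intro!: ennreal_leI power_mono)
  finally have *: "(\<integral>\<^sup>+x. ennreal ((norm (g x - f k x))\<^sup>2) \<partial>lebesgue) \<le> ennreal (e\<^sup>2)" .
  have "integrable lebesgue (\<lambda>x. (norm (g x - f k x))\<^sup>2)"
    by (rule integrableI_bounded) (use * in \<open>auto simp: le_less_trans[OF _ ennreal_less_top]\<close>)
  then have d: "square_integrable (\<lambda>x. g x - f k x)" by (simp add: square_integrable_def)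
  show g: "square_integrable g" using square_integrable_add[OF d f[of k]] by simp
  have "(norm (l2_of g - l2_of (f k)))\<^sup>2 \<le> e\<^sup>2"
    using * nn_integral_norm_sq[OF d] l2_of_diff[OF g f] by simp
  then show "norm (l2_of g - l2_of (f k)) \<le> e" using \<open>0 \<le> e\<close> by (rule power2_le_imp_le)
qed

text \<open>The Riesz-Fischer argument: a sequence with geometric Cauchy rate converges almost
  everywhere, and the pointwise limit is also the limit in norm.\<close>

lemma l2_fast_Cauchy:
  fixes f :: "nat \<Rightarrow> 'a::euclidean_space \<Rightarrow> 'b::euclidean_space"
  assumes f: "\<And>k. square_integrable (f k)"
    and bd: "\<And>k j. j \<ge> k \<Longrightarrow> norm (l2_of (f j) - l2_of (f k)) \<le> (1/2) ^ k"
  obtains g where "square_integrable g" "AE x in lebesgue. (\<lambda>k. f k x) \<longlonglongrightarrow> g x"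
    "\<And>k. norm (l2_of g - l2_of (f k)) \<le> (1/2) ^ k"
proof -
  note [measurable] = square_integrable_measurable[OF f]
  \<comment> \<open>The squared increments have integral at most 4^-k; the weight 2^k spends half of
    this decay, and the integrals remain summable.\<close>
  define D where "D k x = 2 ^ k * (norm (f (Suc k) x - f k x))\<^sup>2" for k x
  have D [measurable]: "D k \<in> borel_measurable lebesgue" for k unfolding D_def by measurable
  have "(\<integral>\<^sup>+x. ennreal (D k x) \<partial>lebesgue) \<le> ennreal ((1/2) ^ k)" for k
  proof -
    have "(\<integral>\<^sup>+x. ennreal (D k x) \<partial>lebesgue) =
        ennreal (2 ^ k) * (\<integral>\<^sup>+x. ennreal ((norm (f (Suc k) x - f k x))\<^sup>2) \<partial>lebesgue)"
      unfolding D_def by (subst nn_integral_cmult[symmetric]) (auto simp: ennreal_mult)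
    also have "\<dots> = ennreal (2 ^ k * (norm (l2_of (f (Suc k)) - l2_of (f k)))\<^sup>2)"
      using f by (simp add: nn_integral_norm_sq square_integrable_diff l2_of_diff ennreal_mult)
    also have "\<dots> \<le> ennreal (2 ^ k * ((1/2) ^ k)\<^sup>2)"
      by (intro ennreal_leI mult_left_mono power_mono bd) auto
    also have "2 ^ k * ((1/2) ^ k)\<^sup>2 = ((1/2::real) ^ k)"
    proof -
      have "(2::real) ^ k * (1/2) ^ k = 1" by (simp flip: power_mult_distrib)
      then show ?thesis by (simp only: power2_eq_square flip: mult.assoc)
    qed
    finally show ?thesis .
  qed
  then have "(\<integral>\<^sup>+x. (\<Sum>k. ennreal (D k x)) \<partial>lebesgue) \<le> (\<Sum>k. ennreal ((1/2) ^ k))"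
    by (subst nn_integral_suminf) (auto intro!: suminf_le)
  also have "\<dots> = ennreal (\<Sum>k. (1/2) ^ k)"
    by (intro suminf_ennreal2) (auto simp: summable_geometric)
  finally have "(\<integral>\<^sup>+x. (\<Sum>k. ennreal (D k x)) \<partial>lebesgue) \<noteq> \<infinity>"
    by (auto simp: top_unique)
  then have "AE x in lebesgue. (\<Sum>k. ennreal (D k x)) \<noteq> \<infinity>"
    by (intro nn_integral_PInf_AE) auto
  then have lim: "AE x in lebesgue. (\<lambda>k. f k x) \<longlonglongrightarrow> lim (\<lambda>k. f k x)"
  proof eventually_elim
    case (elim x)
    then have "summable (\<lambda>k. D k x)"
      by (intro summable_suminf_not_top) (auto simp: D_def)
    then have "summable (\<lambda>k. D k x + (1/2) ^ k)"
      by (intro summable_add) (auto simp: summable_geometric)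
    \<comment> \<open>Young's inequality a <= 2^k a^2 + 2^-k turns the summable weighted squares
      into summable increments.\<close>
    moreover have "norm (f (Suc k) x - f k x) \<le> D k x + (1/2) ^ k" for k
    proof -
      define a P where "a = norm (f (Suc k) x - f k x)" and "P = (2::real) ^ k"
      have P: "0 < P" "(1/2) ^ k = 1 / P" by (simp_all add: P_def power_one_over)
      have "0 \<le> (P * a - 1)\<^sup>2" by simp
      then have "2 * (P * a) \<le> P * (P * a\<^sup>2) + 1"
        by (simp add: power2_eq_square algebra_simps)
      moreover have "0 \<le> P * a" using P by (simp add: a_def)
      ultimately have "P * a \<le> P * (P * a\<^sup>2) + 1" by linarith
      then have "a \<le> P * a\<^sup>2 + 1 / P"
        using P(1) mult_left_mono[of "P * a" "P * (P * a\<^sup>2) + 1" "1 / P"] by (simp add: distrib_left)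
      then show ?thesis unfolding D_def P(2) by (simp add: a_def P_def)
    qed
    ultimately have "summable (\<lambda>k. f (Suc k) x - f k x)"
      by (rule summable_comparison_test')
    then have "convergent (\<lambda>n. \<Sum>k<n. f (Suc k) x - f k x)"
      by (simp add: summable_iff_convergent)
    then have "convergent (\<lambda>n. f n x - f 0 x)"
      by (simp only: sum_lessThan_telescope[of "\<lambda>n. f n x"])
    then have "convergent (\<lambda>n. f n x)" by (simp only: convergent_diff_const_right_iff)
    then show ?case by (simp only: convergent_LIMSEQ_iff)
  qed
  have m: "(\<lambda>x. lim (\<lambda>k. f k x)) \<in> borel_measurable lebesgue" by measurable
  show thesis
  proof (rule that[OF _ lim])
    show "square_integrable (\<lambda>x. lim (\<lambda>k. f k x))"
      by (rule l2_dist_bound_limit(1)[where f = f and k = 0, OF f m lim bd]) simp_all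
    show "norm (l2_of (\<lambda>x. lim (\<lambda>k. f k x)) - l2_of (f k)) \<le> (1/2) ^ k" for k
      by (rule l2_dist_bound_limit(2)[where f = f and k = k, OF f m lim bd]) simp_all
  qed
qed

lemma fast_subsequence:
  fixes X :: "nat \<Rightarrow> 'a::metric_space"
  assumes "Cauchy X"
  obtains r :: "nat \<Rightarrow> nat" where "strict_mono r" "\<And>k j. j \<ge> k \<Longrightarrow> dist (X (r j)) (X (r k)) \<le> (1/2) ^ k"
proof -
  have "\<forall>k. \<exists>N. \<forall>m\<ge>N. \<forall>n\<ge>N. dist (X m) (X n) < (1/2) ^ k"
    by (intro allI metric_CauchyD[OF assms]) simp
  from choice[OF this] obtain N where N: "\<forall>k. \<forall>m\<ge>N k. \<forall>n\<ge>N k. dist (X m) (X n) < (1/2) ^ k"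
    by blast
  define r where "r = rec_nat (N 0) (\<lambda>k a. Suc (max a (N (Suc k))))"
  have r0: "r 0 = N 0" and rS: "r (Suc k) = Suc (max (r k) (N (Suc k)))" for k
    unfolding r_def by simp_all
  have sm: "strict_mono r" unfolding strict_mono_Suc_iff rS by (intro allI) linarith
  have Nr: "N k \<le> r k" for k
  proof (cases k)
    case 0
    then show ?thesis by (simp only: r0)
  next
    case (Suc n)
    then show ?thesis by (simp only: rS)
  qed
  show thesis
  proof (rule that[OF sm])
    fix k j :: nat assume "k \<le> j"
    then have "r k \<le> r j" using sm by (simp only: strict_mono_less_eq)
    with Nr[of k] have "N k \<le> r j" by linarith
    with N Nr[of k] have "dist (X (r j)) (X (r k)) < (1/2) ^ k" by blast
    then show "dist (X (r j)) (X (r k)) \<le> (1/2) ^ k" by linarith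
  qed
qed

instance l2 :: (euclidean_space, euclidean_space) complete_space
proof
  fix X :: "nat \<Rightarrow> ('a, 'b) l2"
  assume "Cauchy X"
  then obtain r :: "nat \<Rightarrow> nat" where r: "strict_mono r"
    and bd: "\<And>k j. j \<ge> k \<Longrightarrow> dist (X (r j)) (X (r k)) \<le> (1/2) ^ k"
    using fast_subsequence[of X] by blast
  obtain g where g: "\<And>k. norm (l2_of g - l2_of (rep_l2 (X (r k)))) \<le> (1/2) ^ k"
  proof (rule l2_fast_Cauchy[of "\<lambda>k. rep_l2 (X (r k))"])
    show "norm (l2_of (rep_l2 (X (r j))) - l2_of (rep_l2 (X (r k)))) \<le> (1/2) ^ k" if "k \<le> j" for j k
      using bd[OF that] by (simp add: dist_norm)
  qed (auto intro: square_integrable_rep)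
  have "(\<lambda>k. norm (X (r k) - l2_of g)) \<longlonglongrightarrow> 0"
    by (rule tendsto_sandwich[OF _ _ tendsto_const LIMSEQ_power_zero[of "1/2::real"]])
      (use g in \<open>auto simp: norm_minus_commute\<close>)
  then have "(\<lambda>k. X (r k)) \<longlonglongrightarrow> l2_of g"
    by (simp add: tendsto_norm_zero_iff LIM_zero_iff)
  then have "(X \<circ> r) \<longlonglongrightarrow> l2_of g" by (simp add: o_def)
  with \<open>Cauchy X\<close> r show "convergent X"
    by (meson Cauchy_converges_subseq convergentI)
qed

section \<open>The space \<open>H\<^sub>0\<^sup>1\<close> as a closed subspace\<close>

lemma integrable_continuous_support:
  fixes f :: "'a::euclidean_space \<Rightarrow> 'b::euclidean_space"
  assumes "continuous_on UNIV f" "compact K" "\<And>x. x \<notin> K \<Longrightarrow> f x = 0"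
  shows "integrable lborel f" "integrable lebesgue f"
proof -
  have "integrable lborel (\<lambda>x. indicator K x *\<^sub>R f x)"
    using assms by (intro borel_integrable_compact) (auto intro: continuous_on_subset)
  moreover have "(\<lambda>x. indicator K x *\<^sub>R f x) = f" using assms(3) by (auto simp: indicator_def)
  ultimately show "integrable lborel f" by simp
  then show "integrable lebesgue f" by (rule integrable_completion[THEN iffD2, rotated])
    (use assms(1) in \<open>simp add: borel_measurable_continuous_onI\<close>)
qed

lemma square_integrable_continuous_support:
  fixes f :: "'a::euclidean_space \<Rightarrow> 'b::euclidean_space"
  assumes "continuous_on UNIV f" "compact K" "\<And>x. x \<notin> K \<Longrightarrow> f x = 0"
  shows "square_integrable f"
proof -
  have "integrable lebesgue (\<lambda>x. (norm (f x))\<^sup>2)"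
    using assms by (intro integrable_continuous_support[of _ K]) (auto intro!: continuous_intros)
  moreover have "f \<in> borel_measurable lebesgue"
    using assms(1) by (simp add: borel_measurable_continuous_onI measurable_completion)
  ultimately show ?thesis by (simp add: square_integrable_def)
qed

lemma test_square_integrable:
  assumes "f \<in> test_functions D"
  shows "square_integrable f" "square_integrable (grad f)"
proof -
  from assms obtain K where K: "smooth f" "compact K" "\<And>x. x \<notin> K \<Longrightarrow> f x = 0" "\<And>x. x \<notin> K \<Longrightarrow> grad f x = 0"
    by (rule test_functionsE) auto
  then show "square_integrable f" "square_integrable (grad f)"
    by (auto intro!: square_integrable_continuous_support[of _ K] smooth_continuous continuous_grad)
qed

lemma test_bounded:
  assumes "f \<in> test_functions D"
  obtains B where "0 < B" "\<And>x. \<bar>f x\<bar> \<le> B" "\<And>x. norm (grad f x) \<le> B"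
proof -
  from assms obtain K where K: "smooth f" "compact K" "\<And>x. x \<notin> K \<Longrightarrow> f x = 0" "\<And>x. x \<notin> K \<Longrightarrow> grad f x = 0"
    by (rule test_functionsE) auto
  have "bounded (f ` K)" "bounded (grad f ` K)"
    using K by (auto intro!: compact_imp_bounded compact_continuous_image smooth_continuous continuous_grad)
  then obtain a b where ab: "\<And>x. x \<in> K \<Longrightarrow> norm (f x) \<le> a" "\<And>x. x \<in> K \<Longrightarrow> norm (grad f x) \<le> b"
    unfolding bounded_iff by auto
  show thesis
  proof (rule that[of "1 + \<bar>a\<bar> + \<bar>b\<bar>"])
    fix x
    show "\<bar>f x\<bar> \<le> 1 + \<bar>a\<bar> + \<bar>b\<bar>" "norm (grad f x) \<le> 1 + \<bar>a\<bar> + \<bar>b\<bar>"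
      using ab[of x] K(3,4)[of x] by (cases "x \<in> K"; force)+
  qed auto
qed

lemma lborel_integral_translate:
  fixes f :: "'a::euclidean_space \<Rightarrow> real"
  assumes "continuous_on UNIV f"
  shows "(LINT x|lborel. f (x + s)) = (LINT x|lborel. f x)"
proof -
  have "(LINT x|lborel. f x) = (LINT x|distr lborel borel ((+) s). f x)"
    by (simp add: lborel_distr_plus)
  also have "\<dots> = (LINT x|lborel. f (s + x))"
    using assms by (intro integral_distr) (auto simp: borel_measurable_continuous_onI)
  finally show ?thesis by (simp add: add.commute)
qed

text \<open>By translation invariance every difference quotient has integral zero; dominated
  convergence passes to the directional derivative. This handles an arbitrary direction without
  iterated integrals.\<close>

lemma integral_grad_test:
  fixes f :: "'a::euclidean_space \<Rightarrow> real"
  assumes "f \<in> test_functions D"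
  shows "(LINT x|lebesgue. grad f x \<bullet> h) = 0"
proof -
  from assms obtain K where K: "smooth f" "compact K" "\<And>x. x \<notin> K \<Longrightarrow> f x = 0"
    by (rule test_functionsE) auto
  obtain B where B: "0 < B" "\<And>x. norm (grad f x) \<le> B" by (rule test_bounded[OF assms]) (use that in auto)
  obtain R where R: "K \<subseteq> cball 0 R"
    using compact_imp_bounded[OF K(2)] unfolding bounded_iff by fastforce
  have lip: "\<bar>f x - f y\<bar> \<le> B * norm (x - y)" for x y
  proof -
    have "onorm (\<lambda>h. grad f x \<bullet> h) \<le> B" for x
      using B(1) by (intro onorm_bound order_trans[OF _ mult_right_mono[OF B(2)[of x]]])
        (auto simp: Cauchy_Schwarz_ineq2)
    then show ?thesis
      using differentiable_bound[of UNIV f "\<lambda>x h. grad f x \<bullet> h" B x y] smooth_has_derivative[OF K(1)] by simp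
  qed
  define t where "t n = 1 / real (Suc n)" for n
  have t: "0 < t n" "t n \<le> 1" for n by (auto simp: t_def divide_simps)
  define q where "q n x = (f (x + t n *\<^sub>R h) - f x) / t n" for n x
  have cq: "continuous_on UNIV (q n)" for n
    unfolding q_def using t[of n]
    by (intro continuous_intros smooth_continuous[OF K(1)] smooth_continuous[OF smooth_translate[OF K(1)]]) auto
  have q0: "(LINT x|lborel. q n x) = 0" for n
  proof -
    have "integrable lborel f"
      by (rule integrable_continuous_support(1)[OF smooth_continuous[OF K(1)] K(2,3)])
    moreover from assms have "(\<lambda>x. f (x + t n *\<^sub>R h)) \<in> test_functions UNIV"
      by (intro test_translate test_mono[OF assms]) simp
    then obtain L where L: "smooth (\<lambda>x. f (x + t n *\<^sub>R h))" "compact L" "\<And>x. x \<notin> L \<Longrightarrow> f (x + t n *\<^sub>R h) = 0"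
      by (rule test_functionsE) auto
    have "integrable lborel (\<lambda>x. f (x + t n *\<^sub>R h))"
      by (rule integrable_continuous_support(1)[OF smooth_continuous[OF L(1)] L(2,3)])
    ultimately show ?thesis
      unfolding q_def using lborel_integral_translate[OF smooth_continuous[OF K(1)], of "t n *\<^sub>R h"] by simp
  qed
  have "(\<lambda>n. LINT x|lborel. q n x) \<longlonglongrightarrow> (LINT x|lborel. grad f x \<bullet> h)"
  proof (rule integral_dominated_convergence)
    \<comment> \<open>The steps \<open>t n\<close> are at most 1, so all quotients vanish outside
      the ball of radius R + |h|, and inside it the Lipschitz bound applies.\<close>
    show "integrable lborel (\<lambda>x. indicator (cball 0 (R + norm h)) x *\<^sub>R (B * norm h))"
      by (intro borel_integrable_compact) auto
    show "AE x in lborel. (\<lambda>n. q n x) \<longlonglongrightarrow> grad f x \<bullet> h"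
    proof (rule AE_I2)
      fix x
      have "((\<lambda>s. f (x + s *\<^sub>R h)) has_derivative (\<lambda>s. grad f x \<bullet> (s *\<^sub>R h))) (at 0)"
        by (rule has_derivative_compose[of "\<lambda>s. x + s *\<^sub>R h" "\<lambda>s. s *\<^sub>R h" 0 UNIV f])
          (auto intro!: derivative_eq_intros smooth_has_derivative[OF K(1), of x, simplified])
      then have "((\<lambda>s. f (x + s *\<^sub>R h)) has_real_derivative grad f x \<bullet> h) (at 0)"
        by (simp add: has_field_derivative_def mult_commute_abs)
      then have lim: "((\<lambda>s. (f (x + s *\<^sub>R h) - f x) / s) \<longlongrightarrow> grad f x \<bullet> h) (at 0)"
        by (simp add: DERIV_def)
      have "t \<longlonglongrightarrow> 0" unfolding t_def by (rule LIMSEQ_Suc[OF lim_1_over_n])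
      then have "filterlim t (at 0) sequentially"
        using t(1) by (auto simp: filterlim_at less_imp_neq[symmetric])
      from filterlim_compose[OF lim this] show "(\<lambda>n. q n x) \<longlonglongrightarrow> grad f x \<bullet> h"
        by (simp add: q_def)
    qed
    show "AE x in lborel. norm (q n x) \<le> indicator (cball 0 (R + norm h)) x *\<^sub>R (B * norm h)" for n
    proof (rule AE_I2)
      fix x
      show "norm (q n x) \<le> indicator (cball 0 (R + norm h)) x *\<^sub>R (B * norm h)"
      proof (cases "x \<in> cball 0 (R + norm h)")
        case True
        have "\<bar>f (x + t n *\<^sub>R h) - f x\<bar> \<le> B * (t n * norm h)"
          using lip[of "x + t n *\<^sub>R h" x] t[of n] by simp
        then have "\<bar>f (x + t n *\<^sub>R h) - f x\<bar> / t n \<le> B * norm h"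
          using t[of n] by (simp add: divide_le_eq mult.assoc mult.commute[of "t n"])
        then show ?thesis using True t[of n] by (simp add: q_def)
      next
        case False
        have "t n * norm h \<le> norm h" using t[of n] by (simp add: mult_left_le_one_le)
        moreover have "norm x \<le> norm (x + t n *\<^sub>R h) + t n * norm h"
          using norm_triangle_ineq4[of "x + t n *\<^sub>R h" "t n *\<^sub>R h"] t[of n] by simp
        moreover have "norm y \<le> R" if "y \<in> K" for y using R that by auto
        ultimately have "x + t n *\<^sub>R h \<notin> K" "x \<notin> K"
          using False norm_ge_zero[of h] by (fastforce simp: not_le)+
        then show ?thesis using False K(3) by (simp add: q_def)
      qed
    qed
    show "(\<lambda>x. grad f x \<bullet> h) \<in> borel_measurable lborel" "q n \<in> borel_measurable lborel" for n
      using cq smooth_continuous[OF smooth_grad_inner[OF K(1)]]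
      by (simp_all add: borel_measurable_continuous_onI)
  qed
  then have "(LINT x|lborel. grad f x \<bullet> h) = 0"
    by (simp add: q0 LIMSEQ_const_iff)
  then show ?thesis
    using smooth_continuous[OF smooth_grad_inner[OF K(1)]]
    by (subst integral_completion) (auto simp: borel_measurable_continuous_onI)
qed

text \<open>The closed graph of the gradient over test functions, with everything extended by zero.
  For open \<open>D\<close> its elements are exactly the pairs of an element of \<open>H01 D\<close>
  and its weak gradient (\<open>H01_W0\<close>, \<open>H01_of_W0\<close>); inclusion of domains
  becomes inclusion of sets.\<close>

definition W0 :: "'a::euclidean_space set \<Rightarrow> (('a, real) l2 \<times> ('a, 'a) l2) set" where
  "W0 D = closure ((\<lambda>\<phi>. (l2_of \<phi>, l2_of (grad \<phi>))) ` test_functions D)"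

lemma W0_test: "\<phi> \<in> test_functions D \<Longrightarrow> (l2_of \<phi>, l2_of (grad \<phi>)) \<in> W0 D"
  unfolding W0_def by (intro subsetD[OF closure_subset] imageI)

lemma W0_seq:
  assumes "(U, G) \<in> W0 D"
  obtains \<phi> where "\<And>n::nat. \<phi> n \<in> test_functions D" "(\<lambda>n. l2_of (\<phi> n)) \<longlonglongrightarrow> U" "(\<lambda>n. l2_of (grad (\<phi> n))) \<longlonglongrightarrow> G"
proof -
  obtain f where f: "\<And>n::nat. f n \<in> (\<lambda>\<phi>. (l2_of \<phi>, l2_of (grad \<phi>))) ` test_functions D" "f \<longlonglongrightarrow> (U, G)"
    using assms unfolding W0_def closure_sequential by blast
  then have "\<forall>n. \<exists>\<phi>. \<phi> \<in> test_functions D \<and> f n = (l2_of \<phi>, l2_of (grad \<phi>))" by blast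
  then obtain \<phi> where \<phi>: "\<And>n. \<phi> n \<in> test_functions D" "\<And>n. f n = (l2_of (\<phi> n), l2_of (grad (\<phi> n)))"
    by metis
  then show thesis
    using that[OF \<phi>(1)] tendsto_fst[OF f(2)] tendsto_snd[OF f(2)] by simp
qed

lemma W0_closed: "closed (W0 D)"
  by (simp add: W0_def)

lemma W0_limit:
  assumes "\<And>n::nat. (U n, G n) \<in> W0 D" "U \<longlonglongrightarrow> V" "G \<longlonglongrightarrow> H"
  shows "(V, H) \<in> W0 D"
  using closed_sequentially[OF W0_closed, of "\<lambda>n. (U n, G n)" D "(V, H)"] assms
  by (auto intro: tendsto_Pair)

lemma W0_mono: "D \<subseteq> E \<Longrightarrow> W0 D \<subseteq> W0 E"
  unfolding W0_def by (intro closure_mono image_mono) (auto intro: test_mono)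

lemma W0_subspace: "subspace (W0 D)"
proof (rule subspaceI)
  show "0 \<in> W0 D"
    using W0_test[OF test_0, of D] by (simp add: grad_const[abs_def] l2_of_0 zero_prod_def)
  fix x y assume "x \<in> W0 D" "y \<in> W0 D"
  then obtain U G V H where xy: "x = (U, G)" "y = (V, H)" "(U, G) \<in> W0 D" "(V, H) \<in> W0 D"
    by (cases x; cases y) auto
  obtain f where f: "\<And>n::nat. f n \<in> test_functions D" "(\<lambda>n. l2_of (f n)) \<longlonglongrightarrow> U" "(\<lambda>n. l2_of (grad (f n))) \<longlonglongrightarrow> G"
    using W0_seq[OF xy(3)] by blast
  obtain g where g: "\<And>n::nat. g n \<in> test_functions D" "(\<lambda>n. l2_of (g n)) \<longlonglongrightarrow> V" "(\<lambda>n. l2_of (grad (g n))) \<longlonglongrightarrow> H"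
    using W0_seq[OF xy(4)] by blast
  have "(U + V, G + H) \<in> W0 D"
  proof (rule W0_limit[of "\<lambda>n. l2_of (f n) + l2_of (g n)" "\<lambda>n. l2_of (grad (f n)) + l2_of (grad (g n))"])
    have "grad (\<lambda>x. f n x + g n x) = (\<lambda>x. grad (f n) x + grad (g n) x)" for n
      by (intro ext grad_add test_smooth[OF f(1)] test_smooth[OF g(1)])
    then show "(l2_of (f n) + l2_of (g n), l2_of (grad (f n)) + l2_of (grad (g n))) \<in> W0 D" for n
      using W0_test[OF test_add[OF f(1)[of n] g(1)[of n]]] test_square_integrable[OF f(1)] test_square_integrable[OF g(1)]
      by (simp add: l2_of_add)
  qed (intro tendsto_intros f g)+
  then show "x + y \<in> W0 D" by (simp add: xy)
next
  fix c x assume "x \<in> W0 D"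
  then obtain U G where x: "x = (U, G)" "(U, G) \<in> W0 D" by (cases x) auto
  obtain f where f: "\<And>n::nat. f n \<in> test_functions D" "(\<lambda>n. l2_of (f n)) \<longlonglongrightarrow> U" "(\<lambda>n. l2_of (grad (f n))) \<longlonglongrightarrow> G"
    using W0_seq[OF x(2)] by blast
  have "(c *\<^sub>R U, c *\<^sub>R G) \<in> W0 D"
  proof (rule W0_limit[of "\<lambda>n. c *\<^sub>R l2_of (f n)" "\<lambda>n. c *\<^sub>R l2_of (grad (f n))"])
    have "grad (\<lambda>x. c * f n x) = (\<lambda>x. c *\<^sub>R grad (f n) x)" for n
      by (intro ext grad_cmult test_smooth[OF f(1)])
    then show "(c *\<^sub>R l2_of (f n), c *\<^sub>R l2_of (grad (f n))) \<in> W0 D" for n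
      using W0_test[OF test_cmult[OF f(1)[of n], of c]] test_square_integrable[OF f(1), of n]  l2_of_scaleR[of "f n" c]
      by (simp add: l2_of_scaleR)
  qed (intro tendsto_intros f)+
  then show "c *\<^sub>R x \<in> W0 D" by (simp add: x)
qed

lemma W0_add: "(U, G) \<in> W0 D \<Longrightarrow> (V, H) \<in> W0 D \<Longrightarrow> (U + V, G + H) \<in> W0 D"
  using subspace_add[OF W0_subspace] by fastforce

lemma W0_scaleR: "(U, G) \<in> W0 D \<Longrightarrow> (c *\<^sub>R U, c *\<^sub>R G) \<in> W0 D"
  using subspace_scale[OF W0_subspace] by fastforce

lemma W0_diff: "(U, G) \<in> W0 D \<Longrightarrow> (V, H) \<in> W0 D \<Longrightarrow> (U - V, G - H) \<in> W0 D"
  using subspace_diff[OF W0_subspace] by fastforce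

text \<open>The formula holds for products of two test functions and passes to the limit in the
  pair. The set \<open>E\<close> is arbitrary: with \<open>E = UNIV\<close> it says that extension
  by zero across the boundary of \<open>D\<close> creates no singular part of the gradient.\<close>

lemma W0_by_parts:
  assumes "(U, G) \<in> W0 D" "\<psi> \<in> test_functions E"
  shows "G \<bullet> l2_of (\<lambda>x. \<psi> x *\<^sub>R h) = - (U \<bullet> l2_of (\<lambda>x. grad \<psi> x \<bullet> h))"
proof -
  obtain f where f: "\<And>n::nat. f n \<in> test_functions D" "(\<lambda>n. l2_of (f n)) \<longlonglongrightarrow> U" "(\<lambda>n. l2_of (grad (f n))) \<longlonglongrightarrow> G"
    using W0_seq[OF assms(1)] by blast
  have s1: "square_integrable (\<lambda>x. \<psi> x *\<^sub>R h)"
    by (rule square_integrable_bound[OF test_square_integrable(1)[OF assms(2)], where C = "norm h"])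
      (use square_integrable_measurable[OF test_square_integrable(1)[OF assms(2)]] in \<open>auto simp: mult.commute\<close>)
  have s2: "square_integrable (\<lambda>x. grad \<psi> x \<bullet> h)"
    by (rule test_square_integrable(1)[OF test_grad_inner[OF assms(2)]])
  have "l2_of (grad (f n)) \<bullet> l2_of (\<lambda>x. \<psi> x *\<^sub>R h) = - (l2_of (f n) \<bullet> l2_of (\<lambda>x. grad \<psi> x \<bullet> h))" for n
  proof -
    note sf = test_square_integrable[OF f(1), of n]
    have "(\<lambda>x. f n x * \<psi> x) \<in> test_functions E"
      using assms(2) test_smooth[OF f(1)] by (intro test_mult)
    then have "0 = (LINT x|lebesgue. grad (\<lambda>x. f n x * \<psi> x) x \<bullet> h)"
      by (simp add: integral_grad_test)
    also have "\<dots> = (LINT x|lebesgue. f n x \<bullet> (grad \<psi> x \<bullet> h) + grad (f n) x \<bullet> (\<psi> x *\<^sub>R h))"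
      using grad_mult[OF test_smooth[OF f(1)] test_smooth[OF assms(2)]] by (simp add: inner_add_left)
    also have "\<dots> = l2_of (f n) \<bullet> l2_of (\<lambda>x. grad \<psi> x \<bullet> h) + l2_of (grad (f n)) \<bullet> l2_of (\<lambda>x. \<psi> x *\<^sub>R h)"
      unfolding inner_l2_of[OF sf(1) s2] inner_l2_of[OF sf(2) s1]
      by (intro Bochner_Integration.integral_add square_integrable_inner sf s1 s2)
    finally show ?thesis by simp
  qed
  moreover have "(\<lambda>n. l2_of (grad (f n)) \<bullet> l2_of (\<lambda>x. \<psi> x *\<^sub>R h)) \<longlonglongrightarrow> G \<bullet> l2_of (\<lambda>x. \<psi> x *\<^sub>R h)"
    "(\<lambda>n. - (l2_of (f n) \<bullet> l2_of (\<lambda>x. grad \<psi> x \<bullet> h))) \<longlonglongrightarrow> - (U \<bullet> l2_of (\<lambda>x. grad \<psi> x \<bullet> h))"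
    using f by (auto intro!: tendsto_intros)
  ultimately show ?thesis by (simp add: LIMSEQ_unique)
qed

section \<open>The fundamental lemma of the calculus of variations\<close>

lemma square_integrable_mult_bounded:
  fixes f :: "'a::euclidean_space \<Rightarrow> 'b::euclidean_space"
  assumes "square_integrable f" "c \<in> borel_measurable lebesgue" "\<And>x. \<bar>c x\<bar> \<le> C"
  shows "square_integrable (\<lambda>x. c x *\<^sub>R f x)"
  by (rule square_integrable_bound[OF assms(1), where C = C])
    (use assms square_integrable_measurable[OF assms(1)] in \<open>auto intro!: mult_right_mono\<close>)

lemma square_integrable_indicator:
  "square_integrable f \<Longrightarrow> A \<in> sets lebesgue \<Longrightarrow> square_integrable (\<lambda>x. indicat_real A x *\<^sub>R f x)"
  by (rule square_integrable_mult_bounded[where C = 1]) (auto simp: indicator_def)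

lemma square_integrable_const_indicator:
  fixes c :: "'b::euclidean_space"
  assumes "A \<in> sets lebesgue" "bounded A"
  shows "square_integrable (\<lambda>x::'a::euclidean_space. indicat_real A x *\<^sub>R c)"
proof -
  have "A \<in> lmeasurable" using assms bounded_set_imp_lmeasurable by blast
  then have "integrable lebesgue (\<lambda>x. indicat_real A x * (norm c)\<^sup>2)"
    by (intro integrable_mult_left integrable_real_indicator) (auto simp: fmeasurable_def)
  moreover have "(norm (indicat_real A x *\<^sub>R c))\<^sup>2 = indicat_real A x * (norm c)\<^sup>2" for x
    by (auto simp: indicator_def)
  ultimately show ?thesis using assms(1) by (simp add: square_integrable_def)
qed

text \<open>Cutoffs living in the neighbourhoods of \<open>K\<close> of width 1/(n+1) tend pointwise
  to the indicator of \<open>K\<close>, and their supports stay in one ball: the form required by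
  dominated convergence.\<close>

lemma cutoff_sequence:
  fixes K :: "'a::euclidean_space set"
  assumes K: "compact K" "K \<noteq> {}" and D: "open D" "K \<subseteq> D"
  obtains \<eta> R where "\<And>n::nat. \<eta> n \<in> test_functions D" "\<And>n x. 0 \<le> \<eta> n x" "\<And>n x. \<eta> n x \<le> 1"
    "\<And>n x. x \<in> K \<Longrightarrow> \<eta> n x = 1" "\<And>x. (\<lambda>n. \<eta> n x) \<longlonglongrightarrow> indicat_real K x"
    "\<And>n x. x \<notin> cball 0 R \<Longrightarrow> \<eta> n x = 0"
proof -
  define V where "V n = D \<inter> {x. infdist x K < 1 / real (Suc n)}" for n
  have V: "open (V n)" "K \<subseteq> V n" for n
    unfolding V_def using D by (auto intro!: open_Int open_Collect_less continuous_intros)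
  have "\<forall>n. \<exists>\<eta>. \<eta> \<in> test_functions (V n) \<and> (\<forall>x. 0 \<le> \<eta> x \<and> \<eta> x \<le> 1) \<and> (\<forall>x\<in>K. \<eta> x = 1)"
  proof
    fix n
    show "\<exists>\<eta>. \<eta> \<in> test_functions (V n) \<and> (\<forall>x. 0 \<le> \<eta> x \<and> \<eta> x \<le> 1) \<and> (\<forall>x\<in>K. \<eta> x = 1)"
      by (rule cutoff_exists[OF K(1) V(1)[of n] V(2)[of n]]) auto
  qed
  from choice[OF this] obtain \<eta> where \<eta>: "\<And>n. \<eta> n \<in> test_functions (V n)"
    "\<And>n x. 0 \<le> \<eta> n x" "\<And>n x. \<eta> n x \<le> 1" "\<And>n x. x \<in> K \<Longrightarrow> \<eta> n x = 1" by blast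
  have out: "\<eta> n x = 0" if "x \<notin> V n" for n x
  proof -
    obtain L where "L \<subseteq> V n" "\<And>x. x \<notin> L \<Longrightarrow> \<eta> n x = 0"
      by (rule test_functionsE[OF \<eta>(1)[of n]]) auto
    then show ?thesis using that by auto
  qed
  obtain a where a: "\<And>y. y \<in> K \<Longrightarrow> norm y \<le> a"
    using compact_imp_bounded[OF K(1)] unfolding bounded_iff by fastforce
  show thesis
  proof (rule that[of \<eta> "a + 1"])
    show "\<eta> n \<in> test_functions D" for n
      using \<eta>(1)[of n] by (rule test_mono) (auto simp: V_def)
    show "\<eta> n x = 0" if "x \<notin> cball 0 (a + 1)" for n x
    proof (rule out, rule notI)
      assume "x \<in> V n"
      then have "infdist x K < 1 / real (Suc n)" by (simp add: V_def)
      also have "\<dots> \<le> 1" by (simp add: divide_simps)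
      finally have "infdist x K < 1" .
      moreover obtain y where y: "y \<in> K" "infdist x K = dist x y"
        using infdist_attains_inf[OF compact_imp_closed[OF K(1)] K(2)] by metis
      ultimately have "norm x < a + 1"
        using a[OF y(1)] norm_triangle_ineq2[of x y] by (auto simp: dist_norm)
      then show False using that by simp
    qed
    show "(\<lambda>n. \<eta> n x) \<longlonglongrightarrow> indicat_real K x" for x
    proof (cases "x \<in> K")
      case True
      then show ?thesis using \<eta>(4) by simp
    next
      case False
      then have "0 < infdist x K"
        using infdist_pos_not_in_closed[OF compact_imp_closed[OF K(1)] K(2)] by simp
      then obtain N where N: "1 / real (Suc N) < infdist x K" using nat_approx_posE by blast
      have "\<eta> n x = 0" if "n \<ge> N" for n
      proof (rule out)
        have "1 / real (Suc n) \<le> 1 / real (Suc N)" using that by (simp add: divide_simps)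
        then show "x \<notin> V n" using N by (simp add: V_def)
      qed
      then show ?thesis using False
        by (auto intro!: tendsto_eventually eventually_sequentiallyI[of N])
    qed
  qed (use \<eta> in auto)
qed

text \<open>Inner regularity in two moves, since \<open>S\<close> may have infinite measure: a
  closed subset that loses less than some e below the measure of \<open>S\<close>, then its
  intersection with a sufficiently large ball.\<close>

lemma measure_pos_compact_subset:
  fixes S :: "'a::euclidean_space set"
  assumes "S \<in> sets lebesgue" "S \<notin> null_sets lebesgue"
  obtains K where "compact K" "K \<subseteq> S" "0 < measure lebesgue K"
proof -
  obtain e where e: "0 < e" "ennreal e < emeasure lebesgue S"
  proof -
    have "0 < emeasure lebesgue S" using assms by (auto simp: null_sets_def zero_less_iff_neq_zero)
    then obtain a where "0 < a" "a < emeasure lebesgue S" using dense by blast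
    then show thesis using that[of "enn2real a"]
      by (cases a) (auto simp: top.not_eq_extremum)
  qed
  obtain T where T: "closed T" "T \<subseteq> S" "S - T \<in> lmeasurable" "emeasure lebesgue (S - T) < ennreal e"
    using sets_lebesgue_inner_closed[OF assms(1) e(1)] by auto
  have "emeasure lebesgue T \<noteq> 0"
  proof
    assume "emeasure lebesgue T = 0"
    moreover have "emeasure lebesgue ((S - T) \<union> T) \<le> emeasure lebesgue (S - T) + emeasure lebesgue T"
      using T(1) assms(1) by (intro emeasure_subadditive sets.Diff) auto
    moreover have "(S - T) \<union> T = S" using T(2) by blast
    ultimately have "emeasure lebesgue S \<le> emeasure lebesgue (S - T)" by (simp only: add_0_right)
    with e(2) T(4) show False by (meson leD less_trans)
  qed
  moreover have "emeasure lebesgue T = 0" if "\<And>n::nat. emeasure lebesgue (T \<inter> cball 0 (real n)) = 0"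
  proof -
    have "T = (\<Union>n::nat. T \<inter> cball 0 (real n))" using real_arch_simple by auto
    moreover have "(\<Union>n::nat. T \<inter> cball 0 (real n)) \<in> null_sets lebesgue"
      using that T(1) by (intro null_sets_UN) (auto simp: null_sets_def)
    ultimately show ?thesis by (metis null_setsD1)
  qed
  ultimately obtain n :: nat where n: "emeasure lebesgue (T \<inter> cball 0 (real n)) \<noteq> 0" by blast
  have c: "compact (T \<inter> cball 0 (real n))" using T(1) by (intro closed_Int_compact) auto
  show thesis
  proof (rule that[OF c])
    show "0 < measure lebesgue (T \<inter> cball 0 (real n))"
      using n lmeasurable_compact[OF c] by (auto simp: measure_def enn2real_positive_iff fmeasurable_def top.not_eq_extremum zero_less_iff_neq_zero)
  qed (use T in auto)
qed

text \<open>If f >= 1/(n+1) on a set of positive measure, cutoffs shrinking to a compact part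
  \<open>K\<close> of it show that the integral of f over \<open>K\<close> is zero, although it is
  at least |K|/(n+1). The other sign is obtained from -f.\<close>

lemma AE_nonpos_of_test:
  fixes f :: "'a::euclidean_space \<Rightarrow> real"
  assumes f: "square_integrable f" and D: "open D"
    and 0: "\<And>\<phi>. \<phi> \<in> test_functions D \<Longrightarrow> (LINT x|lebesgue. f x * \<phi> x) = 0"
  shows "AE x in lebesgue. x \<in> D \<longrightarrow> f x \<le> 0"
proof -
  note [measurable] = square_integrable_measurable[OF f]
  define S where "S n = {x \<in> space lebesgue. 1 / real (Suc n) \<le> f x} \<inter> D" for n
  have S: "S n \<in> sets lebesgue" for n
  proof -
    have "{x \<in> space lebesgue. 1 / real (Suc n) \<le> f x} \<in> sets lebesgue" by measurable
    then show ?thesis unfolding S_def using D by (intro sets.Int) auto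
  qed
  have "S n \<in> null_sets lebesgue" for n
  proof (rule ccontr)
    assume "S n \<notin> null_sets lebesgue"
    then obtain K where K: "compact K" "K \<subseteq> S n" "0 < measure lebesgue K"
      using measure_pos_compact_subset[OF S] by metis
    have ne: "K \<noteq> {}" using K(3) by auto
    have KD: "K \<subseteq> D" using K(2) by (auto simp: S_def)
    obtain \<eta> R where \<eta>: "\<And>n::nat. \<eta> n \<in> test_functions D" "\<And>n x. 0 \<le> \<eta> n x" "\<And>n x. \<eta> n x \<le> 1"
      "\<And>x. (\<lambda>n. \<eta> n x) \<longlonglongrightarrow> indicat_real K x"
      "\<And>n x. x \<notin> cball 0 R \<Longrightarrow> \<eta> n x = 0"
      by (rule cutoff_sequence[OF K(1) ne D KD]) (auto)
    have si: "square_integrable (\<lambda>x. indicat_real (cball 0 R) x *\<^sub>R (1::real))"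
      by (rule square_integrable_const_indicator) auto
    have "square_integrable (\<lambda>x. \<bar>f x\<bar>)" using f by (simp add: square_integrable_def)
    from square_integrable_inner[OF this si]
    have dom: "integrable lebesgue (\<lambda>x. \<bar>f x\<bar> * indicat_real (cball 0 R) x)" by simp
    have "(\<lambda>n. LINT x|lebesgue. f x * \<eta> n x) \<longlonglongrightarrow> (LINT x|lebesgue. f x * indicat_real K x)"
    proof (rule integral_dominated_convergence[OF _ _ dom])
      show "(\<lambda>x. f x * indicat_real K x) \<in> borel_measurable lebesgue"
        using K(1) by (auto intro!: borel_measurable_times borel_measurable_indicator lmeasurable_compact fmeasurableD)
      show "(\<lambda>x. f x * \<eta> n x) \<in> borel_measurable lebesgue" for n
        using square_integrable_measurable[OF test_square_integrable(1)[OF \<eta>(1)[of n]]] by measurable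
      show "AE x in lebesgue. (\<lambda>n. f x * \<eta> n x) \<longlonglongrightarrow> f x * indicat_real K x"
        by (intro AE_I2 tendsto_intros \<eta>)
      show "AE x in lebesgue. norm (f x * \<eta> n x) \<le> \<bar>f x\<bar> * indicat_real (cball 0 R) x" for n
      proof (rule AE_I2)
        fix x
        show "norm (f x * \<eta> n x) \<le> \<bar>f x\<bar> * indicat_real (cball 0 R) x"
          using \<eta>(2,3)[of n x] \<eta>(5)[of x n] by (cases "x \<in> cball 0 R") (auto simp: abs_mult mult_left_le)
      qed
    qed
    then have "(LINT x|lebesgue. f x * indicat_real K x) = 0"
      using 0[OF \<eta>(1)] by (simp add: LIMSEQ_const_iff)
    moreover have "(LINT x|lebesgue. 1 / real (Suc n) * indicat_real K x) \<le> (LINT x|lebesgue. f x * indicat_real K x)"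
    proof (rule integral_mono)
      show "integrable lebesgue (\<lambda>x. 1 / real (Suc n) * indicat_real K x)"
        using lmeasurable_compact[OF K(1)] by (intro integrable_mult_right integrable_real_indicator) (auto simp: fmeasurable_def)
      have "square_integrable (\<lambda>x. indicat_real K x *\<^sub>R (1::real))"
        using K(1) by (intro square_integrable_const_indicator) (auto intro: compact_imp_bounded lmeasurable_compact fmeasurableD)
      from square_integrable_inner[OF f this]
      show "integrable lebesgue (\<lambda>x. f x * indicat_real K x)" by simp
      show "1 / real (Suc n) * indicat_real K x \<le> f x * indicat_real K x" for x
        using K(2) by (cases "x \<in> K") (auto simp: S_def)
    qed
    moreover have "(LINT x|lebesgue. 1 / real (Suc n) * indicat_real K x) = measure lebesgue K / real (Suc n)"
      by simp
    ultimately show False using K(3) by (simp add: field_simps)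
  qed
  then have "(\<Union>n. S n) \<in> null_sets lebesgue" by (rule null_sets_UN)
  then have "AE x in lebesgue. x \<notin> (\<Union>n. S n)" by (rule AE_not_in)
  then show ?thesis
  proof eventually_elim
    case (elim x)
    show ?case
    proof (intro impI leI notI)
      assume "x \<in> D" "0 < f x"
      then obtain n where "1 / real (Suc n) < f x" using nat_approx_posE by blast
      then have "x \<in> S n" using \<open>x \<in> D\<close> by (simp add: S_def)
      then show False using elim by blast
    qed
  qed
qed

lemma AE_zero_of_test:
  fixes f :: "'a::euclidean_space \<Rightarrow> real"
  assumes f: "square_integrable f" and D: "open D"
    and 0: "\<And>\<phi>. \<phi> \<in> test_functions D \<Longrightarrow> (LINT x|lebesgue. f x * \<phi> x) = 0"
  shows "AE x in lebesgue. x \<in> D \<longrightarrow> f x = 0"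
proof -
  have "AE x in lebesgue. x \<in> D \<longrightarrow> f x \<le> 0" by (rule AE_nonpos_of_test[OF assms])
  moreover have "AE x in lebesgue. x \<in> D \<longrightarrow> - f x \<le> 0"
    by (rule AE_nonpos_of_test[OF square_integrable_uminus[OF f] D]) (simp add: 0)
  ultimately show ?thesis by eventually_elim auto
qed

lemma AE_eq_0_Basis:
  fixes f :: "'a \<Rightarrow> 'b::euclidean_space"
  assumes "\<And>i. i \<in> Basis \<Longrightarrow> AE x in M. P x \<longrightarrow> f x \<bullet> i = 0"
  shows "AE x in M. P x \<longrightarrow> f x = 0"
proof -
  have "AE x in M. \<forall>i\<in>Basis. P x \<longrightarrow> f x \<bullet> i = 0"
    using assms by (intro AE_finite_allI) auto
  then show ?thesis by eventually_elim (auto intro: euclidean_eqI)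
qed

lemma inner_test_vector:
  assumes "\<psi> \<in> test_functions E"
  shows "G \<bullet> l2_of (\<lambda>x. \<psi> x *\<^sub>R h) = (LINT x|lebesgue. (rep_l2 G x \<bullet> h) * \<psi> x)"
proof -
  note sp = test_square_integrable(1)[OF assms]
  have "square_integrable (\<lambda>x. \<psi> x *\<^sub>R h)"
    by (rule square_integrable_bound[OF sp, where C = "norm h"])
      (use square_integrable_measurable[OF sp] in \<open>auto simp: mult.commute\<close>)
  from inner_l2_of[OF square_integrable_rep this, of G]
  show ?thesis by (simp add: mult.commute)
qed

lemma square_integrable_inner_const:
  assumes "square_integrable f" shows "square_integrable (\<lambda>x. f x \<bullet> h)"
proof (rule square_integrable_bound[OF assms, where C = "norm h"])
  show "(\<lambda>x. f x \<bullet> h) \<in> borel_measurable lebesgue"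
    using square_integrable_measurable[OF assms] by measurable
  show "AE x in lebesgue. norm (f x \<bullet> h) \<le> norm h * norm (f x)"
    by (simp add: mult.commute[of "norm h"] Cauchy_Schwarz_ineq2)
qed

text \<open>Closability of the gradient. It makes the second component a function of the first,
  which is how gradients produced by different constructions (cutoff, weak limit, restriction to a
  smaller domain) are identified.\<close>

lemma W0_zero_grad:
  assumes "(0, G) \<in> W0 D" shows "G = 0"
proof -
  have "AE x in lebesgue. x \<in> UNIV \<longrightarrow> rep_l2 G x \<bullet> i = 0" for i
  proof (rule AE_zero_of_test[OF square_integrable_inner_const[OF square_integrable_rep] open_UNIV])
    fix \<phi> :: "'a \<Rightarrow> real" assume "\<phi> \<in> test_functions UNIV"
    from W0_by_parts[OF assms this, of i] inner_test_vector[OF this, of G i]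
    show "(LINT x|lebesgue. (rep_l2 G x \<bullet> i) * \<phi> x) = 0" by simp
  qed
  then have "AE x in lebesgue. x \<in> UNIV \<longrightarrow> rep_l2 G x = 0"
    by (rule AE_eq_0_Basis)
  then have "l2_of (rep_l2 G) = l2_of (\<lambda>x. 0)"
    by (intro l2_of_eqI square_integrable_rep) simp
  then show ?thesis by (simp add: l2_of_0)
qed

lemma W0_grad_unique: "(U, G) \<in> W0 D \<Longrightarrow> (U, H) \<in> W0 D \<Longrightarrow> G = H"
  using W0_diff[of U G D U H] W0_zero_grad[of "G - H" D] by simp

text \<open>Vanishing on \<open>A\<close> is orthogonality to everything supported in
  \<open>A\<close>, a closed condition; it is tested in the limit with the restriction of
  \<open>U\<close> itself.\<close>

lemma l2_orthogonal_restrict: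
  fixes U :: "('a::euclidean_space, 'b::euclidean_space) l2"
  assumes A: "A \<in> sets lebesgue" and U: "V \<longlonglongrightarrow> U"
    and V: "\<And>n. V n = l2_of (f n)" "\<And>n. square_integrable (f n)" "\<And>n x. x \<in> A \<Longrightarrow> f n x = 0"
  shows "AE x in lebesgue. x \<in> A \<longrightarrow> rep_l2 U x = 0"
proof -
  define W where "W x = indicat_real A x *\<^sub>R rep_l2 U x" for x
  have W: "square_integrable W"
    unfolding W_def by (rule square_integrable_indicator[OF square_integrable_rep A])
  have "V n \<bullet> l2_of W = 0" for n
  proof -
    have "(\<lambda>x. f n x \<bullet> W x) = (\<lambda>x. 0)" using V(3) by (auto simp: W_def indicator_def)
    then show ?thesis using V W by (simp add: inner_l2_of)
  qed
  moreover have "(\<lambda>n. V n \<bullet> l2_of W) \<longlonglongrightarrow> U \<bullet> l2_of W" by (intro tendsto_intros U)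
  ultimately have "U \<bullet> l2_of W = 0" by (simp add: LIMSEQ_const_iff)
  moreover have "U \<bullet> l2_of W = (LINT x|lebesgue. (norm (W x))\<^sup>2)"
  proof -
    have "(\<lambda>x. rep_l2 U x \<bullet> W x) = (\<lambda>x. (norm (W x))\<^sup>2)"
      by (rule ext) (auto simp: W_def indicator_def power2_norm_eq_inner)
    then show ?thesis using inner_l2_of[OF square_integrable_rep W, of U] by simp
  qed
  ultimately have "(norm (l2_of W))\<^sup>2 = 0" using W by (simp add: norm_l2_of_sq)
  then have "l2_of W = l2_of (\<lambda>x. 0)" by (simp add: l2_of_0)
  then have "AE x in lebesgue. W x = 0" using l2_of_eq_iff[OF W square_integrable_0] by simp
  then show ?thesis by eventually_elim (auto simp: W_def)
qed

lemma W0_vanishes_outside: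
  assumes "(U, G) \<in> W0 D" "open D"
  shows "AE x in lebesgue. x \<notin> D \<longrightarrow> rep_l2 U x = 0" "AE x in lebesgue. x \<notin> D \<longrightarrow> rep_l2 G x = 0"
proof -
  obtain f where f: "\<And>n::nat. f n \<in> test_functions D" "(\<lambda>n. l2_of (f n)) \<longlonglongrightarrow> U" "(\<lambda>n. l2_of (grad (f n))) \<longlonglongrightarrow> G"
    using W0_seq[OF assms(1)] by blast
  have z: "f n x = 0 \<and> grad (f n) x = 0" if "x \<in> - D" for n x
  proof -
    obtain L where "L \<subseteq> D" "\<And>x. x \<notin> L \<Longrightarrow> f n x = 0" "\<And>x. x \<notin> L \<Longrightarrow> grad (f n) x = 0"
      by (rule test_functionsE[OF f(1)[of n]]) auto
    then show ?thesis using that by auto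
  qed
  have D: "- D \<in> sets lebesgue" using assms(2) by (metis Compl_in_sets_lebesgue borel_open sets_completionI_sets sets_lborel)
  show "AE x in lebesgue. x \<notin> D \<longrightarrow> rep_l2 U x = 0"
    using l2_orthogonal_restrict[OF D f(2) refl test_square_integrable(1)[OF f(1)]] z by auto
  show "AE x in lebesgue. x \<notin> D \<longrightarrow> rep_l2 G x = 0"
    using l2_orthogonal_restrict[OF D f(3) refl test_square_integrable(2)[OF f(1)]] z by auto
qed

section \<open>Zero extension and the passage between \<open>H01\<close> and
  \<open>W0\<close>\<close>

definition zext :: "'a set \<Rightarrow> ('a \<Rightarrow> 'b::real_normed_vector) \<Rightarrow> 'a \<Rightarrow> 'b" where
  "zext D u x = indicat_real D x *\<^sub>R u x"

lemma zext_in [simp]: "x \<in> D \<Longrightarrow> zext D u x = u x" and zext_out [simp]: "x \<notin> D \<Longrightarrow> zext D u x = 0"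
  by (simp_all add: zext_def)

lemma lebesgue_open: "open D \<Longrightarrow> D \<in> sets lebesgue"
  by simp

lemma L2_iff_square_integrable:
  assumes "D \<in> sets lebesgue"
  shows "u \<in> L2 D \<longleftrightarrow> square_integrable (zext D u)"
proof -
  have "(\<lambda>x. (norm (zext D u x))\<^sup>2) = (\<lambda>x. indicator D x *\<^sub>R (norm (u x))\<^sup>2)"
    by (auto simp: zext_def indicator_def)
  then show ?thesis
    using assms unfolding L2_def square_integrable_def zext_def
    by (simp add: borel_measurable_restrict_space_iff integrable_restrict_space)
qed

lemma integral_lebesgue_on_indicator:
  fixes f :: "'a::euclidean_space \<Rightarrow> 'b::{banach, second_countable_topology}"
  shows "D \<in> sets lebesgue \<Longrightarrow> (LINT x|lebesgue_on D. f x) = (LINT x|lebesgue. indicator D x *\<^sub>R f x)"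
  by (simp add: integral_restrict_space)

lemma AE_lebesgue_on:
  "D \<in> sets lebesgue \<Longrightarrow> (AE x in lebesgue_on D. P x) \<longleftrightarrow> (AE x in lebesgue. x \<in> D \<longrightarrow> P x)"
  by (simp add: AE_restrict_space_iff)

lemma L2_inner:
  assumes "D \<in> sets lebesgue" "u \<in> L2 D" "v \<in> L2 D"
  shows "(LINT x|lebesgue_on D. u x \<bullet> v x) = l2_of (zext D u) \<bullet> l2_of (zext D v)"
proof -
  have "(\<lambda>x. indicat_real D x *\<^sub>R (u x \<bullet> v x)) = (\<lambda>x. zext D u x \<bullet> zext D v x)"
    by (auto simp: zext_def indicator_def)
  then show ?thesis
    using assms by (simp add: integral_lebesgue_on_indicator inner_l2_of L2_iff_square_integrable)
qed

lemma L2_norm_sq: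
  assumes "D \<in> sets lebesgue" "u \<in> L2 D"
  shows "(LINT x|lebesgue_on D. (norm (u x))\<^sup>2) = (norm (l2_of (zext D u)))\<^sup>2"
  using L2_inner[OF assms assms(2)] by (simp add: power2_norm_eq_inner)

lemma zext_test: "f \<in> test_functions D \<Longrightarrow> zext D f = f" "f \<in> test_functions D \<Longrightarrow> zext D (grad f) = grad f"
  by (erule test_functionsE; force simp: zext_def indicator_def fun_eq_iff)+

lemma test_L2: "D \<in> sets lebesgue \<Longrightarrow> f \<in> test_functions D \<Longrightarrow> f \<in> L2 D \<and> grad f \<in> L2 D"
  by (simp add: L2_iff_square_integrable zext_test test_square_integrable)

lemma zext_diff: "zext D (\<lambda>x. u x - v x) x = zext D u x - zext D v x"
  by (simp add: zext_def scaleR_diff_right)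

lemma L2_diff: "D \<in> sets lebesgue \<Longrightarrow> u \<in> L2 D \<Longrightarrow> v \<in> L2 D \<Longrightarrow> (\<lambda>x. u x - v x) \<in> L2 D"
  using square_integrable_diff[of "zext D u" "zext D v"]
  by (simp add: L2_iff_square_integrable zext_diff[abs_def])

lemma L2_dist_sq:
  assumes "D \<in> sets lebesgue" "u \<in> L2 D" "v \<in> L2 D"
  shows "(LINT x|lebesgue_on D. (norm (u x - v x))\<^sup>2) = (norm (l2_of (zext D u) - l2_of (zext D v)))\<^sup>2"
  using L2_norm_sq[OF assms(1) L2_diff[OF assms]] assms
  by (simp add: zext_diff[abs_def] l2_of_diff L2_iff_square_integrable)

lemma L2_integrable_norm_sq: "u \<in> L2 D \<Longrightarrow> integrable (lebesgue_on D) (\<lambda>x. (norm (u x))\<^sup>2)"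
  by (simp add: L2_def)

lemma H01_approx_integral:
  assumes "D \<in> sets lebesgue" "u \<in> L2 D" "g \<in> L2 D" "f \<in> test_functions D"
  shows "(LINT x|lebesgue_on D. (u x - f x)\<^sup>2 + (norm (g x - grad f x))\<^sup>2) =
    (norm (l2_of (zext D u) - l2_of f))\<^sup>2 + (norm (l2_of (zext D g) - l2_of (grad f)))\<^sup>2"
proof -
  note f = test_L2[OF assms(1,4)]
  have "(LINT x|lebesgue_on D. (norm (u x - f x))\<^sup>2 + (norm (g x - grad f x))\<^sup>2) =
    (LINT x|lebesgue_on D. (norm (u x - f x))\<^sup>2) + (LINT x|lebesgue_on D. (norm (g x - grad f x))\<^sup>2)"
    using assms f by (intro Bochner_Integration.integral_add L2_integrable_norm_sq L2_diff) auto
  then show ?thesis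
    using L2_dist_sq[OF assms(1,2), of f] L2_dist_sq[OF assms(1,3), of "grad f"] f assms(4)
    by (simp add: zext_test)
qed

lemma weak_grad_iff:
  assumes D: "open D" and u: "u \<in> L2 D" and g: "g \<in> L2 D"
  shows "is_weak_grad D u g \<longleftrightarrow> (\<forall>\<phi>\<in>test_functions D. \<forall>i\<in>Basis.
     l2_of (zext D g) \<bullet> l2_of (\<lambda>x. \<phi> x *\<^sub>R i) = - (l2_of (zext D u) \<bullet> l2_of (\<lambda>x. grad \<phi> x \<bullet> i)))"
proof -
  note Ds = lebesgue_open[OF D]
  have "(LINT x|lebesgue_on D. u x * (grad \<phi> x \<bullet> i)) = l2_of (zext D u) \<bullet> l2_of (\<lambda>x. grad \<phi> x \<bullet> i)"
    "(LINT x|lebesgue_on D. (g x \<bullet> i) * \<phi> x) = l2_of (zext D g) \<bullet> l2_of (\<lambda>x. \<phi> x *\<^sub>R i)"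
    if \<phi>: "\<phi> \<in> test_functions D" for \<phi> i
  proof -
    have z1: "zext D (\<lambda>x. grad \<phi> x \<bullet> i) = (\<lambda>x. grad \<phi> x \<bullet> i)"
      by (rule zext_test(1)[OF test_grad_inner[OF \<phi>]])
    have m: "(\<lambda>x. grad \<phi> x \<bullet> i) \<in> L2 D"
      using test_L2[OF Ds test_grad_inner[OF \<phi>]] by simp
    show "(LINT x|lebesgue_on D. u x * (grad \<phi> x \<bullet> i)) = l2_of (zext D u) \<bullet> l2_of (\<lambda>x. grad \<phi> x \<bullet> i)"
      using L2_inner[OF Ds u m] by (simp add: z1)
    have z2: "zext D (\<lambda>x. \<phi> x *\<^sub>R i) = (\<lambda>x. \<phi> x *\<^sub>R i)"
    proof
      fix x
      show "zext D (\<lambda>x. \<phi> x *\<^sub>R i) x = \<phi> x *\<^sub>R i"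
        using fun_cong[OF zext_test(1)[OF \<phi>], of x] by (cases "x \<in> D") auto
    qed
    have "square_integrable (\<lambda>x. \<phi> x *\<^sub>R i)"
      by (rule square_integrable_bound[OF test_square_integrable(1)[OF \<phi>], where C = "norm i"])
        (use square_integrable_measurable[OF test_square_integrable(1)[OF \<phi>]] in \<open>auto simp: mult.commute\<close>)
    then have "(\<lambda>x. \<phi> x *\<^sub>R i) \<in> L2 D" using Ds by (simp add: L2_iff_square_integrable z2)
    from L2_inner[OF Ds g this]
    show "(LINT x|lebesgue_on D. (g x \<bullet> i) * \<phi> x) = l2_of (zext D g) \<bullet> l2_of (\<lambda>x. \<phi> x *\<^sub>R i)"
      by (simp add: z2 mult.commute)
  qed
  then show ?thesis unfolding is_weak_grad_def by (auto simp: eq_neg_iff_add_eq_0 add.commute)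
qed

text \<open>\<open>wgrad\<close> is an arbitrary choice among weak gradients; this lemma makes the
  choice irrelevant, because two candidates differ by a field annihilated by all test
  functions.\<close>

lemma weak_grad_unique:
  assumes D: "open D" and u: "u \<in> L2 D" and g: "g \<in> L2 D" "h \<in> L2 D"
    and w: "is_weak_grad D u g" "is_weak_grad D u h"
  shows "l2_of (zext D g) = l2_of (zext D h)"
proof -
  note Ds = lebesgue_open[OF D]
  have si: "square_integrable (zext D g)" "square_integrable (zext D h)"
    using g Ds by (simp_all add: L2_iff_square_integrable)
  let ?d = "\<lambda>x. zext D g x - zext D h x"
  have sd: "square_integrable ?d" by (rule square_integrable_diff[OF si])
  have "AE x in lebesgue. x \<in> D \<longrightarrow> ?d x \<bullet> i = 0" if i: "i \<in> Basis" for i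
  proof (rule AE_zero_of_test[OF square_integrable_inner_const[OF sd] D])
    fix \<phi> assume \<phi>: "\<phi> \<in> test_functions D"
    have "l2_of ?d \<bullet> l2_of (\<lambda>x. \<phi> x *\<^sub>R i) = 0"
      using w[unfolded weak_grad_iff[OF D u g(1)] weak_grad_iff[OF D u g(2)]] \<phi> i
      by (simp add: l2_of_diff[OF si] inner_diff_left)
    then have "(LINT x|lebesgue. (rep_l2 (l2_of ?d) x \<bullet> i) * \<phi> x) = 0"
      using inner_test_vector[OF \<phi>, of "l2_of ?d" i] by simp
    moreover have "(LINT x|lebesgue. (rep_l2 (l2_of ?d) x \<bullet> i) * \<phi> x) = (LINT x|lebesgue. (?d x \<bullet> i) * \<phi> x)"
    proof (rule integral_cong_AE)
      show "AE x in lebesgue. rep_l2 (l2_of ?d) x \<bullet> i * \<phi> x = ?d x \<bullet> i * \<phi> x"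
        using rep_l2_of[OF sd] by eventually_elim simp
    qed (use square_integrable_measurable[OF sd] square_integrable_measurable[OF test_square_integrable(1)[OF \<phi>]]
        in measurable)
    ultimately show "(LINT x|lebesgue. (?d x \<bullet> i) * \<phi> x) = 0" by simp
  qed
  then have "AE x in lebesgue. x \<in> D \<longrightarrow> ?d x = 0" by (rule AE_eq_0_Basis)
  then have "AE x in lebesgue. zext D g x = zext D h x"
    by eventually_elim (metis eq_iff_diff_eq_0 zext_out)
  then show ?thesis by (rule l2_of_eqI[OF si(1)])
qed

lemma W0_zext_rep:
  assumes "(U, G) \<in> W0 D" "open D"
  shows "l2_of (zext D (rep_l2 U)) = U" "rep_l2 U \<in> L2 D" "l2_of (zext D (rep_l2 G)) = G" "rep_l2 G \<in> L2 D"
proof -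
  note Ds = lebesgue_open[OF assms(2)]
  have s: "square_integrable (zext D (rep_l2 U))" "square_integrable (zext D (rep_l2 G))"
    unfolding zext_def[abs_def] by (intro square_integrable_indicator square_integrable_rep Ds)+
  then show "rep_l2 U \<in> L2 D" "rep_l2 G \<in> L2 D" using Ds by (simp_all add: L2_iff_square_integrable)
  have "AE x in lebesgue. zext D (rep_l2 U) x = rep_l2 U x" "AE x in lebesgue. zext D (rep_l2 G) x = rep_l2 G x"
    using W0_vanishes_outside[OF assms] by (auto elim!: AE_mp simp: zext_def indicator_def)
  then show "l2_of (zext D (rep_l2 U)) = U" "l2_of (zext D (rep_l2 G)) = G"
    using l2_of_eqI[OF s(1)] l2_of_eqI[OF s(2)] by fastforce+
qed

text \<open>The second component is a weak gradient by integration by parts, so the chosen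
  \<open>wgrad\<close> agrees with it by uniqueness. With the converse \<open>H01_W0\<close>, all
  integrals in the definitions become inner products and norms in \<open>l2\<close>.\<close>

lemma H01_of_W0:
  assumes D: "open D" and u: "u \<in> L2 D" and W: "(l2_of (zext D u), G) \<in> W0 D"
  shows "u \<in> H01 D" "l2_of (zext D (wgrad D u)) = G"
proof -
  note Ds = lebesgue_open[OF D] and G = W0_zext_rep(3,4)[OF W D]
  have wG: "is_weak_grad D u (rep_l2 G)"
    using W0_by_parts[OF W] by (simp add: weak_grad_iff[OF D u G(2)] G(1))
  have "wgrad D u \<in> L2 D \<and> is_weak_grad D u (wgrad D u)"
    unfolding wgrad_def by (rule someI[of _ "rep_l2 G"]) (use G wG in simp)
  then have w: "wgrad D u \<in> L2 D" "is_weak_grad D u (wgrad D u)" by auto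
  show eq: "l2_of (zext D (wgrad D u)) = G"
    using weak_grad_unique[OF D u w(1) G(2) w(2) wG] G(1) by simp
  obtain f where f: "\<And>n::nat. f n \<in> test_functions D" "(\<lambda>n. l2_of (f n)) \<longlonglongrightarrow> l2_of (zext D u)"
    "(\<lambda>n. l2_of (grad (f n))) \<longlonglongrightarrow> G"
    using W0_seq[OF W] by blast
  have "(\<lambda>n. (norm (l2_of (zext D u) - l2_of (f n)))\<^sup>2 + (norm (G - l2_of (grad (f n))))\<^sup>2)
      \<longlonglongrightarrow> (norm (l2_of (zext D u) - l2_of (zext D u)))\<^sup>2 + (norm (G - G))\<^sup>2"
    by (intro tendsto_intros f)
  then have "(\<lambda>n. LINT x|lebesgue_on D. (u x - f n x)\<^sup>2 + (norm (wgrad D u x - grad (f n) x))\<^sup>2) \<longlonglongrightarrow> 0"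
    using H01_approx_integral[OF Ds u w(1) f(1)] eq by simp
  moreover have "u \<in> H1 D" using u w by (auto simp: H1_def)
  ultimately show "u \<in> H01 D" using f(1) by (auto simp: H01_def)
qed

lemma H01_W0:
  assumes D: "open D" and u: "u \<in> H01 D"
  shows "u \<in> L2 D" "wgrad D u \<in> L2 D" "(l2_of (zext D u), l2_of (zext D (wgrad D u))) \<in> W0 D"
proof -
  note Ds = lebesgue_open[OF D]
  show uL: "u \<in> L2 D" using u by (simp add: H01_def H1_def)
  have "\<exists>g. g \<in> L2 D \<and> is_weak_grad D u g" using u unfolding H01_def H1_def by blast
  then have "wgrad D u \<in> L2 D \<and> is_weak_grad D u (wgrad D u)"
    unfolding wgrad_def by (rule someI_ex)
  then show w: "wgrad D u \<in> L2 D" by simp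
  obtain f where f: "\<And>n::nat. f n \<in> test_functions D"
    "(\<lambda>n. LINT x|lebesgue_on D. (u x - f n x)\<^sup>2 + (norm (wgrad D u x - grad (f n) x))\<^sup>2) \<longlonglongrightarrow> 0"
    using u unfolding H01_def by blast
  let ?U = "l2_of (zext D u)" and ?G = "l2_of (zext D (wgrad D u))"
  have lim: "(\<lambda>n. (norm (?U - l2_of (f n)))\<^sup>2 + (norm (?G - l2_of (grad (f n))))\<^sup>2) \<longlonglongrightarrow> 0"
    using f(2) H01_approx_integral[OF Ds uL w f(1)] by simp
  have "(\<lambda>n. (norm (?U - l2_of (f n)))\<^sup>2) \<longlonglongrightarrow> 0" "(\<lambda>n. (norm (?G - l2_of (grad (f n))))\<^sup>2) \<longlonglongrightarrow> 0"
    by (rule tendsto_sandwich[OF _ _ tendsto_const lim]; simp)+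
  from this[THEN tendsto_real_sqrt]
  have "(\<lambda>n. norm (?U - l2_of (f n))) \<longlonglongrightarrow> 0" "(\<lambda>n. norm (?G - l2_of (grad (f n)))) \<longlonglongrightarrow> 0"
    by simp_all
  then have "(\<lambda>n. ?U - l2_of (f n)) \<longlonglongrightarrow> 0" "(\<lambda>n. ?G - l2_of (grad (f n))) \<longlonglongrightarrow> 0"
    by (simp_all only: tendsto_norm_zero_iff)
  from tendsto_diff[OF tendsto_const this(1), of ?U] tendsto_diff[OF tendsto_const this(2), of ?G]
  have "(\<lambda>n. l2_of (f n)) \<longlonglongrightarrow> ?U" "(\<lambda>n. l2_of (grad (f n))) \<longlonglongrightarrow> ?G" by simp_all
  then show "(?U, ?G) \<in> W0 D" by (rule W0_limit[OF W0_test[OF f(1)]])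
qed

text \<open>The limit of elements of almost minimal norm in the nested convex sets \<open>A k\<close>; the
  parallelogram law makes such a sequence Cauchy.\<close>

lemma convex_closed_weak_limit:
  fixes S :: "('x::real_inner \<times> 'y::{real_inner, complete_space}) set"
  assumes S: "convex S" "closed S" and ug: "\<And>n::nat. (u n, g n) \<in> S" and lim: "u \<longlonglongrightarrow> U"
    and bd: "\<And>n. (norm (g n))\<^sup>2 \<le> c n" and c: "c \<longlonglongrightarrow> C"
  obtains G where "(U, G) \<in> S" "(norm G)\<^sup>2 \<le> C"
proof -
  define e where "e k = 1 / real (Suc k)" for k
  have e: "0 < e k" "e \<longlonglongrightarrow> 0" for k
    unfolding e_def using LIMSEQ_Suc[OF lim_1_over_n] by simp_all
  have e_mono: "e j \<le> e k" if "k \<le> j" for j k using that by (simp add: e_def divide_simps)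
  define A where "A k = {h. \<exists>v. (v, h) \<in> S \<and> norm (v - U) \<le> e k}" for k
  have A_mono: "A j \<subseteq> A k" if "k \<le> j" for j k
    using e_mono[OF that] by (force simp: A_def)
  have A_mid: "(1/2) *\<^sub>R (h + h') \<in> A k" if "h \<in> A k" "h' \<in> A k" for h h' k
  proof -
    from that obtain v v' where v: "(v, h) \<in> S" "norm (v - U) \<le> e k" "(v', h') \<in> S" "norm (v' - U) \<le> e k"
      by (auto simp: A_def)
    have "(1/2) *\<^sub>R (v, h) + (1/2) *\<^sub>R (v', h') \<in> S"
      using S(1) v by (intro convexD) auto
    then have "((1/2) *\<^sub>R (v + v'), (1/2) *\<^sub>R (h + h')) \<in> S" by (simp add: scaleR_add_right)
    moreover have "norm ((1/2) *\<^sub>R (v + v') - U) \<le> e k"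
    proof -
      have "(1/2) *\<^sub>R (v + v') - U = (1/2) *\<^sub>R ((v - U) + (v' - U))"
        by (simp add: algebra_simps flip: scaleR_add_left)
      then show ?thesis using norm_triangle_ineq[of "v - U" "v' - U"] v by simp
    qed
    ultimately show ?thesis by (auto simp: A_def)
  qed
  have ev: "\<exists>h\<in>A k. (norm h)\<^sup>2 < C + d" if "0 < d" for k d
  proof -
    have "\<forall>\<^sub>F n in sequentially. dist (u n) U < e k" using lim e(1) by (rule tendstoD)
    moreover have "\<forall>\<^sub>F n in sequentially. c n < C + d" using order_tendstoD(2)[OF c, of "C + d"] that by simp
    ultimately obtain n where "dist (u n) U < e k" "c n < C + d"
      using eventually_happens'[OF sequentially_bot eventually_conj] by blast
    then show ?thesis using ug[of n] bd[of n] by (intro bexI[of _ "g n"]) (auto simp: A_def dist_norm)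
  qed
  define m where "m k = (INF h\<in>A k. (norm h)\<^sup>2)" for k
  have bdd: "bdd_below ((\<lambda>h. (norm h)\<^sup>2) ` A k)" for k by (rule bdd_belowI[of _ 0]) auto
  have ne: "A k \<noteq> {}" for k using ev[of 1 k] by auto
  have m_le: "m k \<le> (norm h)\<^sup>2" if "h \<in> A k" for h k
    unfolding m_def by (rule cINF_lower[OF bdd that])
  have mC: "m k \<le> C" for k
  proof (rule field_le_epsilon)
    fix d :: real assume "0 < d"
    then show "m k \<le> C + d" using ev[of d k] m_le by (meson less_imp_le order_trans)
  qed
  have "incseq m"
    unfolding incseq_def m_def using A_mono ne bdd by (auto intro!: cINF_superset_mono)
  then obtain L where L: "m \<longlonglongrightarrow> L" "\<And>k. m k \<le> L"
    using incseq_convergent[of m C] mC by blast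
  have "L \<le> C" using mC L(1) by (intro LIMSEQ_le_const2) auto
  have "\<exists>h\<in>A k. (norm h)\<^sup>2 < m k + e k" for k
    by (rule cINF_less_iff[OF ne bdd, THEN iffD1]) (use e(1)[of k] in \<open>simp flip: m_def\<close>)
  then have "\<forall>k. \<exists>h. h \<in> A k \<and> (norm h)\<^sup>2 < m k + e k" by blast
  from choice[OF this] obtain h where h: "\<And>k. h k \<in> A k" "\<And>k. (norm (h k))\<^sup>2 < m k + e k" by blast
  \<comment> \<open>Both vectors lie in \<open>A k\<close>, hence so does their midpoint, whose
    squared norm is at least \<open>m k\<close>. The parallelogram law then leaves only the gap
    between \<open>m k\<close> and the limit \<open>L\<close> of the increasing infima, plus the
    errors \<open>e k\<close>.\<close>
  have est: "(norm (h k - h j))\<^sup>2 \<le> 2 * (L - m k) + 4 * e k" if "k \<le> j" for k j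
  proof -
    have "4 * m k \<le> (norm (h k + h j))\<^sup>2"
      using m_le[OF A_mid[of "h k" k "h j"]] h(1) A_mono[OF that] by (auto simp: power_divide subset_iff)
    moreover have "(norm (h k - h j))\<^sup>2 + (norm (h k + h j))\<^sup>2 = 2 * (norm (h k))\<^sup>2 + 2 * (norm (h j))\<^sup>2"
      by (simp add: power2_norm_eq_inner algebra_simps inner_commute)
    ultimately show ?thesis using h(2)[of k] h(2)[of j] L(2)[of j] e_mono[OF that] by argo
  qed
  have lim0: "(\<lambda>k. 2 * (L - m k) + 4 * e k) \<longlonglongrightarrow> 0"
    using tendsto_add[OF tendsto_mult[OF tendsto_const[of 2] tendsto_diff[OF tendsto_const[of L] L(1)]]
      tendsto_mult[OF tendsto_const[of 4] e(2)]] by simp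
  have "Cauchy h"
  proof (rule metric_CauchyI)
    fix d :: real assume "0 < d"
    then obtain N where N: "2 * (L - m N) + 4 * e N < (d/2)\<^sup>2"
      using eventually_happens'[OF sequentially_bot order_tendstoD(2)[OF lim0, of "(d/2)\<^sup>2"]] by auto
    have "norm (h N - h j) < d/2" if "N \<le> j" for j
      by (rule power2_less_imp_less[OF le_less_trans[OF est[OF that] N]]) (use \<open>0 < d\<close> in simp)
    then show "\<exists>M. \<forall>i\<ge>M. \<forall>j\<ge>M. dist (h i) (h j) < d"
      by (intro exI[of _ N] allI impI)
        (metis dist_commute dist_norm dist_triangle_half_l)
  qed
  then obtain G where G: "h \<longlonglongrightarrow> G" by (meson Cauchy_convergent convergent_def)
  have "\<forall>k. \<exists>v. (v, h k) \<in> S \<and> norm (v - U) \<le> e k" using h(1) by (auto simp: A_def)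
  from choice[OF this] obtain v where v: "\<And>k. (v k, h k) \<in> S" "\<And>k. norm (v k - U) \<le> e k" by blast
  have "(\<lambda>k. norm (v k - U)) \<longlonglongrightarrow> 0"
    by (rule tendsto_sandwich[OF _ _ tendsto_const e(2)]) (use v in auto)
  then have "v \<longlonglongrightarrow> U" by (simp add: tendsto_norm_zero_iff LIM_zero_iff)
  then have "(U, G) \<in> S"
    using closed_sequentially[OF S(2), of "\<lambda>k. (v k, h k)"] v(1) G by (auto intro: tendsto_Pair)
  moreover have "(norm G)\<^sup>2 \<le> C"
  proof (rule order_trans[OF LIMSEQ_le \<open>L \<le> C\<close>])
    show "(\<lambda>k. (norm (h k))\<^sup>2) \<longlonglongrightarrow> (norm G)\<^sup>2" by (intro tendsto_intros G)
    show "(\<lambda>k. m k + e k) \<longlonglongrightarrow> L" using tendsto_add[OF L(1) e(2)] by simp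
  qed (use h(2) less_imp_le in blast)
  ultimately show thesis by (rule that)
qed

lemma W0_weak_limit:
  assumes "\<And>n::nat. (u n, g n) \<in> W0 D" "u \<longlonglongrightarrow> U" "\<And>n. (norm (g n))\<^sup>2 \<le> c n" "c \<longlonglongrightarrow> C"
  obtains G where "(U, G) \<in> W0 D" "(norm G)\<^sup>2 \<le> C"
  using convex_closed_weak_limit[OF subspace_imp_convex[OF W0_subspace] W0_closed assms] by blast

section \<open>Poincare inequality and Rellich compactness\<close>

text \<open>The map y -> s + t y has Jacobian t^N, which is at least 2^-N for t >= 1/2. This is the
  origin of the factor \<open>2 ^ DIM('a)\<close> in all later estimates.\<close>

lemma nn_integral_affine_le:
  fixes F :: "'a::euclidean_space \<Rightarrow> ennreal"
  assumes [measurable]: "F \<in> borel_measurable borel" and t: "1/2 \<le> t"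
  shows "(\<integral>\<^sup>+y. F (s + t *\<^sub>R y) \<partial>lborel) \<le> 2 ^ DIM('a) * (\<integral>\<^sup>+y. F y \<partial>lborel)"
proof -
  have t0: "t \<noteq> 0" using t by simp
  have "(\<integral>\<^sup>+y. F y \<partial>lborel) = (\<integral>\<^sup>+y. F y \<partial>density (distr lborel borel (\<lambda>x. s + t *\<^sub>R x)) (\<lambda>_. \<bar>t\<bar> ^ DIM('a)))"
    using lborel_affine[OF t0, of s] by simp
  also have "\<dots> = ennreal (\<bar>t\<bar> ^ DIM('a)) * (\<integral>\<^sup>+y. F (s + t *\<^sub>R y) \<partial>lborel)"
    by (simp add: nn_integral_density nn_integral_distr nn_integral_cmult)
  finally have *: "(\<integral>\<^sup>+y. F y \<partial>lborel) = ennreal (\<bar>t\<bar> ^ DIM('a)) * (\<integral>\<^sup>+y. F (s + t *\<^sub>R y) \<partial>lborel)" .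
  have "1 \<le> (2 * \<bar>t\<bar>) ^ DIM('a)" using t by (intro one_le_power) simp
  then have "1 \<le> ennreal (2 ^ DIM('a)) * ennreal (\<bar>t\<bar> ^ DIM('a))"
    by (simp add: power_mult_distrib ennreal_leI flip: ennreal_mult ennreal_1)
  then have "1 * (\<integral>\<^sup>+y. F (s + t *\<^sub>R y) \<partial>lborel) \<le>
      (ennreal (2 ^ DIM('a)) * ennreal (\<bar>t\<bar> ^ DIM('a))) * (\<integral>\<^sup>+y. F (s + t *\<^sub>R y) \<partial>lborel)"
    by (rule mult_right_mono) simp
  also have "\<dots> = 2 ^ DIM('a) * (\<integral>\<^sup>+y. F y \<partial>lborel)"
    by (simp add: * mult.assoc ennreal_power flip: ennreal_numeral)
  finally show ?thesis by simp
qed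

text \<open>Controls the average of \<open>F\<close> at the point dividing the segment from x to y
  in the ratio given by t, uniformly in t; the uniformity matters because the bound is later
  integrated over t in [0, 1].\<close>

lemma nn_integral_segment_le:
  fixes F :: "'a::euclidean_space \<Rightarrow> ennreal"
  assumes F [measurable]: "F \<in> borel_measurable borel" and K [measurable]: "K \<in> sets borel"
    and t: "0 \<le> t" "t \<le> 1"
  shows "(\<integral>\<^sup>+x. \<integral>\<^sup>+y. F ((1 - t) *\<^sub>R x + t *\<^sub>R y) * indicator K x * indicator K y \<partial>lborel \<partial>lborel)
    \<le> 2 ^ DIM('a) * emeasure lborel K * (\<integral>\<^sup>+y. F y \<partial>lborel)" (is "?J t \<le> ?R")
proof -
  have half: "?J t \<le> ?R" if t: "1/2 \<le> t" for t
  proof -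
    have "(\<integral>\<^sup>+y. F ((1 - t) *\<^sub>R x + t *\<^sub>R y) * indicator K x * indicator K y \<partial>lborel) \<le>
      2 ^ DIM('a) * (\<integral>\<^sup>+y. F y \<partial>lborel) * indicator K x" for x
    proof -
      have "(\<integral>\<^sup>+y. F ((1 - t) *\<^sub>R x + t *\<^sub>R y) * indicator K x * indicator K y \<partial>lborel) \<le>
         (\<integral>\<^sup>+y. F ((1 - t) *\<^sub>R x + t *\<^sub>R y) * indicator K x \<partial>lborel)"
        by (intro nn_integral_mono) (simp add: indicator_def)
      also have "\<dots> = (\<integral>\<^sup>+y. F ((1 - t) *\<^sub>R x + t *\<^sub>R y) \<partial>lborel) * indicator K x"
        by (rule nn_integral_multc) measurable
      also have "\<dots> \<le> 2 ^ DIM('a) * (\<integral>\<^sup>+y. F y \<partial>lborel) * indicator K x"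
        by (intro mult_right_mono nn_integral_affine_le F t) simp
      finally show ?thesis .
    qed
    then have "?J t \<le> (\<integral>\<^sup>+x. 2 ^ DIM('a) * (\<integral>\<^sup>+y. F y \<partial>lborel) * indicator K x \<partial>lborel)"
      by (intro nn_integral_mono)
    also have "\<dots> = 2 ^ DIM('a) * (\<integral>\<^sup>+y. F y \<partial>lborel) * emeasure lborel K"
      by (subst nn_integral_cmult_indicator) auto
    also have "\<dots> = ?R" by (simp add: ac_simps)
    finally show ?thesis .
  qed
  show ?thesis
  proof (cases "1/2 \<le> t")
    case True
    then show ?thesis by (rule half)
  next
    case False
    \<comment> \<open>for \<open>t < 1/2\<close> the map \<open>y \<mapsto> (1 - t) x + t y\<close> degenerates, so exchange \<open>x\<close> and \<open>y\<close>\<close>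
    have "?J t = (\<integral>\<^sup>+y. \<integral>\<^sup>+x. F ((1 - t) *\<^sub>R x + t *\<^sub>R y) * indicator K x * indicator K y \<partial>lborel \<partial>lborel)"
      by (rule lborel_pair.Fubini'[symmetric]) measurable
    also have "\<dots> = ?J (1 - t)"
      by (intro nn_integral_cong) (simp add: ac_simps)
    also have "\<dots> \<le> ?R" by (rule half) (use False in simp)
    finally show ?thesis .
  qed
qed

text \<open>The fundamental theorem of calculus along the segment, followed by Cauchy-Schwarz in the
  segment parameter. The extended nonnegative integral is chosen so that the estimate can be fed
  into iterated integrals without integrability conditions.\<close>

lemma increment_sq_le:
  fixes f :: "'a::euclidean_space \<Rightarrow> real"
  assumes f: "smooth f"
  shows "ennreal ((f x - f y)\<^sup>2) \<le> ennreal ((norm (x - y))\<^sup>2) *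
    (\<integral>\<^sup>+t. ennreal ((norm (grad f ((1 - t) *\<^sub>R x + t *\<^sub>R y)))\<^sup>2) * indicator {0..1} t \<partial>lborel)"
proof -
  define p where "p t = (1 - t) *\<^sub>R x + t *\<^sub>R y" for t :: real
  define h where "h t = grad f (p t) \<bullet> (y - x)" for t
  have pc: "continuous_on UNIV p" unfolding p_def by (intro continuous_intros)
  have gc: "continuous_on UNIV (\<lambda>t. grad f (p t))"
    by (rule continuous_on_compose2[OF continuous_grad[OF f, of UNIV] pc]) simp
  have hc: "continuous_on UNIV h" unfolding h_def by (intro continuous_intros gc)
  have D: "((\<lambda>t. f (p t)) has_real_derivative h t) (at t)" for t
  proof -
    have "((\<lambda>t. f (p t)) has_derivative (\<lambda>s. grad f (p t) \<bullet> (s *\<^sub>R (y - x)))) (at t)"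
      unfolding p_def
      by (rule has_derivative_compose[OF _ smooth_has_derivative[OF f]])
        (auto intro!: derivative_eq_intros simp: algebra_simps)
    then show ?thesis by (simp add: has_field_derivative_def h_def mult_commute_abs)
  qed
  define c where "c = f y - f x"
  have ftc: "has_bochner_integral lborel (\<lambda>t. h t * indicator {0..1} t) c"
    using has_bochner_integral_FTC_Icc_real[of 0 1 "\<lambda>t. f (p t)" h] D hc
    by (simp add: c_def p_def continuous_on_eq_continuous_at)
  have int: "integrable lborel (\<lambda>t. indicator {0..1} t *\<^sub>R k t)" if "continuous_on UNIV k" for k :: "real \<Rightarrow> real"
    by (rule borel_integrable_compact) (auto intro: continuous_on_subset[OF that])
  have i2: "integrable lborel (\<lambda>t. (h t)\<^sup>2 * indicator {0..1} t)"
    using int[of "\<lambda>t. (h t)\<^sup>2"] hc by (simp add: continuous_on_power mult.commute)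
  \<comment> \<open>Jensen's inequality in the form that the variance of \<open>h\<close> on [0, 1],
    whose mean is \<open>c\<close>, is nonnegative.\<close>
  have "0 \<le> (LINT t|lborel. (h t - c)\<^sup>2 * indicator {0..1} t)" by simp
  also have "(LINT t|lborel. (h t - c)\<^sup>2 * indicator {0..1} t) =
     (LINT t|lborel. (h t)\<^sup>2 * indicator {0..1} t - 2 * c * (h t * indicator {0..1} t) + c\<^sup>2 * indicator {0..1} t)"
    by (intro Bochner_Integration.integral_cong refl) (simp add: power2_diff algebra_simps)
  also have "\<dots> = (LINT t|lborel. (h t)\<^sup>2 * indicator {0..1} t) - 2 * c * c + c\<^sup>2"
    using i2 ftc int[of "\<lambda>_. 1"]
    by (subst Bochner_Integration.integral_add Bochner_Integration.integral_diff;
        simp add: has_bochner_integral_iff mult.commute)+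
  finally have "c\<^sup>2 \<le> (LINT t|lborel. (h t)\<^sup>2 * indicator {0..1} t)" by (simp add: power2_eq_square)
  then have "ennreal (c\<^sup>2) \<le> (\<integral>\<^sup>+t. ennreal ((h t)\<^sup>2 * indicator {0..1} t) \<partial>lborel)"
    using nn_integral_eq_integral[OF i2] by (simp add: ennreal_leI)
  also have "\<dots> \<le> (\<integral>\<^sup>+t. ennreal ((norm (x - y))\<^sup>2) * (ennreal ((norm (grad f (p t)))\<^sup>2) * indicator {0..1} t) \<partial>lborel)"
  proof (rule nn_integral_mono)
    fix t
    have "(h t)\<^sup>2 \<le> (norm (grad f (p t)) * norm (y - x))\<^sup>2"
      unfolding h_def by (metis Cauchy_Schwarz_ineq2 abs_ge_zero power2_abs power_mono)
    then show "ennreal ((h t)\<^sup>2 * indicator {0..1} t) \<le>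
      ennreal ((norm (x - y))\<^sup>2) * (ennreal ((norm (grad f (p t)))\<^sup>2) * indicator {0..1} t)"
      by (cases "t \<in> {0..1}")
        (auto simp: power_mult_distrib norm_minus_commute mult.commute ennreal_leI simp flip: ennreal_mult)
  qed
  also have "\<dots> = ennreal ((norm (x - y))\<^sup>2) *
    (\<integral>\<^sup>+t. ennreal ((norm (grad f (p t)))\<^sup>2) * indicator {0..1} t \<partial>lborel)"
  proof -
    have [measurable]: "(\<lambda>t. grad f (p t)) \<in> borel_measurable borel"
      by (rule borel_measurable_continuous_onI[OF gc])
    show ?thesis by (rule nn_integral_cmult) measurable
  qed
  finally show ?thesis by (simp add: c_def p_def power2_commute)
qed

text \<open>The increment estimate is integrated over pairs of points. Convexity keeps the segments
  in \<open>K\<close>, so the gradient may be cut off by the indicator of \<open>K\<close>; then the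
  segment parameter is moved to the outside and the uniform bound for fixed t applies.\<close>

lemma double_integral_sq_le:
  fixes f :: "'a::euclidean_space \<Rightarrow> real"
  assumes f: "smooth f" and K [measurable]: "K \<in> sets borel" and "convex K"
    and d: "\<And>x y. x \<in> K \<Longrightarrow> y \<in> K \<Longrightarrow> norm (x - y) \<le> d"
  shows "(\<integral>\<^sup>+x. \<integral>\<^sup>+y. ennreal ((f x - f y)\<^sup>2) * indicator K x * indicator K y \<partial>lborel \<partial>lborel)
    \<le> ennreal (d\<^sup>2) * (2 ^ DIM('a) * emeasure lborel K * (\<integral>\<^sup>+x. ennreal ((norm (grad f x))\<^sup>2) * indicator K x \<partial>lborel))"
proof -
  have fm [measurable]: "f \<in> borel_measurable borel" "grad f \<in> borel_measurable borel"
    using smooth_continuous[OF f] continuous_grad[OF f] by (auto intro: borel_measurable_continuous_onI)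
  define F where "F z = ennreal ((norm (grad f z))\<^sup>2) * indicator K z" for z
  have F [measurable]: "F \<in> borel_measurable borel" unfolding F_def by measurable
  define J where "J x y t = F ((1 - t) *\<^sub>R x + t *\<^sub>R y) * indicator K x * indicator K y * indicator {0..1} t" for x y and t :: real
  have pt: "ennreal ((f x - f y)\<^sup>2) * indicator K x * indicator K y \<le> ennreal (d\<^sup>2) * (\<integral>\<^sup>+t. J x y t \<partial>lborel)" for x y
  proof (cases "x \<in> K \<and> y \<in> K")
    case True
    have "ennreal ((f x - f y)\<^sup>2) \<le> ennreal ((norm (x - y))\<^sup>2) *
      (\<integral>\<^sup>+t. ennreal ((norm (grad f ((1 - t) *\<^sub>R x + t *\<^sub>R y)))\<^sup>2) * indicator {0..1} t \<partial>lborel)"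
      by (rule increment_sq_le[OF f])
    also have "\<dots> \<le> ennreal (d\<^sup>2) * (\<integral>\<^sup>+t. J x y t \<partial>lborel)"
    proof (intro mult_mono nn_integral_mono ennreal_leI power_mono d)
      fix t :: real
      have "(1 - t) *\<^sub>R x + t *\<^sub>R y \<in> K" if "t \<in> {0..1}"
        using \<open>convex K\<close> True that by (intro convexD) auto
      then show "ennreal ((norm (grad f ((1 - t) *\<^sub>R x + t *\<^sub>R y)))\<^sup>2) * indicator {0..1} t \<le> J x y t"
        using True by (cases "t \<in> {0..1}") (auto simp: J_def F_def)
    qed (use True in auto)
    finally show ?thesis using True by simp
  next
    case False
    then show ?thesis by (auto simp: indicator_def)
  qed
  have "(\<integral>\<^sup>+x. \<integral>\<^sup>+y. ennreal ((f x - f y)\<^sup>2) * indicator K x * indicator K y \<partial>lborel \<partial>lborel)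
    \<le> (\<integral>\<^sup>+x. \<integral>\<^sup>+y. ennreal (d\<^sup>2) * (\<integral>\<^sup>+t. J x y t \<partial>lborel) \<partial>lborel \<partial>lborel)"
    by (intro nn_integral_mono pt)
  also have "\<dots> = ennreal (d\<^sup>2) * (\<integral>\<^sup>+x. \<integral>\<^sup>+y. \<integral>\<^sup>+t. J x y t \<partial>lborel \<partial>lborel \<partial>lborel)"
  proof -
    have "(\<integral>\<^sup>+y. ennreal (d\<^sup>2) * (\<integral>\<^sup>+t. J x y t \<partial>lborel) \<partial>lborel) =
      ennreal (d\<^sup>2) * (\<integral>\<^sup>+y. \<integral>\<^sup>+t. J x y t \<partial>lborel \<partial>lborel)" for x
      by (rule nn_integral_cmult) (unfold J_def, measurable)
    then show ?thesis by (simp only:) (rule nn_integral_cmult, unfold J_def, measurable)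
  qed
  also have "(\<integral>\<^sup>+x. \<integral>\<^sup>+y. \<integral>\<^sup>+t. J x y t \<partial>lborel \<partial>lborel \<partial>lborel) = (\<integral>\<^sup>+x. \<integral>\<^sup>+t. \<integral>\<^sup>+y. J x y t \<partial>lborel \<partial>lborel \<partial>lborel)"
    by (intro nn_integral_cong lborel_pair.Fubini') (unfold J_def, measurable)
  also have "\<dots> = (\<integral>\<^sup>+t. \<integral>\<^sup>+x. \<integral>\<^sup>+y. J x y t \<partial>lborel \<partial>lborel \<partial>lborel)"
    by (rule lborel_pair.Fubini') (unfold J_def, measurable)
  also have "\<dots> \<le> (\<integral>\<^sup>+(t::real). (2 ^ DIM('a) * emeasure lborel K * (\<integral>\<^sup>+z. F z \<partial>lborel)) * indicator {0..1} t \<partial>lborel)"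
  proof (rule nn_integral_mono)
    fix t :: real
    show "(\<integral>\<^sup>+x. \<integral>\<^sup>+y. J x y t \<partial>lborel \<partial>lborel) \<le> (2 ^ DIM('a) * emeasure lborel K * (\<integral>\<^sup>+z. F z \<partial>lborel)) * indicator {0..1} t"
    proof (cases "t \<in> {0..1}")
      case True
      then show ?thesis using nn_integral_segment_le[OF F K, of t] by (simp add: J_def)
    next
      case False
      then show ?thesis by (simp add: J_def)
    qed
  qed
  also have "\<dots> = 2 ^ DIM('a) * emeasure lborel K * (\<integral>\<^sup>+z. F z \<partial>lborel)"
    by (subst nn_integral_cmult_indicator) auto
  finally show ?thesis by (simp add: F_def mult_left_mono)
qed

text \<open>Expanding the square identifies the double integral as twice the variance expression of
  f on \<open>K\<close>, so that the Poincare inequality is obtained without subtracting a mean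
  value.\<close>

lemma double_integral_sq_eq:
  fixes f :: "'a::euclidean_space \<Rightarrow> real"
  assumes f: "continuous_on UNIV f" and K: "compact K"
  shows "(\<integral>\<^sup>+x. \<integral>\<^sup>+y. ennreal ((f x - f y)\<^sup>2) * indicator K x * indicator K y \<partial>lborel \<partial>lborel) =
    ennreal (2 * (measure lborel K * (LINT x|lborel. indicator K x * (f x)\<^sup>2) - (LINT x|lborel. indicator K x * f x)\<^sup>2))"
proof -
  define A B V where "A = (LINT x|lborel. indicator K x * f x)" and "B = (LINT x|lborel. indicator K x * (f x)\<^sup>2)"
    and "V = measure lborel K"
  have int: "integrable lborel (\<lambda>x. indicator K x * k x)" if "continuous_on UNIV k" for k :: "'a \<Rightarrow> real"
    using borel_integrable_compact[OF K continuous_on_subset[OF that]] by simp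
  have i0: "integrable lborel (indicat_real K)" using int[of "\<lambda>_. 1"] by simp
  have i1: "integrable lborel (\<lambda>x. indicator K x * f x)" by (rule int[OF f])
  have i2: "integrable lborel (\<lambda>x. indicator K x * (f x)\<^sup>2)" using f by (intro int continuous_intros)
  have V: "(LINT x|lborel. indicat_real K x) = V" by (simp add: V_def)
  have inner: "(\<integral>\<^sup>+y. ennreal ((f x - f y)\<^sup>2) * indicator K x * indicator K y \<partial>lborel) =
      ennreal (indicator K x * ((f x)\<^sup>2 * V - 2 * f x * A + B))" for x
  proof -
    have "has_bochner_integral lborel (\<lambda>y. indicator K x * ((f x)\<^sup>2 * indicator K y - 2 * f x * (indicator K y * f y) + indicator K y * (f y)\<^sup>2))
        (indicator K x * ((f x)\<^sup>2 * V - 2 * f x * A + B))"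
      unfolding A_def B_def V[symmetric] using i0 i1 i2
      by (intro has_bochner_integral_mult_right has_bochner_integral_add has_bochner_integral_diff)
        (auto simp: has_bochner_integral_iff)
    moreover have "(\<lambda>y. indicator K x * ((f x)\<^sup>2 * indicator K y - 2 * f x * (indicator K y * f y) + indicator K y * (f y)\<^sup>2)) =
      (\<lambda>y. (f x - f y)\<^sup>2 * indicat_real K x * indicat_real K y)"
      by (auto simp: fun_eq_iff power2_diff algebra_simps indicator_def)
    ultimately have "has_bochner_integral lborel (\<lambda>y. (f x - f y)\<^sup>2 * indicat_real K x * indicat_real K y)
       (indicator K x * ((f x)\<^sup>2 * V - 2 * f x * A + B))" by simp
    then have "(\<integral>\<^sup>+y. ennreal ((f x - f y)\<^sup>2 * indicat_real K x * indicat_real K y) \<partial>lborel) =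
      ennreal (indicator K x * ((f x)\<^sup>2 * V - 2 * f x * A + B))"
      by (subst nn_integral_eq_integral) (auto simp: has_bochner_integral_iff)
    then show ?thesis
      by (simp add: ennreal_mult'' ennreal_indicator)
  qed
  have "has_bochner_integral lborel (\<lambda>x. V * (indicator K x * (f x)\<^sup>2) - 2 * A * (indicator K x * f x) + B * indicator K x)
     (V * B - 2 * A * A + B * V)"
    unfolding A_def B_def V[symmetric] using i0 i1 i2
    by (intro has_bochner_integral_mult_right has_bochner_integral_add has_bochner_integral_diff)
      (auto simp: has_bochner_integral_iff)
  moreover have "(\<lambda>x. V * (indicator K x * (f x)\<^sup>2) - 2 * A * (indicator K x * f x) + B * indicator K x) =
    (\<lambda>x. indicator K x * ((f x)\<^sup>2 * V - 2 * f x * A + B))"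
    by (auto simp: fun_eq_iff algebra_simps)
  ultimately have hb: "has_bochner_integral lborel (\<lambda>x. indicator K x * ((f x)\<^sup>2 * V - 2 * f x * A + B)) (V * B - 2 * A * A + B * V)"
    by simp
  have nn: "0 \<le> indicator K x * ((f x)\<^sup>2 * V - 2 * f x * A + B)" for x
  proof -
    have "0 \<le> (LINT y|lborel. indicator K y * (f x - f y)\<^sup>2)" by simp
    also have "(LINT y|lborel. indicator K y * (f x - f y)\<^sup>2) =
      (LINT y|lborel. (f x)\<^sup>2 * indicator K y - 2 * f x * (indicator K y * f y) + indicator K y * (f y)\<^sup>2)"
      by (intro Bochner_Integration.integral_cong refl) (simp add: power2_diff algebra_simps)
    also have "\<dots> = (f x)\<^sup>2 * V - 2 * f x * A + B"
      unfolding A_def B_def V[symmetric] using i0 i1 i2 by simp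
    finally show ?thesis by simp
  qed
  show ?thesis
  proof -
    have "(\<integral>\<^sup>+x. ennreal (indicator K x * ((f x)\<^sup>2 * V - 2 * f x * A + B)) \<partial>lborel) = ennreal (V * B - 2 * A * A + B * V)"
      using hb nn by (subst nn_integral_eq_integral) (auto simp only: has_bochner_integral_iff intro!: AE_I2)
    moreover have "V * B - 2 * A * A + B * V = 2 * (V * B - A\<^sup>2)"
      by (simp add: power2_eq_square)
    ultimately show ?thesis unfolding inner by (simp only: A_def B_def V_def)
  qed
qed

lemma lebesgue_integral_lborel:
  fixes f :: "'a::euclidean_space \<Rightarrow> 'b::{banach, second_countable_topology}"
  shows "f \<in> borel_measurable borel \<Longrightarrow> (LINT x|lebesgue. f x) = (LINT x|lborel. f x)"
  by (rule integral_completion) simp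

text \<open>The Poincare inequality multiplied through by |K|. In this form no division occurs and
  both sides are continuous in f and its gradient, so that it extends to \<open>W0\<close> by
  approximation. A factor 1/2 from the double integral is given away.\<close>

lemma Poincare_smooth:
  fixes f :: "'a::euclidean_space \<Rightarrow> real"
  assumes f: "smooth f" and K: "compact K" "convex K" and d: "\<And>x y. x \<in> K \<Longrightarrow> y \<in> K \<Longrightarrow> norm (x - y) \<le> d"
  shows "measure lebesgue K * (LINT x|lebesgue. indicator K x * (f x)\<^sup>2) - (LINT x|lebesgue. indicator K x * f x)\<^sup>2
    \<le> 2 ^ DIM('a) * d\<^sup>2 * measure lebesgue K * (LINT x|lebesgue. indicator K x * (norm (grad f x))\<^sup>2)"
proof -
  have Kb [measurable]: "K \<in> sets borel" using K(1) by (simp add: borel_compact)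
  have fm [measurable]: "f \<in> borel_measurable borel" "grad f \<in> borel_measurable borel"
    using smooth_continuous[OF f] continuous_grad[OF f] by (auto intro: borel_measurable_continuous_onI)
  define G where "G = (LINT x|lborel. indicator K x * (norm (grad f x))\<^sup>2)"
  have iG: "integrable lborel (\<lambda>x. indicator K x * (norm (grad f x))\<^sup>2)"
    using borel_integrable_compact[OF K(1), of "\<lambda>x. (norm (grad f x))\<^sup>2"] continuous_grad[OF f]
    by (simp add: continuous_on_power continuous_on_norm)
  have G0: "0 \<le> G" by (simp add: G_def)
  have nG: "(\<integral>\<^sup>+x. ennreal ((norm (grad f x))\<^sup>2) * indicator K x \<partial>lborel) = ennreal G"
    unfolding G_def using nn_integral_eq_integral[OF iG]
    by (simp add: ennreal_mult'' ennreal_indicator mult.commute)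
  have eK: "emeasure lborel K = ennreal (measure lborel K)"
    using emeasure_compact_finite[OF K(1)] by (simp add: emeasure_eq_ennreal_measure)
  have "ennreal (2 * (measure lborel K * (LINT x|lborel. indicator K x * (f x)\<^sup>2) - (LINT x|lborel. indicator K x * f x)\<^sup>2))
    \<le> ennreal (d\<^sup>2) * (2 ^ DIM('a) * ennreal (measure lborel K) * ennreal G)"
    using double_integral_sq_le[OF f Kb K(2) d] double_integral_sq_eq[OF smooth_continuous[OF f] K(1)]
    unfolding nG eK by simp
  also have "\<dots> = ennreal (d\<^sup>2 * (2 ^ DIM('a) * measure lborel K * G))"
    using G0 by (simp add: ennreal_mult ennreal_power flip: ennreal_numeral)
  finally have "2 * (measure lborel K * (LINT x|lborel. indicator K x * (f x)\<^sup>2) - (LINT x|lborel. indicator K x * f x)\<^sup>2)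
     \<le> d\<^sup>2 * (2 ^ DIM('a) * measure lborel K * G)"
    using G0 by (simp add: ennreal_le_iff)
  moreover have "0 \<le> d\<^sup>2 * (2 ^ DIM('a) * measure lborel K * G)" using G0 by simp
  moreover have "2 * a \<le> b \<Longrightarrow> 0 \<le> b \<Longrightarrow> a \<le> b" for a b :: real by linarith
  ultimately have "measure lborel K * (LINT x|lborel. indicator K x * (f x)\<^sup>2) - (LINT x|lborel. indicator K x * f x)\<^sup>2
     \<le> d\<^sup>2 * (2 ^ DIM('a) * measure lborel K * G)" by blast
  then show ?thesis
    by (simp add: lebesgue_integral_lborel G_def ac_simps measure_completion)
qed

text \<open>Superposition operators, Lipschitz in the value uniformly in the point and fixing zero;
  such operators act as Lipschitz maps on \<open>l2\<close>. Cutoff, restriction to a set, absolute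
  value and its smooth substitutes all have this shape, so one continuity lemma serves them
  all.\<close>

definition nemytskii :: "real \<Rightarrow> ('a::euclidean_space \<Rightarrow> 'b::euclidean_space \<Rightarrow> 'c::euclidean_space) \<Rightarrow> bool" where
  "nemytskii C P \<longleftrightarrow> 0 \<le> C \<and> (\<forall>x. P x 0 = 0) \<and> (\<forall>x a b. norm (P x a - P x b) \<le> C * norm (a - b)) \<and>
     (\<forall>f\<in>borel_measurable lebesgue. (\<lambda>x. P x (f x)) \<in> borel_measurable lebesgue)"

definition lift_op :: "('a::euclidean_space \<Rightarrow> 'b::euclidean_space \<Rightarrow> 'c::euclidean_space) \<Rightarrow> ('a, 'b) l2 \<Rightarrow> ('a, 'c) l2" where
  "lift_op P U = l2_of (\<lambda>x. P x (rep_l2 U x))"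

lemma nemytskii_square_integrable:
  assumes P: "nemytskii C P" and f: "square_integrable f"
  shows "square_integrable (\<lambda>x. P x (f x))"
proof (rule square_integrable_bound[OF f, where C = C])
  have "norm (P x (f x) - P x 0) \<le> C * norm (f x - 0)" for x using P unfolding nemytskii_def by blast
  then show "AE x in lebesgue. norm (P x (f x)) \<le> C * norm (f x)"
    using P by (simp add: nemytskii_def)
qed (use P square_integrable_measurable[OF f] in \<open>simp add: nemytskii_def\<close>)

lemma lift_op_l2_of:
  assumes P: "nemytskii C P" and f: "square_integrable f"
  shows "lift_op P (l2_of f) = l2_of (\<lambda>x. P x (f x))"
  unfolding lift_op_def
  by (rule l2_of_eqI[OF nemytskii_square_integrable[OF P square_integrable_rep]])
    (use rep_l2_of[OF f] in \<open>eventually_elim, simp\<close>)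

lemma rep_lift_op:
  assumes "nemytskii C P" shows "AE x in lebesgue. rep_l2 (lift_op P U) x = P x (rep_l2 U x)"
  unfolding lift_op_def
  by (rule rep_l2_of[OF nemytskii_square_integrable[OF assms square_integrable_rep]])

lemma lift_op_dist:
  assumes P: "nemytskii C P"
  shows "norm (lift_op P U - lift_op P V) \<le> C * norm (U - V)"
  using norm_l2_of_diff_le[OF square_integrable_rep[of U] square_integrable_rep[of V]
    nemytskii_square_integrable[OF P square_integrable_rep[of U]]
    nemytskii_square_integrable[OF P square_integrable_rep[of V]], of C] P
  by (simp add: lift_op_def nemytskii_def)

lemma lift_op_tendsto:
  assumes P: "nemytskii C P" and "V \<longlonglongrightarrow> U"
  shows "(\<lambda>n. lift_op P (V n)) \<longlonglongrightarrow> lift_op P U"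
proof -
  have "(\<lambda>n. norm (V n - U)) \<longlonglongrightarrow> 0" using assms(2) by (simp add: LIM_zero tendsto_norm_zero)
  then have lim: "(\<lambda>n. C * norm (V n - U)) \<longlonglongrightarrow> 0" by (rule tendsto_mult_right_zero)
  have "(\<lambda>n. norm (lift_op P (V n) - lift_op P U)) \<longlonglongrightarrow> 0"
    by (rule tendsto_sandwich[OF _ _ tendsto_const lim]) (use lift_op_dist[OF P] in auto)
  then show ?thesis by (simp add: tendsto_norm_zero_iff LIM_zero_iff)
qed

lemma nemytskii_mult:
  assumes "c \<in> borel_measurable lebesgue" "\<And>x. \<bar>c x\<bar> \<le> C"
  shows "nemytskii C (\<lambda>x a. c x *\<^sub>R a)"
proof -
  have "0 \<le> C" using assms(2)[of undefined] abs_ge_zero order_trans by blast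
  moreover have "norm (c x *\<^sub>R a - c x *\<^sub>R b) \<le> C * norm (a - b)" for x and a b :: 'b
    using mult_right_mono[OF assms(2)[of x], of "norm (a - b)"] by (simp flip: scaleR_diff_right)
  ultimately show ?thesis using assms(1) by (simp add: nemytskii_def)
qed

lemma nemytskii_vec:
  fixes v :: "'a::euclidean_space \<Rightarrow> 'b::euclidean_space"
  assumes "v \<in> borel_measurable lebesgue" "\<And>x. norm (v x) \<le> C"
  shows "nemytskii C (\<lambda>x (a::real). a *\<^sub>R v x)"
proof -
  have "0 \<le> C" using assms(2)[of undefined] norm_ge_zero order_trans by blast
  moreover have "norm (a *\<^sub>R v x - b *\<^sub>R v x) \<le> C * norm (a - b)" for x a b
    using mult_right_mono[OF assms(2)[of x], of "\<bar>a - b\<bar>"] by (simp add: mult.commute flip: scaleR_diff_left)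
  ultimately show ?thesis using assms(1) by (simp add: nemytskii_def)
qed

lemma nemytskii_indicator: "A \<in> sets lebesgue \<Longrightarrow> nemytskii 1 (\<lambda>x a. indicat_real A x *\<^sub>R a)"
  by (rule nemytskii_mult) (auto simp: indicator_def)

lemma nemytskii_real:
  fixes F :: "real \<Rightarrow> real"
  assumes "continuous_on UNIV F" "F 0 = 0" "0 \<le> C" "\<And>a b. \<bar>F a - F b\<bar> \<le> C * \<bar>a - b\<bar>"
  shows "nemytskii C (\<lambda>x::'a::euclidean_space. F)"
proof -
  have "(\<lambda>x. F (f x)) \<in> borel_measurable lebesgue" if "f \<in> borel_measurable lebesgue" for f :: "'a \<Rightarrow> real"
    by (rule measurable_compose[OF that borel_measurable_continuous_onI[OF assms(1)]])
  then show ?thesis using assms by (simp add: nemytskii_def)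
qed

section \<open>Restriction to cells and Rellich's theorem\<close>

definition restr :: "'a::euclidean_space set \<Rightarrow> ('a, 'b::euclidean_space) l2 \<Rightarrow> ('a, 'b) l2" where
  "restr A = lift_op (\<lambda>x a. indicat_real A x *\<^sub>R a)"

definition ind :: "'a::euclidean_space set \<Rightarrow> ('a, real) l2" where
  "ind A = l2_of (\<lambda>x. indicat_real A x *\<^sub>R 1)"

lemma norm_restr_sq:
  assumes "A \<in> sets lebesgue"
  shows "(norm (restr A U))\<^sup>2 = (LINT x|lebesgue. indicat_real A x * (norm (rep_l2 U x))\<^sup>2)"
proof -
  have "(norm (restr A U))\<^sup>2 = (LINT x|lebesgue. (norm (indicat_real A x *\<^sub>R rep_l2 U x))\<^sup>2)"
    unfolding restr_def lift_op_def
    by (rule norm_l2_of_sq[OF nemytskii_square_integrable[OF nemytskii_indicator[OF assms] square_integrable_rep]])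
  moreover have "(norm (indicat_real A x *\<^sub>R rep_l2 U x))\<^sup>2 = indicat_real A x * (norm (rep_l2 U x))\<^sup>2" for x
    by (simp add: indicator_def)
  ultimately show ?thesis by simp
qed

lemma integrable_norm_rep_sq: "integrable lebesgue (\<lambda>x. (norm (rep_l2 U x))\<^sup>2)"
  using square_integrable_rep[of U] by (simp add: square_integrable_def)

lemma integrable_indicator_norm_rep_sq:
  "A \<in> sets lebesgue \<Longrightarrow> integrable lebesgue (\<lambda>x. indicat_real A x * (norm (rep_l2 U x))\<^sup>2)"
  using integrable_mult_indicator[OF _ integrable_norm_rep_sq, of A U] by simp

lemma norm_sq_rep: "(norm U)\<^sup>2 = (LINT x|lebesgue. (norm (rep_l2 U x))\<^sup>2)"
  using norm_l2_of_sq[OF square_integrable_rep, of U] by simp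

lemma inner_rep: "U \<bullet> V = (LINT x|lebesgue. rep_l2 U x \<bullet> rep_l2 V x)"
  using inner_l2_of[OF square_integrable_rep square_integrable_rep, of U V] by simp

lemma W0_Poincare:
  assumes W: "(U, G) \<in> W0 D" and K: "compact K" "convex K"
    and d: "\<And>x y. x \<in> K \<Longrightarrow> y \<in> K \<Longrightarrow> norm (x - y) \<le> d"
  shows "measure lebesgue K * (norm (restr K U))\<^sup>2 - (U \<bullet> ind K)\<^sup>2
    \<le> 2 ^ DIM('a::euclidean_space) * d\<^sup>2 * measure lebesgue (K :: 'a set) * (norm (restr K G))\<^sup>2"
proof -
  have Ks: "K \<in> sets lebesgue" using K(1) by (simp add: fmeasurableD lmeasurable_compact)
  have sK: "square_integrable (\<lambda>x. indicat_real K x *\<^sub>R (1::real))"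
    by (rule square_integrable_const_indicator[OF Ks compact_imp_bounded[OF K(1)]])
  obtain f where f: "\<And>n::nat. f n \<in> test_functions D" "(\<lambda>n. l2_of (f n)) \<longlonglongrightarrow> U" "(\<lambda>n. l2_of (grad (f n))) \<longlonglongrightarrow> G"
    using W0_seq[OF W] by blast
  note sq = test_square_integrable[OF f(1)]
  have "measure lebesgue K * (norm (restr K (l2_of (f n))))\<^sup>2 - (l2_of (f n) \<bullet> ind K)\<^sup>2
      \<le> 2 ^ DIM('a) * d\<^sup>2 * measure lebesgue K * (norm (restr K (l2_of (grad (f n)))))\<^sup>2" for n
  proof -
    have n: "(norm (restr K (l2_of h)))\<^sup>2 = (LINT x|lebesgue. indicat_real K x * (norm (h x))\<^sup>2)"
      if h: "square_integrable h" for h :: "'a \<Rightarrow> 'z::euclidean_space"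
    proof -
      have "(norm (restr K (l2_of h)))\<^sup>2 = (LINT x|lebesgue. (norm (indicat_real K x *\<^sub>R h x))\<^sup>2)"
        unfolding restr_def lift_op_l2_of[OF nemytskii_indicator[OF Ks] h]
        by (rule norm_l2_of_sq[OF nemytskii_square_integrable[OF nemytskii_indicator[OF Ks] h]])
      moreover have "(norm (indicat_real K x *\<^sub>R h x))\<^sup>2 = indicat_real K x * (norm (h x))\<^sup>2" for x
        by (simp add: indicator_def)
      ultimately show ?thesis by simp
    qed
    have i: "l2_of (f n) \<bullet> ind K = (LINT x|lebesgue. indicator K x * f n x)"
      unfolding ind_def inner_l2_of[OF sq(1) sK] by (simp add: mult.commute)
    show ?thesis
      using Poincare_smooth[OF test_smooth[OF f(1)[of n]] K d] by (simp add: n[OF sq(1)] n[OF sq(2)] i)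
  qed
  moreover have "(\<lambda>n. measure lebesgue K * (norm (restr K (l2_of (f n))))\<^sup>2 - (l2_of (f n) \<bullet> ind K)\<^sup>2) \<longlonglongrightarrow>
     measure lebesgue K * (norm (restr K U))\<^sup>2 - (U \<bullet> ind K)\<^sup>2"
    unfolding restr_def by (intro tendsto_intros lift_op_tendsto[OF nemytskii_indicator[OF Ks]] f)
  moreover have "(\<lambda>n. 2 ^ DIM('a) * d\<^sup>2 * measure lebesgue K * (norm (restr K (l2_of (grad (f n)))))\<^sup>2) \<longlonglongrightarrow>
     2 ^ DIM('a) * d\<^sup>2 * measure lebesgue K * (norm (restr K G))\<^sup>2"
    unfolding restr_def by (intro tendsto_intros lift_op_tendsto[OF nemytskii_indicator[OF Ks]] f)
  ultimately show ?thesis by (auto intro: LIMSEQ_le)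
qed

text \<open>Cells of a division may share faces; these are null sets, so the sum of the indicators
  exceeds 1 only on a null set.\<close>

lemma sum_indicator_division:
  assumes "\<D> division_of cbox a b"
  shows "AE x in lebesgue. (\<Sum>Q\<in>\<D>. indicat_real Q x) \<le> 1"
proof -
  note fin = division_of_finite[OF assms]
  have "AE x in lebesgue. \<forall>Q\<in>\<D>. x \<notin> Q - interior Q"
  proof (rule AE_finite_allI[OF fin])
    fix Q assume "Q \<in> \<D>"
    then obtain u v where "Q = cbox u v" using division_ofD(4)[OF assms] by blast
    then have "negligible (Q - interior Q)" using negligible_frontier_interval by (simp add: interior_cbox)
    then show "AE x in lebesgue. x \<notin> Q - interior Q"
      by (intro AE_not_in) (simp add: negligible_iff_null_sets)
  qed
  then show ?thesis
  proof eventually_elim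
    case (elim x)
    show ?case
    proof (cases "\<exists>Q\<in>\<D>. x \<in> Q")
      case True
      then obtain Q where Q: "Q \<in> \<D>" "x \<in> Q" by blast
      have "x \<notin> R" if "R \<in> \<D>" "R \<noteq> Q" for R
        using division_ofD(5)[OF assms Q(1) that(1)] that elim Q by blast
      then have "(\<Sum>R\<in>\<D>. indicat_real R x) = (\<Sum>R\<in>{Q}. indicat_real R x)"
        using fin Q by (intro sum.mono_neutral_right) (auto simp: indicator_def)
      also have "\<dots> = 1" using Q(2) by simp
      finally show ?thesis by simp
    next
      case False
      then show ?thesis by (simp add: indicator_def)
    qed
  qed
qed

text \<open>The source of compactness: the Poincare inequality, summed over the cells, bounds the
  norm of \<open>U\<close> by the mesh times the norm of the gradient plus finitely many linear
  functionals of \<open>U\<close>, namely its integrals over the cells.\<close>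

lemma W0_division_estimate:
  fixes D :: "'a::euclidean_space set"
  assumes W: "(U, G) \<in> W0 D" and D: "open D" "D \<subseteq> cbox a b" and \<D>: "\<D> division_of cbox a b"
    and d: "\<And>Q x y. Q \<in> \<D> \<Longrightarrow> x \<in> Q \<Longrightarrow> y \<in> Q \<Longrightarrow> norm (x - y) \<le> d"
  shows "(norm U)\<^sup>2 \<le> 2 ^ DIM('a) * d\<^sup>2 * (norm G)\<^sup>2 + (\<Sum>Q\<in>\<D>. (U \<bullet> ind Q)\<^sup>2 / measure lebesgue Q)"
proof -
  note fin = division_of_finite[OF \<D>]
  have box: "\<exists>u v. Q = cbox u v" if "Q \<in> \<D>" for Q using division_ofD(4)[OF \<D> that] .
  have Qs: "Q \<in> sets lebesgue" if "Q \<in> \<D>" for Q using box[OF that] by auto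
  have cell: "(norm (restr Q U))\<^sup>2 \<le> 2 ^ DIM('a) * d\<^sup>2 * (norm (restr Q G))\<^sup>2 + (U \<bullet> ind Q)\<^sup>2 / measure lebesgue Q"
    if Q: "Q \<in> \<D>" for Q
  proof (cases "measure lebesgue Q = 0")
    \<comment> \<open>A degenerate cell: the quotient on the right is 0 by the convention for
      division by zero, and the restriction of \<open>U\<close> to a null set vanishes.\<close>
    case True
    obtain u v where uv: "Q = cbox u v" using box[OF Q] by blast
    have "Q \<in> null_sets lebesgue"
      using True uv Qs[OF Q] by (metis completion.complete_measure_axioms emeasure_eq_measure2 ennreal_0 lmeasurable_cbox null_setsI)
    then have "AE x in lebesgue. indicat_real Q x * (norm (rep_l2 U x))\<^sup>2 = 0"
      by (auto dest!: AE_not_in elim!: AE_mp)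
    then have "(norm (restr Q U))\<^sup>2 = 0"
      unfolding norm_restr_sq[OF Qs[OF Q]] by (simp add: integral_eq_zero_AE)
    then show ?thesis by (simp add: True)
  next
    case False
    then have pos: "0 < measure lebesgue Q" by (simp add: zero_less_measure_iff)
    obtain u v where uv: "Q = cbox u v" using box[OF Q] by blast
    have "measure lebesgue Q * (norm (restr Q U))\<^sup>2 - (U \<bullet> ind Q)\<^sup>2
      \<le> 2 ^ DIM('a) * d\<^sup>2 * measure lebesgue Q * (norm (restr Q G))\<^sup>2"
      by (rule W0_Poincare[OF W]) (use uv d[OF Q] in \<open>auto intro: convex_box\<close>)
    then have "(measure lebesgue Q * (norm (restr Q U))\<^sup>2) / measure lebesgue Q \<le>
      (2 ^ DIM('a) * d\<^sup>2 * measure lebesgue Q * (norm (restr Q G))\<^sup>2 + (U \<bullet> ind Q)\<^sup>2) / measure lebesgue Q"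
      using pos by (intro divide_right_mono) auto
    then show ?thesis using pos by (simp add: add_divide_distrib)
  qed
  have "(norm U)\<^sup>2 \<le> (LINT x|lebesgue. (\<Sum>Q\<in>\<D>. indicat_real Q x * (norm (rep_l2 U x))\<^sup>2))"
    unfolding norm_sq_rep[of U]
  proof (rule integral_mono_AE[OF integrable_norm_rep_sq Bochner_Integration.integrable_sum])
    show "AE x in lebesgue. (norm (rep_l2 U x))\<^sup>2 \<le> (\<Sum>Q\<in>\<D>. indicat_real Q x * (norm (rep_l2 U x))\<^sup>2)"
      using W0_vanishes_outside(1)[OF W D(1)]
    proof eventually_elim
      case (elim x)
      show ?case
      proof (cases "x \<in> D")
        case True
        then obtain Q where Q: "Q \<in> \<D>" "x \<in> Q" using D(2) division_ofD(6)[OF \<D>] by blast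
        have "indicat_real Q x * (norm (rep_l2 U x))\<^sup>2 \<le> (\<Sum>Q\<in>\<D>. indicat_real Q x * (norm (rep_l2 U x))\<^sup>2)"
          by (rule member_le_sum[OF Q(1) _ fin]) simp
        then show ?thesis using Q by simp
      next
        case False
        then show ?thesis using elim by simp
      qed
    qed
  qed (intro integrable_indicator_norm_rep_sq Qs)
  also have "\<dots> = (\<Sum>Q\<in>\<D>. (norm (restr Q U))\<^sup>2)"
    by (subst Bochner_Integration.integral_sum)
      (auto simp only: norm_restr_sq Qs intro!: sum.cong integrable_indicator_norm_rep_sq)
  also have "\<dots> \<le> (\<Sum>Q\<in>\<D>. 2 ^ DIM('a) * d\<^sup>2 * (norm (restr Q G))\<^sup>2 + (U \<bullet> ind Q)\<^sup>2 / measure lebesgue Q)"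
    by (intro sum_mono cell)
  also have "\<dots> = 2 ^ DIM('a) * d\<^sup>2 * (\<Sum>Q\<in>\<D>. (norm (restr Q G))\<^sup>2) + (\<Sum>Q\<in>\<D>. (U \<bullet> ind Q)\<^sup>2 / measure lebesgue Q)"
    by (simp add: sum.distrib sum_distrib_left)
  also have "\<dots> \<le> 2 ^ DIM('a) * d\<^sup>2 * (norm G)\<^sup>2 + (\<Sum>Q\<in>\<D>. (U \<bullet> ind Q)\<^sup>2 / measure lebesgue Q)"
  proof (intro add_right_mono mult_left_mono)
    have "(\<Sum>Q\<in>\<D>. (norm (restr Q G))\<^sup>2) = (LINT x|lebesgue. (\<Sum>Q\<in>\<D>. indicat_real Q x * (norm (rep_l2 G x))\<^sup>2))"
      by (subst Bochner_Integration.integral_sum) (auto simp: norm_restr_sq Qs integrable_indicator_norm_rep_sq)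
    also have "\<dots> \<le> (norm G)\<^sup>2"
      unfolding norm_sq_rep[of G]
    proof (rule integral_mono_AE[OF Bochner_Integration.integrable_sum integrable_norm_rep_sq])
      show "AE x in lebesgue. (\<Sum>Q\<in>\<D>. indicat_real Q x * (norm (rep_l2 G x))\<^sup>2) \<le> (norm (rep_l2 G x))\<^sup>2"
        using sum_indicator_division[OF \<D>]
      proof eventually_elim
        case (elim x)
        then show ?case
          using mult_right_mono[OF elim, of "(norm (rep_l2 G x))\<^sup>2"] by (simp add: sum_distrib_right)
      qed
    qed (use Qs integrable_indicator_norm_rep_sq in auto)
    finally show "(\<Sum>Q\<in>\<D>. (norm (restr Q G))\<^sup>2) \<le> (norm G)\<^sup>2" .
  qed simp
  finally show ?thesis .
qed

lemma fine_division:
  fixes a b :: "'a::euclidean_space"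
  assumes "0 < d"
  obtains \<D> where "\<D> division_of cbox a b" "\<And>Q x y. Q \<in> \<D> \<Longrightarrow> x \<in> Q \<Longrightarrow> y \<in> Q \<Longrightarrow> norm (x - y) \<le> d"
proof -
  have "gauge (\<lambda>x. ball x (d/2))" using assms by (intro gaugeI) auto
  then obtain p where p: "p tagged_division_of (cbox a b)" "(\<lambda>x. ball x (d/2)) fine p"
    by (rule fine_division_exists)
  show thesis
  proof (rule that[OF division_of_tagged_division[OF p(1)]])
    fix Q x y assume "Q \<in> snd ` p" "x \<in> Q" "y \<in> Q"
    then obtain z where "Q \<subseteq> ball z (d/2)" using p(2) unfolding fine_def by auto
    then have "dist z x < d/2" "dist z y < d/2" using \<open>x \<in> Q\<close> \<open>y \<in> Q\<close> by auto
    then show "norm (x - y) \<le> d" using dist_triangle_half_r[of z x d y] by (simp add: dist_norm)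
  qed
qed

text \<open>For every mesh 1/(k+1) a division is fixed, and a diagonal subsequence makes the
  integrals over all of these countably many cells converge. The division estimate for differences
  then gives the Cauchy property: the mesh is chosen for the gradient term, and only afterwards the
  index for the finite sum.\<close>

lemma W0_Rellich:
  fixes D :: "'a::euclidean_space set"
  assumes D: "open D" "bounded D" and W: "\<And>n::nat. (U n, G n) \<in> W0 D"
    and R: "\<And>n. norm (U n) \<le> R" "\<And>n. norm (G n) \<le> R"
  obtains r :: "nat \<Rightarrow> nat" and V where "strict_mono r" "(\<lambda>n. U (r n)) \<longlonglongrightarrow> V"
proof -
  obtain a b :: 'a where ab: "D \<subseteq> cbox a b" using bounded_subset_cbox_symmetric[OF D(2)] by (metis (full_types))
  have "\<forall>k::nat. \<exists>\<D>. \<D> division_of cbox a b \<and> (\<forall>Q\<in>\<D>. \<forall>x\<in>Q. \<forall>y\<in>Q. norm (x - y) \<le> 1 / real (Suc k))"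
  proof
    fix k :: nat
    show "\<exists>\<D>. \<D> division_of cbox a b \<and> (\<forall>Q\<in>\<D>. \<forall>x\<in>Q. \<forall>y\<in>Q. norm (x - y) \<le> 1 / real (Suc k))"
      by (rule fine_division[of "1 / real (Suc k)" a b]) auto
  qed
  from choice[OF this] obtain \<D> where \<D>': "\<forall>k::nat. \<D> k division_of cbox a b \<and>
    (\<forall>Q\<in>\<D> k. \<forall>x\<in>Q. \<forall>y\<in>Q. norm (x - y) \<le> 1 / real (Suc k))" by blast
  have \<D>: "\<D> k division_of cbox a b" "Q \<in> \<D> k \<Longrightarrow> x \<in> Q \<Longrightarrow> y \<in> Q \<Longrightarrow> norm (x - y) \<le> 1 / real (Suc k)"
    for k Q x y using \<D>' by blast+
  define S where "S = (\<Union>k. \<D> k)"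
  have S: "countable S" unfolding S_def using division_of_finite[OF \<D>(1)] by (auto intro: countable_finite)
  have bd: "norm (U n \<bullet> ind Q) \<le> R * norm (ind (cbox a b))" if "Q \<in> S" for n Q
  proof -
    obtain k where k: "Q \<in> \<D> k" using \<open>Q \<in> S\<close> by (auto simp: S_def)
    have Q: "Q \<subseteq> cbox a b" "\<exists>u v. Q = cbox u v" using division_ofD(2,4)[OF \<D>(1) k] by auto
    have "norm (ind Q) \<le> 1 * norm (ind (cbox a b))"
      unfolding ind_def using Q
      by (intro norm_l2_of_le square_integrable_const_indicator) (auto simp: indicator_def)
    moreover have "0 \<le> R" using R(1)[of 0] norm_ge_zero order_trans by blast
    ultimately have "norm (U n) * norm (ind Q) \<le> R * norm (ind (cbox a b))"
      using R(1) by (intro mult_mono) auto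
    then show ?thesis using Cauchy_Schwarz_ineq2[of "U n" "ind Q"] by simp
  qed
  obtain r :: "nat \<Rightarrow> nat" where r: "strict_mono r" "\<And>Q. Q \<in> S \<Longrightarrow> \<exists>l. (\<lambda>n. U (r n) \<bullet> ind Q) \<longlonglongrightarrow> l"
    by (rule function_convergent_subsequence[OF S, of "\<lambda>n Q. U n \<bullet> ind Q"]) (use bd in auto)
  then have "\<forall>Q. \<exists>l. Q \<in> S \<longrightarrow> (\<lambda>n. U (r n) \<bullet> ind Q) \<longlonglongrightarrow> l" by blast
  from choice[OF this] obtain l where l: "\<And>Q. Q \<in> S \<Longrightarrow> (\<lambda>n. U (r n) \<bullet> ind Q) \<longlonglongrightarrow> l Q" by blast
  have "Cauchy (\<lambda>n. U (r n))"
  proof (rule metric_CauchyI)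
    fix e :: real assume e: "0 < e"
    \<comment> \<open>Differences of two gradients have norm at most 2 R, so \<open>c k\<close>
      bounds the gradient term at mesh 1/(k+1).\<close>
    define c where "c k = 2 ^ DIM('a) * (1 / real (Suc k))\<^sup>2 * (2 * R)\<^sup>2" for k
    have "c \<longlonglongrightarrow> 2 ^ DIM('a) * 0\<^sup>2 * (2 * R)\<^sup>2"
      unfolding c_def by (intro tendsto_intros LIMSEQ_Suc[OF lim_1_over_n])
    then have "\<forall>\<^sub>F k in sequentially. c k < e\<^sup>2 / 2" using e by (intro order_tendstoD(2)) auto
    then obtain k where k: "c k < e\<^sup>2 / 2" by (auto simp: eventually_sequentially)
    define s where "s n = (\<Sum>Q\<in>\<D> k. 2 * (U (r n) \<bullet> ind Q - l Q)\<^sup>2 / measure lebesgue Q)" for n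
    have "s \<longlonglongrightarrow> (\<Sum>Q\<in>\<D> k. 2 * (l Q - l Q)\<^sup>2 / measure lebesgue Q)"
      unfolding s_def divide_inverse by (intro tendsto_intros l) (auto simp: S_def)
    then have "\<forall>\<^sub>F n in sequentially. s n < e\<^sup>2 / 4" using e by (intro order_tendstoD(2)) auto
    then obtain N where N: "\<And>n. N \<le> n \<Longrightarrow> s n < e\<^sup>2 / 4" by (auto simp: eventually_sequentially)
    show "\<exists>M. \<forall>m\<ge>M. \<forall>n\<ge>M. dist (U (r m)) (U (r n)) < e"
    proof (intro exI[of _ N] allI impI)
      fix m n assume mn: "N \<le> m" "N \<le> n"
      have "norm (G (r m) - G (r n)) \<le> 2 * R"
        using norm_triangle_ineq4[of "G (r m)" "G (r n)"] R(2)[of "r m"] R(2)[of "r n"] by simp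
      then have "(norm (G (r m) - G (r n)))\<^sup>2 \<le> (2 * R)\<^sup>2" by (rule power_mono) simp
      then have 1: "2 ^ DIM('a) * (1 / real (Suc k))\<^sup>2 * (norm (G (r m) - G (r n)))\<^sup>2 \<le> c k"
        unfolding c_def by (intro mult_left_mono) auto
      have 2: "(\<Sum>Q\<in>\<D> k. ((U (r m) - U (r n)) \<bullet> ind Q)\<^sup>2 / measure lebesgue Q) \<le> s m + s n"
        unfolding s_def sum.distrib[symmetric]
      proof (intro sum_mono)
        fix Q
        define x y where "x = U (r m) \<bullet> ind Q - l Q" and "y = U (r n) \<bullet> ind Q - l Q"
        have "((U (r m) - U (r n)) \<bullet> ind Q)\<^sup>2 = (x - y)\<^sup>2" by (simp add: x_def y_def inner_diff_left)
        also have "\<dots> \<le> 2 * x\<^sup>2 + 2 * y\<^sup>2"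
          using zero_le_power2[of "x + y"] by (simp add: power2_sum power2_diff)
        finally have "((U (r m) - U (r n)) \<bullet> ind Q)\<^sup>2 / measure lebesgue Q \<le> (2 * x\<^sup>2 + 2 * y\<^sup>2) / measure lebesgue Q"
          by (intro divide_right_mono) auto
        then show "((U (r m) - U (r n)) \<bullet> ind Q)\<^sup>2 / measure lebesgue Q \<le>
          2 * (U (r m) \<bullet> ind Q - l Q)\<^sup>2 / measure lebesgue Q + 2 * (U (r n) \<bullet> ind Q - l Q)\<^sup>2 / measure lebesgue Q"
          by (simp add: x_def y_def add_divide_distrib)
      qed
      have "(norm (U (r m) - U (r n)))\<^sup>2 \<le> 2 ^ DIM('a) * (1 / real (Suc k))\<^sup>2 * (norm (G (r m) - G (r n)))\<^sup>2 +
         (\<Sum>Q\<in>\<D> k. ((U (r m) - U (r n)) \<bullet> ind Q)\<^sup>2 / measure lebesgue Q)"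
        by (rule W0_division_estimate[OF W0_diff[OF W W] D(1) ab \<D>(1)]) (rule \<D>(2))
      also have "\<dots> \<le> c k + (s m + s n)" by (rule add_mono[OF 1 2])
      also have "\<dots> < e\<^sup>2" using k N[OF mn(1)] N[OF mn(2)] by argo
      finally show "dist (U (r m)) (U (r n)) < e"
        unfolding dist_norm by (rule power2_less_imp_less) (use e in simp)
    qed
  qed
  then obtain V where "(\<lambda>n. U (r n)) \<longlonglongrightarrow> V" by (meson Cauchy_convergent convergent_def)
  with r(1) show thesis by (rule that)
qed

section \<open>Chain rule and strong maximum principle\<close>

lemma W0_mult_test:
  assumes W: "(U, G) \<in> W0 D" and \<psi>: "\<psi> \<in> test_functions E"
  shows "(lift_op (\<lambda>x a. \<psi> x *\<^sub>R a) U, lift_op (\<lambda>x a. \<psi> x *\<^sub>R a) G + lift_op (\<lambda>x a. a *\<^sub>R grad \<psi> x) U) \<in> W0 (D \<inter> E)"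
proof -
  obtain B where B: "\<And>x. \<bar>\<psi> x\<bar> \<le> B" "\<And>x. norm (grad \<psi> x) \<le> B"
    by (rule test_bounded[OF \<psi>]) auto
  note sp = test_square_integrable[OF \<psi>]
  note n1 = nemytskii_mult[OF square_integrable_measurable[OF sp(1)] B(1)]
  note n2 = nemytskii_vec[OF square_integrable_measurable[OF sp(2)] B(2)]
  obtain f where f: "\<And>n::nat. f n \<in> test_functions D" "(\<lambda>n. l2_of (f n)) \<longlonglongrightarrow> U" "(\<lambda>n. l2_of (grad (f n))) \<longlonglongrightarrow> G"
    using W0_seq[OF W] by blast
  note sq = test_square_integrable[OF f(1)]
  show ?thesis
  proof (rule W0_limit)
    fix n
    have t: "(\<lambda>x. \<psi> x * f n x) \<in> test_functions (D \<inter> E)"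
    proof -
      obtain K where K: "compact K" "K \<subseteq> D" "\<And>x. x \<notin> K \<Longrightarrow> f n x = 0"
        by (rule test_functionsE[OF f(1)[of n]]) auto
      obtain L where L: "compact L" "L \<subseteq> E" "\<And>x. x \<notin> L \<Longrightarrow> \<psi> x = 0"
        by (rule test_functionsE[OF \<psi>]) auto
      show ?thesis
        by (rule test_functionsI[of _ "K \<inter> L"])
          (use K L in \<open>auto intro: smooth_mult test_smooth[OF f(1)] test_smooth[OF \<psi>] compact_Int\<close>)
    qed
    have g: "grad (\<lambda>x. \<psi> x * f n x) = (\<lambda>x. \<psi> x *\<^sub>R grad (f n) x + f n x *\<^sub>R grad \<psi> x)"
      by (rule ext) (rule grad_mult[OF test_smooth[OF \<psi>] test_smooth[OF f(1)]])
    show "(lift_op (\<lambda>x a. \<psi> x *\<^sub>R a) (l2_of (f n)),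
       lift_op (\<lambda>x a. \<psi> x *\<^sub>R a) (l2_of (grad (f n))) + lift_op (\<lambda>x a. a *\<^sub>R grad \<psi> x) (l2_of (f n))) \<in> W0 (D \<inter> E)"
      using W0_test[OF t] nemytskii_square_integrable[OF n1 sq(2), of n] nemytskii_square_integrable[OF n2 sq(1), of n]
        lift_op_l2_of[OF n1 sq(1), of n]
      by (simp add: g lift_op_l2_of[OF n1 sq(2)] lift_op_l2_of[OF n2 sq(1)] l2_of_add)
  next
    show "(\<lambda>n. lift_op (\<lambda>x a. \<psi> x *\<^sub>R a) (l2_of (f n))) \<longlonglongrightarrow> lift_op (\<lambda>x a. \<psi> x *\<^sub>R a) U"
      by (rule lift_op_tendsto[OF n1 f(2)])
    show "(\<lambda>n. lift_op (\<lambda>x a. \<psi> x *\<^sub>R a) (l2_of (grad (f n))) + lift_op (\<lambda>x a. a *\<^sub>R grad \<psi> x) (l2_of (f n)))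
      \<longlonglongrightarrow> lift_op (\<lambda>x a. \<psi> x *\<^sub>R a) G + lift_op (\<lambda>x a. a *\<^sub>R grad \<psi> x) U"
      by (intro tendsto_add lift_op_tendsto[OF n1 f(3)] lift_op_tendsto[OF n2 f(2)])
  qed
qed

lemma l2_tendsto_AE_subseq:
  fixes V :: "nat \<Rightarrow> ('a::euclidean_space, 'b::euclidean_space) l2"
  assumes "V \<longlonglongrightarrow> U"
  obtains r :: "nat \<Rightarrow> nat" where "strict_mono r" "AE x in lebesgue. (\<lambda>n. rep_l2 (V (r n)) x) \<longlonglongrightarrow> rep_l2 U x"
proof -
  have "Cauchy V" using assms by (rule LIMSEQ_imp_Cauchy)
  then obtain r :: "nat \<Rightarrow> nat" where r: "strict_mono r"
    and bd: "\<And>k j. j \<ge> k \<Longrightarrow> dist (V (r j)) (V (r k)) \<le> (1/2) ^ k"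
    using fast_subsequence[of V] by blast
  obtain g where g: "square_integrable g" "AE x in lebesgue. (\<lambda>k. rep_l2 (V (r k)) x) \<longlonglongrightarrow> g x"
    "\<And>k. norm (l2_of g - l2_of (rep_l2 (V (r k)))) \<le> (1/2) ^ k"
  proof (rule l2_fast_Cauchy[of "\<lambda>k. rep_l2 (V (r k))"])
    show "norm (l2_of (rep_l2 (V (r j))) - l2_of (rep_l2 (V (r k)))) \<le> (1/2) ^ k" if "k \<le> j" for j k
      using bd[OF that] by (simp add: dist_norm)
  qed (auto intro: square_integrable_rep)
  have "(\<lambda>k. norm (l2_of g - V (r k))) \<longlonglongrightarrow> 0"
    by (rule tendsto_sandwich[OF _ _ tendsto_const LIMSEQ_power_zero[of "1/2::real"]]) (use g(3) in auto)
  moreover have "(\<lambda>k. norm (l2_of g - V (r k))) \<longlonglongrightarrow> norm (l2_of g - U)"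
    using LIMSEQ_subseq_LIMSEQ[OF assms r] by (intro tendsto_intros) (simp add: o_def)
  ultimately have "norm (l2_of g - U) = 0" by (rule LIMSEQ_unique[symmetric])
  then have "l2_of g = l2_of (rep_l2 U)" by simp
  then have "AE x in lebesgue. g x = rep_l2 U x"
    using l2_of_eq_iff[OF g(1) square_integrable_rep] by blast
  with g(2) have "AE x in lebesgue. (\<lambda>k. rep_l2 (V (r k)) x) \<longlonglongrightarrow> rep_l2 U x"
    by eventually_elim simp
  with r show thesis by (rule that)
qed

lemma AE_all_rep_l2_of:
  fixes f :: "nat \<Rightarrow> 'a::euclidean_space \<Rightarrow> 'b::euclidean_space"
  assumes "\<And>n. square_integrable (f n)"
  shows "AE x in lebesgue. \<forall>n. rep_l2 (l2_of (f n)) x = f n x"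
  using rep_l2_of[OF assms] by (simp add: AE_all_countable)

text \<open>Along a subsequence converging almost everywhere, the error of the gradient is split
  into F'(f_n) (grad f_n - G), small because F' is bounded, and (F'(f_n) - F'(u)) G, small by
  dominated convergence. The smoothness condition on compositions and \<open>F 0 = 0\<close> ensure
  that F(f_n) is again a test function.\<close>

lemma W0_chain:
  fixes F F' :: "real \<Rightarrow> real"
  assumes W: "(U, G) \<in> W0 (D :: 'a::euclidean_space set)"
    and F: "\<And>s. (F has_real_derivative F' s) (at s)" "continuous_on UNIV F'" "\<And>s. \<bar>F' s\<bar> \<le> C" "F 0 = 0"
    and smF: "\<forall>f :: 'a \<Rightarrow> real. smooth f \<longrightarrow> smooth (\<lambda>x. F (f x))"
  shows "(lift_op (\<lambda>x. F) U, l2_of (\<lambda>x. F' (rep_l2 U x) *\<^sub>R rep_l2 G x)) \<in> W0 D"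
    "square_integrable (\<lambda>x. F' (rep_l2 U x) *\<^sub>R rep_l2 G x)" "nemytskii C (\<lambda>x::'a. F)"
proof -
  have C: "0 \<le> C" using F(3)[of 0] by linarith
  have lip: "\<bar>F a - F b\<bar> \<le> C * \<bar>a - b\<bar>" for a b
    using field_differentiable_bound[of UNIV F F' C a b] F(1,3) by (simp add: has_field_derivative_at_within)
  have Fc: "continuous_on UNIV F"
    using F(1) by (meson DERIV_isCont continuous_at_imp_continuous_on)
  show n: "nemytskii C (\<lambda>x::'a. F)" by (rule nemytskii_real[OF Fc F(4) C lip])
  have F'm: "(\<lambda>x. F' (f x)) \<in> borel_measurable lebesgue" if "f \<in> borel_measurable lebesgue" for f :: "'a \<Rightarrow> real"
    by (rule measurable_compose[OF that borel_measurable_continuous_onI[OF F(2)]])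
  have sqF: "square_integrable (\<lambda>x. F' (f x) *\<^sub>R g x)"
    if "f \<in> borel_measurable lebesgue" "square_integrable g" for f and g :: "'a \<Rightarrow> 'a"
    by (rule square_integrable_mult_bounded[OF that(2) F'm[OF that(1)] F(3)])
  show sq0: "square_integrable (\<lambda>x. F' (rep_l2 U x) *\<^sub>R rep_l2 G x)"
    by (rule sqF[OF rep_measurable square_integrable_rep])
  obtain f0 where f0: "\<And>n::nat. f0 n \<in> test_functions D" "(\<lambda>n. l2_of (f0 n)) \<longlonglongrightarrow> U" "(\<lambda>n. l2_of (grad (f0 n))) \<longlonglongrightarrow> G"
    using W0_seq[OF W] by blast
  obtain r :: "nat \<Rightarrow> nat" where r: "strict_mono r" "AE x in lebesgue. (\<lambda>n. rep_l2 (l2_of (f0 (r n))) x) \<longlonglongrightarrow> rep_l2 U x"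
    by (rule l2_tendsto_AE_subseq[OF f0(2)])
  define f where "f n = f0 (r n)" for n
  have f: "f n \<in> test_functions D" for n using f0(1) by (simp add: f_def)
  note sq = test_square_integrable[OF f]
  have lim: "(\<lambda>n. l2_of (f n)) \<longlonglongrightarrow> U" "(\<lambda>n. l2_of (grad (f n))) \<longlonglongrightarrow> G"
    using LIMSEQ_subseq_LIMSEQ[OF f0(2) r(1)] LIMSEQ_subseq_LIMSEQ[OF f0(3) r(1)] by (simp_all add: f_def o_def)
  have ae: "AE x in lebesgue. (\<lambda>n. f n x) \<longlonglongrightarrow> rep_l2 U x"
    using r(2) AE_all_rep_l2_of[of f, OF sq(1)] by eventually_elim (simp flip: f_def)
  have t: "(\<lambda>x. F (f n x)) \<in> test_functions D" for n
    by (rule test_compose[OF f smF[rule_format, OF test_smooth[OF f]] F(4)])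
  have g: "grad (\<lambda>x. F (f n x)) = (\<lambda>x. F' (f n x) *\<^sub>R grad (f n) x)" for n
    by (rule ext) (rule grad_compose_real[OF F(1) test_smooth[OF f]])
  show "(lift_op (\<lambda>x. F) U, l2_of (\<lambda>x. F' (rep_l2 U x) *\<^sub>R rep_l2 G x)) \<in> W0 D"
  proof (rule W0_limit)
    show "(lift_op (\<lambda>x. F) (l2_of (f n)), l2_of (\<lambda>x. F' (f n x) *\<^sub>R grad (f n) x)) \<in> W0 D" for n
      using W0_test[OF t[of n]] by (simp add: g lift_op_l2_of[OF n sq(1)])
    show "(\<lambda>n. lift_op (\<lambda>x. F) (l2_of (f n))) \<longlonglongrightarrow> lift_op (\<lambda>x. F) U"
      by (rule lift_op_tendsto[OF n lim(1)])
    \<comment> \<open>The intermediate field: derivative of \<open>F\<close> at the approximating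
      function, but already the limiting gradient.\<close>
    define A where "A n = (\<lambda>x. F' (f n x) *\<^sub>R rep_l2 G x)" for n
    define L where "L = l2_of (\<lambda>x. F' (rep_l2 U x) *\<^sub>R rep_l2 G x)"
    have sqA: "square_integrable (A n)" for n
      unfolding A_def by (rule sqF[OF square_integrable_measurable[OF sq(1)] square_integrable_rep])
    have sqB: "square_integrable (\<lambda>x. F' (f n x) *\<^sub>R grad (f n) x)" for n
      by (rule sqF[OF square_integrable_measurable[OF sq(1)] sq(2)])
    have 1: "norm (l2_of (\<lambda>x. F' (f n x) *\<^sub>R grad (f n) x) - l2_of (A n)) \<le> C * norm (l2_of (grad (f n)) - G)" for n
    proof -
      have "norm (l2_of (\<lambda>x. F' (f n x) *\<^sub>R grad (f n) x) - l2_of (A n)) \<le> C * norm (l2_of (grad (f n)) - l2_of (rep_l2 G))"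
      proof (rule norm_l2_of_diff_le[OF sq(2) square_integrable_rep sqB sqA C])
        show "AE x in lebesgue. norm (F' (f n x) *\<^sub>R grad (f n) x - A n x) \<le> C * norm (grad (f n) x - rep_l2 G x)"
          by (rule AE_I2) (simp add: A_def F(3) mult_right_mono flip: scaleR_diff_right)
      qed
      then show ?thesis by simp
    qed
    have "(\<lambda>n. LINT x|lebesgue. (norm (A n x - F' (rep_l2 U x) *\<^sub>R rep_l2 G x))\<^sup>2) \<longlonglongrightarrow> (LINT x|(lebesgue :: 'a measure). (0::real))"
    proof (rule integral_dominated_convergence)
      show "integrable lebesgue (\<lambda>x. (2 * C)\<^sup>2 * (norm (rep_l2 G x))\<^sup>2)"
        by (intro integrable_mult_right integrable_norm_rep_sq)
      show "AE x in lebesgue. (\<lambda>n. (norm (A n x - F' (rep_l2 U x) *\<^sub>R rep_l2 G x))\<^sup>2) \<longlonglongrightarrow> 0"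
        using ae
      proof eventually_elim
        case (elim x)
        have "isCont F' (rep_l2 U x)" using F(2) by (simp add: continuous_on_eq_continuous_at)
        then have "(\<lambda>n. F' (f n x)) \<longlonglongrightarrow> F' (rep_l2 U x)" using elim by (rule isCont_tendsto_compose)
        then have "(\<lambda>n. (norm (A n x - F' (rep_l2 U x) *\<^sub>R rep_l2 G x))\<^sup>2) \<longlonglongrightarrow>
          (norm (F' (rep_l2 U x) *\<^sub>R rep_l2 G x - F' (rep_l2 U x) *\<^sub>R rep_l2 G x))\<^sup>2"
          unfolding A_def by (intro tendsto_intros)
        then show ?case by simp
      qed
      show "AE x in lebesgue. norm ((norm (A n x - F' (rep_l2 U x) *\<^sub>R rep_l2 G x))\<^sup>2) \<le> (2 * C)\<^sup>2 * (norm (rep_l2 G x))\<^sup>2" for n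
      proof (rule AE_I2)
        fix x
        have "norm (A n x - F' (rep_l2 U x) *\<^sub>R rep_l2 G x) = \<bar>F' (f n x) - F' (rep_l2 U x)\<bar> * norm (rep_l2 G x)"
          by (simp add: A_def flip: scaleR_diff_left)
        also have "\<dots> \<le> (2 * C) * norm (rep_l2 G x)"
          using F(3)[of "f n x"] F(3)[of "rep_l2 U x"] by (intro mult_right_mono) auto
        finally have "(norm (A n x - F' (rep_l2 U x) *\<^sub>R rep_l2 G x))\<^sup>2 \<le> ((2 * C) * norm (rep_l2 G x))\<^sup>2"
          by (rule power_mono) simp
        then show "norm ((norm (A n x - F' (rep_l2 U x) *\<^sub>R rep_l2 G x))\<^sup>2) \<le> (2 * C)\<^sup>2 * (norm (rep_l2 G x))\<^sup>2"
          by (simp only: power_mult_distrib real_norm_def abs_power2)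
      qed
      show "(\<lambda>x. (norm (A n x - F' (rep_l2 U x) *\<^sub>R rep_l2 G x))\<^sup>2) \<in> borel_measurable lebesgue" for n
        by (intro borel_measurable_power
            measurable_compose[OF square_integrable_measurable[OF square_integrable_diff[OF sqA sq0]] borel_measurable_norm])
    qed simp
    then have "(\<lambda>n. (norm (l2_of (A n) - L))\<^sup>2) \<longlonglongrightarrow> 0"
      using norm_l2_of_sq[OF square_integrable_diff[OF sqA sq0]] by (simp add: L_def l2_of_diff[OF sqA sq0])
    from tendsto_real_sqrt[OF this] have 2: "(\<lambda>n. norm (l2_of (A n) - L)) \<longlonglongrightarrow> 0" by simp
    have "(\<lambda>n. norm (l2_of (grad (f n)) - G)) \<longlonglongrightarrow> 0"
      using lim(2) by (simp add: LIM_zero tendsto_norm_zero)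
    from tendsto_add[OF tendsto_mult_right_zero[OF this, of C] 2]
    have 3: "(\<lambda>n. C * norm (l2_of (grad (f n)) - G) + norm (l2_of (A n) - L)) \<longlonglongrightarrow> 0" by simp
    have "(\<lambda>n. norm (l2_of (\<lambda>x. F' (f n x) *\<^sub>R grad (f n) x) - L)) \<longlonglongrightarrow> 0"
    proof (rule tendsto_sandwich[OF _ _ tendsto_const 3])
      show "\<forall>\<^sub>F n in sequentially. norm (l2_of (\<lambda>x. F' (f n x) *\<^sub>R grad (f n) x) - L) \<le>
        C * norm (l2_of (grad (f n)) - G) + norm (l2_of (A n) - L)"
        by (intro always_eventually allI norm_diff_triangle_le[OF 1 order_refl])
    qed simp
    then show "(\<lambda>n. l2_of (\<lambda>x. F' (f n x) *\<^sub>R grad (f n) x)) \<longlonglongrightarrow> l2_of (\<lambda>x. F' (rep_l2 U x) *\<^sub>R rep_l2 G x)"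
      by (simp only: tendsto_norm_zero_iff LIM_zero_iff L_def)
  qed
qed

section \<open>Absolute values\<close>

lemma nemytskii_abs: "nemytskii 1 (\<lambda>x a. \<bar>a\<bar> :: real)"
  by (rule nemytskii_real) (auto intro!: continuous_intros)

definition l2_abs :: "('a::euclidean_space, real) l2 \<Rightarrow> ('a, real) l2" where
  "l2_abs = lift_op (\<lambda>x a. \<bar>a\<bar>)"

lemma rep_l2_abs: "AE x in lebesgue. rep_l2 (l2_abs U) x = \<bar>rep_l2 U x\<bar>"
  unfolding l2_abs_def by (rule rep_lift_op[OF nemytskii_abs])

lemma norm_l2_abs: "norm (l2_abs U) = norm U"
proof -
  have "(norm (l2_abs U))\<^sup>2 = (norm U)\<^sup>2"
    unfolding norm_sq_rep
    by (rule integral_cong_AE) (use rep_l2_abs[of U] in \<open>auto elim!: AE_mp\<close>)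
  then show ?thesis by simp
qed

text \<open>The functions sqrt(s^2 + e^2) - e are smooth, vanish at 0, have slope at most 1 and
  differ from |s| by at most e; since \<open>D\<close> is bounded, the last fact gives convergence
  in L2. The gradients do not grow in norm, and the weak limit lemma provides one for the absolute
  value, with the norm inequality that minimisation asks for.\<close>

lemma W0_abs:
  assumes W: "(U, G) \<in> W0 D" and D: "open D" "bounded D"
  obtains H where "(l2_abs U, H) \<in> W0 D" "norm H \<le> norm G"
proof -
  obtain f where f: "\<And>n::nat. f n \<in> test_functions D" "(\<lambda>n. l2_of (f n)) \<longlonglongrightarrow> U" "(\<lambda>n. l2_of (grad (f n))) \<longlonglongrightarrow> G"
    using W0_seq[OF W] by blast
  note sq = test_square_integrable[OF f(1)]
  define e where "e n = 1 / real (Suc n)" for n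
  have e: "0 < e n" for n by (simp add: e_def)
  have e0: "e \<longlonglongrightarrow> 0" unfolding e_def by (rule LIMSEQ_Suc[OF lim_1_over_n])
  define F where "F n s = sqrt (s\<^sup>2 + (e n)\<^sup>2) - e n" for n s
  define F' where "F' n s = s / sqrt (s\<^sup>2 + (e n)\<^sup>2)" for n s
  have pos: "0 < s\<^sup>2 + (e n)\<^sup>2" for n s using e[of n] by (simp add: add_nonneg_pos)
  have dF: "(F n has_real_derivative F' n s) (at s)" for n s
    unfolding F_def F'_def using pos[of s n]
    by (auto intro!: derivative_eq_intros simp: field_simps)
  have F'1: "\<bar>F' n s\<bar> \<le> 1" for n s
  proof -
    have "\<bar>s\<bar> \<le> sqrt (s\<^sup>2 + (e n)\<^sup>2)" by (simp add: real_le_rsqrt)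
    then show ?thesis using pos[of s n] by (simp add: F'_def divide_le_eq)
  qed
  have sm: "smooth (\<lambda>x. F n (g x))" if "smooth g" for n and g :: "'a \<Rightarrow> real"
  proof -
    have "smooth (\<lambda>x. g x * g x + (e n)\<^sup>2)" by (intro smooth_add smooth_mult smooth_const that)
    then have "smooth (\<lambda>x. sqrt (g x * g x + (e n)\<^sup>2) - e n)"
      using pos[of _ n] by (intro smooth_diff smooth_sqrt smooth_const) (auto simp: power2_eq_square)
    then show ?thesis by (simp add: F_def power2_eq_square)
  qed
  have F_abs: "\<bar>F n s - \<bar>s\<bar>\<bar> \<le> e n" for n s
  proof -
    have "\<bar>s\<bar> \<le> sqrt (s\<^sup>2 + (e n)\<^sup>2)" by (simp add: real_le_rsqrt)
    moreover have "sqrt (s\<^sup>2 + (e n)\<^sup>2) \<le> \<bar>s\<bar> + e n"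
      using sqrt_add_le_add_sqrt[of "s\<^sup>2" "(e n)\<^sup>2"] e[of n] by simp
    ultimately show ?thesis unfolding F_def by linarith
  qed
  have F0: "F n 0 = 0" for n using e[of n] by (simp add: F_def)
  have t: "(\<lambda>x. F n (f n x)) \<in> test_functions D" for n
    by (rule test_compose[OF f(1) sm[OF test_smooth[OF f(1)]] F0])
  note st = test_square_integrable[OF t]
  have Wn: "(l2_of (\<lambda>x. F n (f n x)), l2_of (grad (\<lambda>x. F n (f n x)))) \<in> W0 D" for n by (rule W0_test[OF t])
  have gn: "norm (l2_of (grad (\<lambda>x. F n (f n x)))) \<le> 1 * norm (l2_of (grad (f n)))" for n
  proof (rule norm_l2_of_le[OF sq(2) st(2)])
    have "norm (grad (\<lambda>x. F n (f n x)) x) \<le> 1 * norm (grad (f n) x)" for x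
      unfolding grad_compose_real[OF dF test_smooth[OF f(1)]] norm_scaleR
      by (rule mult_right_mono[OF F'1]) simp
    then show "AE x in lebesgue. norm (grad (\<lambda>x. F n (f n x)) x) \<le> 1 * norm (grad (f n) x)" by simp
  qed simp
  have Ds: "D \<in> sets lebesgue" using D(1) by simp
  have sD: "square_integrable (\<lambda>x. indicat_real D x *\<^sub>R (1::real))"
    by (rule square_integrable_const_indicator[OF Ds D(2)])
  have sabs: "square_integrable (\<lambda>x. \<bar>f n x\<bar>)" for n
    by (rule nemytskii_square_integrable[OF nemytskii_abs sq(1)])
  have 1: "norm (l2_of (\<lambda>x. F n (f n x)) - l2_abs (l2_of (f n))) \<le> e n * norm (ind D)" for n
  proof -
    have "norm (l2_of (\<lambda>x. F n (f n x) - \<bar>f n x\<bar>)) \<le> e n * norm (ind D)"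
      unfolding ind_def
    proof (rule norm_l2_of_le[OF sD square_integrable_diff[OF st(1) sabs]])
      have "norm (F n (f n x) - \<bar>f n x\<bar>) \<le> e n * norm (indicat_real D x *\<^sub>R (1::real))" for x
      proof (cases "x \<in> D")
        case True
        then show ?thesis using F_abs by simp
      next
        case False
        obtain K where "K \<subseteq> D" "\<And>x. x \<notin> K \<Longrightarrow> f n x = 0" by (rule test_functionsE[OF f(1)[of n]]) auto
        then have "f n x = 0" using False by auto
        then show ?thesis using F0 e[of n] by simp
      qed
      then show "AE x in lebesgue. norm (F n (f n x) - \<bar>f n x\<bar>) \<le> e n * norm (indicat_real D x *\<^sub>R (1::real))" by simp
    qed (use e[of n] in simp)
    then show ?thesis
      by (simp add: l2_of_diff[OF st(1) sabs] l2_abs_def lift_op_l2_of[OF nemytskii_abs sq(1)])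
  qed
  have "(\<lambda>n. l2_abs (l2_of (f n))) \<longlonglongrightarrow> l2_abs U"
    unfolding l2_abs_def by (rule lift_op_tendsto[OF nemytskii_abs f(2)])
  then have "(\<lambda>n. norm (l2_abs (l2_of (f n)) - l2_abs U)) \<longlonglongrightarrow> 0" by (simp add: LIM_zero tendsto_norm_zero)
  from tendsto_add[OF tendsto_mult_left_zero[OF e0, of "norm (ind D)"] this]
  have 2: "(\<lambda>n. e n * norm (ind D) + norm (l2_abs (l2_of (f n)) - l2_abs U)) \<longlonglongrightarrow> 0" by simp
  have "(\<lambda>n. norm (l2_of (\<lambda>x. F n (f n x)) - l2_abs U)) \<longlonglongrightarrow> 0"
  proof (rule tendsto_sandwich[OF _ _ tendsto_const 2])
    show "\<forall>\<^sub>F n in sequentially. norm (l2_of (\<lambda>x. F n (f n x)) - l2_abs U) \<le>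
      e n * norm (ind D) + norm (l2_abs (l2_of (f n)) - l2_abs U)"
      by (intro always_eventually allI norm_diff_triangle_le[OF 1 order_refl])
  qed simp
  then have 3: "(\<lambda>n. l2_of (\<lambda>x. F n (f n x))) \<longlonglongrightarrow> l2_abs U"
    by (simp only: tendsto_norm_zero_iff LIM_zero_iff)
  have 4: "(\<lambda>n. (norm (l2_of (grad (f n))))\<^sup>2) \<longlonglongrightarrow> (norm G)\<^sup>2" by (intro tendsto_intros f)
  have 5: "(norm (l2_of (grad (\<lambda>x. F n (f n x)))))\<^sup>2 \<le> (norm (l2_of (grad (f n))))\<^sup>2" for n
    using gn[of n] by (simp add: power_mono)
  obtain H where "(l2_abs U, H) \<in> W0 D" "(norm H)\<^sup>2 \<le> (norm G)\<^sup>2"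
    by (rule W0_weak_limit[OF Wn 3 5 4])
  then show thesis using that power2_le_imp_le[of "norm H" "norm G"] by simp
qed

section \<open>The logarithmic estimate and the strong maximum principle\<close>

lemma smooth_quadratic: "smooth f \<Longrightarrow> smooth (\<lambda>x. (f x)\<^sup>2 + c)"
  using smooth_add[OF smooth_mult[of f f] smooth_const] by (simp add: power2_eq_square)

text \<open>Rationalisation by (Q - s)(Q + s) = e^2. It shows that the regularised reciprocal is
  1/(Q + s), with derivative -1/(Q (Q + s)), so that the squared function is bounded by minus its
  derivative, as for 1/s.\<close>

lemma conjugate_sqrt:
  fixes s e :: real
  assumes "0 \<le> s" "0 < e"
  defines "Q \<equiv> sqrt (s\<^sup>2 + e\<^sup>2)"
  shows "0 < Q" "(Q - s) / e\<^sup>2 = 1 / (Q + s)" "(s / Q - 1) / e\<^sup>2 = - (1 / (Q * (Q + s)))" "s \<le> Q"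
proof -
  have Q2: "Q\<^sup>2 = s\<^sup>2 + e\<^sup>2" by (simp add: Q_def)
  show Q: "0 < Q" using assms by (simp add: Q_def add_nonneg_pos)
  show "s \<le> Q" by (simp add: Q_def real_le_rsqrt)
  have m: "(Q - s) * (Q + s) = e\<^sup>2" using Q2 by (simp add: algebra_simps power2_eq_square)
  have pos: "0 < Q + s" using Q assms(1) by linarith
  show 1: "(Q - s) / e\<^sup>2 = 1 / (Q + s)" using m pos assms(2) by (simp add: frac_eq_eq)
  have "s / Q - 1 = - ((Q - s) / Q)" using Q by (simp add: diff_divide_distrib)
  then have "(s / Q - 1) / e\<^sup>2 = - ((Q - s) / e\<^sup>2 / Q)" by (simp add: mult.commute)
  then show "(s / Q - 1) / e\<^sup>2 = - (1 / (Q * (Q + s)))" unfolding 1 by (simp add: mult.commute)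
qed

text \<open>The test function is \<open>\<psi>\<^sup>2 F(u)\<close> with \<open>F(s) = (sqrt (s\<^sup>2 + e\<^sup>2) - s) / e\<^sup>2\<close>, a smooth substitute for
  \<open>1 / (s + e)\<close> that is defined for negative \<open>s\<close> too: approximating test functions need not be
  nonnegative.\<close>

lemma eigenfunction_log_estimate:
  fixes D :: "'a::euclidean_space set"
  assumes W: "(U, G) \<in> W0 D" and D: "open D" and nonneg: "AE x in lebesgue. 0 \<le> rep_l2 U x"
    and \<mu>: "0 \<le> \<mu>" and eig: "\<And>V H. (V, H) \<in> W0 D \<Longrightarrow> G \<bullet> H = \<mu> * (U \<bullet> V)"
    and \<psi>: "\<psi> \<in> test_functions D" and e: "0 < e"
  shows "(LINT x|lebesgue. (\<psi> x)\<^sup>2 * (norm (rep_l2 G x))\<^sup>2 / ((rep_l2 U x)\<^sup>2 + e\<^sup>2)) \<le> 8 * (norm (l2_of (grad \<psi>)))\<^sup>2"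
proof -
  \<comment> \<open>The chain rule asks for a function vanishing at zero, hence \<open>Fz\<close>;
    the constant \<open>F 0\<close> is restored below as a multiple of the test function
    \<open>q\<close>, the square of \<psi>.\<close>
  define Q F F' Fz where "Q s = sqrt (s\<^sup>2 + e\<^sup>2)" and "F s = (Q s - s) / e\<^sup>2"
    and "F' s = (s / Q s - 1) / e\<^sup>2" and "Fz s = F s - F 0" for s
  have Qpos: "0 < s\<^sup>2 + e\<^sup>2" "0 < Q s" for s using e by (simp_all add: Q_def add_nonneg_pos)
  have dF: "(Fz has_real_derivative F' s) (at s)" for s
    unfolding Fz_def F_def F'_def Q_def using Qpos(1)[of s] e
    by (auto intro!: derivative_eq_intros simp: field_simps)
  have F'c: "continuous_on UNIV F'"
    unfolding F'_def Q_def using Qpos(1) e by (intro continuous_intros) (auto simp: less_imp_neq[symmetric])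
  have F'b: "\<bar>F' s\<bar> \<le> 2 / e\<^sup>2" for s
  proof -
    have "\<bar>s\<bar> \<le> Q s" unfolding Q_def by (simp add: real_le_rsqrt)
    then have "\<bar>s / Q s\<bar> \<le> 1" using Qpos(2)[of s] by (simp add: divide_le_eq)
    then have "\<bar>s / Q s - 1\<bar> \<le> 2" by linarith
    then show ?thesis unfolding F'_def by (simp add: divide_right_mono)
  qed
  have sm: "smooth (\<lambda>x. Fz (f x))" if "smooth f" for f :: "'a \<Rightarrow> real"
  proof -
    have "smooth (\<lambda>x. sqrt ((f x)\<^sup>2 + e\<^sup>2))" using Qpos(1) by (intro smooth_sqrt smooth_quadratic that)
    then have "smooth (\<lambda>x. (1 / e\<^sup>2) * (sqrt ((f x)\<^sup>2 + e\<^sup>2) - f x) - F 0)"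
      by (intro smooth_diff smooth_mult smooth_const that)
    then show ?thesis by (simp add: Fz_def F_def Q_def)
  qed
  define u g where "u = rep_l2 U" and "g = rep_l2 G"
  have z: "Fz 0 = 0" by (simp add: Fz_def)
  have smF: "\<forall>f :: 'a \<Rightarrow> real. smooth f \<longrightarrow> smooth (\<lambda>x. Fz (f x))" using sm by blast
  note ch = W0_chain[OF W dF F'c F'b z smF, folded u_def g_def]
  note ch1 = ch(1) and ch2 = ch(2) and ch3 = ch(3)
  have su: "square_integrable u" "square_integrable g" by (simp_all add: u_def g_def square_integrable_rep)
  have sFz: "square_integrable (\<lambda>x. Fz (u x))" by (rule nemytskii_square_integrable[OF ch3 su(1)])
  have lFz: "lift_op (\<lambda>x. Fz) U = l2_of (\<lambda>x. Fz (u x))" by (simp add: lift_op_def u_def)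
  define q where "q x = \<psi> x * \<psi> x" for x
  have q: "q \<in> test_functions D" unfolding q_def by (rule test_mult[OF \<psi> test_smooth[OF \<psi>]])
  have gq: "grad q x = (2 * \<psi> x) *\<^sub>R grad \<psi> x" for x
    unfolding q_def by (simp add: grad_mult[OF test_smooth[OF \<psi>] test_smooth[OF \<psi>]] flip: scaleR_add_left)
  obtain B where B: "\<And>x. \<bar>q x\<bar> \<le> B" "\<And>x. norm (grad q x) \<le> B" by (rule test_bounded[OF q]) auto
  note sq = test_square_integrable[OF q]
  note n1 = nemytskii_mult[OF square_integrable_measurable[OF sq(1)] B(1)]
  note n2 = nemytskii_vec[OF square_integrable_measurable[OF sq(2)] B(2)]
  note s1 = nemytskii_square_integrable[OF n1 sFz] and s2 = nemytskii_square_integrable[OF n1 ch2]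
    and s3 = nemytskii_square_integrable[OF n2 sFz]
  have m: "(l2_of (\<lambda>x. q x *\<^sub>R Fz (u x)), l2_of (\<lambda>x. q x *\<^sub>R F' (u x) *\<^sub>R g x) + l2_of (\<lambda>x. Fz (u x) *\<^sub>R grad q x)) \<in> W0 D"
    using W0_mult_test[OF ch1 q] lift_op_l2_of[OF n1 ch2] unfolding lFz lift_op_l2_of[OF n1 sFz] lift_op_l2_of[OF n1 ch2] lift_op_l2_of[OF n2 sFz]
    by simp
  have sc: "square_integrable (\<lambda>x. F 0 *\<^sub>R q x)" "square_integrable (\<lambda>x. F 0 *\<^sub>R grad q x)"
    by (intro square_integrable_scaleR sq)+
  define v h where "v x = q x *\<^sub>R Fz (u x) + F 0 *\<^sub>R q x"
    and "h x = (q x *\<^sub>R F' (u x) *\<^sub>R g x + Fz (u x) *\<^sub>R grad q x) + F 0 *\<^sub>R grad q x" for x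
  have sv: "square_integrable v" unfolding v_def by (rule square_integrable_add[OF s1 sc(1)])
  have sh: "square_integrable h"
    unfolding h_def by (intro square_integrable_add s2 s3 sc(2))
  have "(l2_of v, l2_of h) \<in> W0 D"
    using W0_add[OF m W0_scaleR[OF W0_test[OF q], of "F 0"]]
      l2_of_add[OF s1 sc(1)] l2_of_add[OF square_integrable_add[OF s2 s3] sc(2)]
      l2_of_add[OF s2 s3] l2_of_scaleR[OF sq(1), of "F 0"] l2_of_scaleR[OF sq(2), of "F 0"]
    by (simp only: v_def[abs_def] h_def[abs_def])
  from eig[OF this] have "(LINT x|lebesgue. g x \<bullet> h x) = \<mu> * (LINT x|lebesgue. u x \<bullet> v x)"
    using inner_l2_of[OF su(2) sh] inner_l2_of[OF su(1) sv] by (simp add: u_def g_def)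
  \<comment> \<open>The test element \<open>v\<close> equals \<psi>^2 F(u), which is nonnegative
    where u is; so the right-hand side of the eigenvalue equation has a sign and is
    discarded.\<close>
  moreover have "0 \<le> (LINT x|lebesgue. u x \<bullet> v x)"
  proof (rule integral_nonneg_AE)
    show "AE x in lebesgue. 0 \<le> u x \<bullet> v x"
      using nonneg
    proof eventually_elim
      case (elim x)
      have "v x = (\<psi> x)\<^sup>2 * F (u x)" by (simp add: v_def q_def Fz_def power2_eq_square algebra_simps)
      moreover have "0 \<le> F (u x)" using conjugate_sqrt(4)[OF elim e] e by (simp add: F_def Q_def u_def)
      ultimately show ?case using elim by (simp add: u_def)
    qed
  qed
  ultimately have 0: "0 \<le> (LINT x|lebesgue. g x \<bullet> h x)" using \<mu> by simp
  have sgp: "square_integrable (grad \<psi>)" by (rule test_square_integrable(2)[OF \<psi>])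
  have ig: "integrable lebesgue (\<lambda>x. (norm (grad \<psi> x))\<^sup>2)" using sgp by (simp add: square_integrable_def)
  have iT: "integrable lebesgue (\<lambda>x. (\<psi> x)\<^sup>2 * (norm (g x))\<^sup>2 / ((u x)\<^sup>2 + e\<^sup>2))"
  proof (rule Bochner_Integration.integrable_bound)
    show "integrable lebesgue (\<lambda>x. B / e\<^sup>2 * (norm (g x))\<^sup>2)"
      using su(2) by (simp add: square_integrable_def)
    show "(\<lambda>x. (\<psi> x)\<^sup>2 * (norm (g x))\<^sup>2 / ((u x)\<^sup>2 + e\<^sup>2)) \<in> borel_measurable lebesgue"
      using square_integrable_measurable[OF su(1)] square_integrable_measurable[OF su(2)]
        square_integrable_measurable[OF test_square_integrable(1)[OF \<psi>]] by measurable
    show "AE x in lebesgue. norm ((\<psi> x)\<^sup>2 * (norm (g x))\<^sup>2 / ((u x)\<^sup>2 + e\<^sup>2)) \<le> norm (B / e\<^sup>2 * (norm (g x))\<^sup>2)"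
    proof (rule AE_I2)
      fix x
      have "(\<psi> x)\<^sup>2 \<le> B" using B(1)[of x] by (simp add: q_def power2_eq_square)
      then have "(\<psi> x)\<^sup>2 * (norm (g x))\<^sup>2 / ((u x)\<^sup>2 + e\<^sup>2) \<le> B * (norm (g x))\<^sup>2 / e\<^sup>2"
        using e B(1)[of x] by (intro frac_le mult_right_mono) auto
      moreover have "0 \<le> B" using B(1)[of x] by linarith
      ultimately show "norm ((\<psi> x)\<^sup>2 * (norm (g x))\<^sup>2 / ((u x)\<^sup>2 + e\<^sup>2)) \<le> norm (B / e\<^sup>2 * (norm (g x))\<^sup>2)"
        by simp
    qed
  qed
  \<comment> \<open>A pointwise bound. The term with \<open>F'\<close> is negative; half of it
    absorbs the mixed term by Young's inequality, and the other half is at least a quarter of the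
    target because Q (Q + u) <= 2 (u^2 + e^2). Hence 0 <= 2 A - B/4 for the two integrals, which is
    the constant 8.\<close>
  have "(LINT x|lebesgue. g x \<bullet> h x) \<le> (LINT x|lebesgue. 2 * (norm (grad \<psi> x))\<^sup>2 - (1/4) * ((\<psi> x)\<^sup>2 * (norm (g x))\<^sup>2 / ((u x)\<^sup>2 + e\<^sup>2)))"
  proof (rule integral_mono_AE[OF square_integrable_inner[OF su(2) sh]])
    show "integrable lebesgue (\<lambda>x. 2 * (norm (grad \<psi> x))\<^sup>2 - (1/4) * ((\<psi> x)\<^sup>2 * (norm (g x))\<^sup>2 / ((u x)\<^sup>2 + e\<^sup>2)))"
      by (intro Bochner_Integration.integrable_diff integrable_mult_right ig iT)
    show "AE x in lebesgue. g x \<bullet> h x \<le> 2 * (norm (grad \<psi> x))\<^sup>2 - (1/4) * ((\<psi> x)\<^sup>2 * (norm (g x))\<^sup>2 / ((u x)\<^sup>2 + e\<^sup>2))"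
      using nonneg
    proof eventually_elim
      case (elim x)
      note cs = conjugate_sqrt[OF elim e, folded Q_def u_def]
      define t p where "t = 1 / (Q (u x) + u x)" and "p = 1 / (Q (u x) * (Q (u x) + u x))"
      have ux: "0 \<le> u x" using elim by (simp add: u_def)
      have t: "F (u x) = t" using cs(2) by (simp add: F_def t_def)
      have p: "F' (u x) = - p" using cs(3) by (simp add: F'_def p_def)
      have tp: "t\<^sup>2 \<le> p"
      proof -
        have "t\<^sup>2 = 1 / ((Q (u x) + u x) * (Q (u x) + u x))" by (simp add: t_def power2_eq_square)
        also have "\<dots> \<le> p"
          unfolding p_def using cs(1) ux by (intro divide_left_mono mult_right_mono mult_pos_pos) auto
        finally show ?thesis .
      qed
      have pq: "1 / (2 * ((u x)\<^sup>2 + e\<^sup>2)) \<le> p"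
      proof -
        have "Q (u x) * (Q (u x) + u x) \<le> Q (u x) * (2 * Q (u x))"
          using cs(1,4) by (intro mult_left_mono) auto
        also have "\<dots> = 2 * (Q (u x))\<^sup>2" by (simp add: power2_eq_square)
        also have "\<dots> = 2 * ((u x)\<^sup>2 + e\<^sup>2)" by (simp add: Q_def)
        finally show ?thesis unfolding p_def using cs(1) ux Qpos(1)[of "u x"]
          by (intro divide_left_mono mult_pos_pos) auto
      qed
      define w where "w = (t * \<psi> x) *\<^sub>R g x"
      have "h x = (\<psi> x)\<^sup>2 *\<^sub>R F' (u x) *\<^sub>R g x + F (u x) *\<^sub>R grad q x"
        by (simp add: h_def q_def Fz_def power2_eq_square algebra_simps)
      then have "g x \<bullet> h x = (\<psi> x)\<^sup>2 * F' (u x) * (g x \<bullet> g x) + F (u x) * (g x \<bullet> grad q x)"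
        by (simp add: inner_add_right)
      then have "g x \<bullet> h x = 2 * (w \<bullet> grad \<psi> x) - (\<psi> x)\<^sup>2 * p * (norm (g x))\<^sup>2"
        by (simp add: t p gq w_def power2_norm_eq_inner)
      moreover have "2 * (w \<bullet> grad \<psi> x) \<le> (1/2) * (norm w)\<^sup>2 + 2 * (norm (grad \<psi> x))\<^sup>2"
      proof -
        have "0 \<le> (norm (w - 2 *\<^sub>R grad \<psi> x))\<^sup>2" by simp
        also have "\<dots> = (norm w)\<^sup>2 - 4 * (w \<bullet> grad \<psi> x) + 4 * (norm (grad \<psi> x))\<^sup>2"
          by (simp add: power2_norm_eq_inner inner_diff_left inner_diff_right inner_commute)
        finally show ?thesis by argo
      qed
      moreover have "(norm w)\<^sup>2 \<le> (\<psi> x)\<^sup>2 * p * (norm (g x))\<^sup>2"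
      proof -
        have "(norm w)\<^sup>2 = t\<^sup>2 * ((\<psi> x)\<^sup>2 * (norm (g x))\<^sup>2)" by (simp add: w_def power_mult_distrib)
        also have "\<dots> \<le> p * ((\<psi> x)\<^sup>2 * (norm (g x))\<^sup>2)" by (intro mult_right_mono tp) simp
        finally show ?thesis by (simp add: ac_simps)
      qed
      moreover have "(1/2) * ((\<psi> x)\<^sup>2 * (norm (g x))\<^sup>2 / ((u x)\<^sup>2 + e\<^sup>2)) \<le> (\<psi> x)\<^sup>2 * p * (norm (g x))\<^sup>2"
        using mult_left_mono[OF pq, of "(\<psi> x)\<^sup>2 * (norm (g x))\<^sup>2"] by (simp add: ac_simps)
      ultimately show ?case by argo
    qed
  qed
  also have "\<dots> = 2 * (norm (l2_of (grad \<psi>)))\<^sup>2 - (1/4) * (LINT x|lebesgue. (\<psi> x)\<^sup>2 * (norm (g x))\<^sup>2 / ((u x)\<^sup>2 + e\<^sup>2))"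
    unfolding norm_l2_of_sq[OF sgp]
    by (subst Bochner_Integration.integral_diff[OF integrable_mult_right[OF ig] integrable_mult_right[OF iT]])
      (simp only: integral_mult_right_zero)
  finally show ?thesis using 0 unfolding u_def g_def by argo
qed

text \<open>arsinh(u/e) is a primitive of 1/sqrt(s^2 + e^2), so the logarithmic estimate bounds its
  gradient on \<open>K\<close> independently of e. It vanishes on a subset of \<open>K\<close> of
  positive measure, so the Poincare inequality bounds its L2 norm on \<open>K\<close> independently
  of e as well. But on the set where u >= \<delta> > 0 it becomes arbitrarily large as e tends to 0,
  so that set must be null.\<close>

lemma eigenfunction_local_dichotomy:
  fixes D :: "'a::euclidean_space set"
  assumes W: "(U, G) \<in> W0 D" and D: "open D" and nonneg: "AE x in lebesgue. 0 \<le> rep_l2 U x"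
    and \<mu>: "0 \<le> \<mu>" and eig: "\<And>V H. (V, H) \<in> W0 D \<Longrightarrow> G \<bullet> H = \<mu> * (U \<bullet> V)"
    and K: "compact K" "convex K" "K \<subseteq> D"
    and Z: "{x \<in> K. rep_l2 U x = 0} \<notin> null_sets lebesgue"
  shows "AE x in lebesgue. x \<in> K \<longrightarrow> rep_l2 U x = 0"
proof -
  define u g where "u = rep_l2 U" and "g = rep_l2 G"
  have um [measurable]: "u \<in> borel_measurable lebesgue" by (simp add: u_def)
  have Km: "K \<in> lmeasurable" using K(1) by (rule lmeasurable_compact)
  then have Ks [measurable]: "K \<in> sets lebesgue" by blast
  define Z where "Z = {x \<in> K. u x = 0}"
  have Zs: "Z \<in> sets lebesgue"
  proof -
    have "{x \<in> space lebesgue. u x = 0} \<inter> K \<in> sets lebesgue" by measurable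
    then show ?thesis by (simp add: Z_def Int_def conj_commute)
  qed
  have Zm: "Z \<in> lmeasurable" using fmeasurableI2[OF Km _ Zs] by (auto simp: Z_def)
  have Zpos: "0 < measure lebesgue Z"
  proof -
    have "emeasure lebesgue Z \<noteq> 0" using Z Zs by (auto simp only: Z_def u_def null_sets_def)
    then have "measure lebesgue Z \<noteq> 0" using emeasure_eq_measure2[OF Zm] by auto
    then show ?thesis by (simp add: zero_less_measure_iff)
  qed
  obtain \<psi> where \<psi>: "\<psi> \<in> test_functions D" "\<And>x. x \<in> K \<Longrightarrow> \<psi> x = 1"
    by (rule cutoff_exists[OF K(1) D K(3)]) auto
  obtain d where d: "\<And>x y. x \<in> K \<Longrightarrow> y \<in> K \<Longrightarrow> norm (x - y) \<le> d"
    using diameter_bounded_bound[OF compact_imp_bounded[OF K(1)]] by (metis dist_norm)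
  define C where "C = 2 ^ DIM('a) * d\<^sup>2 * measure lebesgue K * (8 * (norm (l2_of (grad \<psi>)))\<^sup>2)"
  have key: "measure lebesgue Z * (LINT x|lebesgue. indicat_real K x * (arsinh (u x / e))\<^sup>2) \<le> C
     \<and> integrable lebesgue (\<lambda>x. indicat_real K x * (arsinh (u x / e))\<^sup>2)" if e: "0 < e" for e
  proof -
    \<comment> \<open>A smooth substitute for log(1 + s/e), defined for negative arguments too and
      vanishing at zero, as the chain rule requires.\<close>
    define L L' where "L s = arsinh (s / e)" and "L' s = inverse (sqrt (s\<^sup>2 + e\<^sup>2))" for s
    have pos: "0 < s\<^sup>2 + e\<^sup>2" for s using e by (simp add: add_nonneg_pos)
    have dL: "(L has_real_derivative L' s) (at s)" for s
    proof -
      have "sqrt ((s / e)\<^sup>2 + 1) = sqrt (s\<^sup>2 + e\<^sup>2) / e"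
      proof -
        have "(s / e)\<^sup>2 + 1 = (s\<^sup>2 + e\<^sup>2) / e\<^sup>2" using e by (simp add: power_divide add_divide_distrib)
        then show ?thesis using e by (simp add: real_sqrt_divide)
      qed
      then have "1 / sqrt ((s / e)\<^sup>2 + 1) * (1 / e) = L' s" using e by (simp add: L'_def divide_inverse)
      moreover have "((\<lambda>s. arsinh (s / e)) has_real_derivative 1 / sqrt ((s / e)\<^sup>2 + 1) * (1 / e)) (at s)"
        by (rule DERIV_chain2[OF arsinh_real_has_field_derivative]) (use e in \<open>auto intro!: derivative_eq_intros\<close>)
      ultimately show ?thesis unfolding L_def[abs_def] by simp
    qed
    have L'c: "continuous_on UNIV L'"
      unfolding L'_def using pos by (intro continuous_intros) (auto simp: less_imp_neq[symmetric])
    have L'b: "\<bar>L' s\<bar> \<le> inverse e" for s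
    proof -
      have "e \<le> sqrt (s\<^sup>2 + e\<^sup>2)" by (simp add: real_le_rsqrt)
      then show ?thesis unfolding L'_def using e by (simp add: le_imp_inverse_le)
    qed
    have sm: "smooth (\<lambda>x. L (f x))" if "smooth f" for f :: "'a \<Rightarrow> real"
    proof (rule smooth_compose_real[OF dL that])
      show "smooth (\<lambda>x. L' (f x))"
        unfolding L'_def using pos
        by (intro smooth_inverse smooth_sqrt smooth_quadratic that) (auto simp: less_imp_neq[symmetric])
    qed
    have L0: "L 0 = 0" by (simp add: L_def)
    have smL: "\<forall>f :: 'a \<Rightarrow> real. smooth f \<longrightarrow> smooth (\<lambda>x. L (f x))" using sm by blast
    note ch = W0_chain[OF W dL L'c L'b L0 smL, folded u_def g_def]
    have lU: "lift_op (\<lambda>x. L) U = l2_of (\<lambda>x. L (u x))" by (simp add: lift_op_def u_def)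
    have sL: "square_integrable (\<lambda>x. L (u x))"
      using nemytskii_square_integrable[OF ch(3) square_integrable_rep[of U]] by (simp add: u_def)
    note nK = nemytskii_indicator[OF Ks]
    define A where "A = restr K (l2_of (\<lambda>x. L (u x)))"
    have A: "A = l2_of (\<lambda>x. indicat_real K x *\<^sub>R L (u x))"
      unfolding A_def restr_def by (rule lift_op_l2_of[OF nK sL])
    note sA = nemytskii_square_integrable[OF nK sL]
    have nA: "(norm A)\<^sup>2 = (LINT x|lebesgue. indicat_real K x * (L (u x))\<^sup>2)"
      unfolding A norm_l2_of_sq[OF sA]
      by (intro Bochner_Integration.integral_cong refl) (simp add: indicator_def)
    have iA: "integrable lebesgue (\<lambda>x. indicat_real K x * (L (u x))\<^sup>2)"
    proof -
      have "(\<lambda>x. (norm (indicat_real K x *\<^sub>R L (u x)))\<^sup>2) = (\<lambda>x. indicat_real K x * (L (u x))\<^sup>2)"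
        by (auto simp: indicator_def)
      then show ?thesis using sA by (simp add: square_integrable_def)
    qed
    have "(norm (restr K (l2_of (\<lambda>x. L' (u x) *\<^sub>R g x))))\<^sup>2 \<le> 8 * (norm (l2_of (grad \<psi>)))\<^sup>2"
    proof -
      note sG = nemytskii_square_integrable[OF nK ch(2)]
      have "(norm (restr K (l2_of (\<lambda>x. L' (u x) *\<^sub>R g x))))\<^sup>2 =
         (LINT x|lebesgue. (norm (indicat_real K x *\<^sub>R L' (u x) *\<^sub>R g x))\<^sup>2)"
        using norm_l2_of_sq[OF sG] lift_op_l2_of[OF nK ch(2)] by (simp only: restr_def)
      also have "\<dots> \<le> (LINT x|lebesgue. (\<psi> x)\<^sup>2 * (norm (g x))\<^sup>2 / ((u x)\<^sup>2 + e\<^sup>2))"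
      proof (rule integral_mono)
        show "integrable lebesgue (\<lambda>x. (norm (indicat_real K x *\<^sub>R L' (u x) *\<^sub>R g x))\<^sup>2)"
          using sG by (simp add: square_integrable_def)
        obtain B where B: "\<And>x. \<bar>\<psi> x\<bar> \<le> B" by (rule test_bounded[OF \<psi>(1)]) auto
        note n1 = nemytskii_mult[OF square_integrable_measurable[OF test_square_integrable(1)[OF \<psi>(1)]] B]
        have "(\<lambda>x. (\<psi> x)\<^sup>2 * (norm (g x))\<^sup>2 / ((u x)\<^sup>2 + e\<^sup>2)) = (\<lambda>x. (norm (\<psi> x *\<^sub>R L' (u x) *\<^sub>R g x))\<^sup>2)"
          using pos by (simp add: L'_def power_mult_distrib power_inverse divide_inverse fun_eq_iff ac_simps less_imp_le)
        then show "integrable lebesgue (\<lambda>x. (\<psi> x)\<^sup>2 * (norm (g x))\<^sup>2 / ((u x)\<^sup>2 + e\<^sup>2))"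
          using nemytskii_square_integrable[OF n1 ch(2)] by (simp add: square_integrable_def)
        fix x
        show "(norm (indicat_real K x *\<^sub>R L' (u x) *\<^sub>R g x))\<^sup>2 \<le> (\<psi> x)\<^sup>2 * (norm (g x))\<^sup>2 / ((u x)\<^sup>2 + e\<^sup>2)"
          using pos[of "u x"] \<psi>(2)[of x]
          by (cases "x \<in> K") (simp_all add: L'_def power_mult_distrib power_inverse divide_inverse less_imp_le)
      qed
      also have "\<dots> \<le> 8 * (norm (l2_of (grad \<psi>)))\<^sup>2"
        unfolding u_def g_def by (rule eigenfunction_log_estimate[OF W D nonneg \<mu> eig \<psi>(1) e])
      finally show ?thesis .
    qed
    then have "2 ^ DIM('a) * d\<^sup>2 * measure lebesgue K * (norm (restr K (l2_of (\<lambda>x. L' (u x) *\<^sub>R g x))))\<^sup>2 \<le> C"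
      unfolding C_def by (intro mult_left_mono) auto
    with W0_Poincare[OF ch(1) K(1,2) d]
    have 1: "measure lebesgue K * (norm A)\<^sup>2 - (l2_of (\<lambda>x. L (u x)) \<bullet> ind K)\<^sup>2 \<le> C"
      by (simp add: lU A_def)
    have KZ: "K - Z \<in> sets lebesgue" "bounded (K - Z)"
      using Zs compact_imp_bounded[OF K(1)] by (auto intro: bounded_subset)
    note sKZ = square_integrable_const_indicator[OF KZ, of "1::real"]
      and sK = square_integrable_const_indicator[OF Ks compact_imp_bounded[OF K(1)], of "1::real"]
    \<comment> \<open>The zero set \<open>Z\<close> does not contribute to the mean, so
      Cauchy-Schwarz costs only |K| - |Z| instead of |K|. Inserted into the Poincare inequality this
      leaves |Z| times the squared norm on the left.\<close>
    have "l2_of (\<lambda>x. L (u x)) \<bullet> ind K = A \<bullet> ind (K - Z)"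
      unfolding A ind_def inner_l2_of[OF sL sK] inner_l2_of[OF sA sKZ]
      by (intro Bochner_Integration.integral_cong refl) (auto simp: indicator_def Z_def L0)
    also have "\<dots>\<^sup>2 \<le> (norm A)\<^sup>2 * (norm (ind (K - Z)))\<^sup>2"
      using Cauchy_Schwarz_ineq2[of A "ind (K - Z)"] by (metis abs_ge_zero power2_abs power_mono power_mult_distrib)
    also have "(norm (ind (K - Z)))\<^sup>2 = measure lebesgue K - measure lebesgue Z"
    proof -
      have "(norm (ind (K - Z)))\<^sup>2 = (LINT x|lebesgue. indicat_real (K - Z) x)"
        unfolding ind_def norm_l2_of_sq[OF sKZ]
        by (intro Bochner_Integration.integral_cong refl) (simp add: indicator_def)
      also have "\<dots> = measure lebesgue (K - Z)" by simp
      also have "\<dots> = measure lebesgue K - measure lebesgue Z"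
        using Km Zm by (intro measurable_measure_Diff) (auto simp: Z_def)
      finally show ?thesis .
    qed
    finally have "(l2_of (\<lambda>x. L (u x)) \<bullet> ind K)\<^sup>2 \<le> (norm A)\<^sup>2 * (measure lebesgue K - measure lebesgue Z)" .
    with 1 have "measure lebesgue Z * (norm A)\<^sup>2 \<le> C" by (simp add: algebra_simps)
    then show ?thesis using iA by (simp add: nA L_def)
  qed
  have null: "measure lebesgue {x \<in> K. \<delta> \<le> u x} = 0" if \<delta>: "0 < \<delta>" for \<delta>
  proof -
    define S where "S = {x \<in> K. \<delta> \<le> u x}"
    have "{x \<in> space lebesgue. \<delta> \<le> u x} \<inter> K \<in> sets lebesgue" by measurable
    then have Ss: "S \<in> sets lebesgue" by (simp add: S_def Int_def conj_commute)
    have Sm: "S \<in> lmeasurable" using fmeasurableI2[OF Km _ Ss] by (auto simp: S_def)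
    have bd: "measure lebesgue Z * (measure lebesgue S * (real n)\<^sup>2) \<le> C" if n: "0 < n" for n :: nat
    proof -
      \<comment> \<open>Chosen such that u >= \<delta> means arsinh(u/e) >= n; the uniform bound
        then reads |Z| |S| n^2 <= C for every n.\<close>
      define e where "e = \<delta> / sinh (real n)"
      have e: "0 < e" using \<delta> n by (simp add: e_def)
      have "measure lebesgue S * (real n)\<^sup>2 = (LINT x|lebesgue. indicat_real S x * (real n)\<^sup>2)" by simp
      also have "\<dots> \<le> (LINT x|lebesgue. indicat_real K x * (arsinh (u x / e))\<^sup>2)"
      proof (rule integral_mono)
        show "integrable lebesgue (\<lambda>x. indicat_real S x * (real n)\<^sup>2)"
          using Sm by (intro integrable_mult_left integrable_real_indicator) (auto simp: fmeasurable_def)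
        show "integrable lebesgue (\<lambda>x. indicat_real K x * (arsinh (u x / e))\<^sup>2)" using key[OF e] by blast
        fix x
        show "indicat_real S x * (real n)\<^sup>2 \<le> indicat_real K x * (arsinh (u x / e))\<^sup>2"
        proof (cases "x \<in> S")
          case True
          then have "sinh (real n) \<le> u x / e" using \<delta> n by (simp add: S_def e_def field_simps)
          then have "real n \<le> arsinh (u x / e)"
            using sinh_real_le_iff[of "real n" "arsinh (u x / e)"] by (simp add: sinh_arsinh_real)
          then have "(real n)\<^sup>2 \<le> (arsinh (u x / e))\<^sup>2" by (simp add: power_mono)
          then show ?thesis using True by (simp add: S_def)
        qed simp
      qed
      finally have "measure lebesgue Z * (measure lebesgue S * (real n)\<^sup>2) \<le>
        measure lebesgue Z * (LINT x|lebesgue. indicat_real K x * (arsinh (u x / e))\<^sup>2)"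
        using Zpos by (intro mult_left_mono) auto
      then show ?thesis using key[OF e] by linarith
    qed
    show ?thesis
    proof (rule ccontr)
      assume "measure lebesgue {x \<in> K. \<delta> \<le> u x} \<noteq> 0"
      then have "0 < measure lebesgue Z * measure lebesgue S" using Zpos by (simp add: S_def zero_less_measure_iff)
      then obtain n :: nat where n: "C < real n * (measure lebesgue Z * measure lebesgue S)"
        using reals_Archimedean3 by blast
      define k where "k = Suc n"
      have "real n \<le> (real k)\<^sup>2" unfolding k_def power2_eq_square
        by (simp add: algebra_simps)
      then have "real n * (measure lebesgue Z * measure lebesgue S) \<le> (real k)\<^sup>2 * (measure lebesgue Z * measure lebesgue S)"
        by (rule mult_right_mono) simp
      with n bd[of k] show False by (simp add: k_def ac_simps)
    qed
  qed
  have "AE x in lebesgue. \<forall>n::nat. x \<notin> {x \<in> K. 1 / real (Suc n) \<le> u x}"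
    unfolding AE_all_countable
  proof
    fix n
    have "{x \<in> space lebesgue. 1 / real (Suc n) \<le> u x} \<inter> K \<in> sets lebesgue" by measurable
    then have Ss: "{x \<in> K. 1 / real (Suc n) \<le> u x} \<in> sets lebesgue" by (simp add: Int_def conj_commute)
    have "{x \<in> K. 1 / real (Suc n) \<le> u x} \<in> lmeasurable" by (rule fmeasurableI2[OF Km _ Ss]) auto
    then have "{x \<in> K. 1 / real (Suc n) \<le> u x} \<in> null_sets lebesgue"
      using null[of "1 / real (Suc n)"] Ss by (intro null_setsI) (simp_all add: emeasure_eq_measure2)
    then show "AE x in lebesgue. x \<notin> {x \<in> K. 1 / real (Suc n) \<le> u x}" by (rule AE_not_in)
  qed
  with nonneg show ?thesis
  proof eventually_elim
    case (elim x)
    show ?case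
    proof (intro impI, rule ccontr)
      assume "x \<in> K" "rep_l2 U x \<noteq> 0"
      then have "0 < u x" using elim(1) by (simp add: u_def)
      then obtain n where "1 / real (Suc n) < u x" using nat_approx_posE by blast
      then show False using elim(2) \<open>x \<in> K\<close> by (auto dest: spec[of _ n])
    qed
  qed
qed

text \<open>The local exceptional sets belong to uncountably many neighbourhoods; Lindelof's theorem
  selects countably many of these that still cover \<open>D\<close>.\<close>

lemma AE_on_open_local:
  fixes D :: "'a::euclidean_space set"
  assumes "\<And>x. x \<in> D \<Longrightarrow> \<exists>S. open S \<and> x \<in> S \<and> (AE y in lebesgue. y \<in> S \<longrightarrow> P y)"
  shows "AE y in lebesgue. y \<in> D \<longrightarrow> P y"
proof -
  define \<F> where "\<F> = {S. open S \<and> (AE y in lebesgue. y \<in> S \<longrightarrow> P y)}"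
  obtain \<G> where \<G>: "\<G> \<subseteq> \<F>" "countable \<G>" "\<Union>\<G> = \<Union>\<F>"
    using Lindelof[of \<F>] by (auto simp: \<F>_def)
  have ae: "AE y in lebesgue. \<forall>S\<in>\<G>. y \<in> S \<longrightarrow> P y"
    using \<G> by (subst AE_ball_countable) (auto simp: \<F>_def)
  have "D \<subseteq> \<Union>\<F>" using assms by (force simp: \<F>_def)
  then have D: "D \<subseteq> \<Union>\<G>" using \<G>(3) by simp
  from ae show ?thesis by eventually_elim (use D in blast)
qed

text \<open>Applied to small closed balls, the dichotomy shows that near each point u is either zero
  almost everywhere or positive almost everywhere. The two kinds of points form disjoint open sets
  covering \<open>D\<close>, and connectedness leaves one of them.\<close>

lemma strong_maximum_principle:
  fixes D :: "'a::euclidean_space set"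
  assumes W: "(U, G) \<in> W0 D" and D: "open D" "connected D" and nonneg: "AE x in lebesgue. 0 \<le> rep_l2 U x"
    and \<mu>: "0 \<le> \<mu>" and eig: "\<And>V H. (V, H) \<in> W0 D \<Longrightarrow> G \<bullet> H = \<mu> * (U \<bullet> V)"
  shows "U = 0 \<or> (AE x in lebesgue. x \<in> D \<longrightarrow> 0 < rep_l2 U x)"
proof -
  define A where "A = {x \<in> D. \<exists>S. open S \<and> x \<in> S \<and> (AE y in lebesgue. y \<in> S \<longrightarrow> rep_l2 U y = 0)}"
  define B where "B = {x \<in> D. \<exists>S. open S \<and> x \<in> S \<and> (AE y in lebesgue. y \<in> S \<longrightarrow> 0 < rep_l2 U y)}"
  have "open A" "open B"
    unfolding A_def B_def open_subopen[of "{x \<in> D. _ x}"] using D(1)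
    by (safe; rename_tac x S; rule_tac x = "D \<inter> S" in exI; blast)+
  moreover have "D \<subseteq> A \<union> B"
  proof
    fix x assume x: "x \<in> D"
    then obtain r where r: "0 < r" "cball x r \<subseteq> D" using D(1) open_contains_cball by blast
    show "x \<in> A \<union> B"
    proof (cases "{y \<in> cball x r. rep_l2 U y = 0} \<in> null_sets lebesgue")
      case True
      from AE_not_in[OF True] nonneg have "AE y in lebesgue. y \<in> ball x r \<longrightarrow> 0 < rep_l2 U y"
        by eventually_elim (auto simp: less_le)
      then show ?thesis using x r(1) by (auto simp: B_def intro!: exI[of _ "ball x r"])
    next
      case False
      have "AE y in lebesgue. y \<in> cball x r \<longrightarrow> rep_l2 U y = 0"
        by (rule eigenfunction_local_dichotomy[OF W D(1) nonneg \<mu> eig compact_cball convex_cball r(2) False])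
      then have "AE y in lebesgue. y \<in> ball x r \<longrightarrow> rep_l2 U y = 0" by eventually_elim auto
      then show ?thesis using x r(1) by (auto simp: A_def intro!: exI[of _ "ball x r"])
    qed
  qed
  \<comment> \<open>At a common point two neighbourhoods would meet in a nonempty open set that is
    null, which is impossible.\<close>
  moreover have "A \<inter> B \<inter> D = {}"
  proof (rule ccontr)
    assume "A \<inter> B \<inter> D \<noteq> {}"
    then obtain x S T where S: "open S" "x \<in> S" "AE y in lebesgue. y \<in> S \<longrightarrow> rep_l2 U y = 0"
      and T: "open T" "x \<in> T" "AE y in lebesgue. y \<in> T \<longrightarrow> 0 < rep_l2 U y"
      by (auto simp: A_def B_def)
    have "AE y in lebesgue. y \<notin> S \<inter> T" using S(3) T(3) by eventually_elim auto
    then have "S \<inter> T \<in> null_sets lebesgue" using S(1) T(1) by (simp add: AE_iff_null_sets)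
    then have "negligible (S \<inter> T)" by (simp add: negligible_iff_null_sets)
    then show False using S T open_not_negligible[of "S \<inter> T"] by blast
  qed
  ultimately have "A \<inter> D = {} \<or> B \<inter> D = {}" using D(2) unfolding connected_def by blast
  then have "D \<subseteq> B \<or> D \<subseteq> A" using \<open>D \<subseteq> A \<union> B\<close> by blast
  then show ?thesis
  proof
    assume "D \<subseteq> B"
    then have "AE x in lebesgue. x \<in> D \<longrightarrow> 0 < rep_l2 U x" by (intro AE_on_open_local) (auto simp: B_def)
    then show ?thesis by simp
  next
    assume "D \<subseteq> A"
    then have "AE x in lebesgue. x \<in> D \<longrightarrow> rep_l2 U x = 0" by (intro AE_on_open_local) (auto simp: A_def)
    with W0_vanishes_outside(1)[OF W D(1)] have "AE x in lebesgue. rep_l2 U x = 0"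
      by eventually_elim auto
    then have "l2_of (rep_l2 U) = l2_of (\<lambda>x. 0)" by (intro l2_of_eqI square_integrable_rep)
    then show ?thesis by (simp add: l2_of_0)
  qed
qed

section \<open>The first Dirichlet eigenvalue\<close>

definition eigenpair :: "'a::euclidean_space set \<Rightarrow> real \<Rightarrow> ('a, real) l2 \<Rightarrow> ('a, 'a) l2 \<Rightarrow> bool" where
  "eigenpair D \<mu> U G \<longleftrightarrow> (U, G) \<in> W0 D \<and> (\<forall>V H. (V, H) \<in> W0 D \<longrightarrow> G \<bullet> H = \<mu> * (U \<bullet> V))"

lemma eigenpair_W0: "eigenpair D \<mu> U G \<Longrightarrow> (U, G) \<in> W0 D"
  and eigenpair_eq: "eigenpair D \<mu> U G \<Longrightarrow> (V, H) \<in> W0 D \<Longrightarrow> G \<bullet> H = \<mu> * (U \<bullet> V)"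
  by (auto simp: eigenpair_def)

lemma eigenpair_norm: "eigenpair D \<mu> U G \<Longrightarrow> (norm G)\<^sup>2 = \<mu> * (norm U)\<^sup>2"
  using eigenpair_eq[OF _ eigenpair_W0] by (simp add: power2_norm_eq_inner)

lemma eigenpair_lincomb:
  assumes "eigenpair D \<mu> U G" "eigenpair D \<mu> V H"
  shows "eigenpair D \<mu> (a *\<^sub>R U + b *\<^sub>R V) (a *\<^sub>R G + b *\<^sub>R H)"
proof -
  have "(a *\<^sub>R U + b *\<^sub>R V, a *\<^sub>R G + b *\<^sub>R H) \<in> W0 D"
    by (intro W0_add W0_scaleR eigenpair_W0[OF assms(1)] eigenpair_W0[OF assms(2)])
  moreover have "(a *\<^sub>R G + b *\<^sub>R H) \<bullet> K = \<mu> * ((a *\<^sub>R U + b *\<^sub>R V) \<bullet> X)" if "(X, K) \<in> W0 D" for X K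
    using eigenpair_eq[OF assms(1) that] eigenpair_eq[OF assms(2) that] by (simp add: inner_add_left algebra_simps)
  ultimately show ?thesis by (simp add: eigenpair_def)
qed

lemma nonzero_on_iff:
  assumes "D \<in> sets lebesgue" "u \<in> L2 D"
  shows "nonzero_on D u \<longleftrightarrow> l2_of (zext D u) \<noteq> 0"
proof -
  have "l2_of (zext D u) = 0 \<longleftrightarrow> (AE x in lebesgue. zext D u x = 0)"
    using l2_of_eq_iff[of "zext D u" "\<lambda>x. 0"] assms square_integrable_0
    by (simp add: L2_iff_square_integrable l2_of_0)
  also have "\<dots> \<longleftrightarrow> (AE x in lebesgue. x \<in> D \<longrightarrow> u x = 0)"
    by (intro AE_cong) (auto simp: zext_def indicator_def)
  finally show ?thesis using assms by (simp add: nonzero_on_def AE_lebesgue_on)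
qed

lemma dirichlet_eigenfunction_iff:
  assumes D: "open D"
  shows "dirichlet_eigenfunction D \<mu> u \<longleftrightarrow> u \<in> L2 D \<and> l2_of (zext D u) \<noteq> 0 \<and> (\<exists>G. eigenpair D \<mu> (l2_of (zext D u)) G)"
proof (intro iffI conjI; (elim conjE)?)
  note Ds = lebesgue_open[OF D]
  assume e: "dirichlet_eigenfunction D \<mu> u"
  then have u: "u \<in> H01 D" "nonzero_on D u" by (auto simp: dirichlet_eigenfunction_def)
  note uH = H01_W0[OF D u(1)]
  show "u \<in> L2 D" by (rule uH(1))
  show "l2_of (zext D u) \<noteq> 0" using u(2) nonzero_on_iff[OF Ds uH(1)] by simp
  show "\<exists>G. eigenpair D \<mu> (l2_of (zext D u)) G"
  proof (intro exI[of _ "l2_of (zext D (wgrad D u))"], unfold eigenpair_def, intro conjI allI impI)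
    show "(l2_of (zext D u), l2_of (zext D (wgrad D u))) \<in> W0 D" by (rule uH(3))
    fix V H assume W: "(V, H) \<in> W0 D"
    note z = W0_zext_rep[OF W D]
    have W': "(l2_of (zext D (rep_l2 V)), H) \<in> W0 D" using W z(1) by simp
    note v = H01_of_W0[OF D z(2) W']
    have "(LINT x|lebesgue_on D. wgrad D u x \<bullet> wgrad D (rep_l2 V) x) =
        \<mu> * (LINT x|lebesgue_on D. u x \<bullet> rep_l2 V x)"
      using e v(1) by (simp add: dirichlet_eigenfunction_def)
    then show "l2_of (zext D (wgrad D u)) \<bullet> H = \<mu> * (l2_of (zext D u) \<bullet> V)"
      using L2_inner[OF Ds uH(2) H01_W0(2)[OF D v(1)]] L2_inner[OF Ds uH(1) z(2)] v(2) z(1) by simp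
  qed
next
  note Ds = lebesgue_open[OF D]
  assume u: "u \<in> L2 D" "l2_of (zext D u) \<noteq> 0" and "\<exists>G. eigenpair D \<mu> (l2_of (zext D u)) G"
  then obtain G where G: "eigenpair D \<mu> (l2_of (zext D u)) G" by blast
  note uH = H01_of_W0[OF D u(1) eigenpair_W0[OF G]]
  show "dirichlet_eigenfunction D \<mu> u"
    unfolding dirichlet_eigenfunction_def
  proof (intro conjI ballI uH)
    show "nonzero_on D u" using u nonzero_on_iff[OF Ds u(1)] by simp
    fix v assume "v \<in> H01 D"
    note v = H01_W0[OF D this]
    show "(LINT x|lebesgue_on D. wgrad D u x \<bullet> wgrad D v x) = \<mu> * (LINT x|lebesgue_on D. u x * v x)"
      using L2_inner[OF Ds H01_W0(2)[OF D uH(1)] v(2)] L2_inner[OF Ds u(1) v(1)] eigenpair_eq[OF G v(3)] uH(2)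
      by simp
  qed
qed

lemma eigenpair_imp_dirichlet_eigenfunction:
  assumes D: "open D" and e: "eigenpair D \<mu> U G" "U \<noteq> 0"
  shows "dirichlet_eigenfunction D \<mu> (rep_l2 U)"
  using W0_zext_rep[OF eigenpair_W0[OF e(1)] D] e by (auto simp: dirichlet_eigenfunction_iff[OF D])

text \<open>The direct method. Rellich's theorem gives strong convergence of the functions, so
  normalisation and membership in the closed set \<open>A\<close> survive; the weak limit lemma
  supplies a gradient of no larger norm. The constraint concerns the function only: it is void for
  the eigenvalue and is M >= 0 for the problem itself.\<close>

lemma constrained_minimizer_exists:
  fixes D :: "'a::euclidean_space set"
  assumes D: "open D" "bounded D" and A: "closed A"
    and ne: "(U0, G0) \<in> W0 D" "U0 \<in> A" "norm U0 = 1"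
  obtains U G where "(U, G) \<in> W0 D" "U \<in> A" "norm U = 1"
    "\<And>V H. (V, H) \<in> W0 D \<Longrightarrow> V \<in> A \<Longrightarrow> norm V = 1 \<Longrightarrow> (norm G)\<^sup>2 \<le> (norm H)\<^sup>2"
proof -
  define S where "S = {(norm H)\<^sup>2 | V H. (V, H) \<in> W0 D \<and> V \<in> A \<and> norm V = 1}"
  have bdd: "bdd_below S" by (rule bdd_belowI[of _ 0]) (auto simp: S_def)
  have Sne: "S \<noteq> {}" using ne by (auto simp: S_def)
  have lower: "Inf S \<le> (norm H)\<^sup>2" if "(V, H) \<in> W0 D" "V \<in> A" "norm V = 1" for V H
    by (rule cInf_lower[OF _ bdd]) (use that in \<open>auto simp: S_def\<close>)
  have "\<forall>n. \<exists>X. X \<in> W0 D \<and> fst X \<in> A \<and> norm (fst X) = 1 \<and> (norm (snd X))\<^sup>2 \<le> Inf S + 1 / real (Suc n)"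
  proof
    fix n
    have "Inf S < Inf S + 1 / real (Suc n)" by simp
    then obtain s where "s \<in> S" "s < Inf S + 1 / real (Suc n)"
      using cInf_less_iff[OF Sne bdd] by blast
    then show "\<exists>X. X \<in> W0 D \<and> fst X \<in> A \<and> norm (fst X) = 1 \<and> (norm (snd X))\<^sup>2 \<le> Inf S + 1 / real (Suc n)"
      unfolding S_def by force
  qed
  from choice[OF this] obtain X where X: "\<forall>n. X n \<in> W0 D \<and> fst (X n) \<in> A \<and> norm (fst (X n)) = 1 \<and>
    (norm (snd (X n)))\<^sup>2 \<le> Inf S + 1 / real (Suc n)" by blast
  define V H where "V n = fst (X n)" and "H n = snd (X n)" for n
  have VH: "(V n, H n) \<in> W0 D" "V n \<in> A" "norm (V n) = 1" "(norm (H n))\<^sup>2 \<le> Inf S + 1 / real (Suc n)" for n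
    using X by (simp_all add: V_def H_def)
  have bH: "norm (V n) \<le> 1 + sqrt (Inf S + 1)" "norm (H n) \<le> 1 + sqrt (Inf S + 1)" for n
  proof -
    have "1 / real (Suc n) \<le> 1" by simp
    then have *: "(norm (H n))\<^sup>2 \<le> Inf S + 1" using VH(4)[of n] by linarith
    then have "norm (H n) \<le> sqrt (Inf S + 1)" by (rule real_le_rsqrt)
    moreover have "0 \<le> sqrt (Inf S + 1)" using calculation norm_ge_zero order_trans by blast
    ultimately show "norm (V n) \<le> 1 + sqrt (Inf S + 1)" "norm (H n) \<le> 1 + sqrt (Inf S + 1)"
      using VH(3)[of n] by auto
  qed
  obtain r :: "nat \<Rightarrow> nat" and U where r: "strict_mono r" "(\<lambda>n. V (r n)) \<longlonglongrightarrow> U"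
    by (rule W0_Rellich[OF D VH(1) bH])
  have lim: "(\<lambda>n. Inf S + 1 / real (Suc (r n))) \<longlonglongrightarrow> Inf S + 0"
    by (intro tendsto_add tendsto_const LIMSEQ_subseq_LIMSEQ[OF LIMSEQ_Suc[OF lim_1_over_n] r(1), unfolded o_def])
  obtain G where G: "(U, G) \<in> W0 D" "(norm G)\<^sup>2 \<le> Inf S + 0"
    by (rule W0_weak_limit[OF VH(1) r(2) VH(4) lim])
  show thesis
  proof (rule that[OF G(1)])
    show "U \<in> A" using closed_sequentially[OF A VH(2) r(2)] .
    have "(\<lambda>n. norm (V (r n))) \<longlonglongrightarrow> norm U" by (intro tendsto_intros r)
    then show "norm U = 1" by (simp add: VH(3) LIMSEQ_const_iff)
    show "(norm G)\<^sup>2 \<le> (norm K)\<^sup>2" if "(Y, K) \<in> W0 D" "Y \<in> A" "norm Y = 1" for Y K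
      by (rule order_trans[OF _ lower[OF that]]) (use G(2) in simp)
  qed
qed

text \<open>Division by the step length and passage to the limit. Only positive steps 1/(n+1) occur,
  and only eventually, because under the constraint a direction may be admissible for small positive
  steps alone.\<close>

lemma one_sided_variation:
  fixes b c :: real
  assumes "\<forall>\<^sub>F n in sequentially. 0 \<le> 2 * (1 / real (Suc n)) * b + (1 / real (Suc n))\<^sup>2 * c"
  shows "0 \<le> b"
proof -
  have "(\<lambda>n. 2 * b + 1 / real (Suc n) * c) \<longlonglongrightarrow> 2 * b + 0 * c"
    by (intro tendsto_intros LIMSEQ_Suc[OF lim_1_over_n])
  moreover have "\<forall>\<^sub>F n in sequentially. 0 \<le> 2 * b + 1 / real (Suc n) * c"
    using assms
  proof eventually_elim
    case (elim n)
    have "0 \<le> real (Suc n) * (2 * (1 / real (Suc n)) * b + (1 / real (Suc n))\<^sup>2 * c)"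
      using elim by (intro mult_nonneg_nonneg) auto
    also have "\<dots> = 2 * b + 1 / real (Suc n) * c"
    proof -
      have "N * (2 * (1 / N) * b + (1 / N)\<^sup>2 * c) = 2 * b + 1 / N * c" if "N \<noteq> 0" for N :: real
        using that by (simp add: field_simps power2_eq_square)
      then show ?thesis by simp
    qed
    finally show ?case .
  qed
  ultimately have "0 \<le> 2 * b + 0 * c" by (intro tendsto_lowerbound[of _ _ sequentially]) auto
  then show ?thesis by simp
qed

lemma quadratic_expansion:
  fixes U V :: "'x::real_inner" and G H :: "'y::real_inner"
  shows "(norm (G + t *\<^sub>R H))\<^sup>2 - \<mu> * (norm (U + t *\<^sub>R V))\<^sup>2 =
    ((norm G)\<^sup>2 - \<mu> * (norm U)\<^sup>2) + 2 * t * (G \<bullet> H - \<mu> * (U \<bullet> V)) + t\<^sup>2 * ((norm H)\<^sup>2 - \<mu> * (norm V)\<^sup>2)"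
  unfolding power2_norm_eq_inner
  by (simp add: inner_add_left inner_add_right inner_commute power2_eq_square algebra_simps)

text \<open>The variation gives an inequality in each direction; applied to V and -V it becomes an
  equation. Minimality is required only for small steps depending on the direction, so that the case
  of an inactive constraint is covered together with the unconstrained one.\<close>

lemma eigenpair_of_minimizer:
  assumes W: "(U, G) \<in> W0 D" and eq: "(norm G)\<^sup>2 = \<mu> * (norm U)\<^sup>2"
    and loc: "\<And>V H. (V, H) \<in> W0 D \<Longrightarrow>
      \<forall>\<^sub>F n in sequentially. \<mu> * (norm (U + (1 / real (Suc n)) *\<^sub>R V))\<^sup>2 \<le> (norm (G + (1 / real (Suc n)) *\<^sub>R H))\<^sup>2"
  shows "eigenpair D \<mu> U G"
proof -
  have ge: "0 \<le> G \<bullet> H - \<mu> * (U \<bullet> V)" if "(V, H) \<in> W0 D" for V H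
  proof (rule one_sided_variation)
    show "\<forall>\<^sub>F n in sequentially. 0 \<le> 2 * (1 / real (Suc n)) * (G \<bullet> H - \<mu> * (U \<bullet> V)) +
       (1 / real (Suc n))\<^sup>2 * ((norm H)\<^sup>2 - \<mu> * (norm V)\<^sup>2)"
      using loc[OF that]
    proof eventually_elim
      case (elim n)
      then show ?case
        using quadratic_expansion[of G "1 / real (Suc n)" H \<mu> U V] eq by linarith
    qed
  qed
  have "G \<bullet> H = \<mu> * (U \<bullet> V)" if "(V, H) \<in> W0 D" for V H
    using ge[OF that] ge[OF W0_scaleR[OF that, of "-1"]] by simp
  then show ?thesis using W by (simp add: eigenpair_def)
qed

section \<open>Existence, minimality and simplicity of the first eigenvalue\<close>

lemma test_function_nonzero:
  assumes "open D" "D \<noteq> {}"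
  obtains \<phi> where "\<phi> \<in> test_functions D" "l2_of \<phi> \<noteq> 0" "\<And>x. 0 \<le> \<phi> x"
proof -
  obtain p where "p \<in> D" using assms(2) by blast
  then obtain r where r: "0 < r" "cball p r \<subseteq> D" using assms(1) open_contains_cball by blast
  obtain \<phi> where \<phi>: "\<phi> \<in> test_functions D" "\<And>x. 0 \<le> \<phi> x" "\<And>x. x \<in> cball p r \<Longrightarrow> \<phi> x = 1"
    by (rule cutoff_exists[OF compact_cball assms(1) r(2)]) auto
  have "l2_of \<phi> \<noteq> 0"
  proof
    assume "l2_of \<phi> = 0"
    then have "AE x in lebesgue. \<phi> x = 0"
      using l2_of_eq_iff[OF test_square_integrable(1)[OF \<phi>(1)] square_integrable_0] by (simp add: l2_of_0)
    then have "AE x in lebesgue. x \<notin> ball p r" by eventually_elim (use \<phi>(3) in force)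
    then have "negligible (ball p r)" by (simp add: AE_iff_null_sets negligible_iff_null_sets)
    then show False using r(1) open_not_negligible[of "ball p r"] by simp
  qed
  then show thesis using that \<phi> by blast
qed

text \<open>\<open>lambda1\<close> is a \<open>LEAST\<close> over the reals and carries information
  only once a least element is exhibited: the minimum of the Rayleigh quotient is attained, is an
  eigenvalue, and lies below every other eigenvalue by testing an eigenfunction with itself.\<close>

lemma first_eigenvalue:
  fixes D :: "'a::euclidean_space set"
  assumes D: "open D" "bounded D" "D \<noteq> {}"
  obtains U G where "eigenpair D (lambda1 D) U G" "norm U = 1" "0 \<le> lambda1 D"
    "\<And>V H. (V, H) \<in> W0 D \<Longrightarrow> lambda1 D * (norm V)\<^sup>2 \<le> (norm H)\<^sup>2"
proof -
  obtain \<phi> where \<phi>: "\<phi> \<in> test_functions D" "l2_of \<phi> \<noteq> 0" by (rule test_function_nonzero[OF D(1,3)])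
  define c where "c = 1 / norm (l2_of \<phi>)"
  have W: "(c *\<^sub>R l2_of \<phi>, c *\<^sub>R l2_of (grad \<phi>)) \<in> W0 D" by (rule W0_scaleR[OF W0_test[OF \<phi>(1)]])
  have n1: "norm (c *\<^sub>R l2_of \<phi>) = 1" using \<phi>(2) by (simp add: c_def)
  obtain U G where U: "(U, G) \<in> W0 D" "norm U = 1"
    and min: "\<And>V H. (V, H) \<in> W0 D \<Longrightarrow> V \<in> UNIV \<Longrightarrow> norm V = 1 \<Longrightarrow> (norm G)\<^sup>2 \<le> (norm H)\<^sup>2"
    by (rule constrained_minimizer_exists[OF D(1,2) closed_UNIV W UNIV_I n1]) auto
  define \<kappa> where "\<kappa> = (norm G)\<^sup>2"
  have low: "\<kappa> * (norm V)\<^sup>2 \<le> (norm H)\<^sup>2" if "(V, H) \<in> W0 D" for V H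
  proof (cases "V = 0")
    case False
    have "(norm G)\<^sup>2 \<le> (norm ((1 / norm V) *\<^sub>R H))\<^sup>2"
      by (rule min[OF W0_scaleR[OF that, of "1 / norm V"]]) (use False in simp_all)
    then show ?thesis using False by (simp add: \<kappa>_def power_divide field_simps)
  qed simp
  have e: "eigenpair D \<kappa> U G"
    by (rule eigenpair_of_minimizer[OF U(1)]) (simp_all add: \<kappa>_def U(2) low[unfolded \<kappa>_def] W0_add W0_scaleR U(1))
  have "lambda1 D = \<kappa>"
    unfolding lambda1_def
  proof (rule Least_equality)
    show "\<exists>u. dirichlet_eigenfunction D \<kappa> u"
    proof -
      have "U \<noteq> 0" using U(2) by auto
      then show ?thesis using eigenpair_imp_dirichlet_eigenfunction[OF D(1) e] by blast
    qed
    fix \<mu> assume "\<exists>u. dirichlet_eigenfunction D \<mu> u"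
    then obtain u K where u: "l2_of (zext D u) \<noteq> 0" "eigenpair D \<mu> (l2_of (zext D u)) K"
      by (auto simp: dirichlet_eigenfunction_iff[OF D(1)])
    have "\<kappa> * (norm (l2_of (zext D u)))\<^sup>2 \<le> \<mu> * (norm (l2_of (zext D u)))\<^sup>2"
      using low[OF eigenpair_W0[OF u(2)]] eigenpair_norm[OF u(2)] by simp
    then show "\<kappa> \<le> \<mu>" using u(1) by simp
  qed
  then show thesis using that[of U G] e U(2) low by (simp add: \<kappa>_def)
qed

lemma lambda1_le:
  "open D \<Longrightarrow> bounded D \<Longrightarrow> D \<noteq> {} \<Longrightarrow> (V, H) \<in> W0 D \<Longrightarrow> lambda1 D * (norm V)\<^sup>2 \<le> (norm H)\<^sup>2"
  and lambda1_nonneg: "open D \<Longrightarrow> bounded D \<Longrightarrow> D \<noteq> {} \<Longrightarrow> 0 \<le> lambda1 D"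
  using first_eigenvalue[of D] by metis+

lemma eigenpair_lambda1:
  assumes D: "open D" "bounded D" "D \<noteq> {}" and W: "(U, G) \<in> W0 D"
    and eq: "(norm G)\<^sup>2 \<le> lambda1 D * (norm U)\<^sup>2"
  shows "eigenpair D (lambda1 D) U G"
proof (rule eigenpair_of_minimizer[OF W])
  show "(norm G)\<^sup>2 = lambda1 D * (norm U)\<^sup>2" using eq lambda1_le[OF D W] by linarith
  show "\<forall>\<^sub>F n in sequentially. lambda1 D * (norm (U + (1 / real (Suc n)) *\<^sub>R V))\<^sup>2 \<le> (norm (G + (1 / real (Suc n)) *\<^sub>R H))\<^sup>2"
    if "(V, H) \<in> W0 D" for V H
    by (intro always_eventually allI lambda1_le[OF D] W0_add W W0_scaleR that)
qed

lemma eigenpair_abs: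
  assumes D: "open D" "bounded D" "D \<noteq> {}" and e: "eigenpair D (lambda1 D) U G"
  obtains H where "eigenpair D (lambda1 D) (l2_abs U) H"
proof -
  obtain H where H: "(l2_abs U, H) \<in> W0 D" "norm H \<le> norm G" by (rule W0_abs[OF eigenpair_W0[OF e] D(1,2)])
  have "(norm H)\<^sup>2 \<le> (norm G)\<^sup>2" using H(2) by (simp add: power_mono)
  then have "(norm H)\<^sup>2 \<le> lambda1 D * (norm (l2_abs U))\<^sup>2"
    using eigenpair_norm[OF e] by (simp add: norm_l2_abs)
  from eigenpair_lambda1[OF D H(1) this] show thesis by (rule that)
qed

lemma positive_first_eigenpair:
  assumes D: "open D" "bounded D" "D \<noteq> {}" "connected D"
  obtains U G where "eigenpair D (lambda1 D) U G" "norm U = 1" "AE x in lebesgue. x \<in> D \<longrightarrow> 0 < rep_l2 U x"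
proof -
  obtain U G where U: "eigenpair D (lambda1 D) U G" "norm U = 1" by (rule first_eigenvalue[OF D(1-3)])
  obtain H where H: "eigenpair D (lambda1 D) (l2_abs U) H" by (rule eigenpair_abs[OF D(1-3) U(1)])
  have nn: "AE x in lebesgue. 0 \<le> rep_l2 (l2_abs U) x" using rep_l2_abs[of U] by eventually_elim simp
  have "l2_abs U = 0 \<or> (AE x in lebesgue. x \<in> D \<longrightarrow> 0 < rep_l2 (l2_abs U) x)"
    by (rule strong_maximum_principle[OF eigenpair_W0[OF H] D(1,4) nn lambda1_nonneg[OF D(1-3)] eigenpair_eq[OF H]])
  moreover have "norm (l2_abs U) = 1" by (simp add: norm_l2_abs U(2))
  ultimately show thesis using that[OF H] by fastforce
qed

text \<open>The component \<open>V\<close> of \<open>U\<close> orthogonal to \<Phi> is an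
  eigenfunction, and so is its positive part; by the maximum principle the latter vanishes or is
  positive throughout \<open>D\<close>. So V \<Phi> has one sign, its integral is zero, and
  \<open>V\<close> vanishes. The case \<Phi> = 0 would make the open set \<open>D\<close>
  null.\<close>

lemma first_eigenfunction_unique:
  assumes D: "open D" "bounded D" "D \<noteq> {}" "connected D"
    and \<Phi>: "eigenpair D (lambda1 D) \<Phi> H" "AE x in lebesgue. x \<in> D \<longrightarrow> 0 < rep_l2 \<Phi> x"
    and U: "eigenpair D (lambda1 D) U G"
  shows "\<exists>c. U = c *\<^sub>R \<Phi>"
proof (cases "\<Phi> = 0")
  case True
  have "AE x in lebesgue. rep_l2 \<Phi> x = 0"
    using l2_of_eq_iff[OF square_integrable_rep square_integrable_0, of \<Phi>] True by (simp add: l2_of_0)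
  with \<Phi>(2) have "AE x in lebesgue. x \<notin> D" by eventually_elim auto
  then have "negligible D" using D(1) by (simp add: AE_iff_null_sets negligible_iff_null_sets)
  then show ?thesis using D open_not_negligible by blast
next
  case False
  define c where "c = (U \<bullet> \<Phi>) / (norm \<Phi>)\<^sup>2"
  define V where "V = U - c *\<^sub>R \<Phi>"
  have orth: "V \<bullet> \<Phi> = 0" using False by (simp add: V_def c_def inner_diff_left power2_norm_eq_inner)
  have eV: "eigenpair D (lambda1 D) V (G - c *\<^sub>R H)"
    using eigenpair_lincomb[OF U \<Phi>(1), of 1 "-c"] by (simp add: V_def)
  obtain K where K: "eigenpair D (lambda1 D) (l2_abs V) K" by (rule eigenpair_abs[OF D(1-3) eV])
  \<comment> \<open>The positive part of \<open>V\<close>. It is an eigenfunction as a linear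
    combination of \<open>V\<close> and its absolute value, which attains the same Rayleigh
    quotient.\<close>
  define P where "P = (1/2) *\<^sub>R l2_abs V + (1/2) *\<^sub>R V"
  have eP: "eigenpair D (lambda1 D) P ((1/2) *\<^sub>R K + (1/2) *\<^sub>R (G - c *\<^sub>R H))"
    unfolding P_def by (rule eigenpair_lincomb[OF K eV])
  have sq: "square_integrable (\<lambda>x. (1/2) *\<^sub>R rep_l2 (l2_abs V) x + (1/2) *\<^sub>R rep_l2 V x)"
    by (intro square_integrable_add square_integrable_scaleR square_integrable_rep)
  have P: "P = l2_of (\<lambda>x. (1/2) *\<^sub>R rep_l2 (l2_abs V) x + (1/2) *\<^sub>R rep_l2 V x)"
    unfolding P_def by (simp only: l2_of_add[OF square_integrable_scaleR[OF square_integrable_rep] square_integrable_scaleR[OF square_integrable_rep]]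
      l2_of_scaleR[OF square_integrable_rep] l2_of_rep)
  have repP: "AE x in lebesgue. rep_l2 P x = max (rep_l2 V x) 0"
    using rep_l2_of[OF sq] rep_l2_abs[of V] unfolding P[symmetric]
    by eventually_elim (simp add: max_def)
  then have nn: "AE x in lebesgue. 0 \<le> rep_l2 P x" by eventually_elim simp
  have "P = 0 \<or> (AE x in lebesgue. x \<in> D \<longrightarrow> 0 < rep_l2 P x)"
    by (rule strong_maximum_principle[OF eigenpair_W0[OF eP] D(1,4) nn lambda1_nonneg[OF D(1-3)] eigenpair_eq[OF eP]])
  then have sgn: "(AE x in lebesgue. rep_l2 V x * rep_l2 \<Phi> x \<le> 0) \<or> (AE x in lebesgue. 0 \<le> rep_l2 V x * rep_l2 \<Phi> x)"
  proof
    assume "P = 0"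
    then have "AE x in lebesgue. rep_l2 P x = 0"
      using l2_of_eq_iff[OF square_integrable_rep square_integrable_0, of P] by (simp add: l2_of_0)
    with repP \<Phi>(2) W0_vanishes_outside(1)[OF eigenpair_W0[OF \<Phi>(1)] D(1)]
    have "AE x in lebesgue. rep_l2 V x * rep_l2 \<Phi> x \<le> 0"
    proof eventually_elim
      case (elim x)
      then show ?case by (cases "x \<in> D") (auto simp: max_def mult_nonpos_nonneg split: if_splits)
    qed
    then show ?thesis by simp
  next
    assume "AE x in lebesgue. x \<in> D \<longrightarrow> 0 < rep_l2 P x"
    with repP \<Phi>(2) W0_vanishes_outside(1)[OF eigenpair_W0[OF \<Phi>(1)] D(1)]
    have "AE x in lebesgue. 0 \<le> rep_l2 V x * rep_l2 \<Phi> x"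
    proof eventually_elim
      case (elim x)
      then show ?case by (cases "x \<in> D") (auto simp: max_def split: if_splits)
    qed
    then show ?thesis by simp
  qed
  have int: "integrable lebesgue (\<lambda>x. rep_l2 V x * rep_l2 \<Phi> x)"
    using square_integrable_inner[OF square_integrable_rep square_integrable_rep, of V \<Phi>] by simp
  have zero: "(LINT x|lebesgue. rep_l2 V x * rep_l2 \<Phi> x) = 0" using orth inner_rep[of V \<Phi>] by simp
  have "AE x in lebesgue. rep_l2 V x * rep_l2 \<Phi> x = 0"
    using sgn
  proof
    assume "AE x in lebesgue. 0 \<le> rep_l2 V x * rep_l2 \<Phi> x"
    then show ?thesis using integral_nonneg_eq_0_iff_AE[OF int] zero by blast
  next
    assume "AE x in lebesgue. rep_l2 V x * rep_l2 \<Phi> x \<le> 0"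
    then have "AE x in lebesgue. 0 \<le> - (rep_l2 V x * rep_l2 \<Phi> x)" by eventually_elim simp
    from integral_nonneg_eq_0_iff_AE[OF integrable_minus[OF int] this] zero show ?thesis by simp
  qed
  with \<Phi>(2) W0_vanishes_outside(1)[OF eigenpair_W0[OF eV] D(1)] have "AE x in lebesgue. rep_l2 V x = 0"
    by eventually_elim auto
  then have "l2_of (rep_l2 V) = l2_of (\<lambda>x. 0)" by (intro l2_of_eqI square_integrable_rep)
  then have "U = c *\<^sub>R \<Phi>" by (simp add: V_def l2_of_0)
  then show ?thesis by blast
qed

lemma inner_pos_of_nonneg:
  assumes W: "(U, G) \<in> W0 D" and D: "open D" and U: "AE x in lebesgue. 0 \<le> rep_l2 U x" "U \<noteq> 0"
    and \<Phi>: "AE x in lebesgue. x \<in> D \<longrightarrow> 0 < rep_l2 \<Phi> x"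
  shows "0 < U \<bullet> \<Phi>"
proof -
  have int: "integrable lebesgue (\<lambda>x. rep_l2 U x * rep_l2 \<Phi> x)"
    using square_integrable_inner[OF square_integrable_rep square_integrable_rep, of U \<Phi>] by simp
  have nn: "AE x in lebesgue. 0 \<le> rep_l2 U x * rep_l2 \<Phi> x"
    using U(1) \<Phi> W0_vanishes_outside(1)[OF W D]
  proof eventually_elim
    case (elim x)
    then show ?case by (cases "x \<in> D") auto
  qed
  have ip: "U \<bullet> \<Phi> = (LINT x|lebesgue. rep_l2 U x * rep_l2 \<Phi> x)" using inner_rep[of U \<Phi>] by simp
  have "U \<bullet> \<Phi> \<noteq> 0"
  proof
    assume "U \<bullet> \<Phi> = 0"
    then have "AE x in lebesgue. rep_l2 U x * rep_l2 \<Phi> x = 0"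
      using integral_nonneg_eq_0_iff_AE[OF int nn] ip by simp
    with \<Phi> W0_vanishes_outside(1)[OF W D] have "AE x in lebesgue. rep_l2 U x = 0"
      by eventually_elim auto
    then have "l2_of (rep_l2 U) = l2_of (\<lambda>x. 0)" by (intro l2_of_eqI square_integrable_rep)
    then show False using U(2) by (simp add: l2_of_0)
  qed
  moreover have "0 \<le> U \<bullet> \<Phi>" unfolding ip by (rule integral_nonneg_AE[OF nn])
  ultimately show ?thesis by simp
qed

text \<open>Testing each equation with the other function gives (\<mu> - \<nu>) times the inner
  product of U and \<Phi> equal to zero, and that inner product is positive.\<close>

lemma nonneg_eigenvalue_first:
  assumes D: "open D" and \<Phi>: "eigenpair D \<nu> \<Phi> H" "AE x in lebesgue. x \<in> D \<longrightarrow> 0 < rep_l2 \<Phi> x"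
    and U: "eigenpair D \<mu> U G" "AE x in lebesgue. 0 \<le> rep_l2 U x" "U \<noteq> 0"
  shows "\<mu> = \<nu>"
proof -
  have "\<mu> * (U \<bullet> \<Phi>) = G \<bullet> H" by (rule eigenpair_eq[OF U(1) eigenpair_W0[OF \<Phi>(1)], symmetric])
  also have "\<dots> = \<nu> * (U \<bullet> \<Phi>)" using eigenpair_eq[OF \<Phi>(1) eigenpair_W0[OF U(1)]] by (simp add: inner_commute)
  finally show ?thesis using inner_pos_of_nonneg[OF eigenpair_W0[OF U(1)] D U(2,3) \<Phi>(2)] by simp
qed

section \<open>Functions supported in the closure of a domain\<close>

lemma distr_lebesgue_translation:
  fixes s :: "'a::euclidean_space"
  shows "(\<lambda>x. s + x) \<in> lebesgue \<rightarrow>\<^sub>M lebesgue" "distr lebesgue lebesgue (\<lambda>x. s + x) = lebesgue"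
proof -
  have T: "(\<lambda>x. s + (\<Sum>j\<in>Basis. (1 * (x \<bullet> j)) *\<^sub>R j)) = (\<lambda>x. s + x)"
    by (simp add: euclidean_representation)
  show "(\<lambda>x. s + x) \<in> lebesgue \<rightarrow>\<^sub>M lebesgue"
    using lebesgue_affine_measurable[of "\<lambda>_. 1" s] T by simp
  have "lebesgue = density (distr lebesgue lebesgue (\<lambda>x. s + x)) (\<lambda>_. 1)"
    using lebesgue_affine_euclidean[of "\<lambda>_. 1" s] unfolding T by simp
  then show "distr lebesgue lebesgue (\<lambda>x. s + x) = lebesgue" by (simp only: density_1)
qed

lemma lebesgue_integral_translation:
  fixes f :: "'a::euclidean_space \<Rightarrow> real"
  assumes "f \<in> borel_measurable lebesgue"
  shows "(\<lambda>x. f (s + x)) \<in> borel_measurable lebesgue"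
    "integrable lebesgue (\<lambda>x. f (s + x)) \<longleftrightarrow> integrable lebesgue f"
    "(LINT x|lebesgue. f (s + x)) = (LINT x|lebesgue. f x)"
  using measurable_compose[OF distr_lebesgue_translation(1) assms]
    integrable_distr_eq[OF distr_lebesgue_translation(1)[of s] assms]
    integral_distr[OF distr_lebesgue_translation(1)[of s] assms]
  by (simp_all add: distr_lebesgue_translation(2))

lemma AE_lebesgue_translation:
  assumes "AE x in lebesgue. P x" shows "AE x in lebesgue. P (s + x)"
proof -
  have "AE x in distr lebesgue lebesgue (\<lambda>x. s + x). P x"
    by (subst distr_lebesgue_translation(2)) (rule assms)
  then show ?thesis using AE_distrD[OF distr_lebesgue_translation(1)[of s]] by simp
qed

definition translate :: "'a::euclidean_space \<Rightarrow> ('a, 'b::euclidean_space) l2 \<Rightarrow> ('a, 'b) l2" where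
  "translate s U = l2_of (\<lambda>x. rep_l2 U (s + x))"

lemma square_integrable_translate:
  assumes "square_integrable f" shows "square_integrable (\<lambda>x. f (s + x))"
proof -
  have m: "(\<lambda>x. (norm (f x))\<^sup>2) \<in> borel_measurable lebesgue"
    using square_integrable_measurable[OF assms] by measurable
  show ?thesis
    using assms lebesgue_integral_translation(2)[OF m, of s]
      measurable_compose[OF distr_lebesgue_translation(1) square_integrable_measurable[OF assms], of s]
    by (simp add: square_integrable_def)
qed

lemma translate_l2_of: "square_integrable f \<Longrightarrow> translate s (l2_of f) = l2_of (\<lambda>x. f (s + x))"
  unfolding translate_def
  by (rule l2_of_eqI[OF square_integrable_translate[OF square_integrable_rep] AE_lebesgue_translation[OF rep_l2_of]])

lemma rep_translate: "AE x in lebesgue. rep_l2 (translate s U) x = rep_l2 U (s + x)"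
  unfolding translate_def by (rule rep_l2_of[OF square_integrable_translate[OF square_integrable_rep]])

lemma norm_l2_of_translate:
  assumes f: "square_integrable f" shows "norm (l2_of (\<lambda>x. f (s + x))) = norm (l2_of f)"
proof -
  have m: "(\<lambda>x. (norm (f x))\<^sup>2) \<in> borel_measurable lebesgue"
    using square_integrable_measurable[OF f] by measurable
  have "(norm (l2_of (\<lambda>x. f (s + x))))\<^sup>2 = (norm (l2_of f))\<^sup>2"
    unfolding norm_l2_of_sq[OF f] norm_l2_of_sq[OF square_integrable_translate[OF f]]
    by (rule lebesgue_integral_translation(3)[OF m])
  then show ?thesis by simp
qed

lemma norm_translate: "norm (translate s U) = norm U"
  using norm_l2_of_translate[OF square_integrable_rep] by (simp add: translate_def)

lemma translate_diff: "translate s U - translate s V = translate s (U - V)"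
proof -
  have "U - V = l2_of (\<lambda>x. rep_l2 U x - rep_l2 V x)"
    by (simp add: l2_of_diff[OF square_integrable_rep square_integrable_rep])
  then have "translate s (U - V) = l2_of (\<lambda>x. rep_l2 U (s + x) - rep_l2 V (s + x))"
    by (simp add: translate_l2_of square_integrable_diff square_integrable_rep)
  then show ?thesis
    by (simp add: translate_def l2_of_diff square_integrable_translate square_integrable_rep)
qed

lemma translate_tendsto: "V \<longlonglongrightarrow> U \<Longrightarrow> (\<lambda>n. translate s (V n)) \<longlonglongrightarrow> translate s U"
  unfolding LIMSEQ_iff by (simp add: translate_diff norm_translate)

lemma W0_translate:
  assumes "(U, G) \<in> W0 UNIV" shows "(translate s U, translate s G) \<in> W0 UNIV"
proof -
  obtain f where f: "\<And>n::nat. f n \<in> test_functions UNIV" "(\<lambda>n. l2_of (f n)) \<longlonglongrightarrow> U" "(\<lambda>n. l2_of (grad (f n))) \<longlonglongrightarrow> G"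
    using W0_seq[OF assms] by blast
  note sq = test_square_integrable[OF f(1)]
  show ?thesis
  proof (rule W0_limit[OF _ translate_tendsto[OF f(2)] translate_tendsto[OF f(3)]])
    fix n
    have t: "(\<lambda>x. f n (s + x)) \<in> test_functions UNIV" using test_translate[OF f(1)[of n], of s] by (simp add: add.commute)
    have "grad (\<lambda>x. f n (s + x)) = (\<lambda>x. grad (f n) (s + x))"
      using grad_translate[OF test_smooth[OF f(1)[of n]], of s] by (simp add: add.commute fun_eq_iff)
    then show "(translate s (l2_of (f n)), translate s (l2_of (grad (f n)))) \<in> W0 UNIV"
      using W0_test[OF t] by (simp add: translate_l2_of sq)
  qed
qed

lemma translate_test_tendsto:
  assumes \<phi>: "\<phi> \<in> test_functions D" and s: "s \<longlonglongrightarrow> 0"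
  shows "(\<lambda>n. translate (s n) (l2_of \<phi>)) \<longlonglongrightarrow> l2_of \<phi>"
proof -
  from \<phi> obtain K where K: "smooth \<phi>" "compact K" "\<And>x. x \<notin> K \<Longrightarrow> \<phi> x = 0" by (rule test_functionsE) auto
  obtain B where B: "0 < B" "\<And>x. norm (grad \<phi> x) \<le> B" by (rule test_bounded[OF \<phi>]) auto
  obtain R where R: "\<And>x. x \<in> K \<Longrightarrow> norm x \<le> R"
    using compact_imp_bounded[OF K(2)] unfolding bounded_iff by fastforce
  have lip: "\<bar>\<phi> x - \<phi> y\<bar> \<le> B * norm (x - y)" for x y
  proof -
    have "onorm (\<lambda>h. grad \<phi> x \<bullet> h) \<le> B" for x
      using B(1) by (intro onorm_bound order_trans[OF _ mult_right_mono[OF B(2)[of x]]])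
        (auto simp: Cauchy_Schwarz_ineq2)
    then show ?thesis
      using differentiable_bound[of UNIV \<phi> "\<lambda>x h. grad \<phi> x \<bullet> h" B x y] smooth_has_derivative[OF K(1)] by simp
  qed
  note sq = test_square_integrable(1)[OF \<phi>]
  define C where "C = (cball 0 (R + 1) :: 'a set)"
  have sC: "square_integrable (\<lambda>x. indicat_real C x *\<^sub>R (1::real))"
    unfolding C_def by (rule square_integrable_const_indicator) auto
  have bd: "norm (translate (s n) (l2_of \<phi>) - l2_of \<phi>) \<le> B * norm (s n) * norm (ind C)" if n: "norm (s n) \<le> 1" for n
  proof -
    have "norm (l2_of (\<lambda>x. \<phi> (s n + x) - \<phi> x)) \<le> B * norm (s n) * norm (ind C)"
      unfolding ind_def
    proof (rule norm_l2_of_le[OF sC square_integrable_diff[OF square_integrable_translate[OF sq] sq]])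
      have "norm (\<phi> (s n + x) - \<phi> x) \<le> B * norm (s n) * norm (indicat_real C x *\<^sub>R (1::real))" for x
      proof (cases "x \<in> C")
        case True
        then show ?thesis using lip[of "s n + x" x] by simp
      next
        case False
        then have "R + 1 < norm x" by (simp add: C_def)
        moreover have "norm x \<le> norm (s n + x) + norm (s n)"
          using norm_triangle_ineq4[of "s n + x" "s n"] by simp
        ultimately have "x \<notin> K" "s n + x \<notin> K" using R[of x] R[of "s n + x"] n by fastforce+
        then show ?thesis using K(3) B(1) by simp
      qed
      then show "AE x in lebesgue. norm (\<phi> (s n + x) - \<phi> x) \<le> B * norm (s n) * norm (indicat_real C x *\<^sub>R (1::real))" by simp
    qed (use B(1) in simp)
    then show ?thesis by (simp add: translate_l2_of[OF sq] l2_of_diff[OF square_integrable_translate[OF sq] sq])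
  qed
  have "(\<lambda>n. B * norm (s n) * norm (ind C)) \<longlonglongrightarrow> B * norm (0::'a) * norm (ind C)" by (intro tendsto_intros s)
  then have lim: "(\<lambda>n. B * norm (s n) * norm (ind C)) \<longlonglongrightarrow> 0" by simp
  have "(\<lambda>n. norm (s n)) \<longlonglongrightarrow> 0" using s by (rule tendsto_norm_zero)
  then have "\<forall>\<^sub>F n in sequentially. norm (s n) < 1" by (rule order_tendstoD) simp
  then have "\<forall>\<^sub>F n in sequentially. norm (translate (s n) (l2_of \<phi>) - l2_of \<phi>) \<le> B * norm (s n) * norm (ind C)"
    by eventually_elim (simp add: bd)
  from tendsto_sandwich[OF always_eventually this tendsto_const lim]
  show ?thesis by (simp add: tendsto_norm_zero_iff LIM_zero_iff)
qed

text \<open>Translations are isometries of \<open>l2\<close>, so an e/3 argument reduces continuity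
  to a single test function, where the Lipschitz bound on a fixed ball suffices.\<close>

lemma translate_W0_tendsto:
  assumes W: "(U, G) \<in> W0 D" and s: "s \<longlonglongrightarrow> 0"
  shows "(\<lambda>n. translate (s n) U) \<longlonglongrightarrow> U"
proof (rule LIMSEQ_I)
  fix e :: real assume e: "0 < e"
  obtain f where f: "\<And>n::nat. f n \<in> test_functions D" "(\<lambda>n. l2_of (f n)) \<longlonglongrightarrow> U"
    using W0_seq[OF W] by blast
  obtain k where k: "norm (l2_of (f k) - U) < e / 3"
    using LIMSEQ_D[OF f(2), of "e/3"] e by auto
  obtain N where N: "\<And>n. N \<le> n \<Longrightarrow> norm (translate (s n) (l2_of (f k)) - l2_of (f k)) < e / 3"
    using LIMSEQ_D[OF translate_test_tendsto[OF f(1)[of k] s], of "e/3"] e by auto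
  have "norm (translate (s n) U - U) < e" if "N \<le> n" for n
  proof -
    define A B where "A = translate (s n) U - translate (s n) (l2_of (f k))" and "B = translate (s n) (l2_of (f k)) - l2_of (f k)"
    have eq: "translate (s n) U - U = A + B + (l2_of (f k) - U)" by (simp add: A_def B_def)
    have "norm (translate (s n) U - U) \<le> norm A + norm B + norm (l2_of (f k) - U)"
      unfolding eq by (rule order_trans[OF norm_triangle_ineq add_right_mono[OF norm_triangle_ineq]])
    moreover have "norm A = norm (l2_of (f k) - U)"
      by (simp add: A_def translate_diff norm_translate norm_minus_commute)
    ultimately show ?thesis using k N[OF that] unfolding B_def by linarith
  qed
  then show "\<exists>no. \<forall>n\<ge>no. norm (translate (s n) U - U) < e" by blast
qed

text \<open>A cutoff supported in \<open>D\<close> and equal to 1 on \<open>K\<close> does not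
  change \<open>U\<close>, while the Leibniz rule moves the pair into \<open>W0 D\<close>;
  uniqueness of the gradient shows that \<open>G\<close> is unchanged as well.\<close>

lemma W0_compact_support:
  assumes W: "(U, G) \<in> W0 E" and K: "compact K" "K \<subseteq> D" and D: "open D"
    and U: "AE x in lebesgue. x \<notin> K \<longrightarrow> rep_l2 U x = 0"
  shows "(U, G) \<in> W0 D"
proof -
  obtain \<psi> where \<psi>: "\<psi> \<in> test_functions D" "\<And>x. x \<in> K \<Longrightarrow> \<psi> x = 1"
    by (rule cutoff_exists[OF K(1) D K(2)]) auto
  obtain B where B: "\<And>x. \<bar>\<psi> x\<bar> \<le> B" by (rule test_bounded[OF \<psi>(1)]) auto
  note n1 = nemytskii_mult[OF square_integrable_measurable[OF test_square_integrable(1)[OF \<psi>(1)]] B]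
  have "lift_op (\<lambda>x a. \<psi> x *\<^sub>R a) U = l2_of (rep_l2 U)"
    unfolding lift_op_def
  proof (rule l2_of_eqI[OF nemytskii_square_integrable[OF n1 square_integrable_rep]])
    show "AE x in lebesgue. \<psi> x *\<^sub>R rep_l2 U x = rep_l2 U x"
      using U
    proof eventually_elim
      case (elim x)
      then show ?case using \<psi>(2)[of x] by (cases "x \<in> K") auto
    qed
  qed
  then obtain G' where G': "(U, G') \<in> W0 (E \<inter> D)" using W0_mult_test[OF W \<psi>(1)] by auto
  then have "(U, G') \<in> W0 E" "(U, G') \<in> W0 D" using W0_mono[of "E \<inter> D"] by auto
  then show ?thesis using W0_grad_unique[OF W] by metis
qed

text \<open>Pushing \<open>U\<close> by a small amount in the direction e lifts its support strictly
  above the graph, onto a compact subset of \<open>D\<close>. The shifted pairs lie in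
  \<open>W0 D\<close>, converge in L2 to \<open>U\<close> and have constant gradient norm, so the
  weak limit lemma brings \<open>U\<close> into \<open>W0 D\<close>. Only continuity of the graph
  function enters.\<close>

lemma W0_boundary_patch:
  fixes D :: "'a::euclidean_space set"
  assumes D: "open D" and e: "norm e = 1" and \<gamma>: "continuous_on UNIV \<gamma>" and r: "0 < r"
    and graph: "\<And>x. x \<in> ball p r \<Longrightarrow> x \<in> D \<longleftrightarrow> \<gamma> (x - (x \<bullet> e) *\<^sub>R e) < x \<bullet> e"
    and W: "(U, G) \<in> W0 UNIV"
    and U: "AE x in lebesgue. x \<notin> closure D \<inter> cball p (r / 2) \<longrightarrow> rep_l2 U x = 0"
  shows "(U, G) \<in> W0 D"
proof -
  \<comment> \<open>Points of the closure lie weakly above the graph by continuity of \<gamma>; the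
    upward shift makes the inequality strict.\<close>
  have cl: "\<gamma> (x - (x \<bullet> e) *\<^sub>R e) \<le> x \<bullet> e" if x: "x \<in> closure D" "x \<in> ball p r" for x
  proof -
    obtain y where y: "\<And>n::nat. y n \<in> D" "y \<longlonglongrightarrow> x" using x(1) closure_sequential by metis
    have "\<forall>\<^sub>F n in sequentially. y n \<in> ball p r" by (rule topological_tendstoD[OF y(2) open_ball x(2)])
    then have ev: "\<forall>\<^sub>F n in sequentially. \<gamma> (y n - (y n \<bullet> e) *\<^sub>R e) \<le> y n \<bullet> e"
      by eventually_elim (use graph y(1) less_imp_le in blast)
    have "(\<lambda>n. y n - (y n \<bullet> e) *\<^sub>R e) \<longlonglongrightarrow> x - (x \<bullet> e) *\<^sub>R e" by (intro tendsto_intros y(2))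
    then have "(\<lambda>n. \<gamma> (y n - (y n \<bullet> e) *\<^sub>R e)) \<longlonglongrightarrow> \<gamma> (x - (x \<bullet> e) *\<^sub>R e)"
      by (rule continuous_on_tendsto_compose[OF \<gamma>]) auto
    moreover have "(\<lambda>n. y n \<bullet> e) \<longlonglongrightarrow> x \<bullet> e" by (intro tendsto_intros y(2))
    ultimately show ?thesis using ev by (intro tendsto_le[OF sequentially_bot])
  qed
  \<comment> \<open>The double successor keeps \<open>t n\<close> strictly below r/2, so that points
    of the ball of radius r/2, once shifted, remain in the ball of radius r where the graph
    description holds.\<close>
  define t where "t n = r / 2 * (1 / real (Suc (Suc n)))" for n
  have t: "0 < t n" "t n < r / 2" for n
  proof -
    have "1 / real (Suc (Suc n)) < 1" by simp
    from mult_strict_left_mono[OF this, of "r / 2"] show "t n < r / 2" using r by (simp add: t_def)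
  qed (use r in \<open>simp add: t_def\<close>)
  \<comment> \<open>\<open>translate s U\<close> evaluates \<open>U\<close> at s + x; the minus sign
    therefore moves the support by \<open>t n\<close> in the direction +e.\<close>
  define s where "s n = - (t n *\<^sub>R e)" for n
  have "t \<longlonglongrightarrow> r / 2 * 0"
    unfolding t_def by (intro tendsto_intros LIMSEQ_Suc[OF LIMSEQ_Suc[OF lim_1_over_n]])
  then have s: "s \<longlonglongrightarrow> 0" unfolding s_def using tendsto_minus[OF tendsto_scaleR[OF _ tendsto_const, of t 0 _ e]] by simp
  define K where "K n = (\<lambda>y. t n *\<^sub>R e + y) ` (closure D \<inter> cball p (r / 2))" for n
  have K: "compact (K n)" for n
    unfolding K_def by (intro compact_translation closed_Int_compact) auto
  have KD: "K n \<subseteq> D" for n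
  proof
    fix z assume "z \<in> K n"
    then obtain y where y: "z = t n *\<^sub>R e + y" "y \<in> closure D" "y \<in> cball p (r / 2)" by (auto simp: K_def)
    have ee: "e \<bullet> e = 1" using e by (metis norm_eq_1)
    have yr: "y \<in> ball p r" using y(3) r by auto
    have "dist p z \<le> dist p y + norm (t n *\<^sub>R e)"
      unfolding y(1) dist_norm using norm_triangle_ineq4[of "p - y" "t n *\<^sub>R e"] by (simp add: algebra_simps)
    also have "\<dots> < r" using y(3) t[of n] e by simp
    finally have zr: "z \<in> ball p r" by simp
    have "z - (z \<bullet> e) *\<^sub>R e = y - (y \<bullet> e) *\<^sub>R e" by (simp add: y(1) inner_add_left ee algebra_simps)
    moreover have "z \<bullet> e = t n + y \<bullet> e" by (simp add: y(1) inner_add_left ee)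
    ultimately show "z \<in> D" using graph[OF zr] cl[OF y(2) yr] t(1)[of n] by simp
  qed
  have Wn: "(translate (s n) U, translate (s n) G) \<in> W0 D" for n
  proof (rule W0_compact_support[OF W0_translate[OF W] K KD D])
    show "AE x in lebesgue. x \<notin> K n \<longrightarrow> rep_l2 (translate (s n) U) x = 0"
      using AE_lebesgue_translation[OF U, of "s n"] rep_translate[of "s n" U]
    proof eventually_elim
      case (elim x)
      show ?case
      proof
        assume "x \<notin> K n"
        then have "s n + x \<notin> closure D \<inter> cball p (r / 2)"
          unfolding K_def s_def by (metis add_minus_cancel imageI)
        then show "rep_l2 (translate (s n) U) x = 0" using elim by simp
      qed
    qed
  qed
  have bd: "(norm (translate (s n) G))\<^sup>2 \<le> (norm G)\<^sup>2" for n by (simp add: norm_translate)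
  obtain G' where G': "(U, G') \<in> W0 D"
    by (rule W0_weak_limit[OF Wn translate_W0_tendsto[OF W s] bd tendsto_const])
  then have "(U, G') \<in> W0 UNIV" using W0_mono[of D UNIV] by auto
  then show ?thesis using W0_grad_unique[OF W] G' by metis
qed

text \<open>The direction of translation depends on the boundary point, so the argument is
  localised: a finite cover of the closure by interior balls and boundary patches, removed one at a
  time by cutoffs. This iterated subtraction takes the place of a partition of unity.\<close>

lemma W0_closure_support:
  fixes D :: "'a::euclidean_space set"
  assumes D: "open D" "compact (closure D)" and bdry: "graph_boundary (\<lambda>\<gamma>. continuous_on UNIV \<gamma>) D"
    and W: "(U, G) \<in> W0 UNIV" and U: "AE x in lebesgue. x \<notin> closure D \<longrightarrow> rep_l2 U x = 0"
  shows "(U, G) \<in> W0 D"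
proof -
  define good where "good p \<rho> \<longleftrightarrow> 0 < \<rho> \<and> (\<forall>U G. (U, G) \<in> W0 UNIV \<longrightarrow>
    (AE x in lebesgue. x \<notin> closure D \<inter> cball p \<rho> \<longrightarrow> rep_l2 U x = 0) \<longrightarrow> (U, G) \<in> W0 D)" for p \<rho>
  have "\<exists>\<rho>. good p \<rho>" if p: "p \<in> closure D" for p
  proof (cases "p \<in> D")
    case True
    then obtain \<rho> where \<rho>: "0 < \<rho>" "cball p \<rho> \<subseteq> D" using D(1) open_contains_cball by blast
    have "good p \<rho>"
      unfolding good_def
    proof (intro conjI allI impI)
      fix U :: "('a, real) l2" and G :: "('a, 'a) l2"
      assume a: "(U, G) \<in> W0 UNIV" "AE x in lebesgue. x \<notin> closure D \<inter> cball p \<rho> \<longrightarrow> rep_l2 U x = 0"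
      from a(2) have "AE x in lebesgue. x \<notin> cball p \<rho> \<longrightarrow> rep_l2 U x = 0" by eventually_elim auto
      then show "(U, G) \<in> W0 D" by (rule W0_compact_support[OF a(1) compact_cball \<rho>(2) D(1)])
    qed (rule \<rho>(1))
    then show ?thesis ..
  next
    case False
    then have "p \<in> frontier D" using p D(1) by (simp add: frontier_def interior_open)
    then obtain e \<gamma> r where g: "norm e = 1" "continuous_on UNIV \<gamma>" "0 < r"
      "\<And>x. x \<in> ball p r \<Longrightarrow> x \<in> D \<longleftrightarrow> \<gamma> (x - (x \<bullet> e) *\<^sub>R e) < x \<bullet> e"
      using bdry unfolding graph_boundary_def by meson
    have "good p (r / 2)"
      unfolding good_def using W0_boundary_patch[OF D(1) g] g(3) by (simp only: half_gt_zero) blast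
    then show ?thesis ..
  qed
  then have "\<forall>p. \<exists>\<rho>. p \<in> closure D \<longrightarrow> good p \<rho>" by blast
  from choice[OF this] obtain \<rho> where \<rho>: "\<And>p. p \<in> closure D \<Longrightarrow> good p (\<rho> p)" by blast
  have \<rho>0: "0 < \<rho> p" if "p \<in> closure D" for p using \<rho>[OF that] by (simp add: good_def)
  obtain F where F: "finite F" "F \<subseteq> closure D" "closure D \<subseteq> (\<Union>p\<in>F. ball p (\<rho> p / 2))"
  proof -
    have "closure D \<subseteq> (\<Union>p\<in>closure D. ball p (\<rho> p / 2))" using \<rho>0 by force
    then show thesis by (rule compactE_image[OF D(2), rotated]) (use that in auto)
  qed
  \<comment> \<open>The induction runs over all pairs supported in the balls considered so far: for
    a new ball the part \<psi> U is handled by its patch, and U - \<psi> U vanishes on that ball,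
    hence falls under the induction hypothesis.\<close>
  have main: "\<forall>U G. (U, G) \<in> W0 UNIV \<longrightarrow> (AE x in lebesgue. x \<notin> closure D \<longrightarrow> rep_l2 U x = 0) \<longrightarrow>
     (AE x in lebesgue. x \<notin> (\<Union>p\<in>F. ball p (\<rho> p / 2)) \<longrightarrow> rep_l2 U x = 0) \<longrightarrow> (U, G) \<in> W0 D"
    using F(1,2)
  proof (induction F rule: finite_induct)
    case empty
    show ?case
    proof (intro allI impI)
      fix U :: "('a, real) l2" and G :: "('a, 'a) l2"
      assume W: "(U, G) \<in> W0 UNIV" and "AE x in lebesgue. x \<notin> (\<Union>p\<in>{}. ball p (\<rho> p / 2)) \<longrightarrow> rep_l2 U x = 0"
      then have "l2_of (rep_l2 U) = l2_of (\<lambda>x. 0)" by (intro l2_of_eqI square_integrable_rep) simp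
      then have "U = 0" by (simp add: l2_of_0)
      then have "G = 0" using W W0_zero_grad by blast
      then show "(U, G) \<in> W0 D" using \<open>U = 0\<close> subspace_0[OF W0_subspace, of D] by (simp add: zero_prod_def)
    qed
  next
    case (insert p F)
    then have p: "p \<in> closure D" and IH: "\<And>U G. (U, G) \<in> W0 UNIV \<Longrightarrow> (AE x in lebesgue. x \<notin> closure D \<longrightarrow> rep_l2 U x = 0) \<Longrightarrow>
     (AE x in lebesgue. x \<notin> (\<Union>p\<in>F. ball p (\<rho> p / 2)) \<longrightarrow> rep_l2 U x = 0) \<Longrightarrow> (U, G) \<in> W0 D" by auto
    show ?case
    proof (intro allI impI)
      fix U :: "('a, real) l2" and G :: "('a, 'a) l2"
      assume W: "(U, G) \<in> W0 UNIV" and U1: "AE x in lebesgue. x \<notin> closure D \<longrightarrow> rep_l2 U x = 0"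
        and U2: "AE x in lebesgue. x \<notin> (\<Union>p\<in>insert p F. ball p (\<rho> p / 2)) \<longrightarrow> rep_l2 U x = 0"
      have sub: "cball p (\<rho> p / 2) \<subseteq> ball p (\<rho> p)" using \<rho>0[OF p] by auto
      obtain \<psi> where \<psi>: "\<psi> \<in> test_functions (ball p (\<rho> p))" "\<And>x. x \<in> cball p (\<rho> p / 2) \<Longrightarrow> \<psi> x = 1"
        by (rule cutoff_exists[OF compact_cball open_ball sub]) auto
      obtain L where L: "L \<subseteq> ball p (\<rho> p)" "\<And>x. x \<notin> L \<Longrightarrow> \<psi> x = 0" by (rule test_functionsE[OF \<psi>(1)]) auto
      obtain B where B: "\<And>x. \<bar>\<psi> x\<bar> \<le> B" by (rule test_bounded[OF \<psi>(1)]) auto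
      note n1 = nemytskii_mult[OF square_integrable_measurable[OF test_square_integrable(1)[OF \<psi>(1)]] B]
      define V where "V = lift_op (\<lambda>x a. \<psi> x *\<^sub>R a) U"
      have rV: "AE x in lebesgue. rep_l2 V x = \<psi> x *\<^sub>R rep_l2 U x" unfolding V_def by (rule rep_lift_op[OF n1])
      obtain H where "(V, H) \<in> W0 (UNIV \<inter> ball p (\<rho> p))" using W0_mult_test[OF W \<psi>(1)] unfolding V_def by blast
      then have VH: "(V, H) \<in> W0 UNIV" using W0_mono[of "UNIV \<inter> ball p (\<rho> p)" UNIV] by auto
      have "AE x in lebesgue. x \<notin> closure D \<inter> cball p (\<rho> p) \<longrightarrow> rep_l2 V x = 0"
        using rV U1
      proof eventually_elim
        case (elim x)
        show ?case
        proof
          assume "x \<notin> closure D \<inter> cball p (\<rho> p)"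
          then have "x \<notin> closure D \<or> x \<notin> L" using subsetD[OF L(1), of x] by auto
          then have "rep_l2 U x = 0 \<or> \<psi> x = 0" using elim(2) L(2) by blast
          then show "rep_l2 V x = 0" using elim(1) by auto
        qed
      qed
      then have VD: "(V, H) \<in> W0 D" using \<rho>[OF p] VH unfolding good_def by blast
      have rUV: "AE x in lebesgue. rep_l2 (U - V) x = (1 - \<psi> x) * rep_l2 U x"
      proof -
        have "AE x in lebesgue. rep_l2 (l2_of (\<lambda>x. rep_l2 U x - rep_l2 V x)) x = rep_l2 U x - rep_l2 V x"
          by (intro rep_l2_of square_integrable_diff square_integrable_rep)
        then show ?thesis
          using rV unfolding l2_of_diff[OF square_integrable_rep square_integrable_rep] l2_of_rep
          by eventually_elim (simp add: algebra_simps)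
      qed
      have "(U - V, G - H) \<in> W0 D"
      proof (rule IH[OF W0_diff[OF W VH]])
        show "AE x in lebesgue. x \<notin> closure D \<longrightarrow> rep_l2 (U - V) x = 0"
          using rUV U1 by eventually_elim auto
        show "AE x in lebesgue. x \<notin> (\<Union>p\<in>F. ball p (\<rho> p / 2)) \<longrightarrow> rep_l2 (U - V) x = 0"
          using rUV U2
        proof eventually_elim
          case (elim x)
          show ?case
          proof
            assume "x \<notin> (\<Union>p\<in>F. ball p (\<rho> p / 2))"
            then have "rep_l2 U x = 0 \<or> \<psi> x = 1" using elim(2) \<psi>(2)[of x] by auto
            then show "rep_l2 (U - V) x = 0" using elim(1) by auto
          qed
        qed
      qed
      from W0_add[OF this VD] show "(U, G) \<in> W0 D" by simp
    qed
  qed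
  have "AE x in lebesgue. x \<notin> (\<Union>p\<in>F. ball p (\<rho> p / 2)) \<longrightarrow> rep_l2 U x = 0"
    using U by eventually_elim (use F(3) in blast)
  with main W U show ?thesis by blast
qed

section \<open>The constrained minimization problem\<close>

text \<open>Mean value theorem with z^(p-1) <= 1 + z, valid because 0 < p - 1 < 1; the factor 2
  bounds p. The right-hand side is a product of two square integrable quantities on a bounded set,
  which is the reason for this shape.\<close>

lemma powr_diff_le:
  fixes a b p :: real
  assumes p: "1 < p" "p < 2"
  shows "\<bar>\<bar>a\<bar> powr p - \<bar>b\<bar> powr p\<bar> \<le> 2 * \<bar>a - b\<bar> * (1 + \<bar>a\<bar> + \<bar>b\<bar>)"
proof -
  have *: "y powr p - x powr p \<le> 2 * (y - x) * (1 + x + y) \<and> x powr p \<le> y powr p" if "0 \<le> x" "x \<le> y" for x y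
  proof (cases "x = y")
    case False
    then have xy: "x < y" using that by simp
    have "continuous_on {x..y} (\<lambda>s. s powr p)" using that p by (intro continuous_on_powr') (auto intro!: continuous_intros)
    moreover have "((\<lambda>s. s powr p) has_real_derivative p * s powr (p - 1)) (at s)" if "x < s" for s
      using has_real_derivative_powr[of s p] that \<open>0 \<le> x\<close> by simp
    ultimately obtain z where z: "x < z" "z < y" "y powr p - x powr p = (y - x) * (p * z powr (p - 1))"
      using MVT[OF xy, of "\<lambda>s. s powr p"] DERIV_unique
      by (metis (no_types, lifting) real_differentiable_def)
    have "z powr (p - 1) \<le> 1 + z"
    proof (cases "z \<le> 1")
      case True
      then have "z powr (p - 1) \<le> 1" using z(1) that p by (intro powr_le1) auto
      then show ?thesis using z(1) that by simp
    next
      case False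
      then have "z powr (p - 1) \<le> z powr 1" using p by (intro powr_mono) auto
      then show ?thesis using False by simp
    qed
    then have "p * z powr (p - 1) \<le> 2 * (1 + x + y)"
      using p z that by (intro mult_mono) auto
    then have "y powr p - x powr p \<le> (y - x) * (2 * (1 + x + y))"
      unfolding z(3) using xy by (intro mult_left_mono) auto
    also have "\<dots> = 2 * (y - x) * (1 + x + y)" by (simp only: ac_simps)
    finally have "y powr p - x powr p \<le> 2 * (y - x) * (1 + x + y)" .
    moreover have "x powr p \<le> y powr p" using that p by (intro powr_mono2) auto
    ultimately show ?thesis ..
  qed simp
  have abs: "2 * (\<bar>a\<bar> - \<bar>b\<bar>) * (1 + \<bar>b\<bar> + \<bar>a\<bar>) \<le> 2 * \<bar>a - b\<bar> * (1 + \<bar>a\<bar> + \<bar>b\<bar>)"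
    "2 * (\<bar>b\<bar> - \<bar>a\<bar>) * (1 + \<bar>a\<bar> + \<bar>b\<bar>) \<le> 2 * \<bar>a - b\<bar> * (1 + \<bar>a\<bar> + \<bar>b\<bar>)"
  proof -
    have d: "2 * (\<bar>a\<bar> - \<bar>b\<bar>) \<le> 2 * \<bar>a - b\<bar>" "2 * (\<bar>b\<bar> - \<bar>a\<bar>) \<le> 2 * \<bar>a - b\<bar>"
      using abs_triangle_ineq2[of a b] abs_triangle_ineq2[of b a] abs_minus_commute[of a b] by simp_all
    have e: "1 + \<bar>b\<bar> + \<bar>a\<bar> = 1 + \<bar>a\<bar> + \<bar>b\<bar>" by simp
    show "2 * (\<bar>a\<bar> - \<bar>b\<bar>) * (1 + \<bar>b\<bar> + \<bar>a\<bar>) \<le> 2 * \<bar>a - b\<bar> * (1 + \<bar>a\<bar> + \<bar>b\<bar>)"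
      unfolding e by (rule mult_right_mono[OF d(1)]) simp
    show "2 * (\<bar>b\<bar> - \<bar>a\<bar>) * (1 + \<bar>a\<bar> + \<bar>b\<bar>) \<le> 2 * \<bar>a - b\<bar> * (1 + \<bar>a\<bar> + \<bar>b\<bar>)"
      by (rule mult_right_mono[OF d(2)]) simp
  qed
  show ?thesis
    using *[of "\<bar>b\<bar>" "\<bar>a\<bar>"] *[of "\<bar>a\<bar>" "\<bar>b\<bar>"] abs by (cases "\<bar>b\<bar> \<le> \<bar>a\<bar>") auto
qed

text \<open>At u = 0 the difference quotient has modulus |h|^(p-1), which tends to 0 because p > 1;
  elsewhere the absolute value is locally inactive.\<close>

lemma abs_powr_deriv:
  fixes u p :: real
  assumes p: "1 < p" and u: "0 \<le> u"
  shows "((\<lambda>s. \<bar>s\<bar> powr p) has_real_derivative p * u powr (p - 1)) (at u)"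
proof (cases "u = 0")
  case True
  have "((\<lambda>h. \<bar>h\<bar> powr (p - 1)) \<longlongrightarrow> \<bar>0::real\<bar> powr (p - 1)) (at 0)"
    using p by (intro tendsto_powr' tendsto_intros) auto
  then have "((\<lambda>h::real. \<bar>h\<bar> powr (p - 1)) \<longlongrightarrow> 0) (at 0)" by simp
  then have "((\<lambda>h. \<bar>\<bar>h\<bar> powr p / h\<bar>) \<longlongrightarrow> 0) (at 0)"
  proof (rule Lim_transform_eventually)
    show "\<forall>\<^sub>F h in at (0::real). \<bar>h\<bar> powr (p - 1) = \<bar>\<bar>h\<bar> powr p / h\<bar>"
      by (auto simp: eventually_at_filter powr_diff abs_divide)
  qed
  then have "((\<lambda>h. \<bar>h\<bar> powr p / h) \<longlongrightarrow> 0) (at 0)" by (rule tendsto_rabs_zero_cancel)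
  then show ?thesis using True p by (simp add: DERIV_def)
next
  case False
  then have u: "0 < u" using u by simp
  have "((\<lambda>s. s powr p) has_real_derivative p * u powr (p - 1)) (at u)" by (rule has_real_derivative_powr[OF u])
  then show ?thesis
    by (rule has_field_derivative_transform_within_open[where S = "{0<..}"]) (use u in auto)
qed

text \<open>\<open>w\<close> is the weight extended by zero, so that the constraint functional
  becomes an integral over the whole space, acting on classes in \<open>l2\<close>.\<close>

locale weighted_problem =
  fixes \<Omega> :: "'a::euclidean_space set" and w :: "'a \<Rightarrow> real" and \<alpha> C :: real
  assumes dom: "open \<Omega>" "bounded \<Omega>" and alpha: "0 < \<alpha>" "\<alpha> < 1"
    and w_meas [measurable]: "w \<in> borel_measurable lebesgue" and w_bd: "AE x in lebesgue. \<bar>w x\<bar> \<le> C" and C: "0 \<le> C"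
    and w_out: "\<And>x. x \<notin> \<Omega> \<Longrightarrow> w x = 0"
begin

definition M :: "('a, real) l2 \<Rightarrow> real" where
  "M U = (LINT x|lebesgue. w x * \<bar>rep_l2 U x\<bar> powr (\<alpha> + 1))"

lemma M_l2_of:
  assumes "square_integrable f"
  shows "M (l2_of f) = (LINT x|lebesgue. w x * \<bar>f x\<bar> powr (\<alpha> + 1))"
  unfolding M_def
proof (rule integral_cong_AE)
  show "AE x in lebesgue. w x * \<bar>rep_l2 (l2_of f) x\<bar> powr (\<alpha> + 1) = w x * \<bar>f x\<bar> powr (\<alpha> + 1)"
    using rep_l2_of[OF assms] by eventually_elim simp
qed (use square_integrable_measurable[OF assms] in measurable)

abbreviation one :: "'a \<Rightarrow> real" where "one x \<equiv> indicat_real \<Omega> x *\<^sub>R 1"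

lemma one_square_integrable: "square_integrable one"
  by (rule square_integrable_const_indicator) (use dom in auto)

text \<open>The quantifiers over a and b stand inside, so that one exceptional null set serves all
  values. The constant 1 is replaced by the indicator of \<Omega>, which is square integrable;
  outside \<Omega> the weight vanishes.\<close>

lemma weighted_powr_diff_le:
  "AE x in lebesgue. \<forall>a b. \<bar>w x * \<bar>a\<bar> powr (\<alpha> + 1) - w x * \<bar>b\<bar> powr (\<alpha> + 1)\<bar> \<le> 2 * C * (\<bar>a - b\<bar> * (one x + \<bar>a\<bar> + \<bar>b\<bar>))"
  using w_bd
proof eventually_elim
  case (elim x)
  show ?case
  proof (intro allI)
    fix a b :: real
    show "\<bar>w x * \<bar>a\<bar> powr (\<alpha> + 1) - w x * \<bar>b\<bar> powr (\<alpha> + 1)\<bar> \<le> 2 * C * (\<bar>a - b\<bar> * (one x + \<bar>a\<bar> + \<bar>b\<bar>))"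
    proof (cases "x \<in> \<Omega>")
      case True
      have "\<bar>w x * \<bar>a\<bar> powr (\<alpha> + 1) - w x * \<bar>b\<bar> powr (\<alpha> + 1)\<bar> = \<bar>w x\<bar> * \<bar>\<bar>a\<bar> powr (\<alpha> + 1) - \<bar>b\<bar> powr (\<alpha> + 1)\<bar>"
        by (simp flip: abs_mult right_diff_distrib)
      also have "\<dots> \<le> C * (2 * \<bar>a - b\<bar> * (1 + \<bar>a\<bar> + \<bar>b\<bar>))"
        using alpha by (intro mult_mono elim powr_diff_le C) auto
      also have "\<dots> = 2 * C * (\<bar>a - b\<bar> * (1 + \<bar>a\<bar> + \<bar>b\<bar>))" by (simp only: ac_simps)
      also have "\<dots> = 2 * C * (\<bar>a - b\<bar> * (one x + \<bar>a\<bar> + \<bar>b\<bar>))" using True by simp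
      finally show ?thesis .
    next
      case False
      have "0 \<le> 2 * C * (\<bar>a - b\<bar> * (one x + \<bar>a\<bar> + \<bar>b\<bar>))" using C by (intro mult_nonneg_nonneg) auto
      then show ?thesis using False w_out by simp
    qed
  qed
qed

lemma square_integrable_abs: "square_integrable f \<Longrightarrow> square_integrable (\<lambda>x. \<bar>f x :: real\<bar>)"
  by (rule nemytskii_square_integrable[OF nemytskii_abs])

lemma norm_l2_of_abs: "square_integrable f \<Longrightarrow> norm (l2_of (\<lambda>x. \<bar>f x :: real\<bar>)) = norm (l2_of f)"
  using norm_l2_abs[of "l2_of f"] by (simp add: l2_abs_def lift_op_l2_of[OF nemytskii_abs])

lemma dominating_integrable:
  assumes "square_integrable f" "square_integrable g" "square_integrable h"
  shows "integrable lebesgue (\<lambda>x. c * (\<bar>f x :: real\<bar> * (one x + \<bar>g x :: real\<bar> + \<bar>h x :: real\<bar>)))"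
  using square_integrable_inner[OF square_integrable_abs[OF assms(1)]
    square_integrable_add[OF square_integrable_add[OF one_square_integrable square_integrable_abs[OF assms(2)]]
      square_integrable_abs[OF assms(3)]]]
  by simp

lemma M_integrable:
  assumes "square_integrable f"
  shows "integrable lebesgue (\<lambda>x. w x * \<bar>f x\<bar> powr (\<alpha> + 1))"
proof (rule Bochner_Integration.integrable_bound)
  show "integrable lebesgue (\<lambda>x. 2 * C * (\<bar>f x\<bar> * (one x + \<bar>f x\<bar> + \<bar>0\<bar>)))"
    by (rule dominating_integrable[OF assms assms square_integrable_0])
  show "AE x in lebesgue. norm (w x * \<bar>f x\<bar> powr (\<alpha> + 1)) \<le> norm (2 * C * (\<bar>f x\<bar> * (one x + \<bar>f x\<bar> + \<bar>0\<bar>)))"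
    using weighted_powr_diff_le
  proof eventually_elim
    case (elim x)
    from elim[rule_format, of "f x" 0] show ?case by simp
  qed
qed (use square_integrable_measurable[OF assms] in measurable)

text \<open>Local Lipschitz continuity of the constraint functional in the L2 norm alone, without
  gradients. It makes the constraint set closed under the convergence that Rellich's theorem
  provides.\<close>

lemma M_diff_le: "\<bar>M U - M V\<bar> \<le> 2 * C * (norm (U - V) * (norm (ind \<Omega>) + norm U + norm V))"
proof -
  define u v where "u = rep_l2 U" and "v = rep_l2 V"
  have s: "square_integrable u" "square_integrable v" by (simp_all add: u_def v_def square_integrable_rep)
  have sa: "square_integrable (\<lambda>x. \<bar>u x\<bar>)" "square_integrable (\<lambda>x. \<bar>v x\<bar>)" using s by (simp_all add: square_integrable_abs)
  have sd: "square_integrable (\<lambda>x. u x - v x)" by (rule square_integrable_diff[OF s])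
  note sda = square_integrable_abs[OF sd]
  note sg1 = square_integrable_add[OF one_square_integrable sa(1)] and sg = square_integrable_add[OF square_integrable_add[OF one_square_integrable sa(1)] sa(2)]
  have "\<bar>M U - M V\<bar> = \<bar>LINT x|lebesgue. w x * \<bar>u x\<bar> powr (\<alpha> + 1) - w x * \<bar>v x\<bar> powr (\<alpha> + 1)\<bar>"
    by (simp add: M_def M_integrable s flip: u_def v_def)
  also have "\<dots> \<le> (LINT x|lebesgue. \<bar>w x * \<bar>u x\<bar> powr (\<alpha> + 1) - w x * \<bar>v x\<bar> powr (\<alpha> + 1)\<bar>)"
    by (rule integral_abs_bound)
  also have "\<dots> \<le> (LINT x|lebesgue. 2 * C * (\<bar>u x - v x\<bar> * (one x + \<bar>u x\<bar> + \<bar>v x\<bar>)))"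
  proof (rule integral_mono_AE)
    show "AE x in lebesgue. \<bar>w x * \<bar>u x\<bar> powr (\<alpha> + 1) - w x * \<bar>v x\<bar> powr (\<alpha> + 1)\<bar> \<le> 2 * C * (\<bar>u x - v x\<bar> * (one x + \<bar>u x\<bar> + \<bar>v x\<bar>))"
      using weighted_powr_diff_le by eventually_elim blast
  qed (intro integrable_abs Bochner_Integration.integrable_diff M_integrable s dominating_integrable sd)+
  also have "\<dots> = 2 * C * (l2_of (\<lambda>x. \<bar>u x - v x\<bar>) \<bullet> l2_of (\<lambda>x. one x + \<bar>u x\<bar> + \<bar>v x\<bar>))"
    unfolding inner_l2_of[OF sda sg] by simp
  also have "\<dots> \<le> 2 * C * (norm (U - V) * (norm (ind \<Omega>) + norm U + norm V))"
  proof (rule mult_left_mono)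
    have "norm (l2_of (\<lambda>x. \<bar>u x - v x\<bar>)) = norm (U - V)"
      unfolding norm_l2_of_abs[OF sd] l2_of_diff[OF s] by (simp add: u_def v_def)
    moreover have "norm (l2_of (\<lambda>x. one x + \<bar>u x\<bar> + \<bar>v x\<bar>)) \<le> norm (ind \<Omega>) + norm U + norm V"
    proof -
      have "l2_of (\<lambda>x. one x + \<bar>u x\<bar> + \<bar>v x\<bar>) = ind \<Omega> + l2_of (\<lambda>x. \<bar>u x\<bar>) + l2_of (\<lambda>x. \<bar>v x\<bar>)"
        unfolding l2_of_add[OF sg1 sa(2)] l2_of_add[OF one_square_integrable sa(1)] ind_def ..
      moreover have "norm (l2_of (\<lambda>x. \<bar>u x\<bar>)) = norm U" "norm (l2_of (\<lambda>x. \<bar>v x\<bar>)) = norm V"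
        using norm_l2_of_abs[OF s(1)] norm_l2_of_abs[OF s(2)] by (simp_all add: u_def v_def)
      ultimately show ?thesis
        using norm_triangle_ineq[of "ind \<Omega> + l2_of (\<lambda>x. \<bar>u x\<bar>)" "l2_of (\<lambda>x. \<bar>v x\<bar>)"]
          norm_triangle_ineq[of "ind \<Omega>" "l2_of (\<lambda>x. \<bar>u x\<bar>)"] by simp
    qed
    ultimately show "l2_of (\<lambda>x. \<bar>u x - v x\<bar>) \<bullet> l2_of (\<lambda>x. one x + \<bar>u x\<bar> + \<bar>v x\<bar>) \<le>
      norm (U - V) * (norm (ind \<Omega>) + norm U + norm V)"
      by (intro order_trans[OF norm_cauchy_schwarz]) (simp add: mult_left_mono)
  qed (use C in simp)
  finally show ?thesis .
qed

lemma M_tendsto: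
  assumes V: "V \<longlonglongrightarrow> U" shows "(\<lambda>n. M (V n)) \<longlonglongrightarrow> M U"
proof -
  have "(\<lambda>n. 2 * C * (norm (V n - U) * (norm (ind \<Omega>) + norm (V n) + norm U))) \<longlonglongrightarrow>
     2 * C * (norm (U - U) * (norm (ind \<Omega>) + norm U + norm U))"
    by (intro tendsto_intros V)
  then have lim: "(\<lambda>n. 2 * C * (norm (V n - U) * (norm (ind \<Omega>) + norm (V n) + norm U))) \<longlonglongrightarrow> 0" by simp
  have "(\<lambda>n. \<bar>M (V n) - M U\<bar>) \<longlonglongrightarrow> 0"
    by (rule tendsto_sandwich[OF _ _ tendsto_const lim]) (use M_diff_le in auto)
  then show ?thesis by (simp add: tendsto_rabs_zero_iff LIM_zero_iff)
qed

lemma M_closed: "closed {U. 0 \<le> M U}"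
  unfolding closed_sequential_limits
proof (intro allI impI, elim conjE)
  fix V U assume "\<forall>n. V n \<in> {U. 0 \<le> M U}" "V \<longlonglongrightarrow> U"
  then show "U \<in> {U. 0 \<le> M U}"
    using LIMSEQ_le_const[OF M_tendsto[of V U], of 0] by auto
qed

lemma M_scaleR: "M (c *\<^sub>R U) = \<bar>c\<bar> powr (\<alpha> + 1) * M U"
proof -
  have "M (c *\<^sub>R U) = M (l2_of (\<lambda>x. c *\<^sub>R rep_l2 U x))"
    by (simp add: l2_of_scaleR[OF square_integrable_rep, of c U, simplified])
  also have "\<dots> = (LINT x|lebesgue. \<bar>c\<bar> powr (\<alpha> + 1) * (w x * \<bar>rep_l2 U x\<bar> powr (\<alpha> + 1)))"
    unfolding M_l2_of[OF square_integrable_scaleR[OF square_integrable_rep]]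
    by (intro Bochner_Integration.integral_cong refl) (simp add: abs_mult powr_mult)
  finally show ?thesis by (simp add: M_def)
qed

lemma M_abs: "M (l2_abs U) = M U"
  unfolding M_def
proof (rule integral_cong_AE)
  show "AE x in lebesgue. w x * \<bar>rep_l2 (l2_abs U) x\<bar> powr (\<alpha> + 1) = w x * \<bar>rep_l2 U x\<bar> powr (\<alpha> + 1)"
    using rep_l2_abs[of U] by eventually_elim simp
qed measurable

text \<open>The density of the derivative of \<open>M\<close> at a nonnegative \<open>U\<close>, up
  to the factor \<alpha> + 1. Since \<alpha> < 1 it grows at most linearly and is square
  integrable.\<close>

definition dM :: "('a, real) l2 \<Rightarrow> 'a \<Rightarrow> real" where
  "dM U x = w x * \<bar>rep_l2 U x\<bar> powr \<alpha>"

lemma dM_square_integrable: "square_integrable (dM U)"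
proof (rule square_integrable_bound[where C = C])
  show "square_integrable (\<lambda>x. one x + \<bar>rep_l2 U x\<bar>)"
    by (intro square_integrable_add one_square_integrable square_integrable_abs square_integrable_rep)
  show "dM U \<in> borel_measurable lebesgue" unfolding dM_def[abs_def] by measurable
  show "AE x in lebesgue. norm (dM U x) \<le> C * norm (one x + \<bar>rep_l2 U x\<bar>)"
    using w_bd
  proof eventually_elim
    case (elim x)
    show ?case
    proof (cases "x \<in> \<Omega>")
      case True
      have "\<bar>rep_l2 U x\<bar> powr \<alpha> \<le> 1 + \<bar>rep_l2 U x\<bar>"
      proof (cases "\<bar>rep_l2 U x\<bar> \<le> 1")
        case True
        then have "\<bar>rep_l2 U x\<bar> powr \<alpha> \<le> 1" using alpha by (intro powr_le1) auto
        then show ?thesis by simp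
      next
        case False
        then have "\<bar>rep_l2 U x\<bar> powr \<alpha> \<le> \<bar>rep_l2 U x\<bar> powr 1" using alpha by (intro powr_mono) auto
        then show ?thesis using False by simp
      qed
      then have "\<bar>w x\<bar> * \<bar>rep_l2 U x\<bar> powr \<alpha> \<le> C * (1 + \<bar>rep_l2 U x\<bar>)"
        using elim C by (intro mult_mono) auto
      then show ?thesis using True by (simp add: dM_def abs_mult)
    next
      case False
      then show ?thesis using C w_out by (simp add: dM_def)
    qed
  qed
qed

text \<open>Differentiation under the integral along the steps 1/(n+1), the only ones used by the
  variations. The steps are at most 1, so the Lipschitz estimate for the integrand dominates the
  difference quotients by a fixed function of U and V.\<close>

lemma M_derivative:
  assumes U: "AE x in lebesgue. 0 \<le> rep_l2 U x"
  shows "(\<lambda>n. (M (U + (1 / real (Suc n)) *\<^sub>R V) - M U) / (1 / real (Suc n))) \<longlonglongrightarrow> (\<alpha> + 1) * (l2_of (dM U) \<bullet> V)"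
proof -
  define u v where "u = rep_l2 U" and "v = rep_l2 V"
  have s: "square_integrable u" "square_integrable v" by (simp_all add: u_def v_def square_integrable_rep)
  note [measurable] = square_integrable_measurable[OF s(1)] square_integrable_measurable[OF s(2)]
  define t where "t n = 1 / real (Suc n)" for n
  have t: "0 < t n" "t n \<le> 1" for n by (auto simp: t_def)
  have sn: "square_integrable (\<lambda>x. u x + t n *\<^sub>R v x)" for n by (intro square_integrable_add square_integrable_scaleR s)
  have Un: "U + t n *\<^sub>R V = l2_of (\<lambda>x. u x + t n *\<^sub>R v x)" for n
  proof -
    have "l2_of u = U" "l2_of v = V" by (simp_all add: u_def v_def)
    then show ?thesis by (simp only: l2_of_add[OF s(1) square_integrable_scaleR[OF s(2)]] l2_of_scaleR[OF s(2)])
  qed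
  define q where "q n x = (w x * \<bar>u x + t n *\<^sub>R v x\<bar> powr (\<alpha> + 1) - w x * \<bar>u x\<bar> powr (\<alpha> + 1)) / t n" for n x
  have "(M (U + t n *\<^sub>R V) - M U) / t n = (LINT x|lebesgue. q n x)" for n
  proof -
    have MU: "M U = (LINT x|lebesgue. w x * \<bar>u x\<bar> powr (\<alpha> + 1))" by (simp add: M_def u_def)
    show ?thesis
      unfolding Un M_l2_of[OF sn] MU q_def
      by (simp only: integral_divide_zero Bochner_Integration.integral_diff[OF M_integrable[OF sn] M_integrable[OF s(1)]])
  qed
  moreover have "(\<lambda>n. LINT x|lebesgue. q n x) \<longlonglongrightarrow> (LINT x|lebesgue. (\<alpha> + 1) * (dM U x \<bullet> v x))"
  proof (rule integral_dominated_convergence)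
    have "integrable lebesgue (\<lambda>x. 2 * C * (\<bar>v x\<bar> * (one x + \<bar>2 * u x\<bar> + \<bar>v x\<bar>)))"
      using dominating_integrable[OF s(2) square_integrable_scaleR[OF s(1), of 2] s(2), of "2 * C"] by simp
    then show "integrable lebesgue (\<lambda>x. 2 * C * (\<bar>v x\<bar> * (one x + \<bar>2 * u x\<bar> + \<bar>v x\<bar>)))" .
    show "AE x in lebesgue. (\<lambda>n. q n x) \<longlonglongrightarrow> (\<alpha> + 1) * (dM U x \<bullet> v x)"
      using U
    proof eventually_elim
      case (elim x)
      have d1: "((\<lambda>r. \<bar>r\<bar> powr (\<alpha> + 1)) has_real_derivative (\<alpha> + 1) * u x powr (\<alpha> + 1 - 1)) (at (u x + 0 * v x))"
        using abs_powr_deriv[of "\<alpha> + 1" "u x"] alpha elim by (simp add: u_def)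
      have "((\<lambda>r. u x + r * v x) has_real_derivative v x) (at 0)" by (auto intro!: derivative_eq_intros)
      from DERIV_chain2[OF d1 this]
      have "((\<lambda>r. (\<bar>u x + r * v x\<bar> powr (\<alpha> + 1) - \<bar>u x\<bar> powr (\<alpha> + 1)) / r) \<longlongrightarrow> (\<alpha> + 1) * u x powr \<alpha> * v x) (at 0)"
        by (simp add: DERIV_def)
      moreover have "filterlim t (at 0) sequentially"
      proof -
        have "t \<longlonglongrightarrow> 0" unfolding t_def by (rule LIMSEQ_Suc[OF lim_1_over_n])
        then show ?thesis using t(1) by (auto simp: filterlim_at less_imp_neq[symmetric])
      qed
      ultimately have "(\<lambda>n. (\<bar>u x + t n * v x\<bar> powr (\<alpha> + 1) - \<bar>u x\<bar> powr (\<alpha> + 1)) / t n) \<longlonglongrightarrow> (\<alpha> + 1) * u x powr \<alpha> * v x"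
        by (rule filterlim_compose)
      from tendsto_mult_left[OF this, of "w x"]
      have "(\<lambda>n. w x * ((\<bar>u x + t n * v x\<bar> powr (\<alpha> + 1) - \<bar>u x\<bar> powr (\<alpha> + 1)) / t n)) \<longlonglongrightarrow> w x * ((\<alpha> + 1) * u x powr \<alpha> * v x)" .
      moreover have "q n x = w x * ((\<bar>u x + t n * v x\<bar> powr (\<alpha> + 1) - \<bar>u x\<bar> powr (\<alpha> + 1)) / t n)" for n
        by (simp add: q_def right_diff_distrib)
      moreover have "(\<alpha> + 1) * (dM U x \<bullet> v x) = w x * ((\<alpha> + 1) * u x powr \<alpha> * v x)"
        using elim by (simp add: dM_def u_def)
      ultimately show ?case by (simp only:)
    qed
    show "AE x in lebesgue. norm (q n x) \<le> 2 * C * (\<bar>v x\<bar> * (one x + \<bar>2 * u x\<bar> + \<bar>v x\<bar>))" for n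
      using weighted_powr_diff_le
    proof eventually_elim
      case (elim x)
      have tv: "\<bar>t n * v x\<bar> = t n * \<bar>v x\<bar>" using t(1)[of n] by (simp add: abs_mult)
      have "t n * \<bar>v x\<bar> \<le> \<bar>v x\<bar>" using t[of n] by (simp add: mult_left_le_one_le)
      then have le: "one x + \<bar>u x + t n * v x\<bar> + \<bar>u x\<bar> \<le> one x + \<bar>2 * u x\<bar> + \<bar>v x\<bar>"
        using tv by linarith
      have "\<bar>w x * \<bar>u x + t n *\<^sub>R v x\<bar> powr (\<alpha> + 1) - w x * \<bar>u x\<bar> powr (\<alpha> + 1)\<bar> \<le>
         2 * C * (\<bar>u x + t n *\<^sub>R v x - u x\<bar> * (one x + \<bar>u x + t n *\<^sub>R v x\<bar> + \<bar>u x\<bar>))"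
        using elim by blast
      also have "\<dots> = t n * (2 * C * (\<bar>v x\<bar> * (one x + \<bar>u x + t n * v x\<bar> + \<bar>u x\<bar>)))"
        using tv by simp
      also have "\<dots> \<le> t n * (2 * C * (\<bar>v x\<bar> * (one x + \<bar>2 * u x\<bar> + \<bar>v x\<bar>)))"
        using t(1)[of n] C le by (intro mult_left_mono) auto
      finally show ?case using t(1)[of n] by (simp add: q_def divide_le_eq mult.commute)
    qed
    show "(\<lambda>x. (\<alpha> + 1) * (dM U x \<bullet> v x)) \<in> borel_measurable lebesgue"
      using square_integrable_measurable[OF dM_square_integrable[of U]] by measurable
    show "q n \<in> borel_measurable lebesgue" for n unfolding q_def[abs_def] by measurable
  qed
  moreover have "(LINT x|lebesgue. (\<alpha> + 1) * (dM U x \<bullet> v x)) = (\<alpha> + 1) * (l2_of (dM U) \<bullet> V)"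
    using inner_l2_of[OF dM_square_integrable s(2), of U] by (simp add: v_def)
  ultimately show ?thesis unfolding t_def[symmetric] by (simp only:)
qed

end

section \<open>Constrained minimizers and the Lagrange multiplier\<close>

context weighted_problem
begin

text \<open>A nonnegative minimizer with minimal value \<kappa>, in homogeneous form: neither
  normalisation nor division occurs, and V = 0 is included, so that the inequality may be applied to
  any perturbation without checking that it is nonzero.\<close>

definition critical :: "real \<Rightarrow> ('a, real) l2 \<Rightarrow> ('a, 'a) l2 \<Rightarrow> bool" where
  "critical \<kappa> U G \<longleftrightarrow> (U, G) \<in> W0 \<Omega> \<and> U \<noteq> 0 \<and> 0 \<le> M U \<and> (AE x in lebesgue. 0 \<le> rep_l2 U x) \<and>
     (norm G)\<^sup>2 = \<kappa> * (norm U)\<^sup>2 \<and> (\<forall>V H. (V, H) \<in> W0 \<Omega> \<longrightarrow> 0 \<le> M V \<longrightarrow> \<kappa> * (norm V)\<^sup>2 \<le> (norm H)\<^sup>2)"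

lemma criticalD:
  assumes "critical \<kappa> U G"
  shows "(U, G) \<in> W0 \<Omega>" "U \<noteq> 0" "0 \<le> M U" "AE x in lebesgue. 0 \<le> rep_l2 U x" "(norm G)\<^sup>2 = \<kappa> * (norm U)\<^sup>2"
    "(V, H) \<in> W0 \<Omega> \<Longrightarrow> 0 \<le> M V \<Longrightarrow> \<kappa> * (norm V)\<^sup>2 \<le> (norm H)\<^sup>2"
  using assms by (auto simp: critical_def)

text \<open>Passing to the absolute value changes neither the norm nor \<open>M\<close> and does not
  increase the gradient norm; minimality then forces equality, so the absolute value is a minimizer
  too. Homogeneity of \<open>M\<close> allows competitors to be normalised.\<close>

lemma critical_exists:
  assumes U0: "(U0, G0) \<in> W0 \<Omega>" "U0 \<noteq> 0" "0 \<le> M U0"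
  obtains \<kappa> U G where "critical \<kappa> U G"
proof -
  define c where "c = 1 / norm U0"
  have W: "(c *\<^sub>R U0, c *\<^sub>R G0) \<in> W0 \<Omega>" by (rule W0_scaleR[OF U0(1)])
  have n1: "norm (c *\<^sub>R U0) = 1" using U0(2) by (simp add: c_def)
  have A: "c *\<^sub>R U0 \<in> {U. 0 \<le> M U}" using U0(3) by (simp add: M_scaleR)
  obtain U G where U: "(U, G) \<in> W0 \<Omega>" "U \<in> {U. 0 \<le> M U}" "norm U = 1"
    and min: "\<And>V H. (V, H) \<in> W0 \<Omega> \<Longrightarrow> V \<in> {U. 0 \<le> M U} \<Longrightarrow> norm V = 1 \<Longrightarrow> (norm G)\<^sup>2 \<le> (norm H)\<^sup>2"
    by (rule constrained_minimizer_exists[OF dom M_closed W A n1]) auto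
  have low: "(norm G)\<^sup>2 * (norm V)\<^sup>2 \<le> (norm H)\<^sup>2" if "(V, H) \<in> W0 \<Omega>" "0 \<le> M V" for V H
  proof (cases "V = 0")
    case False
    have "(norm G)\<^sup>2 \<le> (norm ((1 / norm V) *\<^sub>R H))\<^sup>2"
      by (rule min[OF W0_scaleR[OF that(1), of "1 / norm V"]]) (use False that(2) in \<open>simp_all add: M_scaleR\<close>)
    then show ?thesis using False by (simp add: power_divide field_simps)
  qed simp
  obtain H where H: "(l2_abs U, H) \<in> W0 \<Omega>" "norm H \<le> norm G" by (rule W0_abs[OF U(1) dom])
  have nU: "norm (l2_abs U) = 1" by (simp add: norm_l2_abs U(3))
  have "(norm G)\<^sup>2 \<le> (norm H)\<^sup>2" using low[OF H(1)] U(2) nU by (simp add: M_abs)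
  moreover have "(norm H)\<^sup>2 \<le> (norm G)\<^sup>2" using H(2) by (simp add: power_mono)
  ultimately have GH: "(norm H)\<^sup>2 = (norm G)\<^sup>2" by (rule antisym[rotated])
  have "AE x in lebesgue. 0 \<le> rep_l2 (l2_abs U) x" using rep_l2_abs[of U] by eventually_elim simp
  moreover have "l2_abs U \<noteq> 0" using nU by auto
  ultimately have "critical ((norm G)\<^sup>2) (l2_abs U) H"
    unfolding critical_def using H(1) U(2) GH nU low by (simp add: M_abs)
  then show thesis by (rule that)
qed

text \<open>The contradiction common to two situations: an inactive constraint, and a multiplier
  equal to zero. A nonnegative eigenfunction is a multiple of \<Phi>, and \<open>M\<close> is
  negative on all nonzero multiples of \<Phi> by homogeneity.\<close>

lemma critical_eigenpair_M_neg:
  assumes crit: "critical \<kappa> U G" and e: "eigenpair \<Omega> \<kappa> U G" and conn: "connected \<Omega>" "\<Omega> \<noteq> {}"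
    and \<Phi>: "eigenpair \<Omega> (lambda1 \<Omega>) \<Phi> H" "AE x in lebesgue. x \<in> \<Omega> \<longrightarrow> 0 < rep_l2 \<Phi> x" "M \<Phi> < 0"
  shows False
proof -
  note c = criticalD[OF crit]
  have k: "\<kappa> = lambda1 \<Omega>" by (rule nonneg_eigenvalue_first[OF dom(1) \<Phi>(1,2) e c(4,2)])
  obtain b where b: "U = b *\<^sub>R \<Phi>"
    using first_eigenfunction_unique[OF dom conn(2,1) \<Phi>(1,2) e[unfolded k]] by blast
  then have "b \<noteq> 0" using c(2) by auto
  then have "M U < 0" unfolding b M_scaleR using \<Phi>(3) by (intro mult_pos_neg) auto
  then show False using c(3) by simp
qed

text \<open>If M U > 0, continuity of \<open>M\<close> keeps small perturbations in every direction
  admissible, so \<open>U\<close> is a free local minimizer and therefore an eigenfunction.\<close>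

lemma critical_M_zero:
  assumes crit: "critical \<kappa> U G" and conn: "connected \<Omega>" "\<Omega> \<noteq> {}"
    and \<Phi>: "eigenpair \<Omega> (lambda1 \<Omega>) \<Phi> H" "AE x in lebesgue. x \<in> \<Omega> \<longrightarrow> 0 < rep_l2 \<Phi> x" "M \<Phi> < 0"
  shows "M U = 0"
proof (rule ccontr)
  note c = criticalD[OF crit]
  assume "M U \<noteq> 0"
  then have pos: "0 < M U" using c(3) by simp
  have "eigenpair \<Omega> \<kappa> U G"
  proof (rule eigenpair_of_minimizer[OF c(1,5)])
    fix V K assume VK: "(V, K) \<in> W0 \<Omega>"
    have "(\<lambda>n. U + (1 / real (Suc n)) *\<^sub>R V) \<longlonglongrightarrow> U + 0 *\<^sub>R V"
      by (intro tendsto_intros LIMSEQ_Suc[OF lim_1_over_n])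
    then have "(\<lambda>n. M (U + (1 / real (Suc n)) *\<^sub>R V)) \<longlonglongrightarrow> M U" using M_tendsto by simp
    then have "\<forall>\<^sub>F n in sequentially. 0 < M (U + (1 / real (Suc n)) *\<^sub>R V)" using pos by (rule order_tendstoD)
    then show "\<forall>\<^sub>F n in sequentially. \<kappa> * (norm (U + (1 / real (Suc n)) *\<^sub>R V))\<^sup>2 \<le> (norm (G + (1 / real (Suc n)) *\<^sub>R K))\<^sup>2"
      by eventually_elim (intro c(6) W0_add[OF c(1)] W0_scaleR VK, simp)
  qed
  then show False by (rule critical_eigenpair_M_neg[OF crit _ conn \<Phi>])
qed

lemma test_function_not_orthogonal:
  assumes f: "square_integrable f" "\<And>x. x \<notin> \<Omega> \<Longrightarrow> f x = 0" "l2_of f \<noteq> 0"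
  obtains V H where "(V, H) \<in> W0 \<Omega>" "0 < l2_of f \<bullet> V"
proof -
  have "\<exists>\<phi>\<in>test_functions \<Omega>. l2_of f \<bullet> l2_of \<phi> \<noteq> 0"
  proof (rule ccontr)
    assume "\<not> ?thesis"
    then have t: "(LINT x|lebesgue. f x * \<phi> x) = 0" if "\<phi> \<in> test_functions \<Omega>" for \<phi>
      using inner_l2_of[OF f(1) test_square_integrable(1)[OF that]] that by simp
    have "AE x in lebesgue. x \<in> \<Omega> \<longrightarrow> f x = 0"
      by (rule AE_zero_of_test[OF f(1) dom(1)]) (rule t)
    then have "AE x in lebesgue. f x = 0" by eventually_elim (use f(2) in blast)
    then have "l2_of f = l2_of (\<lambda>x. 0)" by (rule l2_of_eqI[OF f(1)])
    then show False using f(3) by (simp add: l2_of_0)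
  qed
  then obtain \<phi> where \<phi>: "\<phi> \<in> test_functions \<Omega>" "l2_of f \<bullet> l2_of \<phi> \<noteq> 0" by blast
  show thesis
  proof (cases "0 < l2_of f \<bullet> l2_of \<phi>")
    case True
    then show thesis using that[OF W0_test[OF \<phi>(1)]] by simp
  next
    case False
    then have "0 < l2_of f \<bullet> ((-1) *\<^sub>R l2_of \<phi>)" using \<phi>(2) by simp
    then show thesis using that[OF W0_scaleR[OF W0_test[OF \<phi>(1)], of "-1"]] by simp
  qed
qed

lemma dM_out: "x \<notin> \<Omega> \<Longrightarrow> dM U x = 0"
  by (simp add: dM_def w_out)

text \<open>\<open>N\<close> is the derivative of the constraint up to a positive factor, and
  \<open>B\<close> is the weak form of the eigenvalue equation. Since M U = 0, directions with N > 0
  enter the admissible set, so B >= 0 there; this extends to the kernel of \<open>N\<close>, where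
  linearity turns it into B = 0. Hence B is a nonnegative multiple of N.\<close>

lemma critical_Lagrange:
  assumes crit: "critical \<kappa> U G" and conn: "connected \<Omega>" "\<Omega> \<noteq> {}"
    and \<Phi>: "eigenpair \<Omega> (lambda1 \<Omega>) \<Phi> H" "AE x in lebesgue. x \<in> \<Omega> \<longrightarrow> 0 < rep_l2 \<Phi> x" "M \<Phi> < 0"
    and nz: "l2_of (dM U) \<noteq> 0"
  obtains \<tau> where "0 < \<tau>" "\<And>V K. (V, K) \<in> W0 \<Omega> \<Longrightarrow>
    \<tau> * (G \<bullet> K) = \<kappa> * \<tau> * (U \<bullet> V) + \<tau> powr \<alpha> * (l2_of (dM U) \<bullet> V)"
proof -
  note c = criticalD[OF crit]
  have M0: "M U = 0" by (rule critical_M_zero[OF crit conn \<Phi>])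
  define N where "N V = l2_of (dM U) \<bullet> V" for V
  define B where "B V K = G \<bullet> K - \<kappa> * (U \<bullet> V)" for V K
  \<comment> \<open>The derivative of \<open>M\<close> in the direction V is positive and M U = 0,
    so U + tV satisfies the constraint for small t > 0 and minimality applies.\<close>
  have s1: "0 \<le> B V K" if VK: "(V, K) \<in> W0 \<Omega>" and pos: "0 < N V" for V K
    unfolding B_def
  proof (rule one_sided_variation)
    have "0 < (\<alpha> + 1) * N V" using pos alpha by simp
    with M_derivative[OF c(4), of V] have "\<forall>\<^sub>F n in sequentially. 0 < (M (U + (1 / real (Suc n)) *\<^sub>R V) - M U) / (1 / real (Suc n))"
      unfolding N_def by (rule order_tendstoD)
    then show "\<forall>\<^sub>F n in sequentially. 0 \<le> 2 * (1 / real (Suc n)) * (G \<bullet> K - \<kappa> * (U \<bullet> V)) +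
       (1 / real (Suc n))\<^sup>2 * ((norm K)\<^sup>2 - \<kappa> * (norm V)\<^sup>2)"
    proof eventually_elim
      case (elim n)
      then have "0 < M (U + (1 / real (Suc n)) *\<^sub>R V)" using M0 by (simp add: zero_less_divide_iff zero_less_mult_iff)
      then have "\<kappa> * (norm (U + (1 / real (Suc n)) *\<^sub>R V))\<^sup>2 \<le> (norm (G + (1 / real (Suc n)) *\<^sub>R K))\<^sup>2"
        by (intro c(6) W0_add[OF c(1)] W0_scaleR VK) simp
      then show ?case
        using quadratic_expansion[of G "1 / real (Suc n)" K \<kappa> U V] c(5) by linarith
    qed
  qed
  obtain V0 K0 where V0: "(V0, K0) \<in> W0 \<Omega>" "0 < N V0"
    unfolding N_def by (rule test_function_not_orthogonal[OF dM_square_integrable dM_out nz])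
  \<comment> \<open>On the kernel of \<open>N\<close> the first-order information does not show
    admissibility; adding a small multiple of the direction \<open>V0\<close> with positive
    \<open>N\<close> repairs this, and the multiple tends to zero.\<close>
  have s2: "0 \<le> B V K" if VK: "(V, K) \<in> W0 \<Omega>" and zero: "N V = 0" for V K
  proof -
    have "0 \<le> B V K + 1 / real (Suc n) * B V0 K0" for n
    proof -
      have "0 \<le> B (V + (1 / real (Suc n)) *\<^sub>R V0) (K + (1 / real (Suc n)) *\<^sub>R K0)"
        by (rule s1[OF W0_add[OF VK W0_scaleR[OF V0(1)]]]) (use zero V0(2) in \<open>simp add: N_def inner_add_right\<close>)
      also have "\<dots> = B V K + 1 / real (Suc n) * B V0 K0"
        by (simp add: B_def inner_add_right diff_divide_distrib distrib_left)
      finally show ?thesis .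
    qed
    moreover have "(\<lambda>n. B V K + 1 / real (Suc n) * B V0 K0) \<longlonglongrightarrow> B V K + 0 * B V0 K0"
      by (intro tendsto_intros LIMSEQ_Suc[OF lim_1_over_n])
    ultimately have "0 \<le> B V K + 0 * B V0 K0" by (intro LIMSEQ_le_const) auto
    then show ?thesis by simp
  qed
  \<comment> \<open>The multiplier is read off from the single direction \<open>V0\<close>; every
    other direction differs from a multiple of \<open>V0\<close> by an element of the kernel of
    \<open>N\<close>.\<close>
  define \<mu> where "\<mu> = B V0 K0 / N V0"
  have \<mu>0: "0 \<le> \<mu>" unfolding \<mu>_def using s1[OF V0] V0(2) by simp
  have B_eq: "B V K = \<mu> * N V" if VK: "(V, K) \<in> W0 \<Omega>" for V K
  proof -
    define r where "r = N V / N V0"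
    have W': "(V - r *\<^sub>R V0, K - r *\<^sub>R K0) \<in> W0 \<Omega>" by (intro W0_diff VK W0_scaleR V0(1))
    have N': "N (V - r *\<^sub>R V0) = 0" using V0(2) by (simp add: N_def r_def inner_diff_right)
    have N'': "N ((-1) *\<^sub>R (V - r *\<^sub>R V0)) = 0"
      using N' by (simp only: N_def inner_scaleR_right mult_zero_right)
    have "B (V - r *\<^sub>R V0) (K - r *\<^sub>R K0) = B V K - r * B V0 K0"
      "B ((-1) *\<^sub>R (V - r *\<^sub>R V0)) ((-1) *\<^sub>R (K - r *\<^sub>R K0)) = - (B V K - r * B V0 K0)"
      by (simp_all add: B_def inner_diff_right algebra_simps)
    then have "B V K = r * B V0 K0" using s2[OF W' N'] s2[OF W0_scaleR[OF W', of "-1"] N''] by simp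
    then show ?thesis by (simp add: r_def \<mu>_def)
  qed
  have "\<mu> \<noteq> 0"
  proof
    assume "\<mu> = 0"
    then have "eigenpair \<Omega> \<kappa> U G" unfolding eigenpair_def using c(1) B_eq by (auto simp: B_def)
    then show False by (rule critical_eigenpair_M_neg[OF crit _ conn \<Phi>])
  qed
  with \<mu>0 have \<mu>: "0 < \<mu>" by simp
  \<comment> \<open>Solves \<tau>^(\<alpha>-1) = \<mu>: scaling by \<tau> multiplies the linear
    terms by \<tau> and the nonlinear one by \<tau>^\<alpha>, and the choice makes the coefficient
    of the latter equal to 1. It is possible since \<mu> > 0 and \<alpha> < 1.\<close>
  define \<tau> where "\<tau> = (1 / \<mu>) powr (1 / (1 - \<alpha>))"
  have \<tau>: "0 < \<tau>" using \<mu> by (simp add: \<tau>_def)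
  have "\<tau> powr (\<alpha> - 1) = (1 / \<mu>) powr (- 1)"
  proof -
    have "1 / (1 - \<alpha>) * (\<alpha> - 1) = -1" using alpha by (simp add: field_simps)
    then show ?thesis by (simp add: \<tau>_def powr_powr)
  qed
  also have "\<dots> = \<mu>" using \<mu> by (simp add: powr_minus_divide)
  finally have "\<tau> powr (\<alpha> - 1) = \<mu>" .
  moreover have "\<tau> powr \<alpha> = \<tau> * \<tau> powr (\<alpha> - 1)" using \<tau> by (simp add: powr_mult_base)
  ultimately have t: "\<tau> powr \<alpha> = \<tau> * \<mu>" by simp
  show thesis
  proof (rule that[OF \<tau>])
    fix V K assume "(V, K) \<in> W0 \<Omega>"
    from B_eq[OF this] have "G \<bullet> K = \<kappa> * (U \<bullet> V) + \<mu> * N V" by (simp add: B_def)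
    then show "\<tau> * (G \<bullet> K) = \<kappa> * \<tau> * (U \<bullet> V) + \<tau> powr \<alpha> * (l2_of (dM U) \<bullet> V)"
      by (simp add: t N_def algebra_simps)
  qed
qed

text \<open>The source of competitors: every function living where the weight is nonnegative
  satisfies the constraint, in particular the first eigenfunction of such a domain.\<close>

lemma M_nonneg_of_support:
  assumes "(V, H) \<in> W0 D" "open D" "\<And>x. x \<in> D \<Longrightarrow> 0 \<le> w x"
  shows "0 \<le> M V"
  unfolding M_def
proof (rule integral_nonneg_AE)
  show "AE x in lebesgue. 0 \<le> w x * \<bar>rep_l2 V x\<bar> powr (\<alpha> + 1)"
    using W0_vanishes_outside(1)[OF assms(1,2)]
  proof eventually_elim
    case (elim x)
    then show ?case using assms(3)[of x] by (cases "x \<in> D") auto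
  qed
qed

text \<open>For a nonpositive weight the integrand of \<open>M\<close> is nonpositive, so M V >= 0
  forces it to vanish almost everywhere.\<close>

lemma zero_of_nonneg_M:
  assumes V: "(V, H) \<in> W0 \<Omega>" "0 \<le> M V" and w: "AE x in lebesgue. w x \<le> 0"
  shows "AE x in lebesgue. w x = 0 \<or> rep_l2 V x = 0"
proof -
  have i: "integrable lebesgue (\<lambda>x. w x * \<bar>rep_l2 V x\<bar> powr (\<alpha> + 1))"
    by (rule M_integrable[OF square_integrable_rep])
  have nn: "AE x in lebesgue. 0 \<le> - (w x * \<bar>rep_l2 V x\<bar> powr (\<alpha> + 1))"
    using w by eventually_elim (simp add: mult_nonpos_nonneg)
  have "0 \<le> (LINT x|lebesgue. - (w x * \<bar>rep_l2 V x\<bar> powr (\<alpha> + 1)))" by (rule integral_nonneg_AE[OF nn])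
  then have "(LINT x|lebesgue. - (w x * \<bar>rep_l2 V x\<bar> powr (\<alpha> + 1))) = 0" using V(2) by (simp add: M_def)
  then have "AE x in lebesgue. - (w x * \<bar>rep_l2 V x\<bar> powr (\<alpha> + 1)) = 0"
    using integral_nonneg_eq_0_iff_AE[OF integrable_minus[OF i] nn] by blast
  then show ?thesis by eventually_elim auto
qed

end

section \<open>Minimizers and weak solutions\<close>

lemma open_lebesgue_null_iff:
  fixes S :: "'a::euclidean_space set"
  assumes "open S" "bounded S"
  shows "measure lebesgue S = 0 \<longleftrightarrow> S = {}"
proof
  assume 0: "measure lebesgue S = 0"
  have m: "S \<in> lmeasurable" using assms by (simp add: bounded_set_imp_lmeasurable)
  then have "negligible S" using 0 by (simp add: negligible_iff_measure)
  then show "S = {}" using assms(1) open_not_negligible by blast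
qed simp

section \<open>The functionals of the problem in terms of \<open>l2\<close>\<close>

lemma H01_scale:
  assumes D: "open D" and u: "u \<in> H01 D"
  shows "(\<lambda>x. c * u x) \<in> H01 D" "l2_of (zext D (\<lambda>x. c * u x)) = c *\<^sub>R l2_of (zext D u)"
    "l2_of (zext D (wgrad D (\<lambda>x. c * u x))) = c *\<^sub>R l2_of (zext D (wgrad D u))"
proof -
  note uH = H01_W0[OF D u] and Ds = lebesgue_open[OF D]
  have su: "square_integrable (zext D u)" using uH(1) by (simp add: L2_iff_square_integrable[OF Ds])
  have z: "zext D (\<lambda>x. c * u x) = (\<lambda>x. c *\<^sub>R zext D u x)" by (auto simp: zext_def)
  show eq: "l2_of (zext D (\<lambda>x. c * u x)) = c *\<^sub>R l2_of (zext D u)" unfolding z by (rule l2_of_scaleR[OF su])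
  have L: "(\<lambda>x. c * u x) \<in> L2 D"
    unfolding L2_iff_square_integrable[OF Ds] z by (rule square_integrable_scaleR[OF su])
  have W: "(l2_of (zext D (\<lambda>x. c * u x)), c *\<^sub>R l2_of (zext D (wgrad D u))) \<in> W0 D"
    unfolding eq by (rule W0_scaleR[OF uH(3)])
  show "(\<lambda>x. c * u x) \<in> H01 D" "l2_of (zext D (wgrad D (\<lambda>x. c * u x))) = c *\<^sub>R l2_of (zext D (wgrad D u))"
    using H01_of_W0[OF D L W] by simp_all
qed

lemma H_fun_eq:
  assumes D: "open D" and u: "u \<in> H01 D"
  shows "H_fun D \<mu> u = (norm (l2_of (zext D (wgrad D u))))\<^sup>2 - \<mu> * (norm (l2_of (zext D u)))\<^sup>2"
proof -
  note uH = H01_W0[OF D u] and Ds = lebesgue_open[OF D]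
  have "H_fun D \<mu> u = (LINT x|lebesgue_on D. (norm (wgrad D u x))\<^sup>2) - \<mu> * (LINT x|lebesgue_on D. (norm (u x))\<^sup>2)"
    unfolding H_fun_def using L2_integrable_norm_sq[OF uH(1)] L2_integrable_norm_sq[OF uH(2)] by simp
  then show ?thesis by (simp only: L2_norm_sq[OF Ds uH(1)] L2_norm_sq[OF Ds uH(2)])
qed

lemma rayleigh_eq:
  assumes D: "open D" and u: "u \<in> H01 D"
  shows "rayleigh D u = (norm (l2_of (zext D (wgrad D u))))\<^sup>2 / (norm (l2_of (zext D u)))\<^sup>2"
  using L2_norm_sq[OF lebesgue_open[OF D] H01_W0(1)[OF D u]] L2_norm_sq[OF lebesgue_open[OF D] H01_W0(2)[OF D u]]
  by (simp add: rayleigh_def)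

lemma graph_boundary_mono: "graph_boundary P D \<Longrightarrow> (\<And>\<gamma>. P \<gamma> \<Longrightarrow> Q \<gamma>) \<Longrightarrow> graph_boundary Q D"
  unfolding graph_boundary_def by meson

theorem theorem4:
  fixes \<Omega> :: "'a::euclidean_space set"
    and m \<phi> :: "'a \<Rightarrow> real"
    and \<alpha> :: real
  assumes "is_domain \<Omega>" and "bounded \<Omega>" and "C1_boundary \<Omega>"
    and "0 < \<alpha>" and "\<alpha> < 1"
    and "m \<in> Linfty \<Omega>"
    and "0 < measure lebesgue (Omega_zero \<Omega> m \<union> Omega_plus \<Omega> m)"
    and "domain_regularity \<Omega> m"
    and "pos_first_eigenfunction \<Omega> \<phi>"
    and "(LINT x|lebesgue_on \<Omega>. m x * \<phi> x powr (\<alpha> + 1)) < 0"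
  shows
    "((\<exists>u. nonneg_minimizer \<Omega> m \<alpha> u) \<and>
      (\<forall>u. nonneg_minimizer \<Omega> m \<alpha> u \<longrightarrow>
         H_fun \<Omega> (lambda_star \<Omega> m \<alpha>) u = 0 \<and> M_fun \<Omega> m \<alpha> u = 0)) \<and>
     (measure lebesgue (Omega_plus \<Omega> m) = 0 \<longrightarrow>
        lambda_star \<Omega> m \<alpha> = lambda1 (Omega_zero \<Omega> m) \<and>
        (\<exists>\<phi>\<^sub>0. pos_first_eigenfunction (Omega_zero \<Omega> m) \<phi>\<^sub>0) \<and>
        (\<forall>u \<phi>\<^sub>0. nonneg_minimizer \<Omega> m \<alpha> u \<and>
           pos_first_eigenfunction (Omega_zero \<Omega> m) \<phi>\<^sub>0 \<longrightarrow>
           (\<exists>c>0. AE x in lebesgue_on \<Omega>.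
              u x = c * (if x \<in> Omega_zero \<Omega> m then \<phi>\<^sub>0 x else 0)))) \<and>
     (measure lebesgue (Omega_zero \<Omega> m) = 0 \<or>
      (0 < measure lebesgue (Omega_zero \<Omega> m) \<and>
       is_domain (Omega_zero \<Omega> m \<union> Omega_plus \<Omega> m) \<and>
       lambda1 (Omega_zero \<Omega> m \<union> Omega_plus \<Omega> m) < lambda1 (Omega_zero \<Omega> m)) \<longrightarrow>
        (\<forall>u. nonneg_minimizer \<Omega> m \<alpha> u \<longrightarrow>
           (\<exists>\<tau>>0. weak_solution \<Omega> m \<alpha> (lambda_star \<Omega> m \<alpha>) (\<lambda>x. \<tau> * u x) \<and>
              E_second \<Omega> m \<alpha> (lambda_star \<Omega> m \<alpha>) (\<lambda>x. \<tau> * u x) = 0)))"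
proof -
  have dm: "open \<Omega>" "connected \<Omega>" "\<Omega> \<noteq> {}" using assms(1) by (auto simp: is_domain_def)
  note Os = lebesgue_open[OF dm(1)]
  define w where "w = zext \<Omega> m"
  obtain C0 where C0: "AE x in lebesgue_on \<Omega>. \<bar>m x\<bar> \<le> C0" and mm: "m \<in> borel_measurable (lebesgue_on \<Omega>)"
    using assms(6) by (auto simp: Linfty_def)
  define C where "C = max C0 0"
  have wm [measurable]: "w \<in> borel_measurable lebesgue"
    using mm Os unfolding w_def zext_def[abs_def] by (simp add: borel_measurable_restrict_space_iff)
  have w_bd: "AE x in lebesgue. \<bar>w x\<bar> \<le> C"
    using C0[unfolded AE_lebesgue_on[OF Os]]
  proof eventually_elim
    case (elim x)
    then show ?case by (cases "x \<in> \<Omega>") (auto simp: w_def C_def)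
  qed
  interpret weighted_problem \<Omega> w \<alpha> C
    by unfold_locales (use dm assms(2,4,5) wm w_bd in \<open>auto simp: C_def w_def\<close>)
  have M_eq: "M_fun \<Omega> m \<alpha> u = M (l2_of (zext \<Omega> u))" if u: "u \<in> L2 \<Omega>" for u
  proof -
    have su: "square_integrable (zext \<Omega> u)" using u by (simp add: L2_iff_square_integrable[OF Os])
    show ?thesis
      unfolding M_fun_def integral_lebesgue_on_indicator[OF Os] M_l2_of[OF su]
      by (intro Bochner_Integration.integral_cong refl) (simp add: w_def zext_def indicator_def)
  qed
  let ?E = "\<lambda>u::'a \<Rightarrow> real. l2_of (zext \<Omega> u)" and ?G = "\<lambda>u. l2_of (zext \<Omega> (wgrad \<Omega> u))"
  let ?k = "lambda_star \<Omega> m \<alpha>"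
  note H = H01_W0[OF dm(1)]
  have adm: "u \<in> admissible \<Omega> m \<alpha> \<longleftrightarrow> u \<in> H01 \<Omega> \<and> ?E u \<noteq> 0 \<and> 0 \<le> M (?E u)" for u
    unfolding admissible_def using nonzero_on_iff[OF Os H(1)] M_eq[OF H(1)] by auto
  have rep_H01: "rep_l2 U \<in> H01 \<Omega> \<and> ?E (rep_l2 U) = U \<and> ?G (rep_l2 U) = K" if W: "(U, K) \<in> W0 \<Omega>" for U K
  proof -
    note z = W0_zext_rep[OF W dm(1)]
    have "(?E (rep_l2 U), K) \<in> W0 \<Omega>" using W z(1) by simp
    from H01_of_W0[OF dm(1) z(2) this] z(1) show ?thesis by simp
  qed
  have nonneg_rep: "(AE x in lebesgue_on \<Omega>. 0 \<le> u x) \<longleftrightarrow> (AE x in lebesgue. 0 \<le> rep_l2 (?E u) x)" if u: "u \<in> L2 \<Omega>" for u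
  proof -
    have r: "AE x in lebesgue. rep_l2 (?E u) x = zext \<Omega> u x"
      using u by (intro rep_l2_of) (simp add: L2_iff_square_integrable[OF Os])
    have "(AE x in lebesgue. x \<in> \<Omega> \<longrightarrow> 0 \<le> u x) \<longleftrightarrow> (AE x in lebesgue. 0 \<le> zext \<Omega> u x)"
      by (intro AE_cong) (auto simp: zext_def indicator_def)
    also have "\<dots> \<longleftrightarrow> (AE x in lebesgue. 0 \<le> rep_l2 (?E u) x)"
      using r by (auto elim!: AE_mp)
    finally show ?thesis by (simp add: AE_lebesgue_on[OF Os])
  qed

  \<comment> \<open>\<open>D\<close> is \<Omega>^0 and \<open>P\<close> its union with \<Omega>^+.
    On \<open>P\<close> the weight is nonnegative, on \<open>D\<close> it is zero; \<open>P\<close>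
    is open by the regularity assumption although m is only measurable.\<close>
  define D P where "D = Omega_zero \<Omega> m" and "P = Omega_zero \<Omega> m \<union> Omega_plus \<Omega> m"
  have D: "open D" "D \<subseteq> zero_set \<Omega> m" "D \<subseteq> \<Omega>"
    using interior_subset[of "zero_set \<Omega> m"] by (auto simp: D_def Omega_zero_def zero_set_def)
  have Db: "bounded D" using D(3) assms(2) bounded_subset by blast
  have reg: "lipschitz_domain P" "0 < measure lebesgue D \<Longrightarrow> lipschitz_domain D"
    "0 < measure lebesgue D \<Longrightarrow> compact (closure D)"
    "negligible (sym_diff (zero_set \<Omega> m) (closure D))"
    using assms(8) by (auto simp: domain_regularity_def D_def P_def)
  have P: "open P" "P \<noteq> {}" "P \<subseteq> \<Omega>"
    using reg(1) D(3) by (auto simp: lipschitz_domain_def is_domain_def P_def D_def Omega_plus_def)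
  have wP: "0 \<le> w x" if "x \<in> P" for x
    using that D(2) P(3) by (auto simp: w_def P_def D_def Omega_plus_def zero_set_def)
  have wD: "w x = 0" if "x \<in> D" for x
    using that D(2,3) by (auto simp: w_def zero_set_def)

  \<comment> \<open>A bump in \<open>P\<close> shows that the constraint set contains a nonzero
    function, so the infimum is not taken over the empty set.\<close>
  obtain \<psi> where \<psi>: "\<psi> \<in> test_functions P" "l2_of \<psi> \<noteq> 0" by (rule test_function_nonzero[OF P(1,2)])
  have "(l2_of \<psi>, l2_of (grad \<psi>)) \<in> W0 \<Omega>" using W0_test[OF \<psi>(1)] W0_mono[OF P(3)] by blast
  then obtain \<kappa> U0 G0 where crit0: "critical \<kappa> U0 G0"
    using critical_exists[OF _ \<psi>(2) M_nonneg_of_support[OF W0_test[OF \<psi>(1)] P(1) wP]] by blast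
  note c0 = criticalD[OF crit0]
  note r0 = rep_H01[OF c0(1)]
  have adm0: "rep_l2 U0 \<in> admissible \<Omega> m \<alpha>" unfolding adm using r0 c0(2,3) by simp
  have ray0: "rayleigh \<Omega> (rep_l2 U0) = \<kappa>"
    using rayleigh_eq[OF dm(1), of "rep_l2 U0"] r0 c0(2,5) by simp
  have ray: "\<kappa> \<le> rayleigh \<Omega> u" if "u \<in> admissible \<Omega> m \<alpha>" for u
  proof -
    from that have u: "u \<in> H01 \<Omega>" "?E u \<noteq> 0" "0 \<le> M (?E u)" by (auto simp: adm)
    have "\<kappa> * (norm (?E u))\<^sup>2 \<le> (norm (?G u))\<^sup>2" by (rule c0(6)[OF H(3)[OF u(1)] u(3)])
    then show ?thesis using u(2) by (simp add: rayleigh_eq[OF dm(1) u(1)] le_divide_eq)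
  qed
  have star: "?k = \<kappa>"
    unfolding lambda_star_def by (rule cInf_eq_minimum) (use adm0 ray0 ray in \<open>auto intro: rev_image_eqI\<close>)
  \<comment> \<open>Parts (i) to (iii) concern every nonnegative minimizer, not only the constructed
    one. This equivalence hands each of them to the results about \<open>critical\<close>, with the
    minimal value already identified as \<open>lambda_star\<close>.\<close>
  have nm: "nonneg_minimizer \<Omega> m \<alpha> u \<longleftrightarrow> u \<in> H01 \<Omega> \<and> critical ?k (?E u) (?G u)" for u
  proof
    assume u: "nonneg_minimizer \<Omega> m \<alpha> u"
    then have u1: "u \<in> H01 \<Omega>" "?E u \<noteq> 0" "0 \<le> M (?E u)" "rayleigh \<Omega> u = ?k" "AE x in lebesgue_on \<Omega>. 0 \<le> u x"
      by (auto simp: nonneg_minimizer_def adm)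
    have "(norm (?G u))\<^sup>2 = ?k * (norm (?E u))\<^sup>2"
      using u1(2,4) by (simp add: rayleigh_eq[OF dm(1) u1(1)] divide_eq_eq)
    then show "u \<in> H01 \<Omega> \<and> critical ?k (?E u) (?G u)"
      unfolding critical_def using u1 H[OF u1(1)] nonneg_rep[OF H(1)[OF u1(1)]] c0(6) star by simp
  next
    assume "u \<in> H01 \<Omega> \<and> critical ?k (?E u) (?G u)"
    then have u: "u \<in> H01 \<Omega>" and c: "critical ?k (?E u) (?G u)" by auto
    note c' = criticalD[OF c]
    show "nonneg_minimizer \<Omega> m \<alpha> u"
      unfolding nonneg_minimizer_def adm using u c'(2,3,4,5) nonneg_rep[OF H(1)[OF u]]
      by (simp add: rayleigh_eq[OF dm(1) u])
  qed
  have ex: "\<exists>u. nonneg_minimizer \<Omega> m \<alpha> u"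
    unfolding nm using r0 crit0 star by (intro exI[of _ "rep_l2 U0"]) simp

  define \<Phi> where "\<Phi> = ?E \<phi>"
  have \<phi>: "dirichlet_eigenfunction \<Omega> (lambda1 \<Omega>) \<phi>" "AE x in lebesgue_on \<Omega>. 0 < \<phi> x"
    using assms(9) by (auto simp: pos_first_eigenfunction_def)
  from \<phi>(1) obtain GP where \<phi>L: "\<phi> \<in> L2 \<Omega>" and \<Phi>1: "eigenpair \<Omega> (lambda1 \<Omega>) \<Phi> GP"
    by (auto simp: dirichlet_eigenfunction_iff[OF dm(1)] \<Phi>_def)
  have r\<phi>: "AE x in lebesgue. rep_l2 \<Phi> x = zext \<Omega> \<phi> x"
    unfolding \<Phi>_def using \<phi>L by (intro rep_l2_of) (simp add: L2_iff_square_integrable[OF Os])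
  have \<Phi>2: "AE x in lebesgue. x \<in> \<Omega> \<longrightarrow> 0 < rep_l2 \<Phi> x"
    using r\<phi> \<phi>(2)[unfolded AE_lebesgue_on[OF Os]] by eventually_elim simp
  have \<Phi>3: "M \<Phi> < 0"
  proof -
    have "M \<Phi> = M_fun \<Omega> m \<alpha> \<phi>" unfolding \<Phi>_def by (rule M_eq[OF \<phi>L, symmetric])
    also have "\<dots> = (LINT x|lebesgue_on \<Omega>. m x * \<phi> x powr (\<alpha> + 1))"
      unfolding M_fun_def
    proof (rule integral_cong_AE)
      have [measurable]: "\<phi> \<in> borel_measurable (lebesgue_on \<Omega>)" using \<phi>L by (simp add: L2_def)
      note [measurable] = mm
      show "(\<lambda>x. m x * \<bar>\<phi> x\<bar> powr (\<alpha> + 1)) \<in> borel_measurable (lebesgue_on \<Omega>)"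
        "(\<lambda>x. m x * \<phi> x powr (\<alpha> + 1)) \<in> borel_measurable (lebesgue_on \<Omega>)" by measurable
      show "AE x in lebesgue_on \<Omega>. m x * \<bar>\<phi> x\<bar> powr (\<alpha> + 1) = m x * \<phi> x powr (\<alpha> + 1)"
        using \<phi>(2) by eventually_elim simp
    qed
    finally show ?thesis using assms(10) by simp
  qed

  have one: "H_fun \<Omega> ?k u = 0 \<and> M_fun \<Omega> m \<alpha> u = 0" if "nonneg_minimizer \<Omega> m \<alpha> u" for u
  proof -
    from that have u: "u \<in> H01 \<Omega>" "critical ?k (?E u) (?G u)" by (auto simp: nm)
    show ?thesis
      using H_fun_eq[OF dm(1) u(1)] M_eq[OF H(1)[OF u(1)]] criticalD(5)[OF u(2)]
        critical_M_zero[OF u(2) dm(2,3) \<Phi>1 \<Phi>2 \<Phi>3] by simp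
  qed

  \<comment> \<open>Up to a null set the zero set of m is the closure of \<open>D\<close>, so a
    function vanishing where m is nonzero vanishes outside that closure; the Lipschitz boundary then
    places it in \<open>W0 D\<close>.\<close>
  have support: "(V, K) \<in> W0 D"
    if V: "(V, K) \<in> W0 \<Omega>" "AE x in lebesgue. w x = 0 \<or> rep_l2 V x = 0" and pos: "0 < measure lebesgue D" for V K
  proof (rule W0_closure_support[OF D(1) reg(3)[OF pos]])
    show "graph_boundary (\<lambda>\<gamma>. continuous_on UNIV \<gamma>) D"
      using reg(2)[OF pos] unfolding lipschitz_domain_def
      by (auto elim!: graph_boundary_mono intro: lipschitz_on_continuous_on)
    show "(V, K) \<in> W0 UNIV" using V(1) W0_mono[of \<Omega> UNIV] by auto
    have "AE x in lebesgue. x \<notin> sym_diff (zero_set \<Omega> m) (closure D)"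
      using reg(4) by (intro AE_not_in) (simp add: negligible_iff_null_sets)
    with V(2) W0_vanishes_outside(1)[OF V(1) dm(1)]
    show "AE x in lebesgue. x \<notin> closure D \<longrightarrow> rep_l2 V x = 0"
    proof eventually_elim
      case (elim x)
      then show ?case by (cases "x \<in> \<Omega>") (auto simp: w_def zero_set_def)
    qed
  qed
  \<comment> \<open>Functions on \<Omega>^0 do not see the weight, so all of them are admissible
    with M = 0.\<close>
  have in_D: "(V, K) \<in> W0 \<Omega> \<and> M V = 0" if "(V, K) \<in> W0 D" for V K
  proof
    show "(V, K) \<in> W0 \<Omega>" using that W0_mono[OF D(3)] by blast
    have "AE x in lebesgue. w x * \<bar>rep_l2 V x\<bar> powr (\<alpha> + 1) = 0"
      using W0_vanishes_outside(1)[OF that D(1)] by eventually_elim (use wD in auto)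
    then show "M V = 0" unfolding M_def by (rule integral_eq_zero_AE)
  qed

  \<comment> \<open>If \<Omega>^+ is null the weight is nonpositive, so minimizers belong to
    \<open>W0 D\<close>, while conversely all of \<open>W0 D\<close> is admissible. The constrained
    problem thus has the same value as the eigenvalue problem on \<open>D\<close>, and minimizers
    are multiples of its positive eigenfunction by simplicity.\<close>
  have two: "?k = lambda1 D \<and> (\<exists>\<phi>\<^sub>0. pos_first_eigenfunction D \<phi>\<^sub>0) \<and>
        (\<forall>u \<phi>\<^sub>0. nonneg_minimizer \<Omega> m \<alpha> u \<and> pos_first_eigenfunction D \<phi>\<^sub>0 \<longrightarrow>
           (\<exists>c>0. AE x in lebesgue_on \<Omega>. u x = c * (if x \<in> D then \<phi>\<^sub>0 x else 0)))"
    if plus0: "measure lebesgue (Omega_plus \<Omega> m) = 0"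
  proof -
    have plus_eq: "Omega_plus \<Omega> m = {x \<in> space lebesgue. 0 < w x} \<inter> \<Omega>"
      by (auto simp: Omega_plus_def w_def)
    have "Omega_plus \<Omega> m \<in> sets lebesgue" unfolding plus_eq using Os by (intro sets.Int) measurable
    moreover have "bounded (Omega_plus \<Omega> m)" by (rule bounded_subset[OF assms(2)]) (auto simp: Omega_plus_def)
    ultimately have null: "Omega_plus \<Omega> m \<in> null_sets lebesgue"
      using plus0 by (metis bounded_set_imp_lmeasurable negligible_iff_measure negligible_iff_null_sets)
    have Dpos: "0 < measure lebesgue D"
      using assms(7) measure_Un_null_set[OF lebesgue_open[OF D(1)] null] by (simp add: D_def)
    then have Dn: "D \<noteq> {}" by auto
    have Dc: "connected D" using reg(2)[OF Dpos] by (simp add: lipschitz_domain_def is_domain_def)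
    have wneg: "AE x in lebesgue. w x \<le> 0"
      using AE_not_in[OF null] by eventually_elim (auto simp: Omega_plus_def w_def zext_def indicator_def not_less)
    obtain F K where F: "eigenpair D (lambda1 D) F K" "norm F = 1" "AE x in lebesgue. x \<in> D \<longrightarrow> 0 < rep_l2 F x"
      by (rule positive_first_eigenpair[OF D(1) Db Dn Dc])
    have crit_D: "(V, J) \<in> W0 D" if "critical ?k V J" for V J
      using support[OF _ zero_of_nonneg_M[OF _ _ wneg] Dpos] criticalD(1,3)[OF that] by blast
    have "\<kappa> * (norm F)\<^sup>2 \<le> (norm K)\<^sup>2" using in_D[OF eigenpair_W0[OF F(1)]] by (intro c0(6)) auto
    then have le: "\<kappa> \<le> lambda1 D" using eigenpair_norm[OF F(1)] F(2) by simp
    have "(U0, G0) \<in> W0 D" using crit_D crit0 star by simp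
    then have "lambda1 D * (norm U0)\<^sup>2 \<le> \<kappa> * (norm U0)\<^sup>2" using lambda1_le[OF D(1) Db Dn] c0(5) by metis
    then have "lambda1 D \<le> \<kappa>" using c0(2) by simp
    with le have k: "?k = lambda1 D" using star by simp
    have "F \<noteq> 0" using F(2) by auto
    then have "pos_first_eigenfunction D (rep_l2 F)"
      unfolding pos_first_eigenfunction_def
      using eigenpair_imp_dirichlet_eigenfunction[OF D(1) F(1)] F(3) AE_lebesgue_on[OF lebesgue_open[OF D(1)]] by auto
    then have ex0: "\<exists>\<phi>\<^sub>0. pos_first_eigenfunction D \<phi>\<^sub>0" by blast
    have uniq: "\<exists>c>0. AE x in lebesgue_on \<Omega>. u x = c * (if x \<in> D then \<phi>\<^sub>0 x else 0)"
      if u: "nonneg_minimizer \<Omega> m \<alpha> u" and p: "pos_first_eigenfunction D \<phi>\<^sub>0" for u \<phi>\<^sub>0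
    proof -
      note Ds = lebesgue_open[OF D(1)]
      define F0 where "F0 = l2_of (zext D \<phi>\<^sub>0)"
      from p have p': "dirichlet_eigenfunction D (lambda1 D) \<phi>\<^sub>0" "AE x in lebesgue_on D. 0 < \<phi>\<^sub>0 x"
        by (auto simp: pos_first_eigenfunction_def)
      from p'(1) obtain K0 where pL: "\<phi>\<^sub>0 \<in> L2 D" and F0: "eigenpair D (lambda1 D) F0 K0" "F0 \<noteq> 0"
        by (auto simp: dirichlet_eigenfunction_iff[OF D(1)] F0_def)
      have sp: "square_integrable (zext D \<phi>\<^sub>0)" using pL by (simp add: L2_iff_square_integrable[OF Ds])
      have F0pos: "AE x in lebesgue. x \<in> D \<longrightarrow> 0 < rep_l2 F0 x"
        using rep_l2_of[OF sp] p'(2)[unfolded AE_lebesgue_on[OF Ds]] unfolding F0_def by eventually_elim simp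
      from u have uH: "u \<in> H01 \<Omega>" and uc: "critical ?k (?E u) (?G u)" by (auto simp: nm)
      note c = criticalD[OF uc] and uD = crit_D[OF uc]
      have "eigenpair D (lambda1 D) (?E u) (?G u)"
        by (rule eigenpair_lambda1[OF D(1) Db Dn uD]) (use c(5) k in simp)
      then obtain b where b: "?E u = b *\<^sub>R F0"
        using first_eigenfunction_unique[OF D(1) Db Dn Dc F0(1) F0pos] by blast
      have "0 < ?E u \<bullet> F0" by (rule inner_pos_of_nonneg[OF uD D(1) c(4,2) F0pos])
      then have "0 < b * (F0 \<bullet> F0)" by (simp add: b)
      then have bpos: "0 < b" using inner_ge_zero[of F0] by (simp add: zero_less_mult_iff)
      have su: "square_integrable (zext \<Omega> u)" using H(1)[OF uH] by (simp add: L2_iff_square_integrable[OF Os])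
      have "?E u = l2_of (\<lambda>x. b *\<^sub>R zext D \<phi>\<^sub>0 x)" by (simp only: b F0_def l2_of_scaleR[OF sp])
      then have "AE x in lebesgue. zext \<Omega> u x = b *\<^sub>R zext D \<phi>\<^sub>0 x"
        using l2_of_eq_iff[OF su square_integrable_scaleR[OF sp]] by blast
      then have "AE x in lebesgue. x \<in> \<Omega> \<longrightarrow> u x = b * (if x \<in> D then \<phi>\<^sub>0 x else 0)"
        by eventually_elim (auto simp: zext_def indicator_def)
      then show ?thesis using bpos unfolding AE_lebesgue_on[OF Os] by blast
    qed
    show ?thesis using k ex0 uniq by blast
  qed

  have three: "\<exists>\<tau>>0. weak_solution \<Omega> m \<alpha> ?k (\<lambda>x. \<tau> * u x) \<and> E_second \<Omega> m \<alpha> ?k (\<lambda>x. \<tau> * u x) = 0"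
    if cond: "measure lebesgue D = 0 \<or> (0 < measure lebesgue D \<and> is_domain P \<and> lambda1 P < lambda1 D)"
      and u: "nonneg_minimizer \<Omega> m \<alpha> u" for u
  proof -
    from u have uH: "u \<in> H01 \<Omega>" and uc: "critical ?k (?E u) (?G u)" by (auto simp: nm)
    note c = criticalD[OF uc]
    \<comment> \<open>If the derivative of \<open>M\<close> vanished, u would live on the zero set
      of m. When \<Omega>^0 is null this makes u zero. Otherwise u belongs to \<open>W0 D\<close>,
      so the minimum is at least \<open>lambda1 D\<close>; but the first eigenfunction of
      \<open>P\<close> is admissible, so the minimum is at most \<open>lambda1 P\<close>, against
      the strict inequality.\<close>
    have nz: "l2_of (dM (?E u)) \<noteq> 0"
    proof
      assume "l2_of (dM (?E u)) = 0"
      then have "AE x in lebesgue. dM (?E u) x = 0"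
        using l2_of_eq_iff[OF dM_square_integrable square_integrable_0] by (simp add: l2_of_0)
      then have z: "AE x in lebesgue. w x = 0 \<or> rep_l2 (?E u) x = 0"
        by eventually_elim (auto simp: dM_def)
      from cond show False
      proof
        assume "measure lebesgue D = 0"
        then have "D = {}" using open_lebesgue_null_iff[OF D(1) Db] by blast
        then have "negligible (zero_set \<Omega> m)" using reg(4) by simp
        then have "AE x in lebesgue. x \<notin> zero_set \<Omega> m"
          by (intro AE_not_in) (simp add: negligible_iff_null_sets)
        with z W0_vanishes_outside(1)[OF c(1) dm(1)] have "AE x in lebesgue. rep_l2 (?E u) x = 0"
        proof eventually_elim
          case (elim x)
          then show ?case by (cases "x \<in> \<Omega>") (auto simp: w_def zero_set_def)
        qed
        then have "l2_of (rep_l2 (?E u)) = l2_of (\<lambda>x. 0)" by (intro l2_of_eqI square_integrable_rep)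
        then show False using c(2) by (simp add: l2_of_0)
      next
        assume A: "0 < measure lebesgue D \<and> is_domain P \<and> lambda1 P < lambda1 D"
        have uD: "(?E u, ?G u) \<in> W0 D" by (rule support[OF c(1) z]) (use A in blast)
        have Dn: "D \<noteq> {}" using A by auto
        have "lambda1 D * (norm (?E u))\<^sup>2 \<le> ?k * (norm (?E u))\<^sup>2"
          using lambda1_le[OF D(1) Db Dn uD] c(5) by simp
        then have 1: "lambda1 D \<le> ?k" using c(2) by simp
        have Pb: "bounded P" using P(3) assms(2) bounded_subset by blast
        obtain F K where F: "eigenpair P (lambda1 P) F K" "norm F = 1"
          by (rule first_eigenvalue[OF P(1) Pb P(2)])
        have "(F, K) \<in> W0 \<Omega>" using eigenpair_W0[OF F(1)] W0_mono[OF P(3)] by blast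
        then have "?k * (norm F)\<^sup>2 \<le> (norm K)\<^sup>2"
          by (rule c(6)) (rule M_nonneg_of_support[OF eigenpair_W0[OF F(1)] P(1) wP])
        then have "?k \<le> lambda1 P" using eigenpair_norm[OF F(1)] F(2) by simp
        then show False using 1 A by linarith
      qed
    qed
    obtain \<tau> where \<tau>: "0 < \<tau>" and eq: "\<And>V K. (V, K) \<in> W0 \<Omega> \<Longrightarrow>
      \<tau> * (?G u \<bullet> K) = ?k * \<tau> * (?E u \<bullet> V) + \<tau> powr \<alpha> * (l2_of (dM (?E u)) \<bullet> V)"
      using critical_Lagrange[OF uc dm(2,3) \<Phi>1 \<Phi>2 \<Phi>3 nz] by blast
    note sc = H01_scale[OF dm(1) uH, of \<tau>]
    define f where "f x = ?k * (\<tau> * u x) + m x * (\<bar>\<tau> * u x\<bar> powr (\<alpha> - 1) * (\<tau> * u x))" for x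
    define h where "h x = (?k * \<tau>) *\<^sub>R zext \<Omega> u x + \<tau> powr \<alpha> *\<^sub>R dM (?E u) x" for x
    have su: "square_integrable (zext \<Omega> u)" using H(1)[OF uH] by (simp add: L2_iff_square_integrable[OF Os])
    have sh: "square_integrable h"
      unfolding h_def[abs_def] by (intro square_integrable_add square_integrable_scaleR su dM_square_integrable)
    have lh: "l2_of h = (?k * \<tau>) *\<^sub>R ?E u + \<tau> powr \<alpha> *\<^sub>R l2_of (dM (?E u))"
      unfolding h_def[abs_def]
      by (simp only: l2_of_add[OF square_integrable_scaleR[OF su] square_integrable_scaleR[OF dM_square_integrable]]
          l2_of_scaleR[OF su] l2_of_scaleR[OF dM_square_integrable])
    have hf: "AE x in lebesgue. h x = zext \<Omega> f x"
      using rep_l2_of[OF su] c(4)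
    proof eventually_elim
      case (elim x)
      show ?case
      proof (cases "x \<in> \<Omega>")
        case True
        then have ux: "rep_l2 (?E u) x = u x" "0 \<le> u x" using elim by auto
        \<comment> \<open>Where u = 0 both sides vanish, the left one through its last factor and
          the right one because \<open>0 powr \<alpha>\<close> is 0; elsewhere the exponents
          \<alpha> - 1 and 1 add up, u being nonnegative.\<close>
        have "\<bar>\<tau> * u x\<bar> powr (\<alpha> - 1) * (\<tau> * u x) = \<tau> powr \<alpha> * u x powr \<alpha>"
        proof (cases "u x = 0")
          case False
          then have "0 < \<tau> * u x" using ux(2) \<tau> by simp
          then have "\<bar>\<tau> * u x\<bar> powr (\<alpha> - 1) * (\<tau> * u x) = (\<tau> * u x) powr \<alpha>"
            using powr_mult_base[of "\<tau> * u x" "\<alpha> - 1"] by (simp add: mult.commute)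
          then show ?thesis using ux(2) \<tau> by (simp add: powr_mult)
        qed simp
        moreover have "w x = m x" using True by (simp add: w_def)
        ultimately show ?thesis using True ux by (simp add: h_def f_def dM_def)
      next
        case False
        then show ?thesis by (simp add: h_def dM_out)
      qed
    qed
    have zf: "square_integrable (zext \<Omega> f)" by (rule square_integrable_cong[OF sh hf])
    then have fL: "f \<in> L2 \<Omega>" by (simp add: L2_iff_square_integrable[OF Os])
    have lf: "l2_of (zext \<Omega> f) = l2_of h" by (rule l2_of_eqI[OF sh hf, symmetric])
    have "weak_solution \<Omega> m \<alpha> ?k (\<lambda>x. \<tau> * u x)"
      unfolding weak_solution_def
    proof (intro conjI ballI sc(1))
      fix v assume v: "v \<in> H01 \<Omega>"
      note vH = H[OF v]
      have "(LINT x|lebesgue_on \<Omega>. wgrad \<Omega> (\<lambda>x. \<tau> * u x) x \<bullet> wgrad \<Omega> v x) = \<tau> * (?G u \<bullet> ?G v)"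
        using L2_inner[OF Os H(2)[OF sc(1)] vH(2)] sc(3) by simp
      also have "\<dots> = l2_of (zext \<Omega> f) \<bullet> ?E v"
        unfolding eq[OF vH(3)] lf lh by (simp add: inner_add_left)
      also have "\<dots> = (LINT x|lebesgue_on \<Omega>. f x * v x)" using L2_inner[OF Os fL vH(1)] by simp
      finally show "(LINT x|lebesgue_on \<Omega>. wgrad \<Omega> (\<lambda>x. \<tau> * u x) x \<bullet> wgrad \<Omega> v x) =
        (LINT x|lebesgue_on \<Omega>. (?k * (\<tau> * u x) + m x * (\<bar>\<tau> * u x\<bar> powr (\<alpha> - 1) * (\<tau> * u x))) * v x)"
        by (simp only: f_def)
    qed
    moreover have "E_second \<Omega> m \<alpha> ?k (\<lambda>x. \<tau> * u x) = 0"
    proof -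
      have "H_fun \<Omega> ?k (\<lambda>x. \<tau> * u x) = \<tau>\<^sup>2 * ((norm (?G u))\<^sup>2 - ?k * (norm (?E u))\<^sup>2)"
        using H_fun_eq[OF dm(1) sc(1)] sc(2,3) by (simp add: power_mult_distrib algebra_simps)
      moreover have "M_fun \<Omega> m \<alpha> (\<lambda>x. \<tau> * u x) = 0"
        using M_eq[OF H(1)[OF sc(1)]] sc(2) critical_M_zero[OF uc dm(2,3) \<Phi>1 \<Phi>2 \<Phi>3] by (simp add: M_scaleR)
      ultimately show ?thesis using c(5) by (simp add: E_second_def)
    qed
    ultimately show ?thesis using \<tau> by blast
  qed
  show ?thesis
    using ex one two three unfolding D_def P_def by blast
qed

end
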